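(* Let $A,Q,F,V$ satisfy conditions (A1), (A2), (A3) of the context. Then for every $x\in D_V$ the equation $$dX(t)=[AX(t)+F(t,X(t))]\,dt+Q\,dW_t,\qquad X(0)=x,$$ has a martingale solution in $C([0,T];H)$. That is, there exist a filtered probability space $(\bar\Omega,\bar{\mathcal F},\{\bar{\mathcal F}_t\}_{t\in[0,T]},\bar{\mathbb P})$, a space-time white noise (cylindrical Wiener process in $H$) $\bar W_t$, $t\in[0,T]$, adapted to $\{\bar{\mathcal F}_t\}_{t\in[0,T]}$, and an adapted $C([0,T];H)$-valued process $\bar X$ such that $$\bar X(t)=S(t)x+\int_0^tS(t-s)F(s,\bar X(s))\,ds+\int_0^tS(t-s)Q\,d\bar W_s,\qquad t\in[0,T].$$
   Context: $T>0$; $H$ is a separable Hilbert space with scalar product $\langle\cdot,\cdot\rangle$ and norm $\|\cdot\|$. (A1) The self-adjoint operator $A$ generates an analytic semigroup $S(t)$ on $H$; there are a complete orthonormal basis $\{e_k\}_{k\in\mathbb N}$ and sequences of positive reals $\{\alpha_k\},\{\lambda_k\}$ with $Ae_k=-\alpha_ke_k$, $Qe_k=\lambda_ke_k$, $\inf_k\alpha_k>0$, and for some $\gamma_0>0$, $\sum_k\lambda_k^2\alpha_k^{2\gamma_0-1}<\infty$. Moreover $(-A)^{-\gamma}$ is compact for every $\gamma>0$. (A2) $F:[0,T]\times D(F)\to H$ with $D(F)\subseteq H$. There is a family of measurable bounded maps $F^\theta:[0,T]\times H\to H$, $\theta\in(0,1)$, such that for all $\theta$, $t\in[0,T]$, $h\in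 H$ the map $x\mapsto\langle F^\theta(t,x),h\rangle$ is continuous on $H$; and there is a convex lower semicontinuous $V:H\to[1,+\infty]$ such that for all $\theta\in(0,1)$, $t\in[0,T]$: $\|F^\theta(t,x)\|^2\le V(x)$ for $x\in H$ and $\|F(t,x)-F^\theta(t,x)\|\le\theta V(x)$ for $x\in D(F)$. One sets $\|F(t,x)\|=+\infty$ for $x\notin D(F)$, and $D_V:=\{x\in H:V(x)<\infty\}\subseteq D(F)$. Approximating problems: let $\{\theta_n\}\subset(0,1)$ with $\theta_n\to0$ and $F_n:=F^{\theta_n}$. For each $n$ and $x\in D(F)$, let $(\Omega^n,\mathcal F^n,\{\mathcal F^n_t\}_{t\in[0,T]},\mathbb P^n)$, a cylindrical Wiener process $W^n$ in $H$ adapted to $\{\mathcal F^n_t\}$, and a $C([0,T];H)$-valued process $X_n$ be a martingale solution of $dX_n=[AX_n+F_n(t,X_n)]dt+Q\,dW$, $X_n(0)=x$, i.e. $X_n(t)=S(t)x+\int_0^tS(t-s)F_n(s,X_n(s))ds+\int_0^tS(t-s)Q\,dW^n_s$ (such a solution is known to exist); $\mathbb E^n$ is the expectation under $\mathbb P^n$. (A3) There is a constant $c>0$ such that for every $x\in D(F)$, $\sup_{n\in\mathbb N}\int_0^T\mathbb E^nV(X_n(t))\,dt\le c\,V(x)$. *)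

theory Defs
  imports "HOL-Probability.Probability"
begin

section \<open>Unbounded operators\<close>

text \<open>An operator on a Hilbert space is a domain together with a total HOL function whose values
  off the domain are irrelevant.\<close>

definition linear_operator :: "'h::real_vector set \<Rightarrow> ('h \<Rightarrow> 'h) \<Rightarrow> bool" where
  "linear_operator D A \<longleftrightarrow> subspace D \<and>
     (\<forall>x\<in>D. \<forall>y\<in>D. A (x + y) = A x + A y) \<and> (\<forall>r. \<forall>x\<in>D. A (r *\<^sub>R x) = r *\<^sub>R A x)"

text \<open>The left-hand side of the last equivalence says that \<open>(y, z)\<close> is in the graph of the adjoint.\<close>

definition self_adjoint :: "'h::real_inner set \<Rightarrow> ('h \<Rightarrow> 'h) \<Rightarrow> bool" where
  "self_adjoint D A \<longleftrightarrow> linear_operator D A \<and> closure D = UNIV \<and>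
     (\<forall>y z. (\<forall>x\<in>D. inner (A x) y = inner x z) \<longleftrightarrow> y \<in> D \<and> A y = z)"

definition orthonormal_basis :: "(nat \<Rightarrow> 'h::real_inner) \<Rightarrow> bool" where
  "orthonormal_basis e \<longleftrightarrow>
     (\<forall>i j. inner (e i) (e j) = (if i = j then 1 else 0)) \<and> closure (span (range e)) = UNIV"

definition compact_operator :: "('h::real_normed_vector \<Rightarrow> 'h) \<Rightarrow> bool" where
  "compact_operator K \<longleftrightarrow> bounded_linear K \<and> (\<forall>B. bounded B \<longrightarrow> compact (closure (K ` B)))"

text \<open>\<open>(-A)\<^sup>p\<close> by the functional calculus of the operator \<open>A\<close> with \<open>A e\<^sub>k = - \<alpha>\<^sub>k e\<^sub>k\<close>
  (everywhere defined for \<open>p \<le> 0\<close> when \<open>\<alpha>\<close> is bounded away from zero).\<close>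

definition diagonal_power ::
    "(nat \<Rightarrow> 'h::real_inner) \<Rightarrow> (nat \<Rightarrow> real) \<Rightarrow> real \<Rightarrow> 'h \<Rightarrow> 'h" where
  "diagonal_power e \<alpha> p x = (\<Sum>k. (\<alpha> k powr p * inner x (e k)) *\<^sub>R e k)"


section \<open>Analytic semigroups\<close>

definition c0_semigroup :: "(real \<Rightarrow> 'h::real_normed_vector \<Rightarrow>\<^sub>L 'h) \<Rightarrow> bool" where
  "c0_semigroup S \<longleftrightarrow> S 0 = id_blinfun \<and>
     (\<forall>s\<ge>0. \<forall>t\<ge>0. S (s + t) = S s o\<^sub>L S t) \<and>
     (\<forall>x. ((\<lambda>t. S t x) \<longlongrightarrow> x) (at_right 0))"

definition generates ::
    "'h::real_normed_vector set \<Rightarrow> ('h \<Rightarrow> 'h) \<Rightarrow> (real \<Rightarrow> 'h \<Rightarrow>\<^sub>L 'h) \<Rightarrow> bool" where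
  "generates D A S \<longleftrightarrow>
     (\<forall>x y. x \<in> D \<and> A x = y \<longleftrightarrow> ((\<lambda>t. (S t x - x) /\<^sub>R t) \<longlongrightarrow> y) (at_right 0))"

text \<open>The complexification of \<open>H\<close> is \<open>H \<times> H\<close>, the pair \<open>(x, y)\<close> standing for \<open>x + \<i>y\<close>.
  Multiplication by \<open>\<i>\<close> is the map below; a real-linear operator is complex-linear iff it
  commutes with it.\<close>

lift_definition imag_unit :: "('h::real_normed_vector \<times> 'h) \<Rightarrow>\<^sub>L ('h \<times> 'h)" is
  "\<lambda>u. (- snd u, fst u)"
  by (intro bounded_linear_Pair bounded_linear_minus bounded_linear_fst bounded_linear_snd)

definition sector :: "real \<Rightarrow> complex set" where
  "sector \<phi> = {z. z \<noteq> 0 \<and> \<bar>Arg z\<bar> < \<phi>}"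

text \<open>A \<open>C\<^sub>0\<close>-semigroup is analytic if its complexification extends to a semigroup on a sector
  around the positive axis which is holomorphic in operator norm there and strongly continuous at
  the origin. The derivative condition is complex differentiability: the increment \<open>w\<close> acts as
  multiplication of an operator \<open>L\<close> by the complex number \<open>w\<close>.\<close>

definition analytic_semigroup :: "(real \<Rightarrow> 'h::real_normed_vector \<Rightarrow>\<^sub>L 'h) \<Rightarrow> bool" where
  "analytic_semigroup S \<longleftrightarrow> c0_semigroup S \<and>
     (\<exists>\<phi> (U :: complex \<Rightarrow> ('h \<times> 'h) \<Rightarrow>\<^sub>L ('h \<times> 'h)). 0 < \<phi> \<and> \<phi> \<le> pi / 2 \<and>
        (\<forall>t\<ge>0. \<forall>x y. blinfun_apply (U (of_real t)) (x, y) = (S t x, S t y)) \<and>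
        (\<forall>z\<in>sector \<phi>. U z o\<^sub>L imag_unit = imag_unit o\<^sub>L U z) \<and>
        (\<forall>z\<in>sector \<phi>. \<exists>L.
           (U has_derivative (\<lambda>w. Re w *\<^sub>R L + Im w *\<^sub>R (imag_unit o\<^sub>L L))) (at z)) \<and>
        (\<forall>z\<in>sector \<phi>. \<forall>w\<in>sector \<phi>. U (z + w) = U z o\<^sub>L U w) \<and>
        (\<forall>u. ((\<lambda>z. blinfun_apply (U z) u) \<longlongrightarrow> u) (at 0 within sector \<phi>)))"


section \<open>Cylindrical Wiener processes\<close>

definition filtered_prob_space :: "real \<Rightarrow> 'w measure \<Rightarrow> (real \<Rightarrow> 'w measure) \<Rightarrow> bool" where
  "filtered_prob_space T M \<F> \<longleftrightarrow> prob_space M \<and>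
     (\<forall>t\<in>{0..T}. subalgebra M (\<F> t)) \<and>
     (\<forall>s\<in>{0..T}. \<forall>t\<in>{0..T}. s \<le> t \<longrightarrow> sets (\<F> s) \<subseteq> sets (\<F> t))"

definition brownian_motion ::
    "real \<Rightarrow> 'w measure \<Rightarrow> (real \<Rightarrow> 'w measure) \<Rightarrow> (real \<Rightarrow> 'w \<Rightarrow> real) \<Rightarrow> bool" where
  "brownian_motion T M \<F> \<beta> \<longleftrightarrow>
     (\<forall>t\<in>{0..T}. \<beta> t \<in> borel_measurable (\<F> t)) \<and>
     (AE \<omega> in M. \<beta> 0 \<omega> = 0) \<and>
     (AE \<omega> in M. continuous_on {0..T} (\<lambda>t. \<beta> t \<omega>)) \<and>
     (\<forall>s t. 0 \<le> s \<and> s < t \<and> t \<le> T \<longrightarrow>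
        distributed M lborel (\<lambda>\<omega>. \<beta> t \<omega> - \<beta> s \<omega>) (normal_density 0 (sqrt (t - s))) \<and>
        prob_space.indep_set M (sets (\<F> s))
          {(\<lambda>\<omega>. \<beta> t \<omega> - \<beta> s \<omega>) -` B \<inter> space M |B. B \<in> sets borel})"

text \<open>\<open>W t h\<close> is the real random variable \<open>\<langle>W\<^sub>t, h\<rangle>\<close>. A cylindrical Wiener process does not take
  values in \<open>H\<close>, so only these pairings exist, and they are linear in \<open>h\<close> almost surely.\<close>

definition cylindrical_wiener_process ::
    "real \<Rightarrow> 'w measure \<Rightarrow> (real \<Rightarrow> 'w measure) \<Rightarrow> (real \<Rightarrow> 'h::real_inner \<Rightarrow> 'w \<Rightarrow> real) \<Rightarrow> bool" where
  "cylindrical_wiener_process T M \<F> W \<longleftrightarrow>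
     (\<forall>t\<in>{0..T}. \<forall>h. W t h \<in> borel_measurable (\<F> t)) \<and>
     (\<forall>t\<in>{0..T}. \<forall>a b g h. AE \<omega> in M. W t (a *\<^sub>R g + b *\<^sub>R h) \<omega> = a * W t g \<omega> + b * W t h \<omega>) \<and>
     (\<forall>h. norm h = 1 \<longrightarrow> brownian_motion T M \<F> (\<lambda>t. W t h))"


section \<open>Stochastic integrals of deterministic integrands\<close>

definition step_function ::
    "nat \<Rightarrow> (nat \<Rightarrow> real) \<Rightarrow> (nat \<Rightarrow> 'h::real_vector) \<Rightarrow> real \<Rightarrow> 'h" where
  "step_function n \<tau> c s = (\<Sum>i<n. indicator {\<tau> i<..\<tau> (Suc i)} s *\<^sub>R c i)"

definition step_integral ::
    "nat \<Rightarrow> (nat \<Rightarrow> real) \<Rightarrow> (nat \<Rightarrow> 'h::real_vector) \<Rightarrow> (real \<Rightarrow> 'w \<Rightarrow> real) \<Rightarrow> 'w \<Rightarrow> 'h" where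
  "step_integral n \<tau> c \<beta> \<omega> = (\<Sum>i<n. (\<beta> (\<tau> (Suc i)) \<omega> - \<beta> (\<tau> i) \<omega>) *\<^sub>R c i)"

text \<open>\<open>I\<close> is a version of \<open>\<integral>\<^sub>0\<^sup>t g(s) d\<beta>\<^sub>s\<close>: the \<open>L\<^sup>2(\<Omega>; H)\<close>-limit of the integrals of step
  functions converging to \<open>g\<close> in \<open>L\<^sup>2(0, t; H)\<close>.\<close>

definition has_wiener_integral ::
    "'w measure \<Rightarrow> (real \<Rightarrow> 'w \<Rightarrow> real) \<Rightarrow> real \<Rightarrow> (real \<Rightarrow> 'h::real_normed_vector) \<Rightarrow> ('w \<Rightarrow> 'h) \<Rightarrow> bool" where
  "has_wiener_integral M \<beta> t g I \<longleftrightarrow>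
     set_borel_measurable lborel {0..t} g \<and> I \<in> borel_measurable M \<and>
     (\<exists>n \<tau> c. (\<forall>j. \<forall>i\<le>n j. \<tau> j i \<in> {0..t}) \<and> (\<forall>j. \<forall>i<n j. \<tau> j i \<le> \<tau> j (Suc i)) \<and>
        (\<lambda>j. \<integral>\<^sup>+s\<in>{0..t}. ennreal ((norm (g s - step_function (n j) (\<tau> j) (c j) s))\<^sup>2) \<partial>lborel)
          \<longlonglongrightarrow> 0 \<and>
        (\<lambda>j. \<integral>\<^sup>+\<omega>. ennreal ((norm (I \<omega> - step_integral (n j) (\<tau> j) (c j) \<beta> \<omega>))\<^sup>2) \<partial>M)
          \<longlonglongrightarrow> 0)"

text \<open>\<open>I\<close> is a version of \<open>\<integral>\<^sub>0\<^sup>t \<Phi>(s) dW\<^sub>s = \<Sum>\<^sub>k \<integral>\<^sub>0\<^sup>t \<Phi>(s) e\<^sub>k d\<langle>W\<^sub>s, e\<^sub>k\<rangle>\<close>, the series converging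
  in \<open>L\<^sup>2(\<Omega>; H)\<close>. Only the values \<open>\<Phi>(s) e\<^sub>k\<close> enter, so \<open>\<Phi>(s)\<close> need only be defined on a domain
  containing the basis.\<close>

definition has_stochastic_integral ::
    "'w measure \<Rightarrow> (nat \<Rightarrow> 'h::real_normed_vector) \<Rightarrow> (real \<Rightarrow> 'h \<Rightarrow> 'w \<Rightarrow> real) \<Rightarrow> real \<Rightarrow>
       (real \<Rightarrow> 'h \<Rightarrow> 'h) \<Rightarrow> ('w \<Rightarrow> 'h) \<Rightarrow> bool" where
  "has_stochastic_integral M e W t \<Phi> I \<longleftrightarrow> I \<in> borel_measurable M \<and>
     (\<exists>J. (\<forall>k. has_wiener_integral M (\<lambda>s. W s (e k)) t (\<lambda>s. \<Phi> s (e k)) (J k)) \<and>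
        (\<lambda>n. \<integral>\<^sup>+\<omega>. ennreal ((norm (I \<omega> - (\<Sum>k<n. J k \<omega>)))\<^sup>2) \<partial>M) \<longlonglongrightarrow> 0)"


section \<open>Martingale solutions\<close>

text \<open>Mild form of \<open>dX = [AX + G(t, X)] dt + Q dW\<close>, \<open>X(0) = x\<close>, for \<open>G\<close> defined on \<open>[0, T] \<times> D\<close>.
  Since \<open>\<parallel>G(t, x)\<parallel> = \<infinity>\<close> for \<open>x \<notin> D\<close> by convention, the drift being integrable includes
  \<open>X(s) \<in> D\<close> for almost every \<open>s\<close>. The time integral is taken with respect to the completed
  Lebesgue measure because \<open>G\<close> is arbitrary on the exceptional null set of times.\<close>

definition martingale_solution ::
    "real \<Rightarrow> (real \<Rightarrow> 'h::{real_inner, banach, second_countable_topology} \<Rightarrow>\<^sub>L 'h) \<Rightarrow> ('h \<Rightarrow> 'h) \<Rightarrow>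
       (nat \<Rightarrow> 'h) \<Rightarrow> 'h set \<Rightarrow> (real \<Rightarrow> 'h \<Rightarrow> 'h) \<Rightarrow> 'h \<Rightarrow>
       'w measure \<Rightarrow> (real \<Rightarrow> 'w measure) \<Rightarrow> (real \<Rightarrow> 'h \<Rightarrow> 'w \<Rightarrow> real) \<Rightarrow> (real \<Rightarrow> 'w \<Rightarrow> 'h) \<Rightarrow> bool" where
  "martingale_solution T S Q e D G x M \<F> W X \<longleftrightarrow>
     filtered_prob_space T M \<F> \<and> cylindrical_wiener_process T M \<F> W \<and>
     (\<forall>t\<in>{0..T}. X t \<in> borel_measurable (\<F> t)) \<and>
     (\<forall>\<omega>\<in>space M. continuous_on {0..T} (\<lambda>t. X t \<omega>)) \<and>
     (AE \<omega> in M. (AE s in lebesgue. s \<in> {0..T} \<longrightarrow> X s \<omega> \<in> D) \<and>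
        set_integrable lebesgue {0..T} (\<lambda>s. G s (X s \<omega>))) \<and>
     (\<forall>t\<in>{0..T}. \<exists>I. has_stochastic_integral M e W t (\<lambda>s h. S (t - s) (Q h)) I \<and>
        (AE \<omega> in M. X t \<omega> =
           S t x + (LINT s:{0..t}|lebesgue. S (t - s) (G s (X s \<omega>))) + I \<omega>))"


section \<open>Standing assumptions\<close>

definition assumption_A1 ::
    "'h::{real_inner, banach} set \<Rightarrow> ('h \<Rightarrow> 'h) \<Rightarrow> (real \<Rightarrow> 'h \<Rightarrow>\<^sub>L 'h) \<Rightarrow> 'h set \<Rightarrow> ('h \<Rightarrow> 'h) \<Rightarrow>
       (nat \<Rightarrow> 'h) \<Rightarrow> (nat \<Rightarrow> real) \<Rightarrow> (nat \<Rightarrow> real) \<Rightarrow> bool" where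
  "assumption_A1 DA A S DQ Q e \<alpha> lam \<longleftrightarrow>
     self_adjoint DA A \<and> analytic_semigroup S \<and> generates DA A S \<and> linear_operator DQ Q \<and>
     orthonormal_basis e \<and> (\<forall>k. \<alpha> k > 0) \<and> (\<forall>k. lam k > 0) \<and>
     (\<forall>k. e k \<in> DA \<and> A (e k) = - (\<alpha> k *\<^sub>R e k)) \<and>
     (\<forall>k. e k \<in> DQ \<and> Q (e k) = lam k *\<^sub>R e k) \<and>
     (INF k. \<alpha> k) > 0 \<and>
     (\<exists>\<gamma>\<^sub>0>0. summable (\<lambda>k. (lam k)\<^sup>2 * \<alpha> k powr (2 * \<gamma>\<^sub>0 - 1))) \<and>
     (\<forall>\<gamma>>0. compact_operator (diagonal_power e \<alpha> (- \<gamma>)))"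

definition convex_ennreal :: "('h::real_vector \<Rightarrow> ennreal) \<Rightarrow> bool" where
  "convex_ennreal V \<longleftrightarrow> (\<forall>x y. \<forall>u\<in>{0..1}.
     V ((1 - u) *\<^sub>R x + u *\<^sub>R y) \<le> ennreal (1 - u) * V x + ennreal u * V y)"

definition lower_semicontinuous :: "('h::topological_space \<Rightarrow> ennreal) \<Rightarrow> bool" where
  "lower_semicontinuous V \<longleftrightarrow> (\<forall>x. V x \<le> Liminf (at x) V)"

definition finite_domain :: "('h \<Rightarrow> ennreal) \<Rightarrow> 'h set" where
  "finite_domain V = {x. V x < \<infinity>}"

definition assumption_A2 ::
    "real \<Rightarrow> 'h::real_inner set \<Rightarrow> (real \<Rightarrow> 'h \<Rightarrow> 'h) \<Rightarrow> (real \<Rightarrow> real \<Rightarrow> 'h \<Rightarrow> 'h) \<Rightarrow>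
       ('h \<Rightarrow> ennreal) \<Rightarrow> bool" where
  "assumption_A2 T DF F F\<theta> V \<longleftrightarrow>
     (\<forall>\<theta>\<in>{0<..<1}.
        (\<lambda>(t, x). F\<theta> \<theta> t x) \<in> borel_measurable (restrict_space borel ({0..T} \<times> UNIV)) \<and>
        (\<exists>C. \<forall>t\<in>{0..T}. \<forall>x. norm (F\<theta> \<theta> t x) \<le> C) \<and>
        (\<forall>t\<in>{0..T}. \<forall>h. continuous_on UNIV (\<lambda>x. inner (F\<theta> \<theta> t x) h))) \<and>
     convex_ennreal V \<and> lower_semicontinuous V \<and> (\<forall>x. 1 \<le> V x) \<and>
     (\<forall>\<theta>\<in>{0<..<1}. \<forall>t\<in>{0..T}.
        (\<forall>x. ennreal ((norm (F\<theta> \<theta> t x))\<^sup>2) \<le> V x) \<and>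
        (\<forall>x\<in>DF. ennreal (norm (F t x - F\<theta> \<theta> t x)) \<le> ennreal \<theta> * V x)) \<and>
     finite_domain V \<subseteq> DF"

text \<open>\<open>M n x\<close> and \<open>X n x\<close> are the probability space and the process of the \<open>n\<close>-th approximating
  problem started at \<open>x\<close>.\<close>

definition assumption_A3 ::
    "real \<Rightarrow> 'h set \<Rightarrow> ('h \<Rightarrow> ennreal) \<Rightarrow> (nat \<Rightarrow> 'h \<Rightarrow> 'w measure) \<Rightarrow>
       (nat \<Rightarrow> 'h \<Rightarrow> real \<Rightarrow> 'w \<Rightarrow> 'h) \<Rightarrow> bool" where
  "assumption_A3 T DF V M X \<longleftrightarrow> (\<exists>c>0. \<forall>x\<in>DF.
     (SUP n. \<integral>\<^sup>+t\<in>{0..T}. (\<integral>\<^sup>+\<omega>. V (X n x t \<omega>) \<partial>M n x) \<partial>lborel) \<le> ennreal c * V x)"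

end

theory Submission
  imports Defs
begin

text \<open>
The theorem is proved by compactness. In the eigenbasis the semigroup acts on the \<open>k\<close>-th coordinate
by multiplication with \<open>exp (- \<alpha>\<^sub>k t)\<close>, so the mild equation splits into countably many scalar
equations. The noise term of the \<open>k\<close>-th one is a Wiener integral of an exponential over one Brownian
motion; it is Gaussian, and its increments over an interval of length \<open>d\<close> have variance at most
\<open>2 \<lambda>\<^sub>k\<^sup>2 \<alpha>\<^sub>k\<^sup>p\<^sup>-\<^sup>1 d\<^sup>p\<close>. The trace condition makes these bounds summable in \<open>k\<close>, so all moments of the
increments in \<open>H\<close> are controlled and Kolmogorov's argument gives a modulus of continuity. The drift term
is Hoelder continuous of exponent one half with a constant that the energy \<open>\<integral>\<parallel>F\<^sub>n(t, X\<^sub>n)\<parallel>\<^sup>2 dt\<close> bounds,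
and this energy has bounded mean because \<open>\<parallel>F\<^sub>n\<parallel>\<^sup>2 \<le> V\<close>. All of this is uniform in \<open>n\<close>
(\<open>approx_modulus\<close>, \<open>X_tail\<close>).

A solution and its noise are determined by countably many real random variables: the coordinates
of \<open>X\<^sub>n\<close> and of \<open>W\<^sub>n\<close> at dyadic times. A sequence of tight countable families of real variables
has a subsequence with an almost surely convergent version (\<open>skorohod_countable\<close>): a whole family
is coded by one real number, so that Skorokhod's theorem on the real line applies, and this
is why the new probability space can be taken to be a measure on the reals. The uniform modulus of
continuity extends the limit coordinates from the dyadic times to a continuous process, to which
the \<open>X\<^sub>n(t)\<close> converge in probability for every \<open>t\<close>; the tail estimate, in which \<open>1 / \<alpha>\<^sub>k\<close> tends to zero by
compactness of the inverse of \<open>A\<close>, turns convergence of coordinates into convergence in norm.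

The drift passes to the limit (\<open>drift_gap_lim\<close>) by comparing \<open>F\<^sub>n(t, X\<^sub>n)\<close> and \<open>F(t, X)\<close> with a third
map \<open>F\<^sub>m\<close>, \<open>m\<close> fixed: the errors are at most \<open>(\<theta>\<^sub>n + \<theta>\<^sub>m) V\<close> and \<open>\<theta>\<^sub>m V\<close>, whose means are small because
the mean of \<open>V\<close> is bounded along the sequence and, by lower semicontinuity, at the limit, while
\<open>\<langle>F\<^sub>m(t, X\<^sub>n), e\<^sub>k\<rangle>\<close> converges by weak continuity and boundedness of \<open>F\<^sub>m\<close>.

The limit of the noise is a cylindrical Wiener process because the Gaussian law of an increment and
its independence of the past are identities between means of bounded continuous functions
of the coordinates (\<open>independence_limit\<close>), hence stable under almost sure limits
(\<open>indep_gauss_limit\<close>). The stochastic convolution is identified coordinate by coordinate through sums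
over the dyadic grid, which approximate it with an error that does not depend on \<open>n\<close>
(\<open>limit_coord_error\<close>).
\<close>

abbreviation limit_seq :: "(nat => 'a::topological_space) => 'a => bool" (infix "---->" 60) where
 "u ----> l == (u \<longlongrightarrow> l) sequentially"

section \<open>Coding of real sequences by one real number\<close>

definition dig :: "nat => real => int" where "dig m c = \<lfloor>3 ^ Suc m * c\<rfloor> mod 3"
definition bit2 :: "nat => real => int" where "bit2 b y = \<lfloor>2 ^ Suc b * y\<rfloor> mod 2"

lemma bit2_sums:
 assumes "0 <= y" "y < 1"
 shows "(%b. of_int (bit2 b y) / 2 ^ Suc b) sums y"
proof -
 have step: "(\<Sum>b<n. of_int (bit2 b y) / 2 ^ Suc b) = (of_int \<lfloor>2 ^ n * y\<rfloor> :: real) / 2 ^ n" for n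
 proof (induction n)
  case 0
  have "\<lfloor>y\<rfloor> = 0" using assms by (simp add: floor_eq_iff)
  then show ?case by simp
 next
  case (Suc n)
  have "\<lfloor>2 ^ Suc n * y\<rfloor> div 2 = \<lfloor>2 ^ n * y\<rfloor>"
  proof -
   have "\<lfloor>2 ^ Suc n * y\<rfloor> div 2 = \<lfloor>(2 ^ Suc n * y) / of_int 2\<rfloor>"
   using floor_divide_real_eq_div[of 2 "2 ^ Suc n * y"] by simp
   then show ?thesis by simp
  qed
  then have "2 * \<lfloor>2 ^ n * y\<rfloor> + bit2 n y = \<lfloor>2 ^ Suc n * y\<rfloor>"
   unfolding bit2_def by (metis mult_div_mod_eq)
  then have "2 * (of_int \<lfloor>2 ^ n * y\<rfloor> :: real) + of_int (bit2 n y) = of_int \<lfloor>2 ^ Suc n * y\<rfloor>"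
   by (metis of_int_add of_int_mult of_int_numeral)
  with Suc show ?case by (simp add: field_simps)
 qed
 have "(%n. (of_int \<lfloor>2 ^ n * y\<rfloor> :: real) / 2 ^ n) ----> y"
 proof (rule tendsto_sandwich[of "%n. y - (1/2)^n" _ _ "%n. y"])
  show "\<forall>\<^sub>F n in sequentially. y - (1/2)^n <= (of_int \<lfloor>2 ^ n * y\<rfloor> :: real) / 2 ^ n"
  proof (rule always_eventually, rule allI)
   fix n
   have "2 ^ n * y - 1 <= (of_int \<lfloor>2 ^ n * y\<rfloor> :: real)" by linarith
   then have "(2 ^ n * y - 1) / 2 ^ n <= (of_int \<lfloor>2 ^ n * y\<rfloor> :: real) / 2 ^ n"
   by (rule divide_right_mono) simp
   then show "y - (1/2)^n <= (of_int \<lfloor>2 ^ n * y\<rfloor> :: real) / 2 ^ n"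
   by (simp add: diff_divide_distrib power_divide)
  qed
  show "\<forall>\<^sub>F n in sequentially. (of_int \<lfloor>2 ^ n * y\<rfloor> :: real) / 2 ^ n <= y"
   by (rule always_eventually) (simp add: divide_le_eq mult.commute)
  have "(%n. y - (1/2)^n) ----> y - 0"
   by (intro tendsto_intros LIMSEQ_power_zero) simp
  then show "(%n. y - (1/2)^n) ----> y" by simp
 qed simp
 then show ?thesis unfolding sums_def step .
qed

text \<open>Ternary expansions with digits 0 and 1 only leave a gap after every digit. Therefore a digit is a
locally constant function of the code, and decoding is continuous on the set of codes although it is not
continuous on the line.\<close>

lemma ternary_code:
 fixes D :: "nat => int"
 assumes D: "!!m. D m \<in> {0, 1}"
 defines "c \<equiv> (\<Sum>m. of_int (D m) / 3 ^ Suc m :: real)"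
 shows "dig m c = D m" and "frac (3 ^ m * c) <= 1 / 2" and "0 <= c" and "c <= 1"
proof -
 have D01: "0 <= (of_int (D m) :: real)" "(of_int (D m) :: real) <= 1" for m
  using D[of m] by auto
 have gs: "(%i. (1/3)^i / 3 :: real) sums (1/2)"
  using sums_mult[OF geometric_sums[of "1/3::real"], of "1/3"] by (simp add: field_simps)
 have trm: "0 <= (of_int (D (i + m)) :: real) / 3 ^ Suc i" "(of_int (D (i + m)) :: real) / 3 ^ Suc i <= (1/3)^i / 3" for i m
  using D01[of "i+m"] by (auto simp: field_simps power_divide)
 have sm: "summable (%i. of_int (D (i + m)) / 3 ^ Suc i :: real)" for m
  by (rule summable_comparison_test'[OF sums_summable[OF gs], of 0]) (simp only: real_norm_def abs_of_nonneg[OF trm(1)], rule trm(2))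
 define t where "t m = (\<Sum>i. of_int (D (i + m)) / 3 ^ Suc i :: real)" for m
 have t0: "0 <= t m" "t m <= 1/2" for m
 proof -
  show "0 <= t m" unfolding t_def by (intro suminf_nonneg sm trm)
  have "t m <= (\<Sum>i. (1/3)^i / 3 :: real)" unfolding t_def by (intro suminf_le trm sm sums_summable[OF gs])
  then show "t m <= 1/2" using sums_unique[OF gs] by simp
 qed
 have trec: "3 * t m = of_int (D m) + t (Suc m)" for m
 proof -
  have "t m = (\<Sum>i. of_int (D (Suc i + m)) / 3 ^ Suc (Suc i)) + of_int (D m) / 3"
   unfolding t_def using suminf_split_head[OF sm[of m]] by simp
  also have "(\<Sum>i. of_int (D (Suc i + m)) / 3 ^ Suc (Suc i)) = (\<Sum>i. (of_int (D (i + Suc m)) / 3 ^ Suc i) / 3 :: real)"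
   by simp
  also have "... = t (Suc m) / 3" unfolding t_def by (rule suminf_divide[OF sm])
  finally show ?thesis by simp
 qed
 have ct: "c = t 0" by (simp add: c_def t_def)
 have int: "\<exists>z::int. 3 ^ m * c = of_int z + t m & (3 ^ Suc m * c = of_int (3 * z + D m) + t (Suc m))" for m
 proof (induction m)
  case 0
  show ?case using trec[of 0] ct by (intro exI[of _ 0]) simp
 next
  case (Suc m)
  then obtain z where z: "3 ^ Suc m * c = of_int (3 * z + D m) + t (Suc m)" by auto
  have "3 ^ Suc (Suc m) * c = 3 * (3 ^ Suc m * c)" by simp
  also have "... = of_int (3 * (3 * z + D m) + D (Suc m)) + t (Suc (Suc m))"
   unfolding z using trec[of "Suc m"] by simp
  finally show ?case using z by blast
 qed
 show "dig m c = D m"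
 proof -
  obtain z where "3 ^ Suc m * c = of_int (3 * z + D m) + t (Suc m)" using int by blast
  then have "\<lfloor>3 ^ Suc m * c\<rfloor> = 3 * z + D m"
   using t0[of "Suc m"] by (intro floor_unique) linarith+
  then show ?thesis unfolding dig_def using D[of m] by auto
 qed
 show "frac (3 ^ m * c) <= 1 / 2"
 proof -
  obtain z where z: "3 ^ m * c = of_int z + t m" using int by blast
  then have "\<lfloor>3 ^ m * c\<rfloor> = z" using t0[of "m"] by (simp add: floor_eq_iff)
  then show ?thesis unfolding frac_def using z t0[of m] by simp
 qed
 show "0 <= c" "c <= 1" using t0[of 0] ct by auto
qed

lemma dig_tendsto:
 assumes y: "y ----> (l::real)" and fr: "!!n m. frac (3 ^ m * y n) <= 1 / 2"
 shows "\<exists>d. \<forall>\<^sub>F n in sequentially. dig m (y n) = d"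
proof -
 have "Cauchy (%n. 3 ^ Suc m * y n)"
  by (intro LIMSEQ_imp_Cauchy[of _ "3 ^ Suc m * l"] tendsto_mult y tendsto_const)
 then obtain N where N: "!!n. n \<ge> N ==> dist (3 ^ Suc m * y n) (3 ^ Suc m * y N) < 1/2"
  unfolding Cauchy_def by (metis half_gt_zero_iff order_refl zero_less_one)
 have "dig m (y n) = dig m (y N)" if "n \<ge> N" for n
 proof -
  have "\<lfloor>3 ^ Suc m * y n\<rfloor> = \<lfloor>3 ^ Suc m * y N\<rfloor>"
   using N[OF that] fr[of "Suc m" n] fr[of "Suc m" N] unfolding frac_def dist_real_def by linarith
  then show ?thesis by (simp add: dig_def)
 qed
 then show ?thesis by (auto simp: eventually_sequentially)
qed

definition squash :: "real => real" where "squash y = 1 / 2 + arctan y / pi"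
definition unsquash :: "real => real" where "unsquash z = tan (pi * (z - 1 / 2))"

lemma squash_range: "0 < squash y" "squash y < 1"
 using arctan_lbound[of y] arctan_ubound[of y] by (auto simp: squash_def field_simps)

lemma unsquash_squash: "unsquash (squash y) = y"
 by (simp add: unsquash_def squash_def tan_arctan)

definition unit_of_code :: "real => 'i::countable => real" where
 "unit_of_code c i = (\<Sum>b. of_int (dig (to_nat (i, b :: nat)) c) / 2 ^ Suc b)"

definition code_of :: "('i::countable => real) => real" where
 "code_of u = (\<Sum>m. of_int (case from_nat m of (i, b) => bit2 b (squash (u i))) / 3 ^ Suc m)"

lemma bit2_01: "bit2 b y \<in> {0, 1}"
 unfolding bit2_def by auto

lemma unit_of_code_of: "unit_of_code (code_of u) i = squash (u i)"
proof -
 have "(case from_nat m of (i, b) => bit2 b (squash (u i))) \<in> {0, 1}" for m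
  using bit2_01 by (auto split: prod.splits)
 from ternary_code(1)[of "%m. case from_nat m of (i, b) => bit2 b (squash (u i))", OF this]
 have "dig (to_nat (i, b)) (code_of u) = bit2 b (squash (u i))" for b
  unfolding code_of_def by simp
 then show ?thesis
  unfolding unit_of_code_def
  using sums_unique[OF bit2_sums[of "squash (u i)"]] squash_range[of "u i"] by simp
qed

lemma code_of_frac: "frac (3 ^ m * code_of u) <= 1 / 2" and code_of_range: "0 <= code_of u" "code_of u <= 1"
proof -
 have "(case from_nat m of (i, b) => bit2 b (squash (u i))) \<in> {0, 1}" for m
  using bit2_01 by (auto split: prod.splits)
 from ternary_code(2-4)[of "%m. case from_nat m of (i, b) => bit2 b (squash (u i))", OF this]
 show "frac (3 ^ m * code_of u) <= 1 / 2" "0 <= code_of u" "code_of u <= 1"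
  unfolding code_of_def by auto
qed

lemma measurable_dig[measurable]: "dig m \<in> measurable borel (count_space UNIV)"
 unfolding dig_def[abs_def] by measurable

lemma measurable_bit2[measurable]: "bit2 m \<in> measurable borel (count_space UNIV)"
 unfolding bit2_def[abs_def] by measurable

lemma measurable_squash[measurable]: "squash \<in> borel_measurable borel"
 unfolding squash_def[abs_def] by (intro borel_measurable_continuous_onI continuous_intros) auto

lemma measurable_unsquash[measurable]: "unsquash \<in> borel_measurable borel"
 unfolding unsquash_def[abs_def] tan_def by measurable

lemma measurable_unit_of_code[measurable]: "(%c. unit_of_code c i) \<in> borel_measurable borel"
 unfolding unit_of_code_def[abs_def] by measurable

lemma measurable_code_of[measurable]:
 "code_of \<in> borel_measurable (PiM UNIV (%_::'i::countable. borel))"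
proof -
 have "(%u. real_of_int (case from_nat m of (i, b) => bit2 b (squash (u i)))) \<in> borel_measurable (PiM UNIV (%_::'i. borel))" for m
  by (cases "from_nat m :: 'i \<times> nat") simp
 then show ?thesis unfolding code_of_def[abs_def] by measurable
qed

lemma unit_of_code_convergent:
 assumes y: "y ----> (l::real)" and fr: "!!n m. frac (3 ^ m * y n) <= 1 / 2"
 shows "convergent (%n. unit_of_code (y n) i)"
proof -
 have "\<forall>m. \<exists>d. \<forall>\<^sub>F n in sequentially. dig m (y n) = d"
  using dig_tendsto[OF y fr] by blast
 from choice[OF this] obtain d where d: "!!m. \<forall>\<^sub>F n in sequentially. dig m (y n) = d m"
  by blast
 have "(%n. unit_of_code (y n) i) ----> (\<Sum>b. of_int (d (to_nat (i, b))) / 2 ^ Suc b)"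
  unfolding unit_of_code_def
 proof (rule tannerys_theorem[where M = "%b. (1/2) ^ b", THEN conjunct2, THEN conjunct2])
  show "((%n. real_of_int (dig (to_nat (i, b)) (y n)) / 2 ^ Suc b) \<longlongrightarrow> real_of_int (d (to_nat (i, b))) / 2 ^ Suc b) sequentially" for b
   by (rule tendsto_eventually) (use d[of "to_nat (i, b)"] in eventually_elim, simp)
  have "norm (real_of_int (dig m c) / 2 ^ Suc b) <= (1/2) ^ b" for m c b
  proof -
   have "0 <= dig m c" "dig m c <= 2" unfolding dig_def by auto
   then have "norm (real_of_int (dig m c)) <= 2" by simp
   then have "norm (real_of_int (dig m c)) / 2 ^ Suc b <= 2 / 2 ^ Suc b" by (rule divide_right_mono) simp
   also have "... = (1/2) ^ b" by (simp add: power_divide)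
   finally show ?thesis by (simp add: norm_divide norm_power)
  qed
  from this[of "to_nat (i, k)" "y n" k for k n]
  show "\<forall>\<^sub>F (k, n) in sequentially \<times>\<^sub>F sequentially. norm (real_of_int (dig (to_nat (i, k)) (y n)) / 2 ^ Suc k) <= (1/2) ^ k"
   unfolding split_beta by (rule always_eventually[OF allI])
  show "summable (%b. (1/2::real) ^ b)" by (simp add: summable_geometric)
 qed simp_all
 then show ?thesis by (auto simp: convergent_def)
qed

text \<open>A coordinate can be lost in the limit only by escaping to infinity; tightness excludes
this.\<close>

lemma unsquash_blowup:
 assumes "z ----> l" "!!n. 0 < z n" "!!n. z n < 1" and "l = 0 \<or> l = 1"
 shows "\<forall>\<^sub>F n in sequentially. K < \<bar>unsquash (z n)\<bar>"
proof -
 have inv: "!!n. squash (unsquash (z n)) = z n"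
 proof -
  fix n
  have "arctan (tan (pi * (z n - 1 / 2))) = pi * (z n - 1 / 2)"
   using assms(2,3)[of n] by (intro arctan_tan) (auto simp: field_simps)
  then show "squash (unsquash (z n)) = z n"
   by (simp add: squash_def unsquash_def)
 qed
 have mono: "squash x <= squash y" if "x <= y" for x y
  using that by (simp add: squash_def divide_right_mono arctan_le_iff)
 have "\<forall>\<^sub>F n in sequentially. z n < squash (- K) \<or> z n > squash K"
  using assms(4)
 proof
  assume "l = 0"
  then show ?thesis using order_tendstoD(2)[OF assms(1), of "squash (- K)"] squash_range[of "- K"]
   by (auto elim: eventually_mono)
 next
  assume "l = 1"
  then show ?thesis using order_tendstoD(1)[OF assms(1), of "squash K"] squash_range[of "K"]
   by (auto elim: eventually_mono)
 qed
 then show ?thesis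
 proof eventually_elim
  case (elim n)
  then show ?case
   using mono[of "- K" "unsquash (z n)"] mono[of "unsquash (z n)" K] inv[of n] by linarith
 qed
qed

section \<open>Almost surely convergent versions\<close>

text \<open>Countably many real coordinates are squashed into the unit interval, expanded in binary, and their
bits interleaved as ternary digits of one real number. The codes lie in a compact set, so their laws have a
weakly convergent subsequence, and Skorokhod's theorem on the line gives almost surely convergent copies of
the codes; decoding recovers the coordinates.\<close>

lemma skorohod_countable:
 fixes M :: "nat => 'w measure" and U :: "nat => 'w => 'i::countable => real"
 defines "N \<equiv> PiM UNIV (%_::'i. borel :: real measure)"
 assumes prob: "!!n. prob_space (M n)"
  and U: "!!n. U n \<in> measurable (M n) N"
  and tight: "!!i ep. 0 < ep ==> \<exists>K. \<forall>n. measure (M n) {om\<in>space (M n). K < \<bar>U n om i\<bar>} <= ep"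
 obtains r :: "nat => nat" and Om :: "real measure" and U' and L :: "real => 'i => real"
 where "strict_mono r" "prob_space Om" "!!n. U' n \<in> measurable Om N" "L \<in> measurable Om N"
  "!!n. distr Om N (U' n) = distr (M (r n)) N (U (r n))"
  "AE om in Om. \<forall>i. (%n. U' n om i) ----> L om i"
proof -
 interpret M: prob_space "M n" for n by (rule prob)
 note U' = U[unfolded N_def]
 have cU[measurable]: "(%om. code_of (U n om)) \<in> borel_measurable (M n)" for n
  by (rule measurable_compose[OF U' measurable_code_of])
 define \<mu> where "\<mu> n = distr (M n) borel (%om. code_of (U n om))" for n
 have rd: "real_distribution (\<mu> n)" for n
  unfolding \<mu>_def by (rule M.real_distribution_distr) simp
 have "tight \<mu>"
  unfolding tight_def
 proof (intro conjI allI impI rd)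
  fix ep :: real assume "0 < ep"
  have "measure (\<mu> n) {-1<..1} = 1" for n
  proof -
   have "- 1 < code_of (U n om)" "code_of (U n om) <= 1" for om
   using code_of_range[of "U n om"] by auto
   then have "(%om. code_of (U n om)) -` {-1<..1} \<inter> space (M n) = space (M n)" by auto
   then show ?thesis unfolding \<mu>_def by (subst measure_distr) (auto simp: M.prob_space)
  qed
  then show "\<exists>a b. a < b & (\<forall>n. 1 - ep < measure (\<mu> n) {a<..b})"
   using \<open>0 < ep\<close> by (intro exI[of _ "-1"] exI[of _ 1]) simp
 qed
 from tight_imp_convergent_subsubsequence[OF this strict_mono_id]
 obtain r \<mu>\<^sub>l where r: "strict_mono r" "real_distribution \<mu>\<^sub>l" "weak_conv_m (%n. \<mu> (r n)) \<mu>\<^sub>l"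
  by (auto simp: comp_def)
 from Skorohod[of "%n. \<mu> (r n)" \<mu>\<^sub>l, OF rd r(2,3)]
 obtain Om :: "real measure" and Y Yl where sk: "prob_space Om & (\<forall>n. Y n \<in> borel_measurable Om) \<and>
  (\<forall>n. distr Om borel (Y n) = \<mu> (r n)) & Yl \<in> measurable Om lborel & distr Om borel Yl = \<mu>\<^sub>l \<and>
  (\<forall>om\<in>space Om. (%n. Y n om) ----> Yl om)"
  by (elim exE) (rule that)
 from sk have Om: "prob_space Om" by (elim conjE)
 from sk have Y[measurable]: "Y n \<in> borel_measurable Om" for n by (elim conjE allE)
 from sk have dY: "distr Om borel (Y n) = \<mu> (r n)" for n by (elim conjE allE)
 from sk have conv: "om \<in> space Om ==> (%n. Y n om) ----> Yl om" for om by (elim conjE) (rule bspec)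
 interpret Om: prob_space Om by fact
 define dec :: "real => 'i => real" where "dec c i = unsquash (unit_of_code c i)" for c i
 have dec[measurable]: "dec \<in> measurable borel N"
  unfolding N_def by (rule measurable_PiM_single') (auto simp: dec_def[abs_def])
 have dec_code: "dec (code_of u) = u" for u
  by (rule ext) (simp add: dec_def unit_of_code_of unsquash_squash)
 define V where "V n om = dec (Y n om)" for n om
 have V[measurable]: "V n \<in> measurable Om N" for n
  unfolding V_def[abs_def] by measurable
 have Vi[measurable]: "(%om. V n om i) \<in> borel_measurable Om" for n i
  using measurable_compose[OF V[unfolded N_def] measurable_component_singleton[of i]] by simp
 define L where "L om i = lim (%n. V n om i)" for om i
 have L[measurable]: "L \<in> measurable Om N"
  unfolding N_def by (rule measurable_PiM_single') (auto simp: L_def[abs_def])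
 have law: "distr Om N (V n) = distr (M (r n)) N (U (r n))" for n
 proof -
  have "distr Om N (V n) = distr (distr Om borel (Y n)) N dec"
   by (subst distr_distr) (auto simp: V_def[abs_def] comp_def)
  also have "... = distr (M (r n)) N (%om. dec (code_of (U (r n) om)))"
   unfolding dY \<mu>_def by (subst distr_distr) (auto simp: comp_def)
  finally show ?thesis by (simp add: dec_code eta_contract_eq)
 qed
 have "AE om in Om. (\<forall>m. frac (3 ^ m * Y n om) <= 1 / 2) & (\<forall>i::'i. 0 < unit_of_code (Y n om) i & unit_of_code (Y n om) i < 1)" for n
 proof -
  define P where "P c \<longleftrightarrow> (\<forall>m. frac (3 ^ m * c) <= 1 / 2) & (\<forall>i::'i. 0 < unit_of_code c i & unit_of_code c i < 1)" for c
  have P[measurable]: "Measurable.pred borel P" unfolding P_def frac_def by measurable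
  have "P (code_of u)" for u :: "'i => real"
   unfolding P_def unit_of_code_of by (intro conjI allI squash_range code_of_frac)
  then have "AE c in \<mu> (r n). P c"
   unfolding \<mu>_def using P by (subst AE_distr_iff) (auto simp: pred_def)
  then have "AE om in Om. P (Y n om)"
   unfolding dY[symmetric] using P by (subst (asm) AE_distr_iff) (auto simp: pred_def)
  then show ?thesis unfolding P_def .
 qed
 then have ae: "AE om in Om. \<forall>n. (\<forall>m. frac (3 ^ m * Y n om) <= 1 / 2) & (\<forall>i::'i. 0 < unit_of_code (Y n om) i & unit_of_code (Y n om) i < 1)"
  by (simp add: AE_all_countable)
 define z where "z om i = lim (%n. unit_of_code (Y n om) i)" for om and i :: 'i
 have [measurable]: "(%om. z om i) \<in> borel_measurable Om" for i
  unfolding z_def[abs_def] by measurable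
 have zc: "AE om in Om. \<forall>i. (%n. unit_of_code (Y n om) i) ----> z om i"
  using ae AE_space
 proof eventually_elim
  case (elim om)
  then show ?case unfolding z_def
   by (intro allI convergent_LIMSEQ_iff[THEN iffD1] unit_of_code_convergent[OF conv[of om]]) auto
 qed
 have z_interior: "AE om in Om. \<not> (z om i = 0 \<or> z om i = 1)" for i
 proof -
  let ?B = "{om\<in>space Om. z om i = 0 \<or> z om i = 1}"
  have "emeasure Om ?B <= ennreal ep" if "0 < ep" for ep
  proof -
   obtain K where K: "!!n. measure (M n) {om\<in>space (M n). K < \<bar>U n om i\<bar>} <= ep"
   using tight[OF \<open>0 < ep\<close>] by blast
   have mK: "emeasure Om {om\<in>space Om. K < \<bar>V n om i\<bar>} <= ennreal ep" for n
   proof -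
   have [measurable]: "(%u. u i) \<in> borel_measurable N" unfolding N_def by (rule measurable_component_singleton) simp
   have S: "{u \<in> space N. K < \<bar>u i\<bar>} \<in> sets N" by measurable
   have pre1: "V n -` {u \<in> space N. K < \<bar>u i\<bar>} \<inter> space Om = {om\<in>space Om. K < \<bar>V n om i\<bar>}"
   using measurable_space[OF V] by blast
   have pre2: "U (r n) -` {u \<in> space N. K < \<bar>u i\<bar>} \<inter> space (M (r n)) = {om\<in>space (M (r n)). K < \<bar>U (r n) om i\<bar>}"
   using measurable_space[OF U] by blast
   have "emeasure Om {om\<in>space Om. K < \<bar>V n om i\<bar>} = emeasure (distr Om N (V n)) {u \<in> space N. K < \<bar>u i\<bar>}"
   by (simp only: emeasure_distr[OF V S] pre1)
   also have "... = emeasure (M (r n)) {om\<in>space (M (r n)). K < \<bar>U (r n) om i\<bar>}"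
   by (simp only: law emeasure_distr[OF U S] pre2)
   also have "... <= ennreal ep"
   using K[of "r n"] by (simp add: M.emeasure_eq_measure ennreal_leI)
   finally show ?thesis .
   qed
   have "emeasure Om ?B = (\<integral>\<^sup>+om. indicator ?B om \<partial>Om)" by simp
   also have "... <= (\<integral>\<^sup>+om. liminf (%n. indicator {om\<in>space Om. K < \<bar>V n om i\<bar>} om) \<partial>Om)"
   proof (rule nn_integral_mono_AE)
   show "AE om in Om. indicator ?B om <= liminf (%n. indicator {om\<in>space Om. K < \<bar>V n om i\<bar>} om :: ennreal)"
   using ae zc AE_space
   proof eventually_elim
   case (elim om)
   show ?case
   proof (cases "om \<in> ?B")
   case True
   have "\<forall>\<^sub>F n in sequentially. K < \<bar>V n om i\<bar>"
   unfolding V_def dec_def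
   proof (rule unsquash_blowup[of _ "z om i"])
   show "(%n. unit_of_code (Y n om) i) ----> z om i" using elim(2) by (rule spec)
   show "0 < unit_of_code (Y n om) i" "unit_of_code (Y n om) i < 1" for n using elim(1) by blast+
   show "z om i = 0 \<or> z om i = 1" using True by simp
   qed
   then have "\<forall>\<^sub>F n in sequentially. (1 :: ennreal) <= indicator {om\<in>space Om. K < \<bar>V n om i\<bar>} om"
   by eventually_elim (simp add: elim(3))
   then have "1 <= liminf (%n. indicator {om\<in>space Om. K < \<bar>V n om i\<bar>} om :: ennreal)"
   by (rule Liminf_bounded)
   then show ?thesis using True by simp
   qed simp
   qed
   qed
   also have "... <= liminf (%n. \<integral>\<^sup>+om. indicator {om\<in>space Om. K < \<bar>V n om i\<bar>} om \<partial>Om)"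
   by (rule nn_integral_liminf) measurable
   also have "... <= ennreal ep"
   proof (rule Liminf_le)
   show "\<forall>\<^sub>F n in sequentially. (\<integral>\<^sup>+om. indicator {om\<in>space Om. K < \<bar>V n om i\<bar>} om \<partial>Om) <= ennreal ep"
   using mK by (intro always_eventually allI) simp
   qed simp
   finally show ?thesis .
  qed
  then have "emeasure Om ?B <= 0" by - (rule ennreal_le_epsilon, simp)
  then have "emeasure Om ?B = 0" by simp
  then show ?thesis by (rule AE_I[of _ _ ?B, rotated]) auto
 qed
 have "AE om in Om. \<forall>i. (%n. V n om i) ----> L om i"
 proof -
  have "AE om in Om. \<forall>i. \<not> (z om i = 0 \<or> z om i = 1)"
   using z_interior by (simp add: AE_all_countable)
  then show ?thesis
   using ae zc
  proof eventually_elim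
   case (elim om)
   show ?case
   proof
   fix i
   have z: "(%n. unit_of_code (Y n om) i) ----> z om i" using elim by blast
   have "0 < unit_of_code (Y n om) i" "unit_of_code (Y n om) i < 1" for n using elim(2) by blast+
   then have "0 <= z om i" "z om i <= 1"
   by (blast intro: LIMSEQ_le_const[OF z] LIMSEQ_le_const2[OF z] less_imp_le)+
   moreover have "z om i ~= 0" "z om i ~= 1" using elim(1) by blast+
   ultimately have "0 < z om i" "z om i < 1" by linarith+
   then have "cos (pi * (z om i - 1 / 2)) > 0"
   by (intro cos_gt_zero_pi) (auto simp: field_simps)
   then have "cos (pi * (z om i - 1 / 2)) ~= 0" by simp
   then have "(%n. V n om i) ----> unsquash (z om i)"
   unfolding V_def dec_def unsquash_def by (rule isCont_tendsto_compose[OF isCont_tan]) (intro tendsto_intros z)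
   then have "convergent (%n. V n om i)" by (rule convergentI)
   then show "(%n. V n om i) ----> L om i"
   unfolding L_def by (rule convergent_LIMSEQ_iff[THEN iffD1])
   qed
  qed
 qed
 with r(1) Om V L law show thesis by (rule that)
qed

section \<open>Orthonormal expansions\<close>

definition proj :: "(nat => 'h::real_inner) => nat => 'h => 'h" where
 "proj e K x = (\<Sum>k<K. inner x (e k) *\<^sub>R e k)"

context
 fixes e :: "nat => 'h::{real_inner, banach}"
 assumes onb: "orthonormal_basis e"
begin

lemma onb_inner: "inner (e i) (e j) = (if i = j then 1 else 0)"
 using onb unfolding orthonormal_basis_def by auto

lemma onb_norm: "norm (e i) = 1"
 using onb_inner[of i i] by (simp add: norm_eq_sqrt_inner)

lemma onb_inner_sum:
 assumes "finite F"
 shows "inner (\<Sum>k\<in>F. a k *\<^sub>R e k) (e j) = (if j \<in> F then a j else 0)"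
proof -
 have "inner (\<Sum>k\<in>F. a k *\<^sub>R e k) (e j) = (\<Sum>k\<in>F. if k = j then a j else 0)"
  unfolding inner_sum_left by (rule sum.cong) (auto simp: onb_inner)
 then show ?thesis using assms by simp
qed

lemma onb_norm_sum:
 assumes "finite F"
 shows "(norm (\<Sum>k\<in>F. a k *\<^sub>R e k))^2 = (\<Sum>k\<in>F. (a k)^2)"
proof -
 have "(norm (\<Sum>k\<in>F. a k *\<^sub>R e k))^2 = inner (\<Sum>k\<in>F. a k *\<^sub>R e k) (\<Sum>k\<in>F. a k *\<^sub>R e k)"
  by (simp add: dot_square_norm)
 also have "... = (\<Sum>j\<in>F. a j * inner (\<Sum>k\<in>F. a k *\<^sub>R e k) (e j))"
  by (subst inner_sum_right) simp
 also have "... = (\<Sum>j\<in>F. (a j)^2)"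
  using assms by (intro sum.cong) (auto simp: onb_inner_sum power2_eq_square)
 finally show ?thesis .
qed

lemma proj_inner: "inner (proj e K x) (e j) = (if j < K then inner x (e j) else 0)"
 unfolding proj_def by (subst onb_inner_sum) auto

lemma proj_norm: "(norm (proj e K x))^2 = (\<Sum>k<K. (inner x (e k))^2)"
 unfolding proj_def by (rule onb_norm_sum) simp

lemma proj_linear: "linear (proj e K)"
 unfolding proj_def
 by (rule linearI) (simp_all add: inner_add_left sum.distrib scaleR_left_distrib scaleR_sum_right)

lemma proj_complement_norm: "(norm (x - proj e K x))^2 = (norm x)^2 - (\<Sum>k<K. (inner x (e k))^2)"
proof -
 have "inner x (proj e K x) = (\<Sum>k<K. (inner x (e k))^2)"
  unfolding proj_def inner_sum_right by (simp add: power2_eq_square)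
 moreover have "(norm (x - proj e K x))^2 = (norm x)^2 - 2 * inner x (proj e K x) + (norm (proj e K x))^2"
  by (simp add: power2_norm_eq_inner inner_diff_left inner_diff_right inner_commute)
 ultimately show ?thesis using proj_norm[of K x] by simp
qed

lemma proj_le: "norm (proj e K x) <= norm x"
proof -
 have "0 <= (norm (x - proj e K x))^2" by simp
 then have "(norm (proj e K x))^2 <= (norm x)^2"
  unfolding proj_complement_norm proj_norm by simp
 then show ?thesis by (simp add: power2_le_iff_abs_le)
qed

lemma proj_tendsto: "(%K. proj e K x) ----> x"
proof (rule LIMSEQ_I)
 fix ep :: real assume "0 < ep"
 have "x \<in> closure (span (range e))"
  using onb unfolding orthonormal_basis_def by auto
 then obtain y where y: "y \<in> span (range e)" "dist y x < ep / 2"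
  using \<open>0 < ep\<close> closure_approachable[of x] half_gt_zero by blast
 have "\<exists>K0. \<forall>K\<ge>K0. proj e K y = y"
  using y(1)
 proof (induction rule: span_induct_alt)
  case base
  show ?case by (simp add: linear_0[OF proj_linear])
 next
  case (step c z w)
  then obtain i K0 where "z = e i" and K0: "\<forall>K\<ge>K0. proj e K w = w" by auto
  have "proj e K (e i) = e i" if "i < K" for K
  proof -
   have "proj e K (e i) = (\<Sum>k<K. if k = i then e i else 0)"
   unfolding proj_def by (rule sum.cong) (auto simp: onb_inner)
   then show ?thesis using that by simp
  qed
  then have "\<forall>K\<ge>max K0 (Suc i). proj e K (c *\<^sub>R z + w) = c *\<^sub>R z + w"
   using K0 \<open>z = e i\<close> by (simp add: linear_add[OF proj_linear] linear_scale[OF proj_linear])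
  then show ?case by blast
 qed
 then obtain K0 where K0: "!!K. K \<ge> K0 ==> proj e K y = y" by blast
 have "norm (proj e K x - x) < ep" if "K \<ge> K0" for K
 proof -
  have "proj e K x - x = proj e K (x - y) - (x - y)"
   using K0[OF that] by (simp add: linear_diff[OF proj_linear])
  also have "norm ... <= norm (x - y) + norm (x - y)"
   using proj_le[of K "x - y"] by (intro norm_triangle_le_diff) auto
  also have "... < ep" using y(2) by (simp add: dist_norm norm_minus_commute)
  finally show ?thesis .
 qed
 then show "\<exists>no. \<forall>n\<ge>no. norm (proj e n x - x) < ep" by blast
qed

lemma onb_sums: "(%k. inner x (e k) *\<^sub>R e k) sums x"
 using proj_tendsto[of x] unfolding sums_def proj_def .

lemma parseval: "(%k. (inner x (e k))^2) sums (norm x)^2"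
proof -
 have "(%K. (norm (proj e K x))^2) ----> (norm x)^2"
  by (intro tendsto_intros proj_tendsto)
 then show ?thesis unfolding sums_def proj_norm .
qed

lemma onb_eqI: "(!!k. inner x (e k) = inner y (e k)) ==> x = y"
 using onb_sums[of x] onb_sums[of y] sums_unique2 by force

lemma norm_le_by_coords:
 assumes "!!K. (\<Sum>k<K. (inner x (e k))^2) <= B"
 shows "(norm x)^2 <= B"
 using parseval[of x] assms unfolding sums_def by (intro LIMSEQ_le_const2) auto

lemma proj_complement_inner: "inner (x - proj e K x) (e k) = (if k < K then 0 else inner x (e k))"
 by (simp add: inner_diff_left proj_inner)

lemma riesz_fischer:
 assumes "summable (%k. (a k)^2)"
 shows "summable (%k. a k *\<^sub>R e k)"
 unfolding summable_Cauchy
proof (intro allI impI)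
 fix ep :: real assume "0 < ep"
 then obtain N where N: "!!m n. m \<ge> N ==> norm (\<Sum>k=m..<n. (a k)^2) < ep\<^sup>2"
  using assms unfolding summable_Cauchy by (meson zero_less_power)
 have "norm (\<Sum>k=m..<n. a k *\<^sub>R e k) < ep" if "m \<ge> N" for m n
 proof -
  have "(norm (\<Sum>k=m..<n. a k *\<^sub>R e k))^2 < ep\<^sup>2"
   using N[OF that, of n] onb_norm_sum[of "{m..<n}" a] by simp
  then show ?thesis by (rule power2_less_imp_less) (use \<open>0 < ep\<close> in simp)
 qed
 then show "\<exists>N. \<forall>m\<ge>N. \<forall>n. norm (\<Sum>k=m..<n. a k *\<^sub>R e k) < ep" by blast
qed

lemma inner_suminf:
 assumes "summable (%k. a k *\<^sub>R e k)"
 shows "inner (\<Sum>k. a k *\<^sub>R e k) (e j) = a j"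
proof -
 have "(%n. inner (\<Sum>k<n. a k *\<^sub>R e k) (e j)) ----> inner (\<Sum>k. a k *\<^sub>R e k) (e j)"
  by (intro tendsto_intros summable_LIMSEQ[OF assms])
 moreover have "(%n. inner (\<Sum>k<n. a k *\<^sub>R e k) (e j)) ----> a j"
  by (rule tendsto_eventually, rule eventually_sequentiallyI[of "Suc j"]) (simp add: onb_inner_sum)
 ultimately show ?thesis by (rule LIMSEQ_unique)
qed

section \<open>The semigroup in the eigenbasis\<close>

text \<open>Both sides solve the same linear evolution equation with the same initial value.\<close>

lemma semigroup_eigen:
 fixes S :: "real => 'h \<Rightarrow>\<^sub>L 'h"
 assumes an: "analytic_semigroup S" and gen: "generates D A S" and x: "x \<in> D" "A x = - (a *\<^sub>R x)" and t: "0 <= t"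
 shows "S t x = exp (- a * t) *\<^sub>R x"
proof -
 from an have c0: "c0_semigroup S" unfolding analytic_semigroup_def by blast
 from an obtain \<phi> and U :: "complex => ('h \<times> 'h) \<Rightarrow>\<^sub>L ('h \<times> 'h)" where \<phi>: "0 < \<phi>"
  and US: "!!t x y. 0 <= t ==> blinfun_apply (U (of_real t)) (x, y) = (S t x, S t y)"
  and UD: "!!z. z \<in> sector \<phi> ==> \<exists>L. (U has_derivative (%w. Re w *\<^sub>R L + Im w *\<^sub>R (imag_unit o\<^sub>L L))) (at z)"
  unfolding analytic_semigroup_def by blast
 have S0: "S 0 = id_blinfun" and Sadd: "!!s t. 0 <= s ==> 0 <= t ==> S (s + t) = S s o\<^sub>L S t"
  and Sc: "((%t. S t x) \<longlongrightarrow> x) (at_right 0)"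
  using c0 unfolding c0_semigroup_def by auto
 have gx: "((%h. (S h x - x) /\<^sub>R h) \<longlongrightarrow> - (a *\<^sub>R x)) (at_right 0)"
  using gen x unfolding generates_def by metis
 have dS: "((%s. S s x) has_vector_derivative - (a *\<^sub>R S s x)) (at s)" if s: "0 < s" for s
 proof -
  have "of_real s \<in> sector \<phi>" using s \<phi> by (simp add: sector_def)
  then obtain L where L: "(U has_derivative (%w. Re w *\<^sub>R L + Im w *\<^sub>R (imag_unit o\<^sub>L L))) (at (of_real s))"
   using UD by blast
  have o: "(complex_of_real has_derivative complex_of_real) (at s)"
   by (intro bounded_linear_imp_has_derivative bounded_linear_of_real)
  have "((%r. U (of_real r)) has_derivative (%w. Re (of_real w) *\<^sub>R L + Im (of_real w) *\<^sub>R (imag_unit o\<^sub>L L))) (at s)"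
   by (rule has_derivative_compose[OF o L])
  then have "((%r. fst (blinfun_apply (U (of_real r)) (x, 0))) has_derivative (%w. fst (blinfun_apply (w *\<^sub>R L) (x, 0)))) (at s)"
   by (auto intro!: derivative_eq_intros simp: blinfun.bilinear_simps)
  then have "((%r. fst (blinfun_apply (U (of_real r)) (x, 0))) has_vector_derivative fst (L (x, 0))) (at s)"
   unfolding has_vector_derivative_def by (simp add: blinfun.bilinear_simps)
  then have d: "((%r. S r x) has_vector_derivative fst (L (x, 0))) (at s)"
   by (rule has_vector_derivative_transform_within_open[of _ _ _ "{0<..}"]) (use s US in auto)
  have "((%h. (S (s + h) x - S s x) /\<^sub>R h) \<longlongrightarrow> fst (L (x, 0))) (at 0)"
  proof -
   have "((%h. norm (S (s + h) x - S s x - h *\<^sub>R fst (L (x, 0))) / norm h) \<longlongrightarrow> 0) (at 0)"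
   using d unfolding has_vector_derivative_def has_derivative_at by simp
   then have "((%h. norm ((S (s + h) x - S s x) /\<^sub>R h - fst (L (x, 0)))) \<longlongrightarrow> 0) (at 0)"
   proof (rule Lim_transform_eventually)
   show "\<forall>\<^sub>F h in at 0. norm (S (s + h) x - S s x - h *\<^sub>R fst (L (x, 0))) / norm h =
   norm ((S (s + h) x - S s x) /\<^sub>R h - fst (L (x, 0)))"
   unfolding eventually_at_filter
   proof (intro always_eventually allI impI)
   fix h :: real assume "h ~= 0"
   then have "(S (s + h) x - S s x) /\<^sub>R h - fst (L (x, 0)) = (S (s + h) x - S s x - h *\<^sub>R fst (L (x, 0))) /\<^sub>R h"
   by (simp add: scaleR_diff_right)
   then show "norm (S (s + h) x - S s x - h *\<^sub>R fst (L (x, 0))) / norm h =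
   norm ((S (s + h) x - S s x) /\<^sub>R h - fst (L (x, 0)))"
   by (simp add: divide_inverse mult.commute)
   qed
   qed
   then have "((%h. (S (s + h) x - S s x) /\<^sub>R h - fst (L (x, 0))) \<longlongrightarrow> 0) (at 0)"
   by (rule tendsto_norm_zero_cancel)
   then show ?thesis by (rule LIM_zero_cancel)
  qed
  then have 1: "((%h. (S (s + h) x - S s x) /\<^sub>R h) \<longlongrightarrow> fst (L (x, 0))) (at_right 0)"
   by (rule filterlim_mono) (auto simp: at_le)
  have "((%h. S s ((S h x - x) /\<^sub>R h)) \<longlongrightarrow> S s (- (a *\<^sub>R x))) (at_right 0)"
   by (intro tendsto_intros gx)
  then have 2: "((%h. (S (s + h) x - S s x) /\<^sub>R h) \<longlongrightarrow> S s (- (a *\<^sub>R x))) (at_right 0)"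
  proof (rule Lim_transform_eventually)
   show "\<forall>\<^sub>F h in at_right 0. S s ((S h x - x) /\<^sub>R h) = (S (s + h) x - S s x) /\<^sub>R h"
   unfolding eventually_at_filter using s
   by (intro always_eventually allI impI) (simp add: Sadd blinfun.bilinear_simps)
  qed
  have "fst (L (x, 0)) = - (a *\<^sub>R S s x)"
   using tendsto_unique[OF _ 1 2] by (simp add: blinfun.bilinear_simps)
  with d show ?thesis by simp
 qed
 define g where "g s = exp (a * s) *\<^sub>R S s x" for s
 have dg: "(g has_vector_derivative 0) (at s)" if "0 < s" for s
 proof -
  have "((%s. exp (a * s) *\<^sub>R S s x) has_vector_derivative (exp (a * s) *\<^sub>R (- (a *\<^sub>R S s x)) + (exp (a * s) * a) *\<^sub>R S s x)) (at s)"
   by (rule has_vector_derivative_scaleR[OF _ dS[OF that]]) (auto intro!: derivative_eq_intros)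
  then show ?thesis unfolding g_def[abs_def] by simp
 qed
 show ?thesis
 proof (cases "t = 0")
  case True
  then show ?thesis using S0 by simp
 next
  case False
  then have "0 < t" using t by simp
  have "\<exists>c. \<forall>s\<in>{0<..}. g s = c"
  proof (rule has_vector_derivative_zero_constant)
   show "(g has_vector_derivative 0) (at s within {0<..})" if "s \<in> {0<..}" for s
   by (rule has_vector_derivative_at_within[OF dg]) (use that in simp)
  qed auto
  then obtain c where c: "!!s. 0 < s ==> g s = c" by auto
  have "(g \<longlongrightarrow> exp (a * 0) *\<^sub>R x) (at_right 0)"
   unfolding g_def[abs_def] by (intro tendsto_intros Sc)
  moreover have "(g \<longlongrightarrow> c) (at_right 0)"
   by (rule tendsto_eventually) (use c in \<open>auto simp: eventually_at_filter\<close>)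
  ultimately have "c = x" using tendsto_unique[of "at_right (0::real)" g] by simp
  then have "exp (a * t) *\<^sub>R S t x = x" using c[OF \<open>0 < t\<close>] unfolding g_def by simp
  then have "exp (- (a * t)) *\<^sub>R (exp (a * t) *\<^sub>R S t x) = exp (- (a * t)) *\<^sub>R x" by simp
  then show ?thesis by (simp add: exp_minus)
 qed
qed

lemma semigroup_coord:
 fixes S :: "real => 'h \<Rightarrow>\<^sub>L 'h"
 assumes "!!k. S t (e k) = c k *\<^sub>R e k"
 shows "inner (S t h) (e j) = c j * inner h (e j)"
proof -
 have "(%K. inner (S t (proj e K h)) (e j)) ----> inner (S t h) (e j)"
  by (intro tendsto_intros proj_tendsto)
 moreover have "(%K. inner (S t (proj e K h)) (e j)) ----> c j * inner h (e j)"
 proof (rule tendsto_eventually, rule eventually_sequentiallyI[of "Suc j"])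
  fix K assume "Suc j <= K"
  have "S t (proj e K h) = (\<Sum>k<K. (c k * inner h (e k)) *\<^sub>R e k)"
   unfolding proj_def by (simp add: blinfun.sum_right blinfun.scaleR_right assms mult.commute)
  then show "inner (S t (proj e K h)) (e j) = c j * inner h (e j)"
   using \<open>Suc j <= K\<close> by (simp add: onb_inner_sum)
 qed
 ultimately show ?thesis by (rule LIMSEQ_unique)
qed

text \<open>A compact operator sends the orthonormal basis to a sequence with a convergent subsequence in
every subsequence, but the multiples \<open>e k /\<^sub>R al k\<close> are pairwise orthogonal and stay apart
unless their lengths tend to zero.\<close>

lemma eigenvalues_at_top:
 fixes al :: "nat => real"
 assumes pos: "!!k. 0 < al k" and comp: "compact_operator (diagonal_power e al (- 1))"
 shows "filterlim al at_top sequentially"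
proof (rule ccontr)
 assume "\<not> filterlim al at_top sequentially"
 then obtain Z where "\<not> (\<forall>\<^sub>F k in sequentially. Z <= al k)"
  unfolding filterlim_at_top by blast
 then have "\<exists>\<^sub>F k in sequentially. al k < Z"
  by (simp add: not_eventually not_le)
 then have inf: "infinite {k. al k < Z}"
  by (simp add: frequently_cofinite flip: cofinite_eq_sequentially)
 define s where "s = enumerate {k. al k < Z}"
 have s: "al (s j) < Z" for j using enumerate_in_set[OF inf, of j] by (simp add: s_def)
 have sm: "strict_mono s" unfolding s_def using inf by (rule strict_mono_enumerate)
 have "0 < Z" using s[of 0] pos[of "s 0"] by simp
 have de: "diagonal_power e al (- 1) (e j) = (1 / al j) *\<^sub>R e j" for j
 proof -
  have "diagonal_power e al (- 1) (e j) = (\<Sum>k. if k = j then (al j powr - 1) *\<^sub>R e j else 0)"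
   unfolding diagonal_power_def by (rule arg_cong[where f = suminf]) (auto simp: onb_inner)
  also have "... = (al j powr - 1) *\<^sub>R e j"
   using sums_single[of j "%_. (al j powr - 1) *\<^sub>R e j"] by (simp add: sums_iff)
  finally show ?thesis using pos[of j] by (simp add: powr_minus_divide)
 qed
 have "bounded (range e)" by (rule boundedI[of _ 1]) (auto simp: onb_norm)
 then have "compact (closure (diagonal_power e al (- 1) ` range e))"
  using comp unfolding compact_operator_def by blast
 moreover have "(1 / al (s j)) *\<^sub>R e (s j) \<in> closure (diagonal_power e al (- 1) ` range e)" for j
  unfolding de[of "s j", symmetric]
  by (rule subsetD[OF closure_subset]) (intro imageI rangeI)
 ultimately obtain l r where "strict_mono r" "((%j. (1 / al (s j)) *\<^sub>R e (s j)) \<circ> r) ----> l"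
  unfolding compact_def by (metis (no_types, lifting))
 then have "Cauchy (%j. (1 / al (s (r j))) *\<^sub>R e (s (r j)))"
  using LIMSEQ_imp_Cauchy by (auto simp: comp_def)
 then obtain N where N: "!!m n. m \<ge> N ==> n \<ge> N ==> dist ((1 / al (s (r m))) *\<^sub>R e (s (r m))) ((1 / al (s (r n))) *\<^sub>R e (s (r n))) < 1 / Z"
  using \<open>0 < Z\<close> unfolding Cauchy_def by (meson zero_less_divide_1_iff)
 have "s (r (Suc N)) ~= s (r N)"
  using sm \<open>strict_mono r\<close> by (metis lessI less_irrefl strict_mono_less)
 then have "inner ((1 / al (s (r N))) *\<^sub>R e (s (r N)) - (1 / al (s (r (Suc N)))) *\<^sub>R e (s (r (Suc N)))) (e (s (r N))) = 1 / al (s (r N))"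
  by (simp add: inner_diff_left onb_inner)
 also have "1 / al (s (r N)) > 1 / Z"
  using s[of "r N"] pos[of "s (r N)"] by (intro divide_strict_left_mono) auto
 finally have "1 / Z < inner ((1 / al (s (r N))) *\<^sub>R e (s (r N)) - (1 / al (s (r (Suc N)))) *\<^sub>R e (s (r (Suc N)))) (e (s (r N)))" by simp
 also have "... <= norm ((1 / al (s (r N))) *\<^sub>R e (s (r N)) - (1 / al (s (r (Suc N)))) *\<^sub>R e (s (r (Suc N)))) * norm (e (s (r N)))"
  by (rule norm_cauchy_schwarz)
 finally show False using N[of N "Suc N"] by (simp add: dist_norm onb_norm)
qed

end

section \<open>Convolution with the semigroup\<close>

lemma cauchy_schwarz_integral:
 fixes f g :: "'a => real"
 assumes [measurable]: "f \<in> borel_measurable M" "g \<in> borel_measurable M"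
  and f2: "integrable M (%x. (f x)^2)" and g2: "integrable M (%x. (g x)^2)"
 shows "integrable M (%x. f x * g x)"
  and "(\<integral>x. f x * g x \<partial>M)^2 <= (\<integral>x. (f x)^2 \<partial>M) * (\<integral>x. (g x)^2 \<partial>M)"
proof -
 show fg: "integrable M (%x. f x * g x)"
 proof (rule Bochner_Integration.integrable_bound[OF Bochner_Integration.integrable_add[OF f2 g2]])
  have "\<bar>a * b\<bar> <= a\<^sup>2 + b\<^sup>2" for a b :: real
  proof -
   have "0 <= (\<bar>a\<bar> - \<bar>b\<bar>)^2" by simp
   then have "2 * \<bar>a * b\<bar> <= a\<^sup>2 + b\<^sup>2" by (simp add: power2_diff abs_mult)
   then show ?thesis by simp
  qed
  then show "AE x in M. norm (f x * g x) <= norm ((f x)^2 + (g x)^2)"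
   by (intro AE_I2) (metis abs_ge_self order_trans real_norm_def)
 qed measurable
 define A B P where "A = (\<integral>x. (f x)^2 \<partial>M)" "B = (\<integral>x. (g x)^2 \<partial>M)" "P = (\<integral>x. f x * g x \<partial>M)"
 have q: "0 <= A - 2 * c * P + c\<^sup>2 * B" for c
 proof -
  have "0 <= (\<integral>x. (f x)^2 - 2 * c * (f x * g x) + c\<^sup>2 * (g x)^2 \<partial>M)"
  proof (rule Bochner_Integration.integral_nonneg_AE, rule AE_I2)
   fix x
   have "0 <= (f x - c * g x)^2" by simp
   then show "0 <= (f x)^2 - 2 * c * (f x * g x) + c\<^sup>2 * (g x)^2"
   by (simp add: power2_diff power_mult_distrib algebra_simps)
  qed
  also have "... = A - 2 * c * P + c\<^sup>2 * B"
   unfolding A_B_P_def using f2 g2 fg by simp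
  finally show ?thesis .
 qed
 have B0: "0 <= B" unfolding A_B_P_def by simp
 have "P\<^sup>2 <= A * B"
 proof (cases "B = 0")
  case True
  have "P = 0"
  proof (rule ccontr)
   assume "P ~= 0"
   then show False using q[of "(A + 1) / (2 * P)"] True by simp
  qed
  then show ?thesis using True by simp
 next
  case False
  then have "0 <= A - P\<^sup>2 / B" using q[of "P / B"] by (simp add: power2_eq_square power_divide field_simps)
  then show ?thesis using False B0 by (simp add: field_simps)
 qed
 then show "(\<integral>x. f x * g x \<partial>M)^2 <= (\<integral>x. (f x)^2 \<partial>M) * (\<integral>x. (g x)^2 \<partial>M)"
  unfolding A_B_P_def .
qed

definition conv_exp :: "real => (real => real) => real => real" where
 "conv_exp a g t = (LINT s:{0..t}|lborel. exp (- a * (t - s)) * g s)"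

lemma exp_square_integral:
 assumes "0 < a" "u <= v"
 shows "integrable lborel (%s. (indicator {u..v} s * exp (- a * (t - s)))^2 :: real)"
  and "(\<integral>s. (indicator {u..v} s * exp (- a * (t - s)))^2 \<partial>lborel) = (exp (- 2 * a * (t - v)) - exp (- 2 * a * (t - u))) / (2 * a)"
proof -
 have eq: "(%s. (indicator {u..v} s * exp (- a * (t - s)))^2 :: real) = (%s. exp (- 2 * a * (t - s)) * indicator {u..v} s)"
  by (rule ext) (auto simp: power2_eq_square algebra_simps mult_exp_exp split: split_indicator)
 have F: "((%s. exp (- 2 * a * (t - s)) / (2 * a)) has_real_derivative exp (- 2 * a * (t - s))) (at s)" for s
  using assms(1) by (auto intro!: derivative_eq_intros)
 show "integrable lborel (%s. (indicator {u..v} s * exp (- a * (t - s)))^2 :: real)"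
  using has_bochner_integral_FTC_Icc_real[OF assms(2) F] unfolding eq has_bochner_integral_iff by auto
 show "(\<integral>s. (indicator {u..v} s * exp (- a * (t - s)))^2 \<partial>lborel) = (exp (- 2 * a * (t - v)) - exp (- 2 * a * (t - u))) / (2 * a)"
  unfolding eq by (subst integral_FTC_Icc_real[OF assms(2) F]) (auto simp: diff_divide_distrib)
qed

text \<open>By the Cauchy-Schwarz inequality; the gain \<open>1 / (2 * a)\<close> of the second bound is the
square integral of the exponential and makes the high modes of the drift small.\<close>

lemma conv_exp_bounds:
 fixes g :: "real => real"
 assumes a: "0 < a" and [measurable]: "g \<in> borel_measurable borel"
  and g2: "set_integrable lborel {0..T} (%s. (g s)^2)"
 defines "G \<equiv> LINT s:{0..T}|lborel. (g s)^2"
 shows "0 <= t ==> t <= T ==> set_integrable lborel {0..t} (%s. exp (- a * (t - s)) * g s)"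
  and "0 <= t ==> t <= T ==> (conv_exp a g t)^2 <= G / (2 * a)"
  and "0 <= s ==> s <= t ==> t <= T ==> (conv_exp a g t - conv_exp a g s)^2 <= 3 * (t - s) * G"
proof -
 define h where "h s = indicator {0..T} s * g s" for s
 have [measurable]: "h \<in> borel_measurable borel" unfolding h_def[abs_def] by measurable
 have h2eq: "(%s. (h s)^2) = (%s. indicator {0..T} s *\<^sub>R (g s)^2)"
  by (auto simp: h_def split: split_indicator)
 have h2: "integrable lborel (%s. (h s)^2)" and GH: "G = (\<integral>s. (h s)^2 \<partial>lborel)"
  using g2 unfolding h2eq G_def set_integrable_def set_lebesgue_integral_def by auto
 have G0: "0 <= G" unfolding GH by simp
 have ceq: "(%s. indicator {u..v} s *\<^sub>R (exp (- a * (t - s)) * g s)) = (%s. (indicator {u..v} s * exp (- a * (t - s))) * h s)"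
  if "0 <= u" "v <= T" for u v t
  using that by (auto simp: h_def split: split_indicator)
 have piece: "set_integrable lborel {u..v} (%s. exp (- a * (t - s)) * g s)"
   "(LINT s:{u..v}|lborel. exp (- a * (t - s)) * g s)^2 <= (exp (- 2 * a * (t - v)) - exp (- 2 * a * (t - u))) / (2 * a) * G"
  if "0 <= u" "u <= v" "v <= T" for u v t
  using cauchy_schwarz_integral[OF _ _ exp_square_integral(1)[OF a that(2), of t] h2] that
  unfolding set_integrable_def set_lebesgue_integral_def ceq[OF that(1,3)] exp_square_integral(2)[OF a that(2)] GH
  by simp_all
 show "set_integrable lborel {0..t} (%s. exp (- a * (t - s)) * g s)" if "0 <= t" "t <= T"
  using piece(1)[of 0 t t] that by simp
 show b1: "(conv_exp a g t)^2 <= G / (2 * a)" if "0 <= t" "t <= T" for t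
 proof -
  have "(conv_exp a g t)^2 <= (1 - exp (- 2 * a * t)) / (2 * a) * G"
   using piece(2)[of 0 t t] that unfolding conv_exp_def by simp
  also have "... <= 1 / (2 * a) * G"
   using a G0 by (intro mult_right_mono divide_right_mono) auto
  finally show ?thesis by simp
 qed
 show "(conv_exp a g t - conv_exp a g s)^2 <= 3 * (t - s) * G" if st: "0 <= s" "s <= t" "t <= T"
 proof -
  define d where "d = exp (- a * (t - s))"
  define I where "I = (LINT r:{s..t}|lborel. exp (- a * (t - r)) * g r)"
  have d01: "0 < d" "d <= 1" "1 - d <= a * (t - s)"
   using a st exp_ge_add_one_self[of "- a * (t - s)"] by (auto simp: d_def)
  have "conv_exp a g t = (LINT r:{0..s} \<union> {s..t}|lborel. exp (- a * (t - r)) * g r)"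
   unfolding conv_exp_def using st by (simp add: ivl_disj_un_two_touch)
  also have "... = (LINT r:{0..s}|lborel. exp (- a * (t - r)) * g r) + I"
   unfolding I_def
  proof (rule set_integral_Un_AE)
   show "AE x in lborel. \<not> (x \<in> {0..s} & x \<in> {s..t})"
   using AE_lborel_singleton[of s] by eventually_elim auto
  qed (use piece(1)[of 0 s t] piece(1)[of s t t] st in auto)
  also have "(LINT r:{0..s}|lborel. exp (- a * (t - r)) * g r) = (LINT r:{0..s}|lborel. d * (exp (- a * (s - r)) * g r))"
   unfolding d_def by (rule set_lebesgue_integral_cong) (auto simp: mult_exp_exp algebra_simps)
  also have "... = d * conv_exp a g s" unfolding conv_exp_def by simp
  finally have eq: "conv_exp a g t - conv_exp a g s = I - (1 - d) * conv_exp a g s"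
   by (simp add: algebra_simps)
  have I2: "I\<^sup>2 <= (t - s) * G"
  proof -
   have "I\<^sup>2 <= (1 - exp (- 2 * a * (t - s))) / (2 * a) * G"
   using piece(2)[of s t t] st unfolding I_def by simp
   also have "(1 - exp (- 2 * a * (t - s))) / (2 * a) <= t - s"
   using a exp_ge_add_one_self[of "- 2 * a * (t - s)"] by (simp add: field_simps)
   finally show ?thesis using G0 by (simp add: mult_right_mono)
  qed
  have J2: "((1 - d) * conv_exp a g s)^2 <= (t - s) * G / 2"
  proof -
   have "((1 - d) * conv_exp a g s)^2 = (1 - d)^2 * (conv_exp a g s)^2" by (simp add: power_mult_distrib)
   also have "... <= (a * (t - s)) * (G / (2 * a))"
   proof (rule mult_mono)
   have "(1 - d)^2 <= (1 - d) * 1" unfolding power2_eq_square using d01 by (intro mult_left_mono) auto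
   then show "(1 - d)^2 <= a * (t - s)" using d01 by simp
   qed (use b1 st a d01 in auto)
   also have "... = (t - s) * G / 2" using a by simp
   finally show ?thesis .
  qed
  have "(I - (1 - d) * conv_exp a g s)^2 <= 2 * I\<^sup>2 + 2 * ((1 - d) * conv_exp a g s)^2"
  proof -
   have "0 <= (I + (1 - d) * conv_exp a g s)^2" by simp
   then show ?thesis by (simp add: power2_sum power2_diff)
  qed
  also have "... <= 2 * ((t - s) * G) + 2 * ((t - s) * G / 2)" using I2 J2 by linarith
  also have "... = 3 * (t - s) * G" by simp
  finally show ?thesis unfolding eq .
 qed
qed

section \<open>Dyadic grid\<close>

definition dy :: "real => nat => nat => real" where
 "dy T j i = T * real (min i (2 ^ j)) / 2 ^ j"

text \<open>The index of the last point of level \<open>j\<close> that is not after \<open>t\<close>.\<close>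

definition lo :: "real => nat => real => nat" where
 "lo T j t = nat \<lfloor>2 ^ j * t / T\<rfloor>"

definition dyadics :: "real => real set" where
 "dyadics T = {dy T j i | j i. True}"

lemma countable_dyadics: "countable (dyadics T)"
proof -
 have "dyadics T = (%(j, i). dy T j i) ` UNIV" unfolding dyadics_def by auto
 then show ?thesis by simp
qed

lemma dy_in_dyadics[simp]: "dy T j i \<in> dyadics T" unfolding dyadics_def by blast

context
 fixes T :: real
 assumes T: "0 < T"
begin

lemma dy_range: "dy T j i \<in> {0..T}"
proof -
 have "real (min i (2 ^ j)) <= 2 ^ j"
  by (metis min.cobounded2 of_nat_le_iff of_nat_numeral of_nat_power)
 then show ?thesis using T unfolding dy_def by (auto simp: divide_le_eq mult_left_mono)
qed

lemma dyadics_range: "dyadics T \<subseteq> {0..T}" using dy_range unfolding dyadics_def by blast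

lemma dy_mono: "i <= i' ==> dy T j i <= dy T j i'"
 unfolding dy_def using T by (intro divide_right_mono mult_left_mono) (auto simp: min_def)

lemma dy_eq: "i <= 2 ^ j ==> dy T j i = T * real i / 2 ^ j"
 unfolding dy_def by (simp add: min_absorb1)

lemma dy_0: "dy T j 0 = 0" by (simp add: dy_def)

lemma dy_refine: "dy T (j + k) (2 ^ k * i) = dy T j i"
proof -
 have "min (2 ^ k * i) (2 ^ (j + k)) = 2 ^ k * min i (2 ^ j)"
  by (simp add: power_add nat_mult_min_right mult.commute)
 then show ?thesis unfolding dy_def by (simp add: power_add)
qed

lemma lo_le: "t <= T ==> lo T j t <= 2 ^ j"
proof -
 assume "t <= T"
 then have "2 ^ j * t / T <= 2 ^ j" using T by (simp add: divide_le_eq)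
 then have "\<lfloor>2 ^ j * t / T\<rfloor> <= 2 ^ j" by (metis floor_mono floor_numeral_power)
 then have "nat \<lfloor>2 ^ j * t / T\<rfloor> <= nat (2 ^ j)" by (rule nat_mono)
 then show ?thesis unfolding lo_def by (simp add: nat_power_eq)
qed

lemma dy_lo:
 assumes "0 <= t" "t <= T"
 shows "dy T j (lo T j t) <= t" "t < dy T j (lo T j t) + T / 2 ^ j"
proof -
 have e: "dy T j (lo T j t) = T * of_int \<lfloor>2 ^ j * t / T\<rfloor> / 2 ^ j"
  using dy_eq[OF lo_le[OF assms(2)]] assms T unfolding lo_def by simp
 have "of_int \<lfloor>2 ^ j * t / T\<rfloor> <= 2 ^ j * t / T" by linarith
 then have "T * of_int \<lfloor>2 ^ j * t / T\<rfloor> <= T * (2 ^ j * t / T)" using T by (intro mult_left_mono) auto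
 then show "dy T j (lo T j t) <= t" unfolding e using T by (simp add: divide_le_eq mult.commute)
 have "2 ^ j * t / T < of_int \<lfloor>2 ^ j * t / T\<rfloor> + 1" by linarith
 then have "T * (2 ^ j * t / T) < T * (of_int \<lfloor>2 ^ j * t / T\<rfloor> + 1)" using T by (intro mult_strict_left_mono) auto
 then have "2 ^ j * t < T * of_int \<lfloor>2 ^ j * t / T\<rfloor> + T" using T by (simp add: algebra_simps)
 then have "t < (T * of_int \<lfloor>2 ^ j * t / T\<rfloor> + T) / 2 ^ j" by (simp add: less_divide_eq mult.commute)
 then show "t < dy T j (lo T j t) + T / 2 ^ j" unfolding e by (simp add: add_divide_distrib)
qed

lemma dy_step: "dy T j (Suc i) <= dy T j i + T / 2 ^ j"
proof -
 have "min (Suc i) (2 ^ j) <= Suc (min i (2 ^ j))" by simp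
 then have "real (min (Suc i) (2 ^ j)) <= real (Suc (min i (2 ^ j)))" by (simp only: of_nat_le_iff)
 then have "real (min (Suc i) (2 ^ j)) <= real (min i (2 ^ j)) + 1" by simp
 then have "T * real (min (Suc i) (2 ^ j)) <= T * (real (min i (2 ^ j)) + 1)" using T by (intro mult_left_mono) auto
 then show ?thesis unfolding dy_def by (simp add: field_simps)
qed

lemma T_over_pow_tendsto: "(%j. T / 2 ^ j) ----> 0"
proof -
 have "(%j. T * (1 / 2) ^ j) ----> T * 0"
  by (intro tendsto_intros LIMSEQ_power_zero) simp
 then show ?thesis by (simp add: power_divide)
qed

lemma dy_lo_tendsto: "0 <= t ==> t <= T ==> (%j. dy T j (lo T j t)) ----> t"
proof (rule tendsto_sandwich[of "%j. t - T / 2 ^ j" _ _ "%_. t"])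
 assume t: "0 <= t" "t <= T"
 show "\<forall>\<^sub>F j in sequentially. t - T / 2 ^ j <= dy T j (lo T j t)"
  using dy_lo(2)[OF t] by (intro always_eventually allI) (simp add: less_imp_le diff_le_eq)
 show "\<forall>\<^sub>F j in sequentially. dy T j (lo T j t) <= t" using dy_lo(1)[OF t] by simp
 show "(%j. t - T / 2 ^ j) ----> t"
  using tendsto_diff[OF tendsto_const T_over_pow_tendsto, of t] by simp
qed simp

lemma lo_dy: "i <= 2 ^ j ==> lo T (j + k) (dy T j i) = 2 ^ k * i"
proof -
 assume "i <= 2 ^ j"
 then have "2 ^ (j + k) * dy T j i / T = real (2 ^ k * i)"
  using T by (simp add: dy_eq power_add)
 then show ?thesis unfolding lo_def by (simp only: floor_of_nat nat_int)
qed

lemma dyadics_cases: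
 assumes "q \<in> dyadics T"
 obtains j i where "i <= 2 ^ j" "q = dy T j i"
proof -
 from assms obtain j i where "q = dy T j i" unfolding dyadics_def by blast
 then have "q = dy T j (min i (2 ^ j))" by (simp add: dy_def)
 then show thesis by (intro that[of "min i (2 ^ j)" j]) auto
qed

end

section \<open>The diagonal data\<close>

text \<open>The consequences of the standing assumptions that the rest of the proof uses: everything is
diagonal in the basis \<open>e\<close>, with an exponent \<open>p \<le> 1\<close> of Hoelder regularity for
the noise.\<close>

locale diagonal_data =
 fixes T :: real
  and S :: "real => 'h::{real_inner, banach, second_countable_topology} \<Rightarrow>\<^sub>L 'h"
  and Q :: "'h => 'h" and e :: "nat => 'h" and al lam :: "nat => real" and p :: real
 assumes T: "0 < T" and onb: "orthonormal_basis e"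
  and S_eigen: "!!t k. 0 <= t ==> S t (e k) = exp (- al k * t) *\<^sub>R e k"
  and Q_eigen: "!!k. Q (e k) = lam k *\<^sub>R e k"
  and al_pos: "!!k. 0 < al k" and lam_pos: "!!k. 0 < lam k"
  and al_top: "filterlim al at_top sequentially"
  and p: "0 < p" "p <= 1"
  and noise_summable: "summable (%k. (lam k)^2 * al k powr (p - 1))"
begin

lemma S_coord: "0 <= t ==> inner (S t h) (e j) = exp (- al j * t) * inner h (e j)"
 by (rule semigroup_coord[OF onb]) (rule S_eigen)

lemma S_expansion: "0 <= t ==> (%K. \<Sum>k<K. (exp (- al k * t) * inner h (e k)) *\<^sub>R e k) ----> S t h"
 using onb_sums[OF onb, of "S t h"] by (simp add: sums_def S_coord)

lemma S_contraction: "0 <= t ==> norm (S t h) <= norm h"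
proof -
 assume t: "0 <= t"
 have "(\<Sum>k<K. (inner (S t h) (e k))^2) <= (norm h)^2" for K
 proof -
  have "(\<Sum>k<K. (inner (S t h) (e k))^2) <= (\<Sum>k<K. (inner h (e k))^2)"
  proof (rule sum_mono)
   fix k
   have "\<bar>exp (- al k * t)\<bar> <= 1" using al_pos[of k] t by simp
   then have "\<bar>inner (S t h) (e k)\<bar> <= \<bar>inner h (e k)\<bar>"
   unfolding S_coord[OF t] abs_mult by (intro mult_left_le_one_le) auto
   then show "(inner (S t h) (e k))^2 <= (inner h (e k))^2" by (simp add: abs_le_square_iff)
  qed
  also have "... <= (norm h)^2"
   using sum_le_suminf[OF sums_summable[OF parseval[OF onb, of h]], of "{..<K}"] sums_unique[OF parseval[OF onb, of h]] by simp
  finally show ?thesis .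
 qed
 then have "(norm (S t h))^2 <= (norm h)^2" by (rule norm_le_by_coords[OF onb])
 then show ?thesis by (simp add: power2_le_iff_abs_le)
qed

lemma S_continuous: "continuous_on {0..} (%t. S t h)"
proof -
 have "uniform_limit {0..} (%K t. \<Sum>k<K. (exp (- al k * t) * inner h (e k)) *\<^sub>R e k) (%t. S t h) sequentially"
 proof (rule uniform_limitI)
  fix ep :: real assume "0 < ep"
  have "\<forall>\<^sub>F K in sequentially. dist (proj e K h) h < ep"
   using proj_tendsto[OF onb, of h] \<open>0 < ep\<close> by (rule tendstoD)
  then show "\<forall>\<^sub>F K in sequentially. \<forall>t\<in>{0..}. dist (\<Sum>k<K. (exp (- al k * t) * inner h (e k)) *\<^sub>R e k) (S t h) < ep"
  proof eventually_elim
   case (elim K)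
   show ?case
   proof
   fix t :: real assume "t \<in> {0..}"
   then have t: "0 <= t" by simp
   have "S t (proj e K h) = (\<Sum>k<K. (exp (- al k * t) * inner h (e k)) *\<^sub>R e k)"
   unfolding proj_def by (simp add: blinfun.sum_right blinfun.scaleR_right S_eigen[OF t] mult.commute)
   then have "dist (\<Sum>k<K. (exp (- al k * t) * inner h (e k)) *\<^sub>R e k) (S t h) = norm (S t (proj e K h - h))"
   by (simp add: dist_norm blinfun.diff_right)
   also have "... <= norm (proj e K h - h)" by (rule S_contraction[OF t])
   finally show "dist (\<Sum>k<K. (exp (- al k * t) * inner h (e k)) *\<^sub>R e k) (S t h) < ep"
   using elim by (simp add: dist_norm)
   qed
  qed
 qed
 then show ?thesis
  by (rule uniform_limit_theorem[rotated]) (auto intro!: always_eventually continuous_intros)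
qed

lemma S_measurable:
 assumes [measurable]: "f \<in> borel_measurable M" "ta \<in> borel_measurable M"
 shows "(%s. if 0 <= ta s then S (ta s) (f s) else 0) \<in> borel_measurable M"
proof (rule borel_measurable_LIMSEQ_metric)
 show "(%s. if 0 <= ta s then (\<Sum>k<K. (exp (- al k * ta s) * inner (f s) (e k)) *\<^sub>R e k) else 0) \<in> borel_measurable M" for K
  by measurable
 show "(%K. if 0 <= ta s then (\<Sum>k<K. (exp (- al k * ta s) * inner (f s) (e k)) *\<^sub>R e k) else 0)
   ----> (if 0 <= ta s then S (ta s) (f s) else 0)" for s
  using S_expansion[of "ta s" "f s"] by (cases "0 <= ta s") auto
qed

definition convol :: "(real => 'h) => real => 'h" where
 "convol f t = (LINT s:{0..t}|lborel. S (t - s) (f s))"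

definition energy :: "(real => 'h) => real" where
 "energy f = (LINT s:{0..T}|lborel. (norm (f s))^2)"

context
 fixes f :: "real => 'h"
 assumes f[measurable]: "f \<in> borel_measurable borel"
  and f2: "set_integrable lborel {0..T} (%s. (norm (f s))^2)"
begin

lemma coord_square_integrable: "set_integrable lborel {0..T} (%s. (inner (f s) (e k))^2)"
 unfolding set_integrable_def
proof (rule Bochner_Integration.integrable_bound[OF f2[unfolded set_integrable_def]])
 have "(inner (f s) (e k))^2 <= (norm (f s))^2" for s
  using Cauchy_Schwarz_ineq2[of "f s" "e k"] onb_norm[OF onb, of k]
  by (simp add: abs_le_square_iff[symmetric])
 then show "AE s in lborel. norm (indicator {0..T} s *\<^sub>R (inner (f s) (e k))^2) <= norm (indicator {0..T} s *\<^sub>R (norm (f s))^2)"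
  by (intro AE_I2) (auto split: split_indicator)
qed measurable

lemma energy_coords: "(\<Sum>k\<in>F. LINT s:{0..T}|lborel. (inner (f s) (e k))^2) <= energy f" if "finite F"
proof -
 have "(\<Sum>k\<in>F. LINT s:{0..T}|lborel. (inner (f s) (e k))^2) = (LINT s:{0..T}|lborel. (\<Sum>k\<in>F. (inner (f s) (e k))^2))"
  using coord_square_integrable unfolding set_lebesgue_integral_def set_integrable_def scaleR_sum_right
  by (intro Bochner_Integration.integral_sum[symmetric])
 also have "... <= energy f"
  unfolding energy_def
 proof (rule set_integral_mono)
  show "set_integrable lborel {0..T} (%s. \<Sum>k\<in>F. (inner (f s) (e k))^2)"
   using coord_square_integrable unfolding set_integrable_def scaleR_sum_right
   by (intro Bochner_Integration.integrable_sum)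
  show "(\<Sum>k\<in>F. (inner (f s) (e k))^2) <= (norm (f s))^2" for s
   using sum_le_suminf[OF sums_summable[OF parseval[OF onb, of "f s"]] that] sums_unique[OF parseval[OF onb, of "f s"]] by simp
 qed (rule f2)
 finally show ?thesis .
qed

lemma energy_nonneg: "0 <= energy f" using energy_coords[of "{}"] by simp

lemma convol_integrable:
 assumes "0 <= t" "t <= T"
 shows "set_integrable lborel {0..t} (%s. S (t - s) (f s))"
proof -
 have eq: "(%s. indicator {0..t} s *\<^sub>R S (t - s) (f s)) = (%s. indicator {0..t} s *\<^sub>R (if 0 <= t - s then S (t - s) (f s) else 0))"
  by (auto split: split_indicator)
 have [measurable]: "(%s. indicator {0..t} s *\<^sub>R S (t - s) (f s)) \<in> borel_measurable borel"
  unfolding eq by (intro borel_measurable_scaleR S_measurable) auto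
 have "integrable lborel (%s. indicator {0..T} s + indicator {0..T} s *\<^sub>R (norm (f s))^2)"
  using f2 unfolding set_integrable_def
  by (intro Bochner_Integration.integrable_add integrable_real_indicator) (auto simp: emeasure_lborel_Icc_eq)
 then show ?thesis unfolding set_integrable_def
 proof (rule Bochner_Integration.integrable_bound)
  have "norm (S (t - s) (f s)) <= 1 + (norm (f s))^2" if "s <= t" for s
  proof -
   have "norm (S (t - s) (f s)) <= norm (f s)" using that by (intro S_contraction) simp
   also have "... <= 1 + (norm (f s))^2"
   proof -
   have "0 <= (norm (f s) - 1)^2" by simp
   then have "2 * norm (f s) <= 1 + (norm (f s))^2" by (simp add: power2_diff)
   then show ?thesis using norm_ge_zero[of "f s"] by linarith
   qed
   finally show ?thesis .
  qed
  then show "AE s in lborel. norm (indicator {0..t} s *\<^sub>R S (t - s) (f s)) <= norm (indicator {0..T} s + indicator {0..T} s *\<^sub>R (norm (f s))^2)"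
   using assms by (intro AE_I2) (auto split: split_indicator)
 qed measurable
qed

lemma convol_coord:
 assumes "0 <= t" "t <= T"
 shows "inner (convol f t) (e k) = conv_exp (al k) (%s. inner (f s) (e k)) t"
proof -
 have "inner (convol f t) (e k) = (\<integral>s. inner (indicator {0..t} s *\<^sub>R S (t - s) (f s)) (e k) \<partial>lborel)"
  unfolding convol_def set_lebesgue_integral_def
  by (rule integral_inner_left[symmetric]) (rule convol_integrable[OF assms, unfolded set_integrable_def])
 also have "... = conv_exp (al k) (%s. inner (f s) (e k)) t"
  unfolding conv_exp_def set_lebesgue_integral_def
  by (rule Bochner_Integration.integral_cong) (auto simp: S_coord split: split_indicator)
 finally show ?thesis .
qed

text \<open>The coordinatewise bounds have constants that do not depend on the coordinate, so they add up by
Parseval's identity.\<close>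

lemma convol_holder:
 assumes "0 <= s" "s <= t" "t <= T"
 shows "(norm (convol f t - convol f s))^2 <= 3 * (t - s) * energy f"
proof (rule norm_le_by_coords[OF onb])
 fix K
 have "(\<Sum>k<K. (inner (convol f t - convol f s) (e k))^2)
  <= (\<Sum>k<K. 3 * (t - s) * (LINT s:{0..T}|lborel. (inner (f s) (e k))^2))"
 proof (rule sum_mono)
  fix k
  show "(inner (convol f t - convol f s) (e k))^2 <= 3 * (t - s) * (LINT s:{0..T}|lborel. (inner (f s) (e k))^2)"
   using conv_exp_bounds(3)[OF al_pos _ coord_square_integrable assms, of k] assms
   by (simp add: inner_diff_left convol_coord)
 qed
 also have "... <= 3 * (t - s) * energy f"
  unfolding sum_distrib_left[symmetric] using assms by (intro mult_left_mono energy_coords) auto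
 finally show "(\<Sum>k<K. (inner (convol f t - convol f s) (e k))^2) <= 3 * (t - s) * energy f" .
qed

lemma convol_tail:
 assumes "0 <= t" "t <= T" and b: "!!k. k \<ge> K ==> 1 / (2 * al k) <= b"
 shows "(norm (convol f t - proj e K (convol f t)))^2 <= b * energy f"
proof (rule norm_le_by_coords[OF onb])
 fix n
 have "(\<Sum>k<n. (inner (convol f t - proj e K (convol f t)) (e k))^2)
  <= (\<Sum>k<n. b * (LINT s:{0..T}|lborel. (inner (f s) (e k))^2))"
 proof (rule sum_mono)
  fix k
  define G where "G = (LINT s:{0..T}|lborel. (inner (f s) (e k))^2)"
  have G: "0 <= G" using energy_nonneg unfolding G_def set_lebesgue_integral_def by simp
  have b0: "0 <= b" using b[OF order_refl] al_pos[of K] by (smt (verit) divide_nonneg_pos)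
  show "(inner (convol f t - proj e K (convol f t)) (e k))^2 <= b * (LINT s:{0..T}|lborel. (inner (f s) (e k))^2)"
  proof (cases "k < K")
   case True
   then show ?thesis using b0 G unfolding G_def by (simp add: proj_complement_inner[OF onb])
  next
   case False
   then have "(inner (convol f t - proj e K (convol f t)) (e k))^2 <= G / (2 * al k)"
   using conv_exp_bounds(2)[OF al_pos _ coord_square_integrable assms(1,2), of k] assms(1,2)
   unfolding G_def by (simp add: proj_complement_inner[OF onb] convol_coord)
   also have "... = 1 / (2 * al k) * G" by simp
   also have "... <= b * G" using b[of k] False G by (intro mult_right_mono) auto
   finally show ?thesis unfolding G_def .
  qed
 qed
 also have "... <= b * energy f"
 proof -
  have b0: "0 <= b" using b[OF order_refl] al_pos[of K] by (smt (verit) divide_nonneg_pos)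
  show ?thesis unfolding sum_distrib_left[symmetric] using b0 by (intro mult_left_mono energy_coords) auto
 qed
 finally show "(\<Sum>k<n. (inner (convol f t - proj e K (convol f t)) (e k))^2) <= b * energy f" .
qed

end

lemma al_tail_bound: "0 < b ==> \<exists>K. \<forall>k\<ge>K. 1 / (2 * al k) <= b"
proof -
 assume "0 < b"
 have "\<forall>\<^sub>F k in sequentially. 1 / (2 * b) <= al k"
  using al_top unfolding filterlim_at_top by blast
 then obtain K where "!!k. k \<ge> K ==> 1 / (2 * b) <= al k" unfolding eventually_sequentially by blast
 then have "\<forall>k\<ge>K. 1 / (2 * al k) <= b" using \<open>0 < b\<close> al_pos by (auto simp: field_simps)
 then show ?thesis by blast
qed

end

section \<open>Squares and limits of random variables\<close>

lemma nn_L1_AE_subseq: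
 fixes f :: "nat => 'a => real"
 assumes [measurable]: "!!j. f j \<in> borel_measurable M" and pos: "!!j x. 0 <= f j x"
  and lim: "(%j. \<integral>\<^sup>+x. ennreal (f j x) \<partial>M) ----> 0"
 shows "\<exists>r. strict_mono r & (AE x in M. (%j. f (r j) x) ----> 0)"
proof -
 have "\<forall>\<^sub>F j in sequentially. (\<integral>\<^sup>+x. ennreal (f j x) \<partial>M) < 1"
  using lim by (rule order_tendstoD) simp
 then obtain N where N: "!!j. j \<ge> N ==> (\<integral>\<^sup>+x. ennreal (f j x) \<partial>M) < 1"
  unfolding eventually_sequentially by blast
 have fin: "(\<integral>\<^sup>+x. ennreal (f (j + N) x) \<partial>M) < \<infinity>" for j
  using N[of "j + N"] by (metis ennreal_one_less_top infinity_ennreal_def le_add2 order_less_trans)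
 have int: "integrable M (%x. f (j + N) x)" for j
  using fin[of j] pos by (intro integrableI_nonneg) auto
 have "(%j. \<integral>\<^sup>+x. ennreal (f (j + N) x) \<partial>M) ----> 0"
  using lim by (rule LIMSEQ_ignore_initial_segment)
 then have "(%j. ennreal (\<integral>x. norm (f (j + N) x) \<partial>M)) ----> ennreal 0"
  using int pos by (simp add: nn_integral_eq_integral)
 then have "(%j. \<integral>x. norm (f (j + N) x) \<partial>M) ----> 0"
  by (subst (asm) tendsto_ennreal_iff) (auto simp: pos)
 from tendsto_L1_AE_subseq[OF int this]
 obtain r where r: "strict_mono r" "AE x in M. (%j. f (r j + N) x) ----> 0" by blast
 have "strict_mono (%j. r j + N)" using r(1) by (simp add: strict_mono_def)
 with r(2) show ?thesis by blast
qed

lemma norm_add_square_le: "(norm (x + y))^2 <= 2 * (norm x)^2 + 2 * (norm (y :: 'a::real_normed_vector))^2"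
proof -
 have "(norm (x + y))^2 <= (norm x + norm y)^2" by (intro power_mono norm_triangle_ineq) simp
 moreover have "0 <= (norm x - norm y)^2" by simp
 ultimately show ?thesis by (simp add: power2_sum power2_diff)
qed

lemma nn_square_add:
 fixes f g :: "'a => 'b::{real_normed_vector, second_countable_topology}"
 assumes [measurable]: "f \<in> borel_measurable M" "g \<in> borel_measurable M"
 shows "(\<integral>\<^sup>+x. ennreal ((norm (f x + g x))^2) \<partial>M)
  <= 2 * (\<integral>\<^sup>+x. ennreal ((norm (f x))^2) \<partial>M) + 2 * (\<integral>\<^sup>+x. ennreal ((norm (g x))^2) \<partial>M)"
proof -
 have "(\<integral>\<^sup>+x. ennreal ((norm (f x + g x))^2) \<partial>M) <= (\<integral>\<^sup>+x. 2 * ennreal ((norm (f x))^2) + 2 * ennreal ((norm (g x))^2) \<partial>M)"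
 proof (rule nn_integral_mono)
  fix x
  have "ennreal ((norm (f x + g x))^2) <= ennreal (2 * (norm (f x))^2 + 2 * (norm (g x))^2)"
   by (rule ennreal_leI) (rule norm_add_square_le)
  then show "ennreal ((norm (f x + g x))^2) <= 2 * ennreal ((norm (f x))^2) + 2 * ennreal ((norm (g x))^2)"
   by (simp add: ennreal_plus ennreal_mult)
 qed
 also have "... = 2 * (\<integral>\<^sup>+x. ennreal ((norm (f x))^2) \<partial>M) + 2 * (\<integral>\<^sup>+x. ennreal ((norm (g x))^2) \<partial>M)"
  by (subst nn_integral_add) (auto simp: nn_integral_cmult)
 finally show ?thesis .
qed

lemma nn_square_tri:
 fixes f g h :: "'a => 'b::{real_normed_vector, second_countable_topology}"
 assumes [measurable]: "f \<in> borel_measurable M" "g \<in> borel_measurable M" "h \<in> borel_measurable M"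
 shows "(\<integral>\<^sup>+x. ennreal ((norm (f x - h x))^2) \<partial>M)
  <= 2 * (\<integral>\<^sup>+x. ennreal ((norm (f x - g x))^2) \<partial>M) + 2 * (\<integral>\<^sup>+x. ennreal ((norm (g x - h x))^2) \<partial>M)"
 using nn_square_add[of "%x. f x - g x" M "%x. g x - h x"] by simp

lemma L2_limit_moment:
 fixes X :: "'a => real"
 assumes [measurable]: "X \<in> borel_measurable M" "!!j. Y j \<in> borel_measurable M"
  and lim: "(%j. \<integral>\<^sup>+x. ennreal ((X x - Y j x)^2) \<partial>M) ----> 0"
  and bd: "\<forall>\<^sub>F j in sequentially. (\<integral>\<^sup>+x. ennreal (Y j x ^ (2 * m)) \<partial>M) <= C"
 shows "(\<integral>\<^sup>+x. ennreal (X x ^ (2 * m)) \<partial>M) <= C"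
proof -
 obtain r where r: "strict_mono r" "AE x in M. (%j. (X x - Y (r j) x)^2) ----> 0"
  using nn_L1_AE_subseq[OF _ _ lim] by auto
 have "(\<integral>\<^sup>+x. ennreal (X x ^ (2 * m)) \<partial>M) = (\<integral>\<^sup>+x. liminf (%j. ennreal (Y (r j) x ^ (2 * m))) \<partial>M)"
 proof (rule nn_integral_cong_AE)
  show "AE x in M. ennreal (X x ^ (2 * m)) = liminf (%j. ennreal (Y (r j) x ^ (2 * m)))"
   using r(2)
  proof eventually_elim
   case (elim x)
   have "(%j. sqrt ((X x - Y (r j) x)^2)) ----> sqrt 0" by (intro tendsto_intros elim)
   then have "(%j. X x - Y (r j) x) ----> 0" by (simp add: tendsto_rabs_zero_iff)
   then have "(%j. X x - (X x - Y (r j) x)) ----> X x - 0" by (intro tendsto_intros)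
   then have "(%j. Y (r j) x) ----> X x" by simp
   then have "(%j. ennreal (Y (r j) x ^ (2 * m))) ----> ennreal (X x ^ (2 * m))"
   by (intro tendsto_ennrealI tendsto_intros)
   then show ?case by (rule lim_imp_Liminf[OF trivial_limit_sequentially, symmetric])
  qed
 qed
 also have "... <= liminf (%j. \<integral>\<^sup>+x. ennreal (Y (r j) x ^ (2 * m)) \<partial>M)"
  by (rule nn_integral_liminf) measurable
 also have "... <= C"
 proof (rule Liminf_le)
  show "\<forall>\<^sub>F j in sequentially. (\<integral>\<^sup>+x. ennreal (Y (r j) x ^ (2 * m)) \<partial>M) <= C"
   using eventually_subseq[OF r(1) bd] .
 qed simp
 finally show ?thesis .
qed

section \<open>Centered Gaussian variables\<close>

text \<open>Variance zero is allowed, so that degenerate increments need no special case.\<close>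

definition gaussian :: "'w measure => ('w => real) => real => bool" where
 "gaussian M X v \<longleftrightarrow> X \<in> borel_measurable M \<and>
   distr M borel X = distr (density lborel std_normal_density) borel (%x. sqrt v * x)"

definition gauss_moment :: "nat => real" where
 "gauss_moment m = fact (2 * m) / (2 ^ m * fact m)"

lemma gauss_moment_pos: "0 < gauss_moment m" by (simp add: gauss_moment_def)

abbreviation "stdn \<equiv> density lborel std_normal_density"

lemma prob_space_stdn: "prob_space stdn" by (rule prob_space_normal_density) simp

lemma stdn_scaled:
 assumes "0 < v"
 shows "distr stdn borel (%x. sqrt v * x) = density lborel (normal_density 0 (sqrt v))"
proof -
 interpret prob_space stdn by (rule prob_space_stdn)
 have "distributed stdn lborel (%x. x) (%x. ennreal (std_normal_density x))"
  unfolding distributed_def by (auto simp: distr_id2)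
 from normal_density_affine[OF this, of "sqrt v" 0] assms
 have "distributed stdn lborel (%x. sqrt v * x) (%x. ennreal (normal_density 0 (sqrt v) x))"
  by simp
 then have "distr stdn lborel (%x. sqrt v * x) = density lborel (normal_density 0 (sqrt v))"
  by (simp add: distributed_def)
 moreover have "distr stdn lborel (%x. sqrt v * x) = distr stdn borel (%x. sqrt v * x)"
  by (rule distr_cong) auto
 ultimately show ?thesis by simp
qed

lemma gaussian_iff_distributed:
 assumes "0 < v" and [measurable]: "X \<in> borel_measurable M"
 shows "gaussian M X v \<longleftrightarrow> distributed M lborel X (normal_density 0 (sqrt v))"
proof -
 have "distr M lborel X = distr M borel X" by (rule distr_cong) auto
 then show ?thesis
  unfolding gaussian_def distributed_def stdn_scaled[OF assms(1)] by auto
qed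

lemma gaussian_AE_cong:
 assumes "gaussian M X v" and [measurable]: "Y \<in> borel_measurable M" and "AE x in M. X x = Y x"
 shows "gaussian M Y v"
proof -
 have [measurable]: "X \<in> borel_measurable M" using assms(1) by (simp add: gaussian_def)
 have "distr M borel Y = distr M borel X"
  using assms(3) by (intro distr_cong_AE) auto
 then show ?thesis using assms(1) by (simp add: gaussian_def)
qed

lemma gaussian_scale:
 assumes "gaussian M X v"
 shows "gaussian M (%x. c * X x) (c\<^sup>2 * v)"
proof -
 have [measurable]: "X \<in> borel_measurable M" using assms by (simp add: gaussian_def)
 have "distr M borel (%x. c * X x) = distr (distr M borel X) borel (%x. c * x)"
  by (subst distr_distr) (auto simp: comp_def)
 also have "... = distr stdn borel (%x. c * (sqrt v * x))"
 proof -
  have "distr M borel X = distr stdn borel (%x. sqrt v * x)" using assms by (simp add: gaussian_def)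
  then show ?thesis by (simp only:) (subst distr_distr, auto simp: comp_def)
 qed
 also have "... = distr stdn borel (%x. sqrt (c\<^sup>2 * v) * x)"
 proof (cases "0 <= c")
  case True
  then show ?thesis by (simp add: real_sqrt_mult mult.assoc)
 next
  case False
  have minus: "distr stdn borel (%x. - x :: real) = distr stdn borel (%x. x)"
  proof -
   interpret prob_space stdn by (rule prob_space_stdn)
   have "distributed stdn lborel (%x. x) (%x. ennreal (std_normal_density x))"
   unfolding distributed_def by (auto simp: distr_id2)
   from normal_density_affine[OF this, of "- 1" 0]
   have "distributed stdn lborel (%x. - x) (%x. ennreal (std_normal_density x))" by simp
   then have "distr stdn lborel (%x. - x) = stdn" by (simp add: distributed_def)
   moreover have "distr stdn lborel (%x. - x) = distr stdn borel (%x. - x :: real)" by (rule distr_cong) auto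
   moreover have "distr stdn borel (%x. x) = stdn" by (rule distr_id2) simp
   ultimately show ?thesis by simp
  qed
  have "distr stdn borel (%x. c * (sqrt v * x)) = distr (distr stdn borel (%x. x)) borel (%x. c * (sqrt v * x))"
   by (subst distr_distr) (auto simp: comp_def)
  also have "... = distr stdn borel (%x. c * (sqrt v * - x))"
   unfolding minus[symmetric] by (subst distr_distr) (auto simp: comp_def)
  also have "... = distr stdn borel (%x. sqrt (c\<^sup>2 * v) * x)"
   using False by (simp add: real_sqrt_mult mult.assoc)
  finally show ?thesis .
 qed
 finally show ?thesis unfolding gaussian_def by simp
qed

lemma stdn_scaled_0: "distr stdn borel ((*) (0::real)) = return borel 0"
proof -
 interpret N: prob_space stdn by (rule prob_space_stdn)
 have "((*) (0::real)) = (%_. 0)" by auto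
 then show ?thesis by (simp only:) (rule N.distr_const, simp)
qed

lemma gaussian_zero:
 assumes "prob_space M"
 shows "gaussian M (%_. 0) 0"
proof -
 interpret M: prob_space M by fact
 have "distr M borel (%_. 0 :: real) = return borel 0" by (rule M.distr_const) simp
 then show ?thesis unfolding gaussian_def by (simp add: stdn_scaled_0)
qed

lemma gaussian_0_AE:
 assumes "gaussian M X 0"
 shows "AE x in M. X x = 0"
proof -
 have [measurable]: "X \<in> borel_measurable M" using assms by (simp add: gaussian_def)
 have d: "distr M borel X = return borel 0" using assms stdn_scaled_0 unfolding gaussian_def by simp
 have "AE y in distr M borel X. y = 0" unfolding d by (subst AE_return) auto
 then show ?thesis by (subst (asm) AE_distr_iff) auto
qed

lemma (in prob_space) gaussian_add:
 assumes X: "gaussian M X u" and Y: "gaussian M Y v" and ind: "indep_var borel X borel Y"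
  and "0 <= u" "0 <= v"
 shows "gaussian M (%om. X om + Y om) (u + v)"
proof -
 have [measurable]: "X \<in> borel_measurable M" "Y \<in> borel_measurable M"
  using X Y by (auto simp: gaussian_def)
 consider "u = 0" | "v = 0" | "0 < u" "0 < v" using assms by linarith
 then show ?thesis
 proof cases
  case 1
  have "AE om in M. Y om = X om + Y om" using gaussian_0_AE X 1 by force
  then show ?thesis using gaussian_AE_cong[OF Y] 1 by simp
 next
  case 2
  have "AE om in M. X om = X om + Y om" using gaussian_0_AE Y 2 by force
  then show ?thesis using gaussian_AE_cong[OF X] 2 by simp
 next
  case 3
  have "distributed M lborel (%x. X x + Y x) (normal_density (0 + 0) (sqrt ((sqrt u)^2 + (sqrt v)^2)))"
   using X Y 3 by (intro add_indep_normal ind) (auto simp: gaussian_iff_distributed)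
  then show ?thesis using 3 by (subst gaussian_iff_distributed) auto
 qed
qed

lemma gaussian_moment:
 assumes "gaussian M X v" "0 <= v"
 shows "(\<integral>\<^sup>+om. ennreal (X om ^ (2 * m)) \<partial>M) = ennreal (gauss_moment m * v ^ m)"
proof -
 have [measurable]: "X \<in> borel_measurable M" using assms by (simp add: gaussian_def)
 have "(\<integral>\<^sup>+om. ennreal (X om ^ (2 * m)) \<partial>M) = (\<integral>\<^sup>+x. ennreal (x ^ (2 * m)) \<partial>distr M borel X)"
  by (subst nn_integral_distr) auto
 also have "... = (\<integral>\<^sup>+x. ennreal ((sqrt v * x) ^ (2 * m)) \<partial>stdn)"
  using assms(1) unfolding gaussian_def by (simp add: nn_integral_distr)
 also have "... = (\<integral>\<^sup>+x. ennreal (v ^ m * (std_normal_density x * x ^ (2 * m))) \<partial>lborel)"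
 proof -
  have "(sqrt v * x) ^ (2 * m) = v ^ m * x ^ (2 * m)" for x
   by (simp only: power_mult_distrib power_mult real_sqrt_pow2[OF assms(2)])
  then show ?thesis
   by (subst nn_integral_density) (auto intro!: nn_integral_cong simp: ennreal_mult'[symmetric] mult_ac)
 qed
 also have "... = ennreal (v ^ m * gauss_moment m)"
  using std_normal_moment_even[of m] assms(2) unfolding gauss_moment_def
  by (subst nn_integral_eq_integral) (auto simp: has_bochner_integral_iff power_mult)
 finally show ?thesis by (simp add: mult.commute)
qed

lemma Int_stable_vimages: "Int_stable {X -` A \<inter> Om | A. A \<in> sets N}"
proof (rule Int_stableI)
 fix a b assume "a \<in> {X -` A \<inter> Om | A. A \<in> sets N}" "b \<in> {X -` A \<inter> Om | A. A \<in> sets N}"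
 then obtain A B where "a = X -` A \<inter> Om" "b = X -` B \<inter> Om" "A \<in> sets N" "B \<in> sets N" by blast
 then have "a \<inter> b = X -` (A \<inter> B) \<inter> Om" "A \<inter> B \<in> sets N" by auto
 then show "a \<inter> b \<in> {X -` A \<inter> Om | A. A \<in> sets N}" by blast
qed

section \<open>Wiener integrals over one Brownian motion\<close>

locale brownian = prob_space M for M :: "'w measure" +
 fixes T :: real and \<F> and be :: "real => 'w => real"
 assumes T: "0 < T" and filt: "filtered_prob_space T M \<F>" and bm: "brownian_motion T M \<F> be"
begin

lemma filt_measurable: "t \<in> {0..T} ==> Y \<in> measurable (\<F> t) N ==> Y \<in> measurable M N"
 using filt unfolding filtered_prob_space_def by (auto intro: measurable_from_subalg)

lemma filt_space: "t \<in> {0..T} ==> space (\<F> t) = space M"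
 using filt unfolding filtered_prob_space_def subalgebra_def by auto

lemma filt_mono: "s \<in> {0..T} ==> t \<in> {0..T} ==> s <= t ==> Y \<in> measurable (\<F> s) N ==> Y \<in> measurable (\<F> t) N"
proof (rule measurable_from_subalg)
 assume *: "s \<in> {0..T}" "t \<in> {0..T}" "s <= t"
 then have "sets (\<F> s) \<subseteq> sets (\<F> t)" using filt unfolding filtered_prob_space_def by blast
 then show "subalgebra (\<F> t) (\<F> s)" unfolding subalgebra_def using * by (simp add: filt_space)
qed

lemma bm_adapted: "t \<in> {0..T} ==> be t \<in> borel_measurable (\<F> t)"
 using bm unfolding brownian_motion_def by auto

lemma bm_measurable: "t \<in> {0..T} ==> be t \<in> borel_measurable M"
 using bm_adapted filt_measurable by blast

lemma bm_zero: "AE om in M. be 0 om = 0" using bm unfolding brownian_motion_def by auto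

lemma bm_incr_gaussian:
 assumes "0 <= s" "s <= t" "t <= T"
 shows "gaussian M (%om. be t om - be s om) (t - s)"
proof (cases "s = t")
 case True
 then show ?thesis using gaussian_zero[OF prob_space_axioms] by simp
next
 case False
 have [measurable]: "be t \<in> borel_measurable M" "be s \<in> borel_measurable M" using assms bm_measurable by auto
 show ?thesis using False assms bm unfolding brownian_motion_def
  by (subst gaussian_iff_distributed) auto
qed

lemma bm_incr_indep:
 assumes "0 <= s" "s < t" "t <= T" and Y: "Y \<in> borel_measurable (\<F> s)"
 shows "indep_var borel Y borel (%om. be t om - be s om)"
proof -
 have [measurable]: "be t \<in> borel_measurable M" "be s \<in> borel_measurable M" using assms bm_measurable by auto
 have [measurable]: "Y \<in> borel_measurable M" by (rule filt_measurable[OF _ Y]) (use assms in auto)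
 let ?B = "{(%om. be t om - be s om) -` B \<inter> space M |B. B \<in> sets borel}"
 have ind: "indep_set (sets (\<F> s)) ?B"
  using assms bm unfolding brownian_motion_def by auto
 have sp: "space (\<F> s) = space M" using assms by (intro filt_space) auto
 have sub: "{Y -` A \<inter> space M | A. A \<in> sets borel} \<subseteq> sets (\<F> s)"
  using measurable_sets[OF Y] unfolding sp by auto
 have "indep_set {Y -` A \<inter> space M | A. A \<in> sets borel} ?B"
 proof (rule indep_setI)
  show "{Y -` A \<inter> space M | A. A \<in> sets borel} \<subseteq> events" using sub indep_setD_ev1[OF ind] by blast
  show "?B \<subseteq> events" by (rule indep_setD_ev2[OF ind])
 qed (use sub indep_setD[OF ind] in blast)
 then have "indep_set (sigma_sets (space M) {Y -` A \<inter> space M | A. A \<in> sets borel}) (sigma_sets (space M) ?B)"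
  by (rule indep_set_sigma_sets) (rule Int_stable_vimages)+
 then show ?thesis unfolding indep_var_eq by simp
qed

lemma bm_square_integrable:
 assumes "0 <= s" "s <= t" "t <= T"
 shows "integrable M (%om. (be t om - be s om)^2)" "(\<integral>om. (be t om - be s om)^2 \<partial>M) = t - s"
proof -
 have [measurable]: "be t \<in> borel_measurable M" "be s \<in> borel_measurable M" using assms bm_measurable by auto
 have "(\<integral>\<^sup>+om. ennreal ((be t om - be s om)^2) \<partial>M) = ennreal (t - s)"
  using gaussian_moment[OF bm_incr_gaussian[OF assms], of 1] assms by (simp add: gauss_moment_def)
 then have "has_bochner_integral M (%om. (be t om - be s om)^2) (t - s)"
  using assms by (intro has_bochner_integral_nn_integral) auto
 then show "integrable M (%om. (be t om - be s om)^2)" "(\<integral>om. (be t om - be s om)^2 \<partial>M) = t - s"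
  by (auto simp: has_bochner_integral_iff)
qed

lemma gaussian_mean:
 assumes "gaussian M X v" "0 <= v"
 shows "integrable M X" "(\<integral>om. X om \<partial>M) = 0"
proof -
 have [measurable]: "X \<in> borel_measurable M" using assms by (simp add: gaussian_def)
 have i: "integrable stdn (%x. x)" "(\<integral>x. x \<partial>stdn) = 0"
  using std_normal_moment_odd[of 0] by (auto simp: integrable_density integral_density has_bochner_integral_iff)
 have d: "distr M borel X = distr stdn borel (%x. sqrt v * x)" using assms by (simp add: gaussian_def)
 have "integrable (distr M borel X) (%x. x)"
  unfolding d by (subst integrable_distr_eq) (auto intro: integrable_mult_right i)
 then show "integrable M X" by (subst (asm) integrable_distr_eq) auto
 have "(\<integral>om. X om \<partial>M) = (\<integral>x. x \<partial>distr M borel X)" by (subst integral_distr) auto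
 also have "... = (\<integral>x. sqrt v * x \<partial>stdn)" unfolding d by (subst integral_distr) auto
 finally show "(\<integral>om. X om \<partial>M) = 0" using i by simp
qed

lemma bm_cov:
 assumes "s \<in> {0..T}" "t \<in> {0..T}"
 shows "integrable M (%om. be s om * be t om)" "(\<integral>om. be s om * be t om \<partial>M) = min s t"
proof -
 have main: "integrable M (%om. be s om * be t om) & (\<integral>om. be s om * be t om \<partial>M) = s"
  if st: "0 <= s" "s <= t" "t <= T" for s t
 proof -
  have [measurable]: "be t \<in> borel_measurable M" "be s \<in> borel_measurable M" "be 0 \<in> borel_measurable M"
   using st bm_measurable T by auto
  have g: "gaussian M (be s) s"
  proof (rule gaussian_AE_cong[of M "%om. be s om - be 0 om"])
   show "gaussian M (%om. be s om - be 0 om) s" using bm_incr_gaussian[of 0 s] st by simp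
   show "AE om in M. be s om - be 0 om = be s om" using bm_zero by eventually_elim simp
  qed simp
  have sq: "integrable M (%om. (be s om)^2)" "(\<integral>om. (be s om)^2 \<partial>M) = s"
  proof -
   have "AE om in M. (be s om - be 0 om)^2 = (be s om)^2" using bm_zero by eventually_elim simp
   then show "integrable M (%om. (be s om)^2)" "(\<integral>om. (be s om)^2 \<partial>M) = s"
   using bm_square_integrable[of 0 s] st integrable_cong_AE[of "%om. (be s om - be 0 om)^2" M "%om. (be s om)^2"]
   integral_cong_AE[of "%om. (be s om - be 0 om)^2" M "%om. (be s om)^2"] by auto
  qed
  have gi: "gaussian M (%om. be t om - be s om) (t - s)" using st by (rule bm_incr_gaussian)
  have cr: "integrable M (%om. be s om * (be t om - be s om)) & (\<integral>om. be s om * (be t om - be s om) \<partial>M) = 0"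
  proof (cases "s = t")
   case False
   have ind: "indep_var borel (be s) borel (%om. be t om - be s om)"
   using st False by (intro bm_incr_indep bm_adapted) auto
   have "integrable M (be s)" "integrable M (%om. be t om - be s om)" "expectation (be s) = 0"
   using gaussian_mean[OF g] gaussian_mean[OF gi] st by auto
   then show ?thesis
   using indep_var_integrable[OF ind] indep_var_lebesgue_integral[OF ind] by simp
  qed simp
  have eq: "(%om. be s om * be t om) = (%om. (be s om)^2 + be s om * (be t om - be s om))"
   by (auto simp: power2_eq_square algebra_simps)
  show ?thesis unfolding eq using sq cr by simp
 qed
 show "integrable M (%om. be s om * be t om)" "(\<integral>om. be s om * be t om \<partial>M) = min s t"
  using main[of s t] main[of t s] assms by (cases "s <= t"; simp add: mult.commute min_def)+
qed

definition lcomb :: "(real \<times> 'h::real_vector) list => 'w => 'h" where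
 "lcomb xs om = (\<Sum>(t, c)\<leftarrow>xs. be t om *\<^sub>R c)"

definition lfun :: "(real \<times> 'h::real_vector) list => real => 'h" where
 "lfun xs s = (\<Sum>(t, c)\<leftarrow>xs. indicator {0<..t} s *\<^sub>R c)"

lemma lcomb_simps[simp]: "lcomb [] om = 0" "lcomb (x # xs) om = be (fst x) om *\<^sub>R snd x + lcomb xs om"
 "lcomb (xs @ ys) om = lcomb xs om + lcomb ys om"
 by (auto simp: lcomb_def split_beta)

lemma lfun_simps[simp]: "lfun [] s = 0" "lfun (x # xs) s = indicator {0<..fst x} s *\<^sub>R snd x + lfun xs s"
 "lfun (xs @ ys) s = lfun xs s + lfun ys s"
 by (auto simp: lfun_def split_beta)

lemma lcomb_isometry_inner:
 fixes xs ys :: "(real \<times> 'h::{real_inner, second_countable_topology, banach}) list"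
 assumes "fst ` set xs \<subseteq> {0..T}" "fst ` set ys \<subseteq> {0..T}"
 shows "integrable M (%om. inner (lcomb xs om) (lcomb ys om)) & integrable lborel (%s. inner (lfun xs s) (lfun ys s)) \<and>
  (\<integral>om. inner (lcomb xs om) (lcomb ys om) \<partial>M) = (\<integral>s. inner (lfun xs s) (lfun ys s) \<partial>lborel)"
 using assms(1)
proof (induction xs)
 case Nil
 then show ?case by simp
next
 case (Cons x xs)
 obtain t c where x: "x = (t, c)" by force
 have t: "t \<in> {0..T}" using Cons.prems x by simp
 have "integrable M (%om. inner (be t om *\<^sub>R c) (lcomb ys om)) & integrable lborel (%s. inner (indicator {0<..t} s *\<^sub>R c) (lfun ys s)) \<and>
  (\<integral>om. inner (be t om *\<^sub>R c) (lcomb ys om) \<partial>M) = (\<integral>s. inner (indicator {0<..t} s *\<^sub>R c) (lfun ys s) \<partial>lborel)"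
  using assms(2)
 proof (induction ys)
  case Nil
  then show ?case by simp
 next
  case (Cons y ys)
  obtain u d where y: "y = (u, d)" by force
  have u: "u \<in> {0..T}" using Cons.prems y by simp
  have ieq: "indicator {0<..t} s * indicator {0<..u} s = (indicator {0<..min t u} s :: real)" for s
   by (auto split: split_indicator)
  have 1: "integrable M (%om. (be t om * be u om) * inner c d)" "(\<integral>om. (be t om * be u om) * inner c d \<partial>M) = min t u * inner c d"
   using bm_cov[OF t u] by auto
  have 2: "integrable lborel (%s. indicator {0<..min t u} s * inner c d)" "(\<integral>s. indicator {0<..min t u} s * inner c d \<partial>lborel) = min t u * inner c d"
   using t u by (auto simp: emeasure_lborel_Ioc)
  have "fst ` set ys \<subseteq> {0..T}" using Cons.prems by simp
  note IH = Cons.IH[OF this]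
  have e1: "(%om. inner (be t om *\<^sub>R c) (lcomb (y # ys) om)) = (%om. (be t om * be u om) * inner c d + inner (be t om *\<^sub>R c) (lcomb ys om))"
   by (auto simp: y inner_add_right algebra_simps)
  have e2: "(%s. inner (indicator {0<..t} s *\<^sub>R c) (lfun (y # ys) s)) = (%s. indicator {0<..min t u} s * inner c d + inner (indicator {0<..t} s *\<^sub>R c) (lfun ys s))"
   unfolding ieq[symmetric] by (auto simp: y inner_add_right algebra_simps)
  show ?case unfolding e1 e2
   using Bochner_Integration.integrable_add[OF 1(1) IH[THEN conjunct1]]
   Bochner_Integration.integrable_add[OF 2(1) IH[THEN conjunct2, THEN conjunct1]]
   Bochner_Integration.integral_add[OF 1(1) IH[THEN conjunct1]]
   Bochner_Integration.integral_add[OF 2(1) IH[THEN conjunct2, THEN conjunct1]]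
   1(2) 2(2) IH[THEN conjunct2, THEN conjunct2]
   by (simp only: simp_thms)
 qed
 then show ?case
  using Cons unfolding x by (simp add: inner_add_left)
qed

lemma lcomb_isometry:
 fixes xs :: "(real \<times> 'h::{real_inner, second_countable_topology, banach}) list"
 assumes "fst ` set xs \<subseteq> {0..T}"
 shows "(\<integral>\<^sup>+om. ennreal ((norm (lcomb xs om))^2) \<partial>M) = (\<integral>\<^sup>+s. ennreal ((norm (lfun xs s))^2) \<partial>lborel)"
 using lcomb_isometry_inner[OF assms assms] unfolding power2_norm_eq_inner
 by (simp add: nn_integral_eq_integral)

definition step_list :: "nat => (nat => real) => (nat => 'h::real_vector) => (real \<times> 'h) list" where
 "step_list n ta c = concat (map (%i. [(ta (Suc i), c i), (ta i, - c i)]) [0..<n])"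

lemma lcomb_step: "lcomb (step_list n ta c) om = step_integral n ta c be om"
 unfolding step_list_def step_integral_def
 by (induction n) (auto simp: scaleR_left_diff_distrib)

lemma lfun_step:
 assumes "!!i. i < n ==> ta i <= ta (Suc i)" "!!i. i <= n ==> 0 <= ta i"
 shows "lfun (step_list n ta c) s = step_function n ta c s"
 using assms unfolding step_list_def step_function_def
proof (induction n)
 case (Suc n)
 have "indicator {0<..ta (Suc n)} s *\<^sub>R c n + indicator {0<..ta n} s *\<^sub>R - c n = indicator {ta n<..ta (Suc n)} s *\<^sub>R c n"
  using Suc.prems(1)[of n] Suc.prems(2)[of n] by (auto split: split_indicator)
 then show ?case using Suc by simp
qed simp

lemma step_list_times: "\<forall>i\<le>n. ta i \<in> {0..t} ==> fst ` set (step_list n ta c) \<subseteq> {0..t}"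
 unfolding step_list_def by auto

lemma step_list_uminus: "lcomb (step_list n ta (%i. - c i)) om = - lcomb (step_list n ta c) om"
  "lfun (step_list n ta (%i. - c i)) s = - lfun (step_list n ta c) s"
 unfolding step_list_def by (induction n) auto

lemma step_function_outside: "\<forall>i\<le>n. ta i \<in> {0..t} ==> s \<notin> {0..t} ==> step_function n ta c s = 0"
 unfolding step_function_def
 by (rule sum.neutral) (auto simp: indicator_def dest: spec[of _ "Suc _"], (metis Suc_leI less_imp_le order_trans)+)

lemma step_isometry:
 fixes c c' :: "nat => 'h::{real_inner, second_countable_topology, banach}"
 assumes t: "t <= T"
  and ta: "\<forall>i\<le>n. ta i \<in> {0..t}" "\<forall>i<n. ta i <= ta (Suc i)"
  and ta': "\<forall>i\<le>n'. ta' i \<in> {0..t}" "\<forall>i<n'. ta' i <= ta' (Suc i)"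
 shows "(\<integral>\<^sup>+om. ennreal ((norm (step_integral n ta c be om - step_integral n' ta' c' be om))^2) \<partial>M)
  = (\<integral>\<^sup>+s\<in>{0..t}. ennreal ((norm (step_function n ta c s - step_function n' ta' c' s))^2) \<partial>lborel)"
proof -
 define xs where "xs = step_list n ta c @ step_list n' ta' (%i. - c' i)"
 have "fst ` set xs \<subseteq> {0..T}"
  using step_list_times[OF ta(1), of c] step_list_times[OF ta'(1), of "%i. - c' i"] t unfolding xs_def by force
 from lcomb_isometry[OF this]
 have "(\<integral>\<^sup>+om. ennreal ((norm (step_integral n ta c be om - step_integral n' ta' c' be om))^2) \<partial>M)
  = (\<integral>\<^sup>+s. ennreal ((norm (lfun (step_list n ta c) s - lfun (step_list n' ta' c') s))^2) \<partial>lborel)"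
  unfolding xs_def by (simp add: step_list_uminus lcomb_step)
 also have "... = (\<integral>\<^sup>+s. ennreal ((norm (step_function n ta c s - step_function n' ta' c' s))^2) \<partial>lborel)"
  using ta ta' by (subst (1 2) lfun_step) auto
 also have "... = (\<integral>\<^sup>+s\<in>{0..t}. ennreal ((norm (step_function n ta c s - step_function n' ta' c' s))^2) \<partial>lborel)"
  using step_function_outside[OF ta(1), of _ c] step_function_outside[OF ta'(1), of _ c']
  by (intro nn_integral_cong) (auto split: split_indicator)
 finally show ?thesis .
qed

lemma step_integral_measurable:
 fixes c :: "nat => 'h::{real_normed_vector, second_countable_topology}"
 assumes "\<forall>i\<le>n. ta i \<in> {0..T}"
 shows "step_integral n ta c be \<in> borel_measurable M"
 unfolding step_integral_def[abs_def] using assms bm_measurable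
 by (intro borel_measurable_sum borel_measurable_scaleR borel_measurable_diff) auto

lemma step_function_measurable[measurable]:
 fixes c :: "nat => 'h::{real_normed_vector, second_countable_topology}"
 shows "step_function n ta c \<in> borel_measurable borel"
 unfolding step_function_def[abs_def] by measurable

text \<open>The isometry for step functions transfers to any approximation: the error in mean square is that
of the integrands.\<close>

lemma wiener_integral_approx:
 fixes g :: "real => 'h::{real_inner, second_countable_topology, banach}"
 assumes J: "has_wiener_integral M be t g J" and t: "t <= T"
  and ta: "\<forall>i\<le>n. ta i \<in> {0..t}" "\<forall>i<n. ta i <= ta (Suc i)"
 shows "(\<integral>\<^sup>+om. ennreal ((norm (J om - step_integral n ta c be om))^2) \<partial>M)
  <= 4 * (\<integral>\<^sup>+s\<in>{0..t}. ennreal ((norm (g s - step_function n ta c s))^2) \<partial>lborel)"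
proof -
 from J obtain n' ta' c' where [measurable]: "J \<in> borel_measurable M" and g: "set_borel_measurable lborel {0..t} g"
  and ta': "\<forall>j. \<forall>i\<le>n' j. ta' j i \<in> {0..t}" "\<forall>j. \<forall>i<n' j. ta' j i <= ta' j (Suc i)"
  and l1: "(%j. \<integral>\<^sup>+s\<in>{0..t}. ennreal ((norm (g s - step_function (n' j) (ta' j) (c' j) s))^2) \<partial>lborel) ----> 0"
  and l2: "(%j. \<integral>\<^sup>+om. ennreal ((norm (J om - step_integral (n' j) (ta' j) (c' j) be om))^2) \<partial>M) ----> 0"
  unfolding has_wiener_integral_def by blast
 let ?X = "\<integral>\<^sup>+om. ennreal ((norm (J om - step_integral n ta c be om))^2) \<partial>M"
 let ?G = "\<integral>\<^sup>+s\<in>{0..t}. ennreal ((norm (g s - step_function n ta c s))^2) \<partial>lborel"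
 define a where "a j = (\<integral>\<^sup>+om. ennreal ((norm (J om - step_integral (n' j) (ta' j) (c' j) be om))^2) \<partial>M)" for j
 define b where "b j = (\<integral>\<^sup>+s\<in>{0..t}. ennreal ((norm (g s - step_function (n' j) (ta' j) (c' j) s))^2) \<partial>lborel)" for j
 have m1[measurable]: "step_integral n ta c be \<in> borel_measurable M"
  using ta(1) t by (intro step_integral_measurable) auto
 have m2[measurable]: "step_integral (n' j) (ta' j) (c' j) be \<in> borel_measurable M" for j
 proof (rule step_integral_measurable)
  show "\<forall>i\<le>n' j. ta' j i \<in> {0..T}" using ta'(1) t by (metis atLeastAtMost_iff order_trans)
 qed
 have [measurable]: "(%s. indicator {0..t} s *\<^sub>R g s) \<in> borel_measurable borel"
  using g unfolding set_borel_measurable_def by simp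
 have "?X <= (2 * a j + 4 * b j) + 4 * ?G" for j
 proof -
  have "?X <= 2 * a j + 2 * (\<integral>\<^sup>+om. ennreal ((norm (step_integral (n' j) (ta' j) (c' j) be om - step_integral n ta c be om))^2) \<partial>M)"
   unfolding a_def by (rule nn_square_tri) auto
  also have "(\<integral>\<^sup>+om. ennreal ((norm (step_integral (n' j) (ta' j) (c' j) be om - step_integral n ta c be om))^2) \<partial>M)
   = (\<integral>\<^sup>+s\<in>{0..t}. ennreal ((norm (step_function (n' j) (ta' j) (c' j) s - step_function n ta c s))^2) \<partial>lborel)"
   using ta ta' t by (intro step_isometry) auto
  also have "... = (\<integral>\<^sup>+s. ennreal ((norm (indicator {0..t} s *\<^sub>R step_function (n' j) (ta' j) (c' j) s - indicator {0..t} s *\<^sub>R step_function n ta c s))^2) \<partial>lborel)"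
   by (intro nn_integral_cong) (auto split: split_indicator)
  also have "... <= 2 * (\<integral>\<^sup>+s. ennreal ((norm (indicator {0..t} s *\<^sub>R step_function (n' j) (ta' j) (c' j) s - indicator {0..t} s *\<^sub>R g s))^2) \<partial>lborel)
   + 2 * (\<integral>\<^sup>+s. ennreal ((norm (indicator {0..t} s *\<^sub>R g s - indicator {0..t} s *\<^sub>R step_function n ta c s))^2) \<partial>lborel)"
   by (rule nn_square_tri) auto
  also have "(\<integral>\<^sup>+s. ennreal ((norm (indicator {0..t} s *\<^sub>R step_function (n' j) (ta' j) (c' j) s - indicator {0..t} s *\<^sub>R g s))^2) \<partial>lborel) = b j"
   unfolding b_def by (intro nn_integral_cong) (auto split: split_indicator simp: norm_minus_commute)
  also have "(\<integral>\<^sup>+s. ennreal ((norm (indicator {0..t} s *\<^sub>R g s - indicator {0..t} s *\<^sub>R step_function n ta c s))^2) \<partial>lborel) = ?G"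
   by (intro nn_integral_cong) (auto split: split_indicator)
  finally have "?X <= 2 * a j + 2 * (2 * b j + 2 * ?G)" by (simp add: mult_left_mono)
  then show ?thesis by (simp add: distrib_left mult.assoc[symmetric] add.assoc)
 qed
 moreover have "(%j. (2 * a j + 4 * b j) + 4 * ?G) ----> (2 * 0 + 4 * 0) + 4 * ?G"
  using l1 l2 unfolding a_def b_def
  by (intro tendsto_add ennreal_tendsto_cmult tendsto_const) auto
 ultimately have "?X <= (2 * 0 + 4 * 0) + 4 * ?G"
  by (intro LIMSEQ_le_const) auto
 then show ?thesis by simp
qed

end

section \<open>Independence of a Gaussian variable from the past\<close>

definition cutoff :: "nat => real => real => real" where
 "cutoff m a y = max 0 (min 1 (1 - real m * (y - a)))"

lemma cutoff_cont: "continuous_on UNIV (cutoff m a)"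
 unfolding cutoff_def[abs_def] by (intro continuous_intros)

lemma cutoff_bound: "\<bar>cutoff m a y\<bar> <= 1"
 by (auto simp: cutoff_def)

lemma cutoff_measurable[measurable]: "cutoff m a \<in> borel_measurable borel"
 by (rule borel_measurable_continuous_onI[OF cutoff_cont])

lemma cutoff_lim: "(%m. cutoff m a y) ----> indicator {..a} y"
proof (cases "y <= a")
 case True
 have "cutoff m a y = 1" for m using mult_nonneg_nonpos[of "real m" "y - a"] True by (simp add: cutoff_def)
 then show ?thesis using True by simp
next
 case False
 obtain N where N: "1 / (y - a) < real N" using reals_Archimedean2 by blast
 have "cutoff m a y = indicator {..a} y" if "N <= m" for m
 proof -
  have "1 < real N * (y - a)" using N False by (simp add: divide_less_eq)
  also have "... <= real m * (y - a)" using that False by (intro mult_right_mono) auto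
  finally show ?thesis using False by (simp add: cutoff_def)
 qed
 then have "\<forall>\<^sub>F m in sequentially. cutoff m a y = indicator {..a} y"
  by (intro eventually_sequentiallyI[of N]) blast
 then show ?thesis by (rule tendsto_eventually)
qed

context prob_space
begin

text \<open>\<open>Z\<close> is centered Gaussian of variance \<open>v\<close> and independent of the
variables \<open>\<Lambda> c\<close>, \<open>c \<in> D\<close>. The formulation by bounded continuous test
functions is the one that is stable under almost sure limits.\<close>

definition indep_gauss :: "('i => 'a => real) => 'i set => ('a => real) => real => bool" where
 "indep_gauss \<Lambda> D Z v \<longleftrightarrow> Z \<in> borel_measurable M \<and>
   (\<forall>(I :: 'i set) (ps :: real => real) (g :: 'i => real => real). finite I --> I \<subseteq> D --> continuous_on UNIV ps --> (\<forall>y. \<bar>ps y\<bar> <= 1) \<longrightarrow>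
   (\<forall>c. continuous_on UNIV (g c)) --> (\<forall>c y. \<bar>g c y\<bar> <= 1) \<longrightarrow>
   (\<integral>om. ps (Z om) * (\<Prod>c\<in>I. g c (\<Lambda> c om)) \<partial>M)
   = (\<integral>(y :: real). ps (sqrt v * y) \<partial>stdn) * (\<integral>om. (\<Prod>c\<in>I. g c (\<Lambda> c om)) \<partial>M))"

lemma indep_gaussD:
 fixes \<Lambda> :: "'i => 'a => real"
 assumes "indep_gauss \<Lambda> D Z v" "finite I" "I \<subseteq> D" "continuous_on UNIV ps" "!!y. \<bar>ps y\<bar> <= 1"
  "!!c. continuous_on UNIV (g c)" "!!c y. \<bar>g c y\<bar> <= (1::real)"
 shows "(\<integral>om. ps (Z om) * (\<Prod>c\<in>I. g c (\<Lambda> c om)) \<partial>M)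
   = (\<integral>y. ps (sqrt v * y) \<partial>stdn) * (\<integral>om. (\<Prod>c\<in>I. g c (\<Lambda> c om)) \<partial>M)"
 using assms(1)[unfolded indep_gauss_def] assms(2-) by blast

lemma indep_gauss_measurable: "indep_gauss \<Lambda> D Z v ==> Z \<in> borel_measurable M"
 unfolding indep_gauss_def by blast

lemma indep_gauss_mono: "indep_gauss \<Lambda> D Z v ==> D' \<subseteq> D ==> indep_gauss \<Lambda> D' Z v"
 unfolding indep_gauss_def by (meson order_trans)

lemma indep_gauss_limit:
 assumes Z: "!!n. indep_gauss \<Lambda> D (Z n) (v n)"
  and Z'[measurable]: "Z' \<in> borel_measurable M" and [measurable]: "!!c. \<Lambda> c \<in> borel_measurable M"
  and conv: "AE om in M. (%n. Z n om) ----> Z' om" and v: "v ----> v'"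
 shows "indep_gauss \<Lambda> D Z' v'"
 unfolding indep_gauss_def
proof (intro conjI allI impI)
 fix ps :: "real => real" and g :: "'b => real => real" and I
 assume I: "finite I" "I \<subseteq> D" and ps: "continuous_on UNIV ps" "\<forall>y. \<bar>ps y\<bar> <= 1"
  and g: "\<forall>c. continuous_on UNIV (g c)" "\<forall>c y. \<bar>g c y\<bar> <= 1"
 have [measurable]: "ps \<in> borel_measurable borel" by (rule borel_measurable_continuous_onI[OF ps(1)])
 have [measurable]: "g c \<in> borel_measurable borel" for c by (rule borel_measurable_continuous_onI) (use g(1) in blast)
 have [measurable]: "Z n \<in> borel_measurable M" for n by (rule indep_gauss_measurable[OF Z])
 define Ga where "Ga om = (\<Prod>c\<in>I. g c (\<Lambda> c om))" for om
 have Gam[measurable]: "Ga \<in> borel_measurable M" unfolding Ga_def[abs_def] by measurable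
 have Ga1: "\<bar>Ga om\<bar> <= 1" for om unfolding Ga_def abs_prod by (rule prod_le_1) (use g(2) in auto)
 have psc: "(%n. ps (u n)) ----> ps l" if "u ----> l" for u l
  using continuous_on_tendsto_compose[OF ps(1) that] by simp
 have 1: "(%n. \<integral>om. ps (Z n om) * Ga om \<partial>M) ----> (\<integral>om. ps (Z' om) * Ga om \<partial>M)"
 proof (rule integral_dominated_convergence[where w = "%_. 1"])
  show "AE om in M. (%n. ps (Z n om) * Ga om) ----> ps (Z' om) * Ga om"
   using conv by eventually_elim (rule tendsto_mult[OF psc tendsto_const])
  have "\<bar>ps (Z n om)\<bar> * \<bar>Ga om\<bar> <= 1" for n om
   by (rule mult_le_one) (use ps(2) Ga1 in auto)
  then show "AE om in M. norm (ps (Z n om) * Ga om) <= 1" for n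
   by (intro AE_I2) (simp add: abs_mult)
  show "integrable M (%_. 1 :: real)" by simp
 qed measurable
 interpret N: prob_space stdn by (rule prob_space_stdn)
 have 2: "(%n. \<integral>y. ps (sqrt (v n) * y) \<partial>stdn) ----> (\<integral>y. ps (sqrt v' * y) \<partial>stdn)"
 proof (rule integral_dominated_convergence[where w = "%_. 1"])
  show "AE y in stdn. (%n. ps (sqrt (v n) * y)) ----> ps (sqrt v' * y)"
   by (intro AE_I2 psc tendsto_mult tendsto_real_sqrt v tendsto_const)
  show "AE y in stdn. norm (ps (sqrt (v n) * y)) <= 1" for n
   using ps(2) by (intro AE_I2) simp
  show "integrable stdn (%_. 1 :: real)" by simp
 qed measurable
 have eq: "(\<integral>om. ps (Z n om) * Ga om \<partial>M) = (\<integral>y. ps (sqrt (v n) * y) \<partial>stdn) * (\<integral>om. Ga om \<partial>M)" for n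
  unfolding Ga_def by (rule indep_gaussD[OF Z I ps(1) _ _ , rule_format]) (use ps(2) g in auto)
 have "(%n. \<integral>om. ps (Z n om) * Ga om \<partial>M) ----> (\<integral>y. ps (sqrt v' * y) \<partial>stdn) * (\<integral>om. Ga om \<partial>M)"
  unfolding eq by (intro tendsto_mult 2 tendsto_const)
 from LIMSEQ_unique[OF 1 this]
 show "(\<integral>om. ps (Z' om) * (\<Prod>c\<in>I. g c (\<Lambda> c om)) \<partial>M)
   = (\<integral>y. ps (sqrt v' * y) \<partial>stdn) * (\<integral>om. (\<Prod>c\<in>I. g c (\<Lambda> c om)) \<partial>M)"
  unfolding Ga_def .
qed (rule Z')

text \<open>Indicators of half-lines are limits of bounded continuous functions.\<close>

lemma indep_gauss_halfline:
 assumes Z: "indep_gauss \<Lambda> D Z v" and [measurable]: "!!c. \<Lambda> c \<in> borel_measurable M" and I: "finite I" "I \<subseteq> D"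
 shows "prob {om\<in>space M. Z om <= a & (\<forall>c\<in>I. \<Lambda> c om <= u c)}
  = measure stdn {y. sqrt v * y <= a} * prob {om\<in>space M. \<forall>c\<in>I. \<Lambda> c om <= u c}"
proof -
 have [measurable]: "Z \<in> borel_measurable M" by (rule indep_gauss_measurable[OF Z])
 define hit where "hit om = (\<Prod>c\<in>I. (indicator {..u c} (\<Lambda> c om) :: real))" for om
 define Ga where "Ga m om = (\<Prod>c\<in>I. cutoff m (u c) (\<Lambda> c om))" for m om
 have [measurable]: "hit \<in> borel_measurable M" "!!m. Ga m \<in> borel_measurable M"
  unfolding hit_def[abs_def] Ga_def[abs_def] by measurable
 have pc: "(%m. Ga m om) ----> hit om" for om unfolding Ga_def hit_def by (intro tendsto_prod cutoff_lim)
 have pb: "\<bar>Ga m om\<bar> <= 1" for m om unfolding Ga_def abs_prod by (rule prod_le_1) (auto simp: cutoff_bound)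
 have 1: "(%m. \<integral>om. cutoff m a (Z om) * Ga m om \<partial>M) ----> (\<integral>om. indicator {..a} (Z om) * hit om \<partial>M)"
 proof (rule integral_dominated_convergence[where w = "%_. 1"])
  show "AE om in M. (%m. cutoff m a (Z om) * Ga m om) ----> indicator {..a} (Z om) * hit om"
   by (intro AE_I2 tendsto_mult cutoff_lim pc)
  have "\<bar>cutoff m a (Z om)\<bar> * \<bar>Ga m om\<bar> <= 1" for m om
   by (rule mult_le_one) (auto simp: cutoff_bound pb)
  then show "AE om in M. norm (cutoff m a (Z om) * Ga m om) <= 1" for m by (intro AE_I2) (simp add: abs_mult)
  show "integrable M (%_. 1 :: real)" by simp
 qed measurable
 have 2: "(%m. \<integral>om. Ga m om \<partial>M) ----> (\<integral>om. hit om \<partial>M)"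
 proof (rule integral_dominated_convergence[where w = "%_. 1"])
  show "AE om in M. (%m. Ga m om) ----> hit om" by (intro AE_I2 pc)
  show "AE om in M. norm (Ga m om) <= 1" for m by (intro AE_I2) (simp add: pb)
  show "integrable M (%_. 1 :: real)" by simp
 qed measurable
 interpret N: prob_space stdn by (rule prob_space_stdn)
 have 3: "(%m. \<integral>y. cutoff m a (sqrt v * y) \<partial>stdn) ----> (\<integral>y. indicator {..a} (sqrt v * y) \<partial>stdn)"
 proof (rule integral_dominated_convergence[where w = "%_. 1"])
  show "AE y in stdn. (%m. cutoff m a (sqrt v * y)) ----> indicator {..a} (sqrt v * y)" by (intro AE_I2 cutoff_lim)
  show "AE y in stdn. norm (cutoff m a (sqrt v * y)) <= 1" for m by (intro AE_I2) (simp add: cutoff_bound)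
  show "integrable stdn (%_. 1 :: real)" by simp
 qed measurable
 have eq: "(\<integral>om. cutoff m a (Z om) * Ga m om \<partial>M) = (\<integral>y. cutoff m a (sqrt v * y) \<partial>stdn) * (\<integral>om. Ga m om \<partial>M)" for m
  unfolding Ga_def
  by (rule indep_gaussD[OF Z I, where ps = "cutoff m a" and g = "%c. cutoff m (u c)"]) (rule cutoff_cont cutoff_bound)+
 have "(%m. \<integral>om. cutoff m a (Z om) * Ga m om \<partial>M) ----> (\<integral>y. indicator {..a} (sqrt v * y) \<partial>stdn) * (\<integral>om. hit om \<partial>M)"
  unfolding eq by (intro tendsto_mult 3 2)
 from LIMSEQ_unique[OF 1 this]
 have main: "(\<integral>om. indicator {..a} (Z om) * hit om \<partial>M) = (\<integral>y. indicator {..a} (sqrt v * y) \<partial>stdn) * (\<integral>om. hit om \<partial>M)" .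
 have hit: "hit om = (if \<forall>c\<in>I. \<Lambda> c om <= u c then 1 else 0)" for om
 proof (cases "\<forall>c\<in>I. \<Lambda> c om <= u c")
  case True
  then have "hit om = 1" unfolding hit_def by (intro prod.neutral) simp
  then show ?thesis using True by simp
 next
  case False
  then obtain c where c: "c \<in> I" "\<not> \<Lambda> c om <= u c" by blast
  have "hit om = 0" unfolding hit_def by (rule prod_zero[OF I(1) bexI[OF _ c(1)]]) (use c(2) in simp)
  then show ?thesis using False by simp
 qed
 have a1: "(\<integral>om. indicator {..a} (Z om) * hit om \<partial>M) = prob {om\<in>space M. Z om <= a & (\<forall>c\<in>I. \<Lambda> c om <= u c)}"
 proof -
  have "(\<integral>om. indicator {..a} (Z om) * hit om \<partial>M) = (\<integral>om. indicator {om\<in>space M. Z om <= a & (\<forall>c\<in>I. \<Lambda> c om <= u c)} om \<partial>M)"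
   by (rule Bochner_Integration.integral_cong) (auto simp: hit split: split_indicator)
  also have "... = prob ({om\<in>space M. Z om <= a & (\<forall>c\<in>I. \<Lambda> c om <= u c)} \<inter> space M)" by (rule Bochner_Integration.integral_indicator)
  finally show ?thesis by (simp add: Int_absorb2)
 qed
 have a2: "(\<integral>om. hit om \<partial>M) = prob {om\<in>space M. \<forall>c\<in>I. \<Lambda> c om <= u c}"
 proof -
  have "(\<integral>om. hit om \<partial>M) = (\<integral>om. indicator {om\<in>space M. \<forall>c\<in>I. \<Lambda> c om <= u c} om \<partial>M)"
   by (rule Bochner_Integration.integral_cong) (auto simp: hit split: split_indicator)
  also have "... = prob ({om\<in>space M. \<forall>c\<in>I. \<Lambda> c om <= u c} \<inter> space M)" by (rule Bochner_Integration.integral_indicator)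
  finally show ?thesis by (simp add: Int_absorb2)
 qed
 have a3: "(\<integral>y. indicator {..a} (sqrt v * y) \<partial>stdn) = measure stdn {y. sqrt v * y <= a}"
 proof -
  have "(\<integral>y. indicator {..a} (sqrt v * y) \<partial>stdn) = (\<integral>y. indicator {y. sqrt v * y <= a} y \<partial>stdn)"
   by (rule Bochner_Integration.integral_cong) (auto split: split_indicator)
  also have "... = measure stdn ({y. sqrt v * y <= a} \<inter> space stdn)" by (rule Bochner_Integration.integral_indicator)
  finally show ?thesis by simp
 qed
 show ?thesis using main unfolding a1 a2 a3 .
qed

lemma indep_gauss_cdf:
 assumes "indep_gauss \<Lambda> D Z v" "!!c. \<Lambda> c \<in> borel_measurable M"
 shows "prob {om\<in>space M. Z om <= a} = measure stdn {y. sqrt v * y <= a}"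
 using indep_gauss_halfline[OF assms, of "{}" a "%_. 0"] by (simp add: prob_space)

lemma indep_gauss_gaussian:
 assumes Z: "indep_gauss \<Lambda> D Z v" and \<Lambda>: "!!c. \<Lambda> c \<in> borel_measurable M"
 shows "gaussian M Z v"
proof -
 interpret N: prob_space stdn by (rule prob_space_stdn)
 have Zm: "Z \<in> borel_measurable M" by (rule indep_gauss_measurable[OF Z])
 have sm: "(%x. sqrt v * x) \<in> borel_measurable stdn" by simp
 have "distr M borel Z = distr stdn borel (%x. sqrt v * x)"
 proof (rule cdf_unique)
  show "real_distribution (distr M borel Z)" by (rule real_distribution_distr[OF Zm])
  show "real_distribution (distr stdn borel (%x. sqrt v * x))" by (rule N.real_distribution_distr[OF sm])
  show "cdf (distr M borel Z) = cdf (distr stdn borel (%x. sqrt v * x))"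
  proof
   fix a
   have "cdf (distr M borel Z) a = prob (Z -` {..a} \<inter> space M)"
   unfolding cdf_def by (rule measure_distr[OF Zm]) simp
   also have "Z -` {..a} \<inter> space M = {om\<in>space M. Z om <= a}" by auto
   also have "prob ... = measure stdn {y. sqrt v * y <= a}" by (rule indep_gauss_cdf[OF Z \<Lambda>])
   also have "{y. sqrt v * y <= a} = (%x. sqrt v * x) -` {..a} \<inter> space stdn" by auto
   also have "measure stdn ... = cdf (distr stdn borel (%x. sqrt v * x)) a"
   unfolding cdf_def by (rule measure_distr[OF sm, symmetric]) simp
   finally show "cdf (distr M borel Z) a = cdf (distr stdn borel (%x. sqrt v * x)) a" .
  qed
 qed
 then show ?thesis unfolding gaussian_def using Zm by blast
qed

definition hist :: "('i => 'a => real) => 'i set => 'a set set" where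
 "hist \<Lambda> D = {{om\<in>space M. \<forall>c\<in>I. \<Lambda> c om <= u c} |I u. finite I & I \<subseteq> D}"

lemma hist_Pow: "hist \<Lambda> D \<subseteq> Pow (space M)" unfolding hist_def by blast

lemma hist_events:
 assumes [measurable]: "!!c. \<Lambda> c \<in> borel_measurable M"
 shows "hist \<Lambda> D \<subseteq> events"
proof
 fix A assume "A \<in> hist \<Lambda> D"
 then obtain I u where I: "finite I" and A: "A = {om\<in>space M. \<forall>c\<in>I. \<Lambda> c om <= u c}" unfolding hist_def by blast
 show "A \<in> events" unfolding A by (rule sets.sets_Collect_finite_All[OF _ I]) measurable
qed

lemma hist_mono: "D \<subseteq> D' ==> hist \<Lambda> D \<subseteq> hist \<Lambda> D'"
 unfolding hist_def by blast

lemma hist_measurable: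
 assumes "c \<in> D"
 shows "\<Lambda> c \<in> borel_measurable (sigma (space M) (hist \<Lambda> D))"
proof (rule borel_measurableI_le)
 fix y :: real
 have "{om\<in>space M. \<forall>c'\<in>{c}. \<Lambda> c' om <= (%_. y) c'} \<in> hist \<Lambda> D"
  unfolding hist_def using assms by (intro CollectI exI[of _ "{c}"] exI[of _ "%_. y"]) auto
 then have "{om\<in>space M. \<Lambda> c om <= y} \<in> hist \<Lambda> D" by simp
 then show "{om\<in>space (sigma (space M) (hist \<Lambda> D)). \<Lambda> c om <= y} \<in> sets (sigma (space M) (hist \<Lambda> D))"
  unfolding space_measure_of[OF hist_Pow] sets_measure_of[OF hist_Pow] by (rule sigma_sets.Basic)
qed

lemma hist_Int_stable: "Int_stable (hist \<Lambda> D)"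
 unfolding Int_stable_def
proof (intro ballI)
 fix A B assume "A \<in> hist \<Lambda> D" "B \<in> hist \<Lambda> D"
 then obtain I u J w where I: "finite I" "I \<subseteq> D" and A: "A = {om\<in>space M. \<forall>c\<in>I. \<Lambda> c om <= u c}"
  and J: "finite J" "J \<subseteq> D" and B: "B = {om\<in>space M. \<forall>c\<in>J. \<Lambda> c om <= w c}"
  unfolding hist_def by blast
 define z where "z c = (if c \<in> I then if c \<in> J then min (u c) (w c) else u c else w c)" for c
 have "A \<inter> B = {om\<in>space M. \<forall>c\<in>I \<union> J. \<Lambda> c om <= z c}"
  unfolding A B z_def by (auto split: if_splits)
 then show "A \<inter> B \<in> hist \<Lambda> D" unfolding hist_def using I J by blast
qed

text \<open>Both \<open>\<sigma>\<close>-algebras are generated by half-lines, which form a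
\<open>\<pi>\<close>-system.\<close>

lemma indep_gauss_indep:
 assumes Z: "indep_gauss \<Lambda> D Z v" and \<Lambda>: "!!c. \<Lambda> c \<in> borel_measurable M"
 shows "indep_set (sigma_sets (space M) (hist \<Lambda> D)) {Z -` B \<inter> space M |B. B \<in> sets borel}"
proof -
 have [measurable]: "Z \<in> borel_measurable M" by (rule indep_gauss_measurable[OF Z])
 define H where "H = {{om\<in>space M. Z om <= a} |a. True}"
 have ind: "indep_set (hist \<Lambda> D) H"
 proof (rule indep_setI)
  show "hist \<Lambda> D \<subseteq> events" by (rule hist_events[OF \<Lambda>])
  show "H \<subseteq> events" unfolding H_def by auto
  fix A B assume "A \<in> hist \<Lambda> D" "B \<in> H"
  then obtain I u a where I: "finite I" "I \<subseteq> D" and A: "A = {om\<in>space M. \<forall>c\<in>I. \<Lambda> c om <= u c}"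
   and B: "B = {om\<in>space M. Z om <= a}" unfolding hist_def H_def by blast
  have "A \<inter> B = {om\<in>space M. Z om <= a & (\<forall>c\<in>I. \<Lambda> c om <= u c)}" unfolding A B by blast
  then show "prob (A \<inter> B) = prob A * prob B"
   using indep_gauss_halfline[OF Z \<Lambda> I, of a u] unfolding A B indep_gauss_cdf[OF Z \<Lambda>] by (simp only: mult.commute)
 qed
 have "Int_stable H"
  unfolding Int_stable_def
 proof (intro ballI)
  fix A B assume "A \<in> H" "B \<in> H"
  then obtain a b where A: "A = {om\<in>space M. Z om <= a}" and B: "B = {om\<in>space M. Z om <= b}" unfolding H_def by blast
  have "A \<inter> B = {om\<in>space M. Z om <= min a b}" unfolding A B by auto
  then show "A \<inter> B \<in> H" unfolding H_def by blast
 qed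
 from indep_set_sigma_sets[OF ind hist_Int_stable this]
 have ind2: "indep_set (sigma_sets (space M) (hist \<Lambda> D)) (sigma_sets (space M) H)" .
 have HP: "H \<subseteq> Pow (space M)" unfolding H_def by blast
 have "Z \<in> borel_measurable (sigma (space M) H)"
 proof (rule borel_measurableI_le)
  fix y :: real
  have "{om\<in>space M. Z om <= y} \<in> H" unfolding H_def by blast
  then show "{om\<in>space (sigma (space M) H). Z om <= y} \<in> sets (sigma (space M) H)"
   using HP by (simp add: space_measure_of sets_measure_of sigma_sets.Basic)
 qed
 then have "Z -` B \<inter> space M \<in> sigma_sets (space M) H" if "B \<in> sets borel" for B
  using measurable_sets[of Z "sigma (space M) H" borel B] that HP by (simp add: space_measure_of sets_measure_of)
 then have "{Z -` B \<inter> space M |B. B \<in> sets borel} \<subseteq> sigma_sets (space M) H" by blast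
 then show ?thesis using ind2 unfolding indep_sets2_eq by blast
qed

text \<open>The \<open>\<sigma>\<close>-algebra of the past, completed by all events that agree almost surely
with one of its members. The completion is needed because the limit process is defined by a case distinction
on an almost sure event in order to be continuous everywhere.\<close>

definition aug :: "('i => 'a => real) => 'i set => 'a measure" where
 "aug \<Lambda> D = sigma (space M) {E\<in>events. \<exists>E'\<in>sigma_sets (space M) (hist \<Lambda> D). AE om in M. om \<in> E \<longleftrightarrow> om \<in> E'}"

lemma space_aug: "space (aug \<Lambda> D) = space M"
 unfolding aug_def by (rule space_measure_of) (use sets.sets_into_space in blast)

lemma sets_aug: "sets (aug \<Lambda> D) = {E\<in>events. \<exists>E'\<in>sigma_sets (space M) (hist \<Lambda> D). AE om in M. om \<in> E \<longleftrightarrow> om \<in> E'}"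
proof -
 let ?S = "sigma_sets (space M) (hist \<Lambda> D)"
 let ?E = "{E\<in>events. \<exists>E'\<in>?S. AE om in M. om \<in> E \<longleftrightarrow> om \<in> E'}"
 have sub: "?E \<subseteq> Pow (space M)" using sets.sets_into_space by blast
 have "sigma_algebra (space M) ?E"
  unfolding sigma_algebra_iff2
 proof (intro conjI ballI allI impI)
  show "?E \<subseteq> Pow (space M)" by (rule sub)
  show "{} \<in> ?E" using sigma_sets.Empty[of "space M" "hist \<Lambda> D"] by auto
  fix E assume "E \<in> ?E"
  then obtain E' where E: "E \<in> events" "E' \<in> ?S" "AE om in M. om \<in> E \<longleftrightarrow> om \<in> E'" by blast
  have "AE om in M. om \<in> space M - E \<longleftrightarrow> om \<in> space M - E'" using E(3) by eventually_elim blast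
  then show "space M - E \<in> ?E" using E(1) sigma_sets.Compl[OF E(2)] by blast
 next
  fix A :: "nat => 'a set" assume A: "range A \<subseteq> ?E"
  then have "\<forall>i. \<exists>E'. E' \<in> ?S & (AE om in M. om \<in> A i \<longleftrightarrow> om \<in> E')" by blast
  then obtain A' where A': "!!i. A' i \<in> ?S" "!!i. AE om in M. om \<in> A i \<longleftrightarrow> om \<in> A' i" by metis
  have "AE om in M. \<forall>i. om \<in> A i \<longleftrightarrow> om \<in> A' i" using A'(2) by (simp add: AE_all_countable)
  then have "AE om in M. om \<in> (\<Union>i. A i) \<longleftrightarrow> om \<in> (\<Union>i. A' i)" by eventually_elim blast
  moreover have "(\<Union>i. A' i) \<in> ?S" by (rule sigma_sets.Union[OF A'(1)])
  moreover have "(\<Union>i. A i) \<in> events" using A by (intro sets.countable_UN) auto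
  ultimately show "(\<Union>i. A i) \<in> ?E" by blast
 qed
 from sigma_algebra.sigma_sets_eq[OF this] show ?thesis
  unfolding aug_def using sub by (simp add: sets_measure_of)
qed

lemma subalgebra_aug: "subalgebra M (aug \<Lambda> D)"
 unfolding subalgebra_def space_aug sets_aug by blast

lemma aug_mono: "D \<subseteq> D' ==> sets (aug \<Lambda> D) \<subseteq> sets (aug \<Lambda> D')"
 unfolding sets_aug using sigma_sets_mono'[OF hist_mono[of D D' \<Lambda>]] by blast

lemma aug_measurable:
 assumes Y: "Y \<in> measurable M N" and Y': "Y' \<in> measurable (sigma (space M) (hist \<Lambda> D)) N"
  and eq: "AE om in M. Y om = Y' om"
 shows "Y \<in> measurable (aug \<Lambda> D) N"
proof (rule measurableI)
 show "om \<in> space (aug \<Lambda> D) ==> Y om \<in> space N" for om using measurable_space[OF Y] unfolding space_aug by blast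
 fix B assume B: "B \<in> sets N"
 have "Y' -` B \<inter> space M \<in> sigma_sets (space M) (hist \<Lambda> D)"
  using measurable_sets[OF Y' B] hist_Pow[of \<Lambda> D] by (simp add: space_measure_of sets_measure_of)
 moreover have "AE om in M. om \<in> Y -` B \<inter> space M \<longleftrightarrow> om \<in> Y' -` B \<inter> space M" using eq by eventually_elim simp
 ultimately show "Y -` B \<inter> space (aug \<Lambda> D) \<in> sets (aug \<Lambda> D)"
  unfolding space_aug sets_aug using measurable_sets[OF Y B] by blast
qed

lemma hist_measurable_M:
 assumes "!!c. \<Lambda> c \<in> borel_measurable M" "Y \<in> measurable (sigma (space M) (hist \<Lambda> D)) N"
 shows "Y \<in> measurable M N"
proof -
 have "sigma_sets (space M) (hist \<Lambda> D) \<subseteq> events" by (rule sets.sigma_sets_subset[OF hist_events[OF assms(1)]])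
 then have "subalgebra M (sigma (space M) (hist \<Lambda> D))"
  unfolding subalgebra_def using hist_Pow[of \<Lambda> D] by (simp add: space_measure_of sets_measure_of)
 then show ?thesis by (rule measurable_from_subalg[OF _ assms(2)])
qed

lemma indep_gauss_aug:
 assumes Z: "indep_gauss \<Lambda> D Z v" and \<Lambda>: "!!c. \<Lambda> c \<in> borel_measurable M"
 shows "indep_set (sets (aug \<Lambda> D)) {Z -` B \<inter> space M |B. B \<in> sets borel}"
proof -
 let ?S = "sigma_sets (space M) (hist \<Lambda> D)"
 have ind: "?S \<subseteq> events" "{Z -` B \<inter> space M |B. B \<in> sets borel} \<subseteq> events"
  "!!A B. A \<in> ?S ==> B \<in> {Z -` B \<inter> space M |B. B \<in> sets borel} ==> prob (A \<inter> B) = prob A * prob B"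
  using indep_gauss_indep[OF Z \<Lambda>] unfolding indep_sets2_eq by blast+
 show ?thesis
 proof (rule indep_setI)
  show "sets (aug \<Lambda> D) \<subseteq> events" unfolding sets_aug by blast
  show "{Z -` B \<inter> space M |B. B \<in> sets borel} \<subseteq> events" by (rule ind(2))
  fix A B assume A: "A \<in> sets (aug \<Lambda> D)" and B: "B \<in> {Z -` B \<inter> space M |B. B \<in> sets borel}"
  then obtain A' where A': "A' \<in> ?S" "AE om in M. om \<in> A \<longleftrightarrow> om \<in> A'" and Ae: "A \<in> events" unfolding sets_aug by blast
  have Be: "B \<in> events" and A'e: "A' \<in> events" using ind B A' by blast+
  have "prob (A \<inter> B) = prob (A' \<inter> B)"
  proof (rule finite_measure_eq_AE)
   show "AE om in M. om \<in> A \<inter> B \<longleftrightarrow> om \<in> A' \<inter> B" using A'(2) by eventually_elim blast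
  qed (use Ae Be A'e in auto)
  also have "... = prob A' * prob B" by (rule ind(3)[OF A'(1) B])
  also have "prob A' = prob A"
  proof (rule finite_measure_eq_AE)
   show "AE om in M. om \<in> A' \<longleftrightarrow> om \<in> A" using A'(2) by eventually_elim blast
  qed (use Ae A'e in auto)
  finally show "prob (A \<inter> B) = prob A * prob B" .
 qed
qed

end

section \<open>Moduli of continuity from moments\<close>

section \<open>A quantitative continuity criterion\<close>

lemma markov_nn:
 assumes [measurable]: "f \<in> borel_measurable M" and "0 < b" and pos: "!!om. 0 <= f om"
  and B: "(\<integral>\<^sup>+om. ennreal (f om) \<partial>M) <= ennreal B"
 shows "emeasure M {om\<in>space M. b < f om} <= ennreal (B / b)"
proof -
 have "emeasure M {om\<in>space M. b < f om} = (\<integral>\<^sup>+om. indicator {om\<in>space M. b < f om} om \<partial>M)"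
  by simp
 also have "... <= (\<integral>\<^sup>+om. ennreal (1 / b) * ennreal (f om) \<partial>M)"
 proof (rule nn_integral_mono)
  fix om
  show "indicator {om\<in>space M. b < f om} om <= ennreal (1 / b) * ennreal (f om)"
  proof (cases "b < f om")
   case True
   then have "1 <= 1 / b * f om" using \<open>0 < b\<close> by simp
   then have "ennreal 1 <= ennreal (1 / b * f om)" by (rule ennreal_leI)
   also have "... = ennreal (1 / b) * ennreal (f om)" using \<open>0 < b\<close> by (intro ennreal_mult') simp
   finally show ?thesis by (auto split: split_indicator)
  qed simp
 qed
 also have "... = ennreal (1 / b) * (\<integral>\<^sup>+om. ennreal (f om) \<partial>M)" by (rule nn_integral_cmult) simp
 also have "... <= ennreal (1 / b) * ennreal B" by (rule mult_left_mono[OF B]) simp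
 also have "... = ennreal (B / b)" using \<open>0 < b\<close> by (subst ennreal_mult'[symmetric]) auto
 finally show ?thesis .
qed

text \<open>Two dyadic points at distance less than \<open>T / 2 ^ J\<close> are joined by a path that uses at
most a bounded number of steps of each level from \<open>J\<close> on.\<close>

lemma dyadic_chaining:
 fixes u :: "real => 'h::real_normed_vector"
 assumes T: "0 < T"
  and step: "!!j i. j \<ge> J ==> i < 2 ^ j ==> norm (u (dy T j (Suc i)) - u (dy T j i)) <= r j"
  and r0: "!!j. 0 <= r j" and R: "!!n. (\<Sum>j=J..n. r j) <= R"
  and q: "q \<in> dyadics T" "q' \<in> dyadics T" "\<bar>q - q'\<bar> < T / 2 ^ J"
 shows "norm (u q' - u q) <= 3 * R"
proof -
 have chain: "norm (u (dy T n i) - u (dy T J (i div 2 ^ (n - J)))) <= (\<Sum>j=Suc J..n. r j)" if "J <= n" "i <= 2 ^ n" for n i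
  using that
 proof (induction n arbitrary: i rule: dec_induct)
  case base
  then show ?case by simp
 next
  case (step n)
  have half: "dy T (Suc n) (2 * (i div 2)) = dy T n (i div 2)"
   using dy_refine[of T n 1 "i div 2"] T by simp
  have "norm (u (dy T (Suc n) i) - u (dy T n (i div 2))) <= r (Suc n)"
  proof (cases "even i")
   case True
   then show ?thesis using half r0 by simp
  next
   case False
   then have i: "i = Suc (2 * (i div 2))" by presburger
   then have "2 * (i div 2) < 2 ^ Suc n" using step.prems by linarith
   then have "norm (u (dy T (Suc n) (Suc (2 * (i div 2)))) - u (dy T (Suc n) (2 * (i div 2)))) <= r (Suc n)"
   using step.hyps by (intro assms(2)) auto
   then show ?thesis using half i by simp
  qed
  moreover have "norm (u (dy T n (i div 2)) - u (dy T J (i div 2 div 2 ^ (n - J)))) <= (\<Sum>j=Suc J..n. r j)"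
   using step.prems by (intro step.IH) simp
  moreover have "i div 2 div 2 ^ (n - J) = i div 2 ^ (Suc n - J)"
   using step.hyps by (simp add: div_mult2_eq[symmetric] Suc_diff_le)
  ultimately have "norm (u (dy T (Suc n) i) - u (dy T J (i div 2 ^ (Suc n - J)))) <= r (Suc n) + (\<Sum>j=Suc J..n. r j)"
   using norm_diff_triangle_le by fastforce
  then show ?case using step.hyps by simp
 qed
 have Rs: "(\<Sum>j=Suc J..n. r j) <= R" "r J <= R" "0 <= R" for n
 proof -
  have "(\<Sum>j=Suc J..n. r j) <= (\<Sum>j=J..n. r j)" using r0 by (intro sum_mono2) auto
  then show "(\<Sum>j=Suc J..n. r j) <= R" using R[of n] by simp
  show "r J <= R" using R[of J] by simp
  then show "0 <= R" using r0[of J] by simp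
 qed
 obtain a i where a: "i <= 2 ^ a" "q = dy T a i" by (rule dyadics_cases[OF T q(1)])
 obtain b i' where b: "i' <= 2 ^ b" "q' = dy T b i'" by (rule dyadics_cases[OF T q(2)])
 define n where "n = a + b + J"
 define k k' where "k = 2 ^ (n - a) * i" "k' = 2 ^ (n - b) * i'"
 have n: "a + (n - a) = n" "b + (n - b) = n" unfolding n_def by auto
 have kq: "q = dy T n k" "q' = dy T n k'"
  using dy_refine[OF T, of a "n - a" i] dy_refine[OF T, of b "n - b" i'] unfolding n k_k'_def a(2) b(2) by auto
 have kn: "k <= 2 ^ n" "k' <= 2 ^ n"
 proof -
  have "k <= 2 ^ (n - a) * 2 ^ a" "k' <= 2 ^ (n - b) * 2 ^ b" unfolding k_k'_def using a b by simp_all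
  then show "k <= 2 ^ n" "k' <= 2 ^ n" unfolding n_def by (simp_all add: power_add[symmetric] add.commute add.left_commute)
 qed
 define l l' where "l = k div 2 ^ (n - J)" "l' = k' div 2 ^ (n - J)"
 have near: "\<bar>int k - int k'\<bar> < 2 ^ (n - J)"
 proof -
  have "\<bar>T * real k / 2 ^ n - T * real k' / 2 ^ n\<bar> < T / 2 ^ J"
   using q(3) kq kn by (simp add: dy_eq[OF T])
  moreover have "T * real k / 2 ^ n - T * real k' / 2 ^ n = T / 2 ^ n * (real k - real k')" by (simp add: field_simps)
  ultimately have "T / 2 ^ n * \<bar>real k - real k'\<bar> < T / 2 ^ J" using T by (simp add: abs_mult)
  then have "\<bar>real k - real k'\<bar> < 2 ^ n / 2 ^ J" using T by (simp add: field_simps)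
  also have "... = 2 ^ (n - J)" by (simp add: n_def power_add)
  finally have "real_of_int \<bar>int k - int k'\<bar> < real_of_int (2 ^ (n - J))" by simp
  then show ?thesis by (simp only: of_int_less_iff)
 qed
 have ll: "l' <= Suc l" "l <= Suc l'"
 proof -
  have "\<bar>int k - int k'\<bar> < int (2 ^ (n - J))" using near by simp
  then have "k' < k + 2 ^ (n - J)" "k < k' + 2 ^ (n - J)" by linarith+
  then have "k' div 2 ^ (n - J) <= (k + 2 ^ (n - J)) div 2 ^ (n - J)" "k div 2 ^ (n - J) <= (k' + 2 ^ (n - J)) div 2 ^ (n - J)"
   by (intro div_le_mono less_imp_le; simp)+
  then show "l' <= Suc l" "l <= Suc l'" unfolding l_l'_def by auto
 qed
 have lJ: "l <= 2 ^ J" "l' <= 2 ^ J"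
 proof -
  have "2 ^ n div 2 ^ (n - J) = (2 ^ J :: nat)" unfolding n_def by (simp add: power_add)
  then show "l <= 2 ^ J" "l' <= 2 ^ J" unfolding l_l'_def using div_le_mono[OF kn(1), of "2 ^ (n - J)"] div_le_mono[OF kn(2), of "2 ^ (n - J)"] by auto
 qed
 have mid: "norm (u (dy T J l') - u (dy T J l)) <= R"
 proof -
  consider "l = l'" | "l' = Suc l" | "l = Suc l'" using ll by linarith
  then show ?thesis
  proof cases
   case 1 then show ?thesis using Rs by simp
  next
   case 2
   then have "norm (u (dy T J l') - u (dy T J l)) <= r J" using lJ step[of J l] by simp
   then show ?thesis using Rs by simp
  next
   case 3
   then have "norm (u (dy T J l') - u (dy T J l)) <= r J" using lJ step[of J l'] by (simp add: norm_minus_commute)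
   then show ?thesis using Rs by simp
  qed
 qed
 have 1: "norm (u q - u (dy T J l)) <= R"
  unfolding kq(1) l_l'_def by (rule order_trans[OF chain Rs(1)]) (use kn in \<open>auto simp: n_def\<close>)
 have 2: "norm (u q' - u (dy T J l')) <= R"
  unfolding kq(2) l_l'_def by (rule order_trans[OF chain Rs(1)]) (use kn in \<open>auto simp: n_def\<close>)
 have "u q' - u q = (u q' - u (dy T J l')) + (u (dy T J l') - u (dy T J l)) - (u q - u (dy T J l))" by simp
 also have "norm ... <= norm (u q' - u (dy T J l')) + norm (u (dy T J l') - u (dy T J l)) + norm (u q - u (dy T J l))"
  using norm_triangle_ineq[of "u q' - u (dy T J l')" "u (dy T J l') - u (dy T J l)"]
   norm_triangle_ineq4[of "(u q' - u (dy T J l')) + (u (dy T J l') - u (dy T J l))" "u q - u (dy T J l)"] by linarith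
 finally show ?thesis using 1 2 mid by simp
qed

text \<open>The width of the modulus depends on the moment bound only; this uniformity over all probability
spaces is what makes the estimate usable for a sequence of solutions.\<close>

lemma kolmogorov_modulus:
 fixes T C ep et :: real and m :: nat
 assumes T: "0 < T" and m: "0 < m" and C: "0 <= C" and eps: "0 < ep" "0 < et"
 shows "\<exists>dl>0. \<forall>(M :: 'w measure) (Z :: real => 'w => 'h::{real_normed_vector, second_countable_topology}).
  (\<forall>q\<in>dyadics T. Z q \<in> borel_measurable M) \<longrightarrow>
  (\<forall>q\<in>dyadics T. \<forall>q'\<in>dyadics T. (\<integral>\<^sup>+om. ennreal (norm (Z q' om - Z q om) ^ (2 * m)) \<partial>M) <= ennreal (C * (q' - q)^2)) \<longrightarrow>
  emeasure M {om\<in>space M. \<exists>q\<in>dyadics T. \<exists>q'\<in>dyadics T. \<bar>q - q'\<bar> < dl & ep < norm (Z q' om - Z q om)} <= ennreal et"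
proof -
 define s :: real where "s = 1 / sqrt 2"
 define rh where "rh = root (2 * m) s"
 have s: "0 < s" "s < 1" "s * s = 1 / 2" by (auto simp: s_def)
 have rh: "0 < rh" "rh < 1" "rh ^ (2 * m) = s" using m s by (auto simp: rh_def)
 have "(%J. 3 * (rh ^ J / (1 - rh))) ----> 3 * (0 / (1 - rh))"
  using rh by (intro tendsto_intros LIMSEQ_power_zero) auto
 then have "\<forall>\<^sub>F J in sequentially. 3 * (rh ^ J / (1 - rh)) < ep" using eps by (intro order_tendstoD) auto
 moreover have "(%J. C * T\<^sup>2 * s ^ J / (1 - s)) ----> C * T\<^sup>2 * 0 / (1 - s)"
  using s by (intro tendsto_intros LIMSEQ_power_zero) auto
 then have "\<forall>\<^sub>F J in sequentially. C * T\<^sup>2 * s ^ J / (1 - s) < et" using eps by (intro order_tendstoD) auto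
 ultimately have "\<forall>\<^sub>F J in sequentially. 3 * (rh ^ J / (1 - rh)) < ep & C * T\<^sup>2 * s ^ J / (1 - s) < et"
  by (rule eventually_conj)
 then obtain J where J: "3 * (rh ^ J / (1 - rh)) < ep" "C * T\<^sup>2 * s ^ J / (1 - s) < et"
  unfolding eventually_sequentially by blast
 show ?thesis
 proof (intro exI[of _ "T / 2 ^ J"] conjI allI impI)
  show "0 < T / 2 ^ J" using T by simp
  fix M :: "'w measure" and Z :: "real => 'w => 'h"
  assume Z: "\<forall>q\<in>dyadics T. Z q \<in> borel_measurable M"
   and mom: "\<forall>q\<in>dyadics T. \<forall>q'\<in>dyadics T. (\<integral>\<^sup>+om. ennreal (norm (Z q' om - Z q om) ^ (2 * m)) \<partial>M) <= ennreal (C * (q' - q)^2)"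
  have [measurable]: "Z (dy T j i) \<in> borel_measurable M" for j i using Z by simp
  define B where "B j i = {om\<in>space M. rh ^ j < norm (Z (dy T j (Suc i)) om - Z (dy T j i) om)}" for j i
  have Bm[measurable]: "B j i \<in> sets M" for j i unfolding B_def by measurable
  have Bij: "emeasure M (B j i) <= ennreal (C * T\<^sup>2 * (s / 2) ^ j)" for j i
  proof -
   have "(\<integral>\<^sup>+om. ennreal (norm (Z (dy T j (Suc i)) om - Z (dy T j i) om) ^ (2 * m)) \<partial>M) <= ennreal (C * (dy T j (Suc i) - dy T j i)^2)"
   using mom by simp
   also have "... <= ennreal (C * (T / 2 ^ j)^2)"
   using dy_step[OF T, of j i] dy_mono[OF T, of i "Suc i" j] C by (intro ennreal_leI mult_left_mono power_mono) auto
   finally have "emeasure M {om\<in>space M. (rh ^ j) ^ (2 * m) < norm (Z (dy T j (Suc i)) om - Z (dy T j i) om) ^ (2 * m)}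
   <= ennreal (C * (T / 2 ^ j)^2 / (rh ^ j) ^ (2 * m))"
   using rh by (intro markov_nn) auto
   also have "(rh ^ j) ^ (2 * m) = s ^ j" using rh(3) by (metis mult.commute power_mult)
   also have "C * (T / 2 ^ j)^2 / s ^ j = C * T\<^sup>2 * (s / 2) ^ j"
   proof -
   have "s ^ j * ((2 ^ j)^2 * s ^ j) = (s * ((2 * 2) * s)) ^ j"
   by (simp only: power2_eq_square power_mult_distrib)
   also have "s * ((2 * 2) * s) = 2" using s(3) by linarith
   finally have e: "s ^ j * ((2 ^ j)^2 * s ^ j) = (2 :: real) ^ j" .
   have "1 / ((2 ^ j)^2 * s ^ j) = s ^ j / (s ^ j * ((2 ^ j)^2 * s ^ j))" using s by simp
   also have "... = (s / 2) ^ j" unfolding e by (simp add: power_divide)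
   finally have f: "1 / ((2 ^ j)^2 * s ^ j) = (s / 2) ^ j" .
   have "C * (T / 2 ^ j)^2 / s ^ j = C * T\<^sup>2 * (1 / ((2 ^ j)^2 * s ^ j))" by (simp add: power_divide)
   then show ?thesis unfolding f .
   qed
   finally have b: "emeasure M {om\<in>space M. s ^ j < norm (Z (dy T j (Suc i)) om - Z (dy T j i) om) ^ (2 * m)} <= ennreal (C * T\<^sup>2 * (s / 2) ^ j)" .
   have "B j i \<subseteq> {om\<in>space M. s ^ j < norm (Z (dy T j (Suc i)) om - Z (dy T j i) om) ^ (2 * m)}"
   proof -
   have "(rh ^ j) ^ (2 * m) < x ^ (2 * m)" if "rh ^ j < x" for x
   using that rh m by (intro power_strict_mono) auto
   then show ?thesis unfolding B_def \<open>(rh ^ j) ^ (2 * m) = s ^ j\<close> by auto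
   qed
   then have "emeasure M (B j i) <= emeasure M {om\<in>space M. s ^ j < norm (Z (dy T j (Suc i)) om - Z (dy T j i) om) ^ (2 * m)}"
   by (intro emeasure_mono) measurable
   then show ?thesis using b by (rule order_trans)
  qed
  define D where "D k = (\<Union>i<2 ^ (J + k). B (J + k) i)" for k
  have Dm[measurable]: "D k \<in> sets M" for k unfolding D_def by measurable
  have Dk: "emeasure M (D k) <= ennreal (C * T\<^sup>2 * s ^ J * s ^ k)" for k
  proof -
   have "emeasure M (D k) <= (\<Sum>i<2 ^ (J + k). emeasure M (B (J + k) i))"
   unfolding D_def by (rule emeasure_subadditive_finite) auto
   also have "... <= (\<Sum>i<(2 ^ (J + k) :: nat). ennreal (C * T\<^sup>2 * (s / 2) ^ (J + k)))"
   by (intro sum_mono Bij)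
   also have "... = ennreal (2 ^ (J + k) * (C * T\<^sup>2 * (s / 2) ^ (J + k)))"
   using C s by (subst sum_ennreal) auto
   also have "2 ^ (J + k) * (C * T\<^sup>2 * (s / 2) ^ (J + k)) = C * T\<^sup>2 * s ^ J * s ^ k"
   by (simp add: power_divide power_add)
   finally show ?thesis .
  qed
  have "emeasure M (\<Union>k. D k) <= (\<Sum>k. emeasure M (D k))"
   by (rule emeasure_subadditive_countably) auto
  also have "... <= (\<Sum>k. ennreal (C * T\<^sup>2 * s ^ J * s ^ k))"
   by (intro suminf_le Dk) auto
  also have "... = ennreal (C * T\<^sup>2 * s ^ J * (1 / (1 - s)))"
  proof -
   have "(%k. C * T\<^sup>2 * s ^ J * s ^ k) sums (C * T\<^sup>2 * s ^ J * (1 / (1 - s)))"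
   using s by (intro sums_mult geometric_sums) auto
   then have "(%k. ennreal (C * T\<^sup>2 * s ^ J * s ^ k)) sums ennreal (C * T\<^sup>2 * s ^ J * (1 / (1 - s)))"
   using C s by (subst sums_ennreal) auto
   then show ?thesis by (rule sums_unique[symmetric])
  qed
  also have "... <= ennreal et" using J(2) by (intro ennreal_leI) simp
  finally have D: "emeasure M (\<Union>k. D k) <= ennreal et" .
  have "{om\<in>space M. \<exists>q\<in>dyadics T. \<exists>q'\<in>dyadics T. \<bar>q - q'\<bar> < T / 2 ^ J & ep < norm (Z q' om - Z q om)} \<subseteq> (\<Union>k. D k)"
  proof (rule subsetI, rule ccontr)
   fix om assume w: "om \<in> {om\<in>space M. \<exists>q\<in>dyadics T. \<exists>q'\<in>dyadics T. \<bar>q - q'\<bar> < T / 2 ^ J & ep < norm (Z q' om - Z q om)}"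
   and n: "om \<notin> (\<Union>k. D k)"
   then obtain q q' where q: "q \<in> dyadics T" "q' \<in> dyadics T" "\<bar>q - q'\<bar> < T / 2 ^ J" "ep < norm (Z q' om - Z q om)"
   and sp: "om \<in> space M" by blast
   have "norm (Z q' om - Z q om) <= 3 * (rh ^ J / (1 - rh))"
   proof (rule dyadic_chaining[OF T, of J "%q. Z q om" "%j. rh ^ j"])
   fix j i assume "J <= j" "i < (2 :: nat) ^ j"
   then obtain k where "j = J + k" using le_Suc_ex by blast
   then have "om \<notin> B j i" using n \<open>i < 2 ^ j\<close> unfolding D_def by blast
   then show "norm (Z (dy T j (Suc i)) om - Z (dy T j i) om) <= rh ^ j" using sp unfolding B_def by auto
   next
   show "(\<Sum>j=J..n. rh ^ j) <= rh ^ J / (1 - rh)" for n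
   proof (cases "J <= n")
   case True
   have "(1 - rh) * (\<Sum>j=J..n. rh ^ j) = rh ^ J - rh ^ Suc n"
   using sum_gp_multiplied[OF True, of rh] by simp
   also have "... <= rh ^ J" using rh by simp
   finally show ?thesis using rh by (simp add: le_divide_eq mult.commute)
   qed (use rh in simp)
   qed (use q rh in auto)
   then show False using q(4) J(1) by simp
  qed
  then have "emeasure M {om\<in>space M. \<exists>q\<in>dyadics T. \<exists>q'\<in>dyadics T. \<bar>q - q'\<bar> < T / 2 ^ J & ep < norm (Z q' om - Z q om)} <= emeasure M (\<Union>k. D k)"
   by (intro emeasure_mono) measurable
  then show "emeasure M {om\<in>space M. \<exists>q\<in>dyadics T. \<exists>q'\<in>dyadics T. \<bar>q - q'\<bar> < T / 2 ^ J & ep < norm (Z q' om - Z q om)} <= ennreal et"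
   using D by (rule order_trans)
 qed
qed

section \<open>Moments of a Gaussian series\<close>

text \<open>Jensen's inequality for the weights \<open>w\<close>.\<close>

lemma power_mean_weighted:
 fixes x w :: "nat => real"
 assumes x: "!!k. k < K ==> 0 <= x k" and w: "!!k. k < K ==> 0 < w k" and "0 < m"
 shows "(\<Sum>k<K. x k) ^ m <= (\<Sum>k<K. w k) ^ (m - 1) * (\<Sum>k<K. w k * (x k / w k) ^ m)"
proof (cases "K = 0")
 case True
 then show ?thesis using \<open>0 < m\<close> by (simp add: zero_power)
next
 case False
 define W where "W = (\<Sum>k<K. w k)"
 have W: "0 < W" unfolding W_def using False w by (intro sum_pos) auto
 have cv: "convex_on {0::real..} (%x. x ^ m)"
  by (cases "even m") (auto intro: convex_power_odd convex_on_subset[OF convex_power_even])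
 have "(\<Sum>k<K. (w k / W) *\<^sub>R (x k / w k)) ^ m <= (\<Sum>k<K. (w k / W) * (x k / w k) ^ m)"
  by (rule convex_on_sum[OF _ _ cv])
   (use False w x W in \<open>auto simp: W_def less_imp_le sum_divide_distrib[symmetric]\<close>)
 also have "(\<Sum>k<K. (w k / W) *\<^sub>R (x k / w k)) = (\<Sum>k<K. x k) / W"
  unfolding sum_divide_distrib by (rule sum.cong) (auto simp: w less_imp_neq[symmetric] dest: w)
 also have "(\<Sum>k<K. (w k / W) * (x k / w k) ^ m) = (\<Sum>k<K. w k * (x k / w k) ^ m) / W"
  unfolding sum_divide_distrib by (rule sum.cong) auto
 finally have le: "(\<Sum>k<K. x k) ^ m / W ^ m <= (\<Sum>k<K. w k * (x k / w k) ^ m) / W" by (simp add: power_divide)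
 have Wm: "W ^ m = W ^ (m - 1) * W" using \<open>0 < m\<close> by (metis Suc_diff_1 power_Suc2)
 have "(\<Sum>k<K. x k) ^ m <= (\<Sum>k<K. w k * (x k / w k) ^ m) / W * W ^ m"
  using le W by (simp add: divide_le_eq)
 also have "... = W ^ (m - 1) * (\<Sum>k<K. w k * (x k / w k) ^ m)" unfolding Wm using W by simp
 finally show ?thesis unfolding W_def .
qed

text \<open>Moments of the norm follow from those of the coordinates by the weighted power mean inequality,
with the summable variances as weights.\<close>

lemma series_moment:
 fixes D :: "'w => 'h::{real_inner, banach, second_countable_topology}"
 assumes onb: "orthonormal_basis e" and [measurable]: "D \<in> borel_measurable M" and "0 < m"
  and w: "!!k. 0 < w k" "summable w" and c: "0 <= c" and d: "0 <= d"
  and mom: "!!k. (\<integral>\<^sup>+om. ennreal (inner (D om) (e k) ^ (2 * m)) \<partial>M) <= ennreal (c * (w k * d) ^ m)"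
 shows "(\<integral>\<^sup>+om. ennreal (norm (D om) ^ (2 * m)) \<partial>M) <= ennreal (c * (suminf w * d) ^ m)"
proof -
 have fin: "(\<integral>\<^sup>+om. ennreal ((\<Sum>k<K. (inner (D om) (e k))^2) ^ m) \<partial>M) <= ennreal (c * (suminf w * d) ^ m)" for K
 proof -
  define W where "W = (\<Sum>k<K. w k)"
  have W: "0 <= W" unfolding W_def by (intro sum_nonneg less_imp_le w)
  have W': "W <= suminf w" unfolding W_def by (rule sum_le_suminf[OF w(2)]) (auto intro: less_imp_le w)
  have "(\<integral>\<^sup>+om. ennreal ((\<Sum>k<K. (inner (D om) (e k))^2) ^ m) \<partial>M)
   <= (\<integral>\<^sup>+om. (\<Sum>k<K. ennreal (W ^ (m - 1) * w k / w k ^ m) * ennreal (inner (D om) (e k) ^ (2 * m))) \<partial>M)"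
  proof (rule nn_integral_mono)
   fix om
   have "(\<Sum>k<K. (inner (D om) (e k))^2) ^ m <= W ^ (m - 1) * (\<Sum>k<K. w k * ((inner (D om) (e k))^2 / w k) ^ m)"
   unfolding W_def using w \<open>0 < m\<close> by (intro power_mean_weighted) auto
   also have "... = (\<Sum>k<K. (W ^ (m - 1) * w k / w k ^ m) * inner (D om) (e k) ^ (2 * m))"
   unfolding sum_distrib_left by (rule sum.cong) (auto simp: power_divide power_mult)
   finally have "ennreal ((\<Sum>k<K. (inner (D om) (e k))^2) ^ m) <= ennreal (\<Sum>k<K. (W ^ (m - 1) * w k / w k ^ m) * inner (D om) (e k) ^ (2 * m))"
   by (rule ennreal_leI)
   also have "... = (\<Sum>k<K. ennreal ((W ^ (m - 1) * w k / w k ^ m) * inner (D om) (e k) ^ (2 * m)))"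
   by (rule sum_ennreal[symmetric]) (use W w in \<open>auto simp: power_mult less_imp_le\<close>)
   also have "... = (\<Sum>k<K. ennreal (W ^ (m - 1) * w k / w k ^ m) * ennreal (inner (D om) (e k) ^ (2 * m)))"
   by (intro sum.cong refl ennreal_mult') (use W w in \<open>auto simp: power_mult less_imp_le\<close>)
   finally show "ennreal ((\<Sum>k<K. (inner (D om) (e k))^2) ^ m) <= (\<Sum>k<K. ennreal (W ^ (m - 1) * w k / w k ^ m) * ennreal (inner (D om) (e k) ^ (2 * m)))" .
  qed
  also have "... = (\<Sum>k<K. ennreal (W ^ (m - 1) * w k / w k ^ m) * (\<integral>\<^sup>+om. ennreal (inner (D om) (e k) ^ (2 * m)) \<partial>M))"
   by (subst nn_integral_sum) (auto simp: nn_integral_cmult)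
  also have "... <= (\<Sum>k<K. ennreal (W ^ (m - 1) * w k / w k ^ m) * ennreal (c * (w k * d) ^ m))"
   by (intro sum_mono mult_left_mono mom) simp
  also have "... = (\<Sum>k<K. ennreal (W ^ (m - 1) * c * d ^ m * w k))"
  proof (rule sum.cong[OF refl])
   fix k
   have "W ^ (m - 1) * w k / w k ^ m * (c * (w k * d) ^ m) = W ^ (m - 1) * c * d ^ m * w k"
   using w(1)[of k] by (simp add: power_mult_distrib)
   then show "ennreal (W ^ (m - 1) * w k / w k ^ m) * ennreal (c * (w k * d) ^ m) = ennreal (W ^ (m - 1) * c * d ^ m * w k)"
   using w(1)[of k] W c d by (subst ennreal_mult[symmetric]) (auto simp: less_imp_le)
  qed
  also have "... = ennreal (W ^ (m - 1) * c * d ^ m * W)"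
   unfolding W_def sum_distrib_left by (rule sum_ennreal) (use W w c d in \<open>auto simp: W_def[symmetric] less_imp_le\<close>)
  also have "W ^ (m - 1) * c * d ^ m * W = c * (W * d) ^ m"
   using \<open>0 < m\<close> by (cases m) (auto simp: power_mult_distrib)
  also have "ennreal (c * (W * d) ^ m) <= ennreal (c * (suminf w * d) ^ m)"
   using W W' c d by (intro ennreal_leI mult_left_mono power_mono mult_right_mono) auto
  finally show ?thesis .
 qed
 have "(\<integral>\<^sup>+om. ennreal (norm (D om) ^ (2 * m)) \<partial>M) = (\<integral>\<^sup>+om. liminf (%K. ennreal ((\<Sum>k<K. (inner (D om) (e k))^2) ^ m)) \<partial>M)"
 proof (rule nn_integral_cong)
  fix om
  have "(%K. ennreal ((\<Sum>k<K. (inner (D om) (e k))^2) ^ m)) ----> ennreal (((norm (D om))^2) ^ m)"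
   using parseval[OF onb, of "D om"] unfolding sums_def by (intro tendsto_ennrealI tendsto_power)
  then have "(%K. ennreal ((\<Sum>k<K. (inner (D om) (e k))^2) ^ m)) ----> ennreal (norm (D om) ^ (2 * m))"
   by (simp only: power_mult)
  then show "ennreal (norm (D om) ^ (2 * m)) = liminf (%K. ennreal ((\<Sum>k<K. (inner (D om) (e k))^2) ^ m))"
   by (rule lim_imp_Liminf[OF trivial_limit_sequentially, symmetric])
 qed
 also have "... <= liminf (%K. \<integral>\<^sup>+om. ennreal ((\<Sum>k<K. (inner (D om) (e k))^2) ^ m) \<partial>M)"
  by (rule nn_integral_liminf) measurable
 also have "... <= ennreal (c * (suminf w * d) ^ m)"
  by (rule Liminf_le) (auto intro: always_eventually fin)
 finally show ?thesis .
qed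

section \<open>Wiener integrals on the dyadic grid\<close>

section \<open>Riemann sums for the stochastic convolution\<close>

definition grid_sum :: "real => real => real => nat => (real => real) => real" where
 "grid_sum T a t j b = (\<Sum>i<lo T j t. exp (- a * (t - dy T j i)) * (b (dy T j (Suc i)) - b (dy T j i)))"

text \<open>Bounds the square distance on \<open>{0..T}\<close> between an exponential and its left-point
approximation on level \<open>j\<close>; the second summand accounts for the incomplete last cell.\<close>

definition grid_error :: "real => real => nat => real" where
 "grid_error T a j = T * (a * T / 2 ^ j)^2 + T / 2 ^ j"

lemma grid_error_tendsto: "0 < T ==> (%j. grid_error T a j) ----> 0"
proof -
 assume T: "0 < T"
 have "(%j. T * (a * (T / 2 ^ j))^2 + T / 2 ^ j) ----> T * (a * 0)^2 + 0"
  by (intro tendsto_intros T_over_pow_tendsto[OF T])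
 then show ?thesis unfolding grid_error_def by simp
qed

lemma grid_error_nonneg: "0 < T ==> 0 <= grid_error T a j"
 unfolding grid_error_def by simp

lemma grid_cell:
 assumes T: "0 < T" and s: "0 < s" "s <= T" and i': "i' < 2 ^ j"
 shows "s \<in> {dy T j i'<..dy T j (Suc i')} \<longleftrightarrow> i' = nat (\<lceil>2 ^ j * s / T\<rceil> - 1)"
proof -
 define y where "y = 2 ^ j * s / T"
 have y: "0 < y" using s T by (simp add: y_def)
 have e: "dy T j i' = T * real i' / 2 ^ j" "dy T j (Suc i') = T * real (Suc i') / 2 ^ j"
  using i' by (intro dy_eq[OF T]; simp)+
 have sy: "s = T * y / 2 ^ j" using T by (simp add: y_def)
 have l: "dy T j i' < s \<longleftrightarrow> real i' < y"
  unfolding e sy using T by (simp add: divide_less_cancel mult_less_cancel_left)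
 have u: "s <= dy T j (Suc i') \<longleftrightarrow> y <= real (Suc i')"
  unfolding e sy using T by (simp add: divide_le_cancel mult_le_cancel_left)
 have "real i' < y & y <= real (Suc i') \<longleftrightarrow> \<lceil>y\<rceil> = int i' + 1"
  by (auto simp: ceiling_eq_iff)
 also have "... \<longleftrightarrow> i' = nat (\<lceil>y\<rceil> - 1)"
 proof -
  have "1 <= \<lceil>y\<rceil>" using y by linarith
  then show ?thesis by auto
 qed
 finally show ?thesis using l u unfolding y_def by simp
qed

lemma grid_step_value:
 fixes c :: "nat => 'h::real_vector"
 assumes T: "0 < T" and s: "0 < s" "s <= T" and n: "n <= 2 ^ j"
 defines "i \<equiv> nat (\<lceil>2 ^ j * s / T\<rceil> - 1)"
 shows "step_function n (dy T j) c s = (if i < n then c i else 0)"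
proof -
 have "step_function n (dy T j) c s = (\<Sum>i'<n. if i' = i then c i else 0)"
  unfolding step_function_def
 proof (rule sum.cong[OF refl])
  fix i' assume "i' \<in> {..<n}"
  then have "i' < 2 ^ j" using n by simp
  from grid_cell[OF T s this]
  show "indicator {dy T j i'<..dy T j (Suc i')} s *\<^sub>R c i' = (if i' = i then c i else 0)"
   unfolding i_def by (auto simp: indicator_def)
 qed
 then show ?thesis by simp
qed

lemma grid_step_error:
 fixes v :: "'h::{real_normed_vector, second_countable_topology}"
 assumes T: "0 < T" and a: "0 < a" and t: "0 <= t" "t <= T"
 shows "(\<integral>\<^sup>+s\<in>{0..t}. ennreal ((norm (exp (- a * (t - s)) *\<^sub>R v
   - step_function (lo T j t) (dy T j) (%i. exp (- a * (t - dy T j i)) *\<^sub>R v) s))^2) \<partial>lborel)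
  <= ennreal ((norm v)^2 * grid_error T a j)"
proof -
 define n where "n = lo T j t"
 define h where "h = T / 2 ^ j"
 have n: "n <= 2 ^ j" unfolding n_def by (rule lo_le[OF T t(2)])
 have pw: "(norm (exp (- a * (t - s)) *\<^sub>R v - step_function n (dy T j) (%i. exp (- a * (t - dy T j i)) *\<^sub>R v) s))^2
   <= (norm v)^2 * (a * h)^2 * indicator {0..T} s + (norm v)^2 * indicator {dy T j n<..t} s" if s: "0 < s" "s <= t" for s
 proof -
  define i where "i = nat (\<lceil>2 ^ j * s / T\<rceil> - 1)"
  have sT: "s <= T" using s t by simp
  have val: "step_function n (dy T j) (%i. exp (- a * (t - dy T j i)) *\<^sub>R v) s = (if i < n then exp (- a * (t - dy T j i)) *\<^sub>R v else 0)"
   unfolding i_def by (rule grid_step_value[OF T s(1) sT n])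
  have ipow: "i < 2 ^ j"
  proof -
   have "2 ^ j * s / T <= 2 ^ j" using sT T by (simp add: divide_le_eq)
   then have "\<lceil>2 ^ j * s / T\<rceil> <= 2 ^ j" by (simp add: ceiling_le_iff)
   moreover have "0 < 2 ^ j * s / T" using s T by simp
   ultimately have "int i < 2 ^ j" unfolding i_def by (simp add: nat_less_iff)
   then show ?thesis by (metis of_nat_less_iff of_nat_numeral of_nat_power)
  qed
  have cell: "dy T j i < s" "s <= dy T j (Suc i)" using grid_cell[OF T s(1) sT ipow] unfolding i_def by auto
  show ?thesis
  proof (cases "i < n")
   case True
   define d where "d = s - dy T j i"
   have d: "0 < d" "d <= h" using cell dy_step[OF T, of j i] unfolding d_def h_def by auto
   have "exp (- a * (t - s)) - exp (- a * (t - dy T j i)) = exp (- a * (t - s)) * (1 - exp (- a * d))"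
   unfolding d_def by (simp add: right_diff_distrib mult_exp_exp algebra_simps)
   moreover have "0 <= exp (- a * (t - s)) * (1 - exp (- a * d))" using a d by simp
   moreover have "exp (- a * (t - s)) * (1 - exp (- a * d)) <= 1 * (a * d)"
   using a d s exp_ge_add_one_self[of "- a * d"] by (intro mult_mono) auto
   moreover have "a * d <= a * h" using a d by simp
   ultimately have "\<bar>exp (- a * (t - s)) - exp (- a * (t - dy T j i))\<bar> <= a * h" by linarith
   then have "norm ((exp (- a * (t - s)) - exp (- a * (t - dy T j i))) *\<^sub>R v) <= a * h * norm v"
   by (simp add: mult_right_mono)
   then have "(norm ((exp (- a * (t - s)) - exp (- a * (t - dy T j i))) *\<^sub>R v))^2 <= (a * h * norm v)^2"
   by (rule power_mono) simp
   also have "... = (norm v)^2 * (a * h)^2" by (simp add: power_mult_distrib)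
   finally show ?thesis unfolding val using True s sT by (simp add: scaleR_left_diff_distrib add_increasing2)
  next
   case False
   have "dy T j n <= dy T j i" using False by (intro dy_mono[OF T]) simp
   then have "s \<in> {dy T j n<..t}" using cell s by simp
   moreover have "norm (exp (- a * (t - s)) *\<^sub>R v) <= norm v" using a s by (simp add: mult_left_le_one_le)
   then have "(norm (exp (- a * (t - s)) *\<^sub>R v))^2 <= (norm v)^2" by (rule power_mono) simp
   ultimately show ?thesis unfolding val using False by (simp add: add_increasing)
  qed
 qed
 have "(\<integral>\<^sup>+s\<in>{0..t}. ennreal ((norm (exp (- a * (t - s)) *\<^sub>R v - step_function n (dy T j) (%i. exp (- a * (t - dy T j i)) *\<^sub>R v) s))^2) \<partial>lborel)
  <= (\<integral>\<^sup>+s. ennreal ((norm v)^2 * (a * h)^2) * indicator {0..T} s + ennreal ((norm v)^2) * indicator {dy T j n<..t} s \<partial>lborel)"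
 proof (rule nn_integral_mono_AE)
  show "AE s in lborel. ennreal ((norm (exp (- a * (t - s)) *\<^sub>R v - step_function n (dy T j) (%i. exp (- a * (t - dy T j i)) *\<^sub>R v) s))^2) * indicator {0..t} s
   <= ennreal ((norm v)^2 * (a * h)^2) * indicator {0..T} s + ennreal ((norm v)^2) * indicator {dy T j n<..t} s"
   using AE_lborel_singleton[of 0]
  proof eventually_elim
   case (elim s)
   show ?case
   proof (cases "s \<in> {0..t}")
   case True
   then have "0 < s" "s <= t" using elim by auto
   from ennreal_leI[OF pw[OF this]]
   show ?thesis using True by (auto simp: ennreal_plus[symmetric] split: split_indicator simp del: ennreal_plus)
   qed simp
  qed
 qed
 also have "... = ennreal ((norm v)^2 * (a * h)^2) * ennreal T + ennreal ((norm v)^2) * ennreal (t - dy T j n)"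
  using T dy_lo(1)[OF T t, of j] by (subst nn_integral_add) (auto simp: nn_integral_cmult_indicator n_def)
 also have "... <= ennreal ((norm v)^2 * (a * h)^2) * ennreal T + ennreal ((norm v)^2) * ennreal h"
  using dy_lo(2)[OF T t, of j] by (intro add_left_mono mult_left_mono ennreal_leI) (auto simp: n_def h_def)
 also have "... = ennreal ((norm v)^2 * grid_error T a j)"
  using T by (simp add: ennreal_mult'[symmetric] ennreal_plus[symmetric] h_def grid_error_def algebra_simps del: ennreal_plus)
 finally show ?thesis unfolding n_def .
qed

context brownian
begin

lemma gaussian_steps:
 assumes "n <= 2 ^ j"
 shows "gaussian M (%om. \<Sum>i<n. d i * (be (dy T j (Suc i)) om - be (dy T j i) om)) (\<Sum>i<n. (d i)^2 * (T / 2 ^ j))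
  & (%om. \<Sum>i<n. d i * (be (dy T j (Suc i)) om - be (dy T j i) om)) \<in> borel_measurable (\<F> (dy T j n))"
 using assms
proof (induction n)
 case 0
 then show ?case using gaussian_zero[OF prob_space_axioms] by simp
next
 case (Suc n)
 define X where "X om = (\<Sum>i<n. d i * (be (dy T j (Suc i)) om - be (dy T j i) om))" for om
 have X: "gaussian M X (\<Sum>i<n. (d i)^2 * (T / 2 ^ j))" "X \<in> borel_measurable (\<F> (dy T j n))"
  using Suc unfolding X_def[abs_def] by auto
 have r: "dy T j i \<in> {0..T}" for i by (rule dy_range[OF T])
 have less: "dy T j n < dy T j (Suc n)" "dy T j (Suc n) - dy T j n = T / 2 ^ j"
  using Suc.prems T by (auto simp: dy_eq[OF T] field_simps)
 have inc: "gaussian M (%om. be (dy T j (Suc n)) om - be (dy T j n) om) (T / 2 ^ j)"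
  using bm_incr_gaussian[of "dy T j n" "dy T j (Suc n)"] r[of n] r[of "Suc n"] less by simp
 have "indep_var borel X borel (%om. be (dy T j (Suc n)) om - be (dy T j n) om)"
  using r[of n] r[of "Suc n"] less X(2) by (intro bm_incr_indep) auto
 then have "indep_var borel ((%x. x) \<circ> X) borel ((%x. d n * x) \<circ> (%om. be (dy T j (Suc n)) om - be (dy T j n) om))"
  by (rule indep_var_compose) auto
 then have ind: "indep_var borel X borel (%om. d n * (be (dy T j (Suc n)) om - be (dy T j n) om))"
  by (simp add: comp_def)
 have "gaussian M (%om. X om + d n * (be (dy T j (Suc n)) om - be (dy T j n) om)) ((\<Sum>i<n. (d i)^2 * (T / 2 ^ j)) + (d n)^2 * (T / 2 ^ j))"
  using T by (intro gaussian_add X gaussian_scale inc ind sum_nonneg) auto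
 moreover have "(%om. X om + d n * (be (dy T j (Suc n)) om - be (dy T j n) om)) \<in> borel_measurable (\<F> (dy T j (Suc n)))"
 proof -
  have [measurable]: "X \<in> borel_measurable (\<F> (dy T j (Suc n)))" "be (dy T j (Suc n)) \<in> borel_measurable (\<F> (dy T j (Suc n)))"
   "be (dy T j n) \<in> borel_measurable (\<F> (dy T j (Suc n)))"
   using X(2) r less bm_adapted by (auto intro!: filt_mono[of "dy T j n" "dy T j (Suc n)"])
  show ?thesis by measurable
 qed
 ultimately show ?case unfolding X_def by simp
qed

lemma grid_sum_increment:
 assumes a: "0 < a" and i: "i0 <= i1" "i1 <= 2 ^ j0" and j: "j0 <= j"
 defines "s \<equiv> dy T j0 i0" and "t \<equiv> dy T j0 i1"
 obtains v where "gaussian M (%om. grid_sum T a t j (%u. be u om) - grid_sum T a s j (%u. be u om)) v"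
  "0 <= v" "v <= ((1 - exp (- 2 * a * (t - s))) + (1 - exp (- a * (t - s)))^2) / (2 * a)"
proof -
 obtain k where k: "j = j0 + k" using j le_Suc_ex by blast
 define m n where "m = 2 ^ k * i0" "n = 2 ^ k * i1"
 have lo: "lo T j s = m" "lo T j t = n"
  unfolding k s_def t_def m_n_def using i by (auto intro!: lo_dy[OF T])
 have mn: "m <= n" "n <= 2 ^ j" unfolding m_n_def k using i by (auto simp: power_add mult.commute)
 have sm: "s = dy T j m" "t = dy T j n" unfolding s_def t_def m_n_def k by (simp_all add: dy_refine[OF T])
 define h where "h = T / 2 ^ j"
 have h: "0 < h" using T by (simp add: h_def)
 have dyh: "dy T j i = real i * h" if "i <= n" for i using that mn by (simp add: dy_eq[OF T] h_def)
 define dl where "dl = t - s"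
 have dl: "0 <= dl" unfolding dl_def sm using mn by (simp add: dy_mono[OF T])
 define q where "q = 1 - exp (- a * dl)"
 define d where "d i = exp (- a * (t - dy T j i)) - (if i < m then exp (- a * (s - dy T j i)) else 0)" for i
 have eq: "(%om. grid_sum T a t j (%u. be u om) - grid_sum T a s j (%u. be u om))
   = (%om. \<Sum>i<n. d i * (be (dy T j (Suc i)) om - be (dy T j i) om))"
 proof
  fix om
  have "(\<Sum>i<m. exp (- a * (s - dy T j i)) * (be (dy T j (Suc i)) om - be (dy T j i) om))
   = (\<Sum>i<n. (if i < m then exp (- a * (s - dy T j i)) else 0) * (be (dy T j (Suc i)) om - be (dy T j i) om))"
   using mn(1) by (intro sum.mono_neutral_cong_left) auto
  then show "grid_sum T a t j (%u. be u om) - grid_sum T a s j (%u. be u om)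
   = (\<Sum>i<n. d i * (be (dy T j (Suc i)) om - be (dy T j i) om))"
   unfolding grid_sum_def lo d_def left_diff_distrib sum_subtractf by simp
 qed
 define E where "E r i = exp (- 2 * a * (r - real i * h))" for r i
 have cell: "E r i * h <= (E r (Suc i) - E r i) / (2 * a)" for r i
 proof -
  have "E r (Suc i) = E r i * exp (2 * a * h)"
   unfolding E_def mult_exp_exp by (simp add: algebra_simps)
  moreover have "1 + 2 * a * h <= exp (2 * a * h)" by (rule exp_ge_add_one_self)
  then have "E r i * (1 + 2 * a * h) <= E r i * exp (2 * a * h)" by (intro mult_left_mono) (auto simp: E_def)
  ultimately have "E r i * (2 * a * h) <= E r (Suc i) - E r i" by (simp add: algebra_simps)
  then show ?thesis using a by (simp add: field_simps)
 qed
 have tele: "(\<Sum>i=l..<u. E r i * h) <= (E r u - E r l) / (2 * a)" if "l <= u" for l u r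
 proof -
  have "(\<Sum>i=l..<u. E r i * h) <= (\<Sum>i=l..<u. (E r (Suc i) - E r i) / (2 * a))" by (intro sum_mono cell)
  also have "... = (E r u - E r l) / (2 * a)"
   unfolding sum_divide_distrib[symmetric] using sum_Suc_diff'[OF that, of "E r"] by simp
  finally show ?thesis .
 qed
 have sq: "(exp (- a * (r - real i * h)))^2 = E r i" for r i
  unfolding E_def power2_eq_square mult_exp_exp by (simp add: algebra_simps)
 have "(\<Sum>i<n. (d i)^2 * h) = (\<Sum>i=0..<m. (d i)^2 * h) + (\<Sum>i=m..<n. (d i)^2 * h)"
  using mn(1) by (simp add: sum.atLeastLessThan_concat lessThan_atLeast0)
 also have "(\<Sum>i=0..<m. (d i)^2 * h) = (\<Sum>i=0..<m. q\<^sup>2 * (E s i * h))"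
 proof (rule sum.cong[OF refl])
  fix i assume "i \<in> {0..<m}"
  then have "d i = exp (- a * (t - real i * h)) - exp (- a * (s - real i * h))"
   using mn by (simp add: d_def dyh)
  also have "... = - (q * exp (- a * (s - real i * h)))"
   unfolding q_def dl_def left_diff_distrib mult_exp_exp by (simp add: algebra_simps)
  finally show "(d i)^2 * h = q\<^sup>2 * (E s i * h)" by (simp add: power_mult_distrib sq[simplified])
 qed
 also have "(\<Sum>i=m..<n. (d i)^2 * h) = (\<Sum>i=m..<n. E t i * h)"
  by (rule sum.cong[OF refl]) (simp add: d_def dyh sq[simplified])
 also have "(\<Sum>i=0..<m. q\<^sup>2 * (E s i * h)) + (\<Sum>i=m..<n. E t i * h) <= q\<^sup>2 * (1 / (2 * a)) + (1 - exp (- 2 * a * dl)) / (2 * a)"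
 proof (rule add_mono)
  have "(\<Sum>i=0..<m. E s i * h) <= (E s m - E s 0) / (2 * a)" by (rule tele) simp
  also have "... <= 1 / (2 * a)"
  proof (rule divide_right_mono)
   have "E s m = 1" unfolding E_def using sm(1) dyh[of m] mn by simp
   moreover have "0 <= E s 0" unfolding E_def by simp
   ultimately show "E s m - E s 0 <= 1" by simp
  qed (use a in simp)
  finally show "(\<Sum>i=0..<m. q\<^sup>2 * (E s i * h)) <= q\<^sup>2 * (1 / (2 * a))"
   unfolding sum_distrib_left[symmetric] by (intro mult_left_mono) auto
  have "(\<Sum>i=m..<n. E t i * h) <= (E t n - E t m) / (2 * a)" by (rule tele) (rule mn)
  also have "... = (1 - exp (- 2 * a * dl)) / (2 * a)"
   unfolding E_def dl_def using sm dyh[of m] dyh[of n] mn by simp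
  finally show "(\<Sum>i=m..<n. E t i * h) <= (1 - exp (- 2 * a * dl)) / (2 * a)" .
 qed
 also have "... = ((1 - exp (- 2 * a * dl)) + q\<^sup>2) / (2 * a)" by (simp add: add_divide_distrib)
 finally have bound: "(\<Sum>i<n. (d i)^2 * h) <= ((1 - exp (- 2 * a * dl)) + q\<^sup>2) / (2 * a)" .
 show thesis
 proof (rule that[of "\<Sum>i<n. (d i)^2 * h"])
  show "gaussian M (%om. grid_sum T a t j (%u. be u om) - grid_sum T a s j (%u. be u om)) (\<Sum>i<n. (d i)^2 * h)"
   unfolding eq h_def using gaussian_steps[OF mn(2), of d] by blast
  show "0 <= (\<Sum>i<n. (d i)^2 * h)" using h by (intro sum_nonneg) auto
  show "(\<Sum>i<n. (d i)^2 * h) <= ((1 - exp (- 2 * a * (t - s))) + (1 - exp (- a * (t - s)))^2) / (2 * a)"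
   using bound unfolding q_def dl_def .
 qed
qed

end

text \<open>Interpolates between \<open>1 - exp (- x) \<le> 1\<close> and \<open>1 - exp (- x) \<le>
x\<close>; the exponent \<open>p\<close> comes from the trace condition.\<close>

lemma variance_bound:
 fixes a dl p :: real
 assumes "0 < a" "0 <= dl" "0 < p" "p <= 1"
 shows "((1 - exp (- 2 * a * dl)) + (1 - exp (- a * dl))^2) / (2 * a) <= 2 * a powr (p - 1) * dl powr p"
proof (cases "dl = 0")
 case True
 then show ?thesis using assms by simp
next
 case False
 then have d: "0 < dl" using assms by simp
 define y where "y = 2 * a * dl"
 have y: "0 < y" using assms d by (simp add: y_def)
 have min: "min 1 y <= y powr p"
 proof (cases "1 <= y")
  case True
  then show ?thesis using assms(3) by (simp add: ge_one_powr_ge_zero min_def)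
 next
  case False
  then have "y powr 1 <= y powr p" using y assms by (intro powr_mono') auto
  then show ?thesis using y by simp
 qed
 have 1: "1 - exp (- 2 * a * dl) <= min 1 y"
  using exp_ge_add_one_self[of "- 2 * a * dl"] by (simp add: y_def)
 have 2: "(1 - exp (- a * dl))^2 <= min 1 y"
 proof -
  define z where "z = 1 - exp (- a * dl)"
  have z: "0 <= z" "z <= 1" "z <= a * dl" using assms d exp_ge_add_one_self[of "- a * dl"] by (auto simp: z_def)
  have "z\<^sup>2 <= z * 1" unfolding power2_eq_square using z by (intro mult_left_mono) auto
  moreover have "a * dl <= y" using assms by (simp add: y_def)
  ultimately show ?thesis using z unfolding z_def[symmetric] by simp
 qed
 have "y powr p = 2 powr p * (a * dl) powr p"
  unfolding y_def mult.assoc using assms by (subst powr_mult) auto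
 also have "... <= 2 powr 1 * (a * dl) powr p"
  using assms by (intro mult_right_mono powr_mono) auto
 also have "... = 2 * (a powr p * dl powr p)" using assms by (simp add: powr_mult)
 finally have yp: "y powr p <= 2 * (a powr p * dl powr p)" .
 have "(1 - exp (- 2 * a * dl)) + (1 - exp (- a * dl))^2 <= 2 * (2 * (a powr p * dl powr p))"
  using 1 2 min yp by linarith
 then have "((1 - exp (- 2 * a * dl)) + (1 - exp (- a * dl))^2) / (2 * a) <= (2 * (2 * (a powr p * dl powr p))) / (2 * a)"
  using assms by (intro divide_right_mono) auto
 also have "... = 2 * (a powr p / a) * dl powr p" using assms by simp
 also have "a powr p / a = a powr (p - 1)" using assms by (simp add: powr_diff)
 finally show ?thesis .
qed

section \<open>Coordinates of the stochastic convolution\<close>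

context diagonal_data
begin

lemma wiener_brownian:
 assumes "prob_space M" "filtered_prob_space T M \<F>" "cylindrical_wiener_process T M \<F> W" "norm h = 1"
 shows "brownian M T \<F> (%t. W t h)"
 using assms T unfolding cylindrical_wiener_process_def brownian_def brownian_axioms_def by blast

lemma integrand_eigen: "s <= t ==> S (t - s) (Q (e k)) = exp (- al k * (t - s)) *\<^sub>R (lam k *\<^sub>R e k)"
 by (simp add: Q_eigen blinfun.scaleR_right S_eigen mult.commute)

lemma step_integral_grid:
 "step_integral (lo T j t) (dy T j) (%i. exp (- al k * (t - dy T j i)) *\<^sub>R (lam k *\<^sub>R e k)) be om
  = (lam k * grid_sum T (al k) t j (%u. be u om)) *\<^sub>R e k"
 unfolding step_integral_def grid_sum_def sum_distrib_left scaleR_sum_left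
 by (rule sum.cong) (auto simp: mult_ac)

lemma integrand_step_error:
 assumes "0 <= t" "t <= T"
 shows "(\<integral>\<^sup>+s\<in>{0..t}. ennreal ((norm (S (t - s) (Q (e k))
   - step_function (lo T j t) (dy T j) (%i. exp (- al k * (t - dy T j i)) *\<^sub>R (lam k *\<^sub>R e k)) s))^2) \<partial>lborel)
  <= ennreal ((lam k)^2 * grid_error T (al k) j)"
proof -
 have "(\<integral>\<^sup>+s\<in>{0..t}. ennreal ((norm (S (t - s) (Q (e k))
   - step_function (lo T j t) (dy T j) (%i. exp (- al k * (t - dy T j i)) *\<^sub>R (lam k *\<^sub>R e k)) s))^2) \<partial>lborel)
   = (\<integral>\<^sup>+s\<in>{0..t}. ennreal ((norm (exp (- al k * (t - s)) *\<^sub>R (lam k *\<^sub>R e k)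
   - step_function (lo T j t) (dy T j) (%i. exp (- al k * (t - dy T j i)) *\<^sub>R (lam k *\<^sub>R e k)) s))^2) \<partial>lborel)"
  by (intro nn_integral_cong) (auto simp: integrand_eigen split: split_indicator)
 also have "... <= ennreal ((norm (lam k *\<^sub>R e k))^2 * grid_error T (al k) j)"
  by (rule grid_step_error[OF T al_pos assms])
 finally show ?thesis by (simp add: onb_norm[OF onb])
qed

lemma grid_times:
 assumes "0 <= t" "t <= T"
 shows "\<forall>i\<le>lo T j t. dy T j i \<in> {0..t}" "\<forall>i<lo T j t. dy T j i <= dy T j (Suc i)"
proof -
 show "\<forall>i\<le>lo T j t. dy T j i \<in> {0..t}"
  using dy_mono[OF T, of _ "lo T j t" j] dy_lo(1)[OF T assms, of j] dy_range[OF T, of j] by (auto intro: order_trans)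
 show "\<forall>i<lo T j t. dy T j i <= dy T j (Suc i)" by (simp add: dy_mono[OF T])
qed

text \<open>By orthogonality only the \<open>k\<close>-th term of the series contributes to the
\<open>k\<close>-th coordinate.\<close>

lemma stochastic_integral_coord:
 assumes M: "prob_space M" and filt: "filtered_prob_space T M \<F>" and W: "cylindrical_wiener_process T M \<F> W"
  and t: "0 <= t" "t <= T" and I: "has_stochastic_integral M e W t (%s h. S (t - s) (Q h)) I"
 shows "(\<integral>\<^sup>+om. ennreal ((inner (I om) (e k) - lam k * grid_sum T (al k) t j (%u. W u (e k) om))^2) \<partial>M)
  <= ennreal (8 * (lam k)^2 * grid_error T (al k) j)"
proof -
 interpret B: brownian M T \<F> "%t. W t (e i)" for i
  by (rule wiener_brownian[OF M filt W]) (rule onb_norm[OF onb])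
 from I obtain J where Im[measurable]: "I \<in> borel_measurable M"
  and J: "!!k. has_wiener_integral M (%s. W s (e k)) t (%s. S (t - s) (Q (e k))) (J k)"
  and lim: "(%n. \<integral>\<^sup>+om. ennreal ((norm (I om - (\<Sum>k<n. J k om)))^2) \<partial>M) ----> 0"
  unfolding has_stochastic_integral_def by blast
 have [measurable]: "J k \<in> borel_measurable M" for k using J[of k] unfolding has_wiener_integral_def by blast
 define R where "R k j om = lam k * grid_sum T (al k) t j (%u. W u (e k) om)" for k j om
 have [measurable]: "R k j \<in> borel_measurable M" for k j
  unfolding R_def[abs_def] grid_sum_def using B.bm_measurable dy_range[OF T] by measurable
 have Jerr: "(\<integral>\<^sup>+om. ennreal ((norm (J k om - R k j om *\<^sub>R e k))^2) \<partial>M) <= ennreal (4 * ((lam k)^2 * grid_error T (al k) j))" for k j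
 proof -
  have "(\<integral>\<^sup>+om. ennreal ((norm (J k om - R k j om *\<^sub>R e k))^2) \<partial>M) <= 4 * ennreal ((lam k)^2 * grid_error T (al k) j)"
   using B.wiener_integral_approx[OF J[of k] t(2) grid_times[OF t, of j], where c = "%i. exp (- al k * (t - dy T j i)) *\<^sub>R (lam k *\<^sub>R e k)"]
   integrand_step_error[OF t, of k j]
   unfolding step_integral_grid R_def by (meson mult_left_mono order_trans zero_le)
  then show ?thesis using grid_error_nonneg[OF T] by (simp add: ennreal_mult)
 qed
 have orth: "AE om in M. inner (J l om) (e k) = 0" if "l ~= k" for l
 proof -
  have "(\<integral>\<^sup>+om. ennreal ((inner (J l om) (e k))^2) \<partial>M) <= ennreal (4 * ((lam l)^2 * grid_error T (al l) j))" for j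
  proof (rule order_trans[OF nn_integral_mono Jerr])
   fix om
   have "\<bar>inner (J l om - R l j om *\<^sub>R e l) (e k)\<bar> <= norm (J l om - R l j om *\<^sub>R e l) * norm (e k)"
   by (rule Cauchy_Schwarz_ineq2)
   then have "\<bar>inner (J l om) (e k)\<bar> <= norm (J l om - R l j om *\<^sub>R e l)"
   using that by (simp add: inner_diff_left onb_inner[OF onb] onb_norm[OF onb])
   then show "ennreal ((inner (J l om) (e k))^2) <= ennreal ((norm (J l om - R l j om *\<^sub>R e l))^2)"
   by (intro ennreal_leI) (metis abs_le_square_iff abs_norm_cancel)
  qed
  moreover have "(%j. ennreal (4 * ((lam l)^2 * grid_error T (al l) j))) ----> ennreal (4 * ((lam l)^2 * 0))"
   by (intro tendsto_ennrealI tendsto_intros grid_error_tendsto[OF T])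
  ultimately have "(\<integral>\<^sup>+om. ennreal ((inner (J l om) (e k))^2) \<partial>M) <= ennreal (4 * ((lam l)^2 * 0))"
   by (intro LIMSEQ_le_const) auto
  then have "(\<integral>\<^sup>+om. ennreal ((inner (J l om) (e k))^2) \<partial>M) = 0" by simp
  then show ?thesis by (subst (asm) nn_integral_0_iff_AE) auto
 qed
 have orth': "AE om in M. \<forall>l. l ~= k --> inner (J l om) (e k) = 0"
  using orth by (simp add: AE_all_countable)
 let ?L = "\<integral>\<^sup>+om. ennreal ((inner (I om) (e k) - R k j om)^2) \<partial>M"
 have "?L <= 2 * (\<integral>\<^sup>+om. ennreal ((norm (I om - (\<Sum>k<n. J k om)))^2) \<partial>M) + 2 * ennreal (4 * ((lam k)^2 * grid_error T (al k) j))"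
  if "Suc k <= n" for n
 proof -
  have "?L <= 2 * (\<integral>\<^sup>+om. ennreal ((norm (inner (I om) (e k) - inner (\<Sum>k<n. J k om) (e k)))^2) \<partial>M)
   + 2 * (\<integral>\<^sup>+om. ennreal ((norm (inner (\<Sum>k<n. J k om) (e k) - R k j om))^2) \<partial>M)"
   using nn_square_tri[of "%om. inner (I om) (e k)" M "%om. inner (\<Sum>k<n. J k om) (e k)" "R k j"] by simp
  also have "... <= 2 * (\<integral>\<^sup>+om. ennreal ((norm (I om - (\<Sum>k<n. J k om)))^2) \<partial>M) + 2 * ennreal (4 * ((lam k)^2 * grid_error T (al k) j))"
  proof (intro add_mono mult_left_mono)
   show "(\<integral>\<^sup>+om. ennreal ((norm (inner (I om) (e k) - inner (\<Sum>k<n. J k om) (e k)))^2) \<partial>M) <= (\<integral>\<^sup>+om. ennreal ((norm (I om - (\<Sum>k<n. J k om)))^2) \<partial>M)"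
   proof (intro nn_integral_mono ennreal_leI power_mono)
   fix om
   show "norm (inner (I om) (e k) - inner (\<Sum>k<n. J k om) (e k)) <= norm (I om - (\<Sum>k<n. J k om))"
   using Cauchy_Schwarz_ineq2[of "I om - (\<Sum>k<n. J k om)" "e k"] by (simp add: inner_diff_left onb_norm[OF onb])
   qed simp
   have "(\<integral>\<^sup>+om. ennreal ((norm (inner (\<Sum>k<n. J k om) (e k) - R k j om))^2) \<partial>M) <= (\<integral>\<^sup>+om. ennreal ((norm (J k om - R k j om *\<^sub>R e k))^2) \<partial>M)"
   proof (rule nn_integral_mono_AE)
   show "AE om in M. ennreal ((norm (inner (\<Sum>k<n. J k om) (e k) - R k j om))^2) <= ennreal ((norm (J k om - R k j om *\<^sub>R e k))^2)"
   using orth'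
   proof eventually_elim
   case (elim om)
   have "inner (\<Sum>l<n. J l om) (e k) = (\<Sum>l<n. if l = k then inner (J k om) (e k) else 0)"
   unfolding inner_sum_left using elim by (intro sum.cong) auto
   then have "inner (\<Sum>l<n. J l om) (e k) - R k j om = inner (J k om - R k j om *\<^sub>R e k) (e k)"
   using that by (simp add: inner_diff_left onb_inner[OF onb])
   then have "norm (inner (\<Sum>l<n. J l om) (e k) - R k j om) <= norm (J k om - R k j om *\<^sub>R e k)"
   using Cauchy_Schwarz_ineq2[of "J k om - R k j om *\<^sub>R e k" "e k"] by (simp add: onb_norm[OF onb])
   then show ?case by (intro ennreal_leI power_mono) auto
   qed
   qed
   then show "(\<integral>\<^sup>+om. ennreal ((norm (inner (\<Sum>k<n. J k om) (e k) - R k j om))^2) \<partial>M) <= ennreal (4 * ((lam k)^2 * grid_error T (al k) j))"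
   using Jerr by (rule order_trans)
  qed simp_all
  finally show ?thesis .
 qed
 moreover have "(%n. 2 * (\<integral>\<^sup>+om. ennreal ((norm (I om - (\<Sum>k<n. J k om)))^2) \<partial>M) + 2 * ennreal (4 * ((lam k)^2 * grid_error T (al k) j)))
  ----> 2 * 0 + 2 * ennreal (4 * ((lam k)^2 * grid_error T (al k) j))"
  by (intro tendsto_add ennreal_tendsto_cmult lim tendsto_const) auto
 ultimately have "?L <= 2 * 0 + 2 * ennreal (4 * ((lam k)^2 * grid_error T (al k) j))"
  by (intro LIMSEQ_le_const[of _ _ "?L"]) blast+
 also have "... = ennreal (8 * (lam k)^2 * grid_error T (al k) j)"
  using grid_error_nonneg[OF T, of "al k" j]
  by (simp add: ennreal_mult'[symmetric, of 2, simplified] mult.assoc)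
 finally show ?thesis unfolding R_def .
qed

end

section \<open>Uniform estimates for the approximating solutions\<close>

section \<open>Estimates for the approximating equations\<close>

lemma series_second_moment:
 fixes D :: "'w => 'h::{real_inner, banach, second_countable_topology}"
 assumes onb: "orthonormal_basis e" and [measurable]: "D \<in> borel_measurable M"
  and v: "!!k. 0 <= v k" "v sums V"
  and mom: "!!k. (\<integral>\<^sup>+om. ennreal ((inner (D om) (e k))^2) \<partial>M) <= ennreal (v k)"
 shows "(\<integral>\<^sup>+om. ennreal ((norm (D om))^2) \<partial>M) <= ennreal V"
proof -
 have "(\<integral>\<^sup>+om. ennreal ((norm (D om))^2) \<partial>M) = (\<integral>\<^sup>+om. (\<Sum>k. ennreal ((inner (D om) (e k))^2)) \<partial>M)"
 proof (rule nn_integral_cong)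
  fix om
  have "(%k. ennreal ((inner (D om) (e k))^2)) sums ennreal ((norm (D om))^2)"
   using parseval[OF onb, of "D om"] by (subst sums_ennreal) auto
  then show "ennreal ((norm (D om))^2) = (\<Sum>k. ennreal ((inner (D om) (e k))^2))" by (rule sums_unique)
 qed
 also have "... = (\<Sum>k. \<integral>\<^sup>+om. ennreal ((inner (D om) (e k))^2) \<partial>M)"
  by (rule nn_integral_suminf) measurable
 also have "... <= (\<Sum>k. ennreal (v k))" by (intro suminf_le mom) auto
 also have "... = ennreal V"
 proof -
  have "0 <= V" using v by (metis suminf_nonneg sums_summable sums_unique)
  then have "(%k. ennreal (v k)) sums ennreal V" using v by (subst sums_ennreal) auto
  then show ?thesis by (rule sums_unique[symmetric])
 qed
 finally show ?thesis .
qed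

lemma ennreal_twice_sum: "0 <= a ==> 0 <= b ==> 2 * ennreal a + 2 * ennreal b = ennreal (2 * a + 2 * b)"
proof -
 assume "0 <= a" "0 <= b"
 then have "ennreal (2 * a + 2 * b) = ennreal (2 * a) + ennreal (2 * b)" by (intro ennreal_plus) auto
 also have "... = 2 * ennreal a + 2 * ennreal b"
  using \<open>0 <= a\<close> \<open>0 <= b\<close> by (simp only: ennreal_mult' ennreal_numeral zero_le_numeral)
 finally show ?thesis by simp
qed

definition modulus_event :: "real => 'w measure => (real => 'w => 'h::real_normed_vector) => real => real => 'w set" where
 "modulus_event T M X dl ep = {om\<in>space M. \<exists>q\<in>dyadics T. \<exists>q'\<in>dyadics T. \<bar>q - q'\<bar> < dl & ep < norm (X q' om - X q om)}"

lemma modulus_event_sets: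
 fixes X :: "real => 'w => 'h::{real_normed_vector, second_countable_topology}"
 assumes "!!q. q \<in> dyadics T ==> X q \<in> borel_measurable M"
 shows "modulus_event T M X dl ep \<in> sets M"
proof -
 have "modulus_event T M X dl ep = (\<Union>q\<in>dyadics T. \<Union>q'\<in>dyadics T. {om\<in>space M. \<bar>q - q'\<bar> < dl & ep < norm (X q' om - X q om)})"
  unfolding modulus_event_def by auto
 also have "... \<in> sets M"
 proof (intro sets.countable_UN'' countable_dyadics)
  fix q q' assume [simp]: "q \<in> dyadics T" "q' \<in> dyadics T"
  have [measurable]: "X q \<in> borel_measurable M" "X q' \<in> borel_measurable M" using assms by auto
  show "{om\<in>space M. \<bar>q - q'\<bar> < dl & ep < norm (X q' om - X q om)} \<in> sets M" by measurable
 qed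
 finally show ?thesis .
qed

text \<open>A solution with bounded drift. The constant \<open>C\<close> is the only quantity besides the
initial value on which estimates may depend.\<close>

locale approx_solution = diagonal_data T S Q e al lam p + prob_space M
 for T and S :: "real => 'h::{real_inner, banach, second_countable_topology} \<Rightarrow>\<^sub>L 'h" and Q e al lam p
  and M :: "'w measure" +
 fixes \<F> :: "real => 'w measure" and W :: "real => 'h => 'w => real" and X :: "real => 'w => 'h"
  and G :: "real => 'h => 'h" and x :: 'h and C :: real
 assumes sol: "martingale_solution T S Q e UNIV G x M \<F> W X"
  and G_meas: "(%z. G (fst z) (snd z)) \<in> borel_measurable (borel \<Otimes>\<^sub>M borel)"
  and G_bdd: "\<exists>B. \<forall>t x. norm (G t x) <= B"
  and C: "0 <= C"
  and drift_energy: "(\<integral>\<^sup>+om. (\<integral>\<^sup>+t\<in>{0..T}. ennreal ((norm (G t (X t om)))^2) \<partial>lborel) \<partial>M) <= ennreal C"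
begin

lemma filt: "filtered_prob_space T M \<F>" and cylW: "cylindrical_wiener_process T M \<F> W"
 using sol unfolding martingale_solution_def by auto

lemma brown: "norm h = 1 ==> brownian M T \<F> (%t. W t h)"
 by (rule wiener_brownian[OF prob_space_axioms filt cylW])

sublocale B0: brownian M T \<F> "%t. W t (e 0)"
 by (rule brown) (rule onb_norm[OF onb])

lemma X_adapted: "t \<in> {0..T} ==> X t \<in> borel_measurable (\<F> t)"
 using sol unfolding martingale_solution_def by auto

lemma X_measurable: "t \<in> {0..T} ==> X t \<in> borel_measurable M"
 using X_adapted B0.filt_measurable by blast

lemma W_adapted: "t \<in> {0..T} ==> W t h \<in> borel_measurable (\<F> t)"
 using cylW unfolding cylindrical_wiener_process_def by auto

lemma W_measurable: "t \<in> {0..T} ==> W t h \<in> borel_measurable M"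
 using W_adapted B0.filt_measurable by blast

lemma X_continuous: "om \<in> space M ==> continuous_on {0..T} (%t. X t om)"
 using sol unfolding martingale_solution_def by auto

lemma dy_in: "dy T j i \<in> {0..T}" by (rule dy_range[OF T])

lemma X_dyadic_limit: "om \<in> space M ==> t \<in> {0..T} ==> (%j. X (dy T j (lo T j t)) om) ----> X t om"
 using X_continuous[of om] dy_lo_tendsto[OF T, of t] dy_in
 by (intro continuous_on_tendsto_compose[of "{0..T}" "%t. X t om"]) (auto intro!: always_eventually)

definition Xj :: "real => 'w => 'h" where
 "Xj t om = lim (%j. X (dy T j (lo T j t)) om)"

lemma Xj_eq: "om \<in> space M ==> t \<in> {0..T} ==> Xj t om = X t om"
 unfolding Xj_def by (rule limI[OF X_dyadic_limit])

lemma lo_measurable[measurable]: "lo T j \<in> measurable borel (count_space UNIV)"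
 unfolding lo_def[abs_def] by measurable

lemma Xj_measurable[measurable]: "(%z. Xj (snd z) (fst z)) \<in> borel_measurable (M \<Otimes>\<^sub>M borel)"
proof -
 have "(%z. X (dy T j (lo T j (snd z))) (fst z)) \<in> borel_measurable (M \<Otimes>\<^sub>M borel)" for j
 proof (rule measurable_compose_countable)
  show "(%z. X (dy T j i) (fst z)) \<in> borel_measurable (M \<Otimes>\<^sub>M borel)" for i
   using measurable_compose[OF measurable_fst X_measurable[OF dy_in]] .
  show "(%z. lo T j (snd z)) \<in> measurable (M \<Otimes>\<^sub>M borel) (count_space UNIV)" by measurable
 qed
 then show ?thesis unfolding Xj_def by measurable
qed

definition drift :: "'w => real => 'h" where
 "drift om s = G s (Xj s om)"

lemma drift_measurable2[measurable]: "(%z. drift (fst z) (snd z)) \<in> borel_measurable (M \<Otimes>\<^sub>M borel)"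
proof -
 have "(%z. (snd z, Xj (snd z) (fst z))) \<in> measurable (M \<Otimes>\<^sub>M borel) (borel \<Otimes>\<^sub>M borel)" by measurable
 from measurable_compose[OF this G_meas] show ?thesis unfolding drift_def by simp
qed

lemma drift_measurable[measurable]: "om \<in> space M ==> drift om \<in> borel_measurable borel"
 using measurable_compose[OF measurable_Pair1' drift_measurable2] by simp

lemma drift_square_integrable: "om \<in> space M ==> set_integrable lborel {0..T} (%s. (norm (drift om s))^2)"
 unfolding set_integrable_def
proof -
 assume w: "om \<in> space M"
 obtain B where B: "!!t x. norm (G t x) <= B" using G_bdd by blast
 have "integrable lborel (%s. indicator {0..T} s * B\<^sup>2)"
  using T by (intro integrable_mult_left integrable_real_indicator) (auto simp: emeasure_lborel_Icc_eq)
 then show "integrable lborel (%s. indicator {0..T} s *\<^sub>R (norm (drift om s))^2)"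
 proof (rule Bochner_Integration.integrable_bound)
  show "(%s. indicator {0..T} s *\<^sub>R (norm (drift om s))^2) \<in> borel_measurable lborel"
   using drift_measurable[OF w] by measurable
  show "AE s in lborel. norm (indicator {0..T} s *\<^sub>R (norm (drift om s))^2) <= norm (indicator {0..T} s * B\<^sup>2)"
   using B unfolding drift_def by (intro AE_I2) (auto intro!: power_mono split: split_indicator)
 qed
qed

lemmas convol_facts = drift_measurable drift_square_integrable

lemma energy_nn: "om \<in> space M ==> ennreal (energy (drift om)) = (\<integral>\<^sup>+t\<in>{0..T}. ennreal ((norm (G t (X t om)))^2) \<partial>lborel)"
proof -
 assume w: "om \<in> space M"
 have "(\<integral>\<^sup>+t\<in>{0..T}. ennreal ((norm (G t (X t om)))^2) \<partial>lborel) = (\<integral>\<^sup>+s. ennreal (indicator {0..T} s *\<^sub>R (norm (drift om s))^2) \<partial>lborel)"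
  by (intro nn_integral_cong) (auto simp: drift_def Xj_eq[OF w] split: split_indicator)
 also have "... = ennreal (energy (drift om))"
  unfolding energy_def set_lebesgue_integral_def
  using drift_square_integrable[OF w] unfolding set_integrable_def by (intro nn_integral_eq_integral) auto
 finally show ?thesis by simp
qed

lemma energy_measurable[measurable]: "(%om. energy (drift om)) \<in> borel_measurable M"
 unfolding energy_def set_lebesgue_integral_def by (intro lborel.borel_measurable_lebesgue_integral) measurable

lemma energy_expectation: "(\<integral>\<^sup>+om. ennreal (energy (drift om)) \<partial>M) <= ennreal C"
 using drift_energy by (subst nn_integral_cong[OF energy_nn]) auto

lemma convol_measurable: "0 <= t ==> (%om. convol (drift om) t) \<in> borel_measurable M"
proof -
 assume t: "0 <= t"
 have "(%om. \<integral>s. indicator {0..t} s *\<^sub>R (if 0 <= t - s then S (t - s) (drift om s) else 0) \<partial>lborel) \<in> borel_measurable M"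
 proof (rule lborel.borel_measurable_lebesgue_integral)
  have "(%z. if 0 <= t - snd z then S (t - snd z) (drift (fst z) (snd z)) else 0) \<in> borel_measurable (M \<Otimes>\<^sub>M borel)"
   by (rule S_measurable) measurable
  then show "(%(om, s). indicator {0..t} s *\<^sub>R (if 0 <= t - s then S (t - s) (drift om s) else 0)) \<in> borel_measurable (M \<Otimes>\<^sub>M lborel)"
   unfolding split_beta by measurable
 qed
 moreover have "(%om. \<integral>s. indicator {0..t} s *\<^sub>R (if 0 <= t - s then S (t - s) (drift om s) else 0) \<partial>lborel) = (%om. convol (drift om) t)"
  unfolding convol_def set_lebesgue_integral_def
  by (intro ext Bochner_Integration.integral_cong) (auto split: split_indicator)
 ultimately show ?thesis by simp
qed

definition Z :: "real => 'w => 'h" where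
 "Z t om = X t om - S t x - convol (drift om) t"

lemma Z_measurable: "t \<in> {0..T} ==> Z t \<in> borel_measurable M"
proof -
 assume t: "t \<in> {0..T}"
 have [measurable]: "X t \<in> borel_measurable M" "(%om. convol (drift om) t) \<in> borel_measurable M"
  using t by (auto intro: X_measurable convol_measurable)
 show ?thesis unfolding Z_def[abs_def] by measurable
qed

lemma convol_lebesgue:
 assumes w: "om \<in> space M" and t: "t \<in> {0..T}"
 shows "(LINT s:{0..t}|lebesgue. S (t - s) (G s (X s om))) = convol (drift om) t"
proof -
 let ?h = "%s. indicator {0..t} s *\<^sub>R (if 0 <= t - s then S (t - s) (drift om s) else 0)"
 have "(%s. if 0 <= t - s then S (t - s) (drift om s) else 0) \<in> borel_measurable lborel"
  by (rule S_measurable) (use drift_measurable[OF w] in simp_all)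
 then have hm: "?h \<in> borel_measurable lborel"
  by (rule borel_measurable_scaleR[rotated]) simp
 have "(%s. indicator {0..t} s *\<^sub>R S (t - s) (G s (X s om))) = ?h"
  using t by (auto simp: drift_def Xj_eq[OF w] split: split_indicator)
 moreover have "(%s. indicator {0..t} s *\<^sub>R S (t - s) (drift om s)) = ?h"
  by (auto split: split_indicator)
 ultimately show ?thesis
  unfolding set_lebesgue_integral_def convol_def by (simp only:) (rule integral_completion[OF hm])
qed

lemma Z_coord:
 assumes t: "t \<in> {0..T}"
 shows "(\<integral>\<^sup>+om. ennreal ((inner (Z t om) (e k) - lam k * grid_sum T (al k) t j (%u. W u (e k) om))^2) \<partial>M)
  <= ennreal (8 * (lam k)^2 * grid_error T (al k) j)"
proof -
 obtain I where I: "has_stochastic_integral M e W t (%s h. S (t - s) (Q h)) I"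
  and eq: "AE om in M. X t om = S t x + (LINT s:{0..t}|lebesgue. S (t - s) (G s (X s om))) + I om"
  using sol t unfolding martingale_solution_def by blast
 have "AE om in M. Z t om = I om"
  using eq AE_space by eventually_elim (simp add: Z_def convol_lebesgue[OF _ t])
 then have "AE om in M. ennreal ((inner (Z t om) (e k) - lam k * grid_sum T (al k) t j (%u. W u (e k) om))^2)
   = ennreal ((inner (I om) (e k) - lam k * grid_sum T (al k) t j (%u. W u (e k) om))^2)"
  by eventually_elim simp
 then have "(\<integral>\<^sup>+om. ennreal ((inner (Z t om) (e k) - lam k * grid_sum T (al k) t j (%u. W u (e k) om))^2) \<partial>M)
  = (\<integral>\<^sup>+om. ennreal ((inner (I om) (e k) - lam k * grid_sum T (al k) t j (%u. W u (e k) om))^2) \<partial>M)"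
  by (rule nn_integral_cong_AE)
 also have "... <= ennreal (8 * (lam k)^2 * grid_error T (al k) j)"
  using t by (intro stochastic_integral_coord[OF prob_space_axioms filt cylW _ _ I]) auto
 finally show ?thesis .
qed

lemma grid_sum_measurable: "(%om. grid_sum T a t j (%u. W u h om)) \<in> borel_measurable M"
 unfolding grid_sum_def using W_measurable[OF dy_in] by measurable

lemma Z_coord_moment:
 assumes i: "i0 <= i1" "i1 <= 2 ^ j0"
 defines "s \<equiv> dy T j0 i0" and "t \<equiv> dy T j0 i1"
 shows "(\<integral>\<^sup>+om. ennreal (inner (Z t om - Z s om) (e k) ^ (2 * m)) \<partial>M)
  <= ennreal (gauss_moment m * ((2 * (lam k)^2 * al k powr (p - 1)) * (t - s) powr p) ^ m)"
proof -
 interpret Bk: brownian M T \<F> "%t. W t (e k)" by (rule brown) (rule onb_norm[OF onb])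
 have st: "s \<in> {0..T}" "t \<in> {0..T}" "s <= t" unfolding s_def t_def using dy_in dy_mono[OF T i(1)] by auto
 have [measurable]: "Z s \<in> borel_measurable M" "Z t \<in> borel_measurable M" using st Z_measurable by auto
 note [measurable] = grid_sum_measurable
 define R where "R u j om = lam k * grid_sum T (al k) u j (%u. W u (e k) om)" for u j om
 have [measurable]: "R u j \<in> borel_measurable M" for u j unfolding R_def[abs_def] by measurable
 show ?thesis
 proof (rule L2_limit_moment[where Y = "%j om. R t j om - R s j om"])
  show "(%j. \<integral>\<^sup>+om. ennreal ((inner (Z t om - Z s om) (e k) - (R t j om - R s j om))^2) \<partial>M) ----> 0"
  proof (rule tendsto_sandwich[of "%_. 0"])
   show "\<forall>\<^sub>F j in sequentially. (\<integral>\<^sup>+om. ennreal ((inner (Z t om - Z s om) (e k) - (R t j om - R s j om))^2) \<partial>M)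
   <= ennreal (32 * ((lam k)^2 * grid_error T (al k) j))"
   proof (rule always_eventually, rule allI)
   fix j
   have "(\<integral>\<^sup>+om. ennreal ((inner (Z t om - Z s om) (e k) - (R t j om - R s j om))^2) \<partial>M)
   = (\<integral>\<^sup>+om. ennreal ((norm ((inner (Z t om) (e k) - R t j om) + - (inner (Z s om) (e k) - R s j om)))^2) \<partial>M)"
   by (simp add: inner_diff_left algebra_simps)
   also have "... <= 2 * (\<integral>\<^sup>+om. ennreal ((norm (inner (Z t om) (e k) - R t j om))^2) \<partial>M) + 2 * (\<integral>\<^sup>+om. ennreal ((norm (- (inner (Z s om) (e k) - R s j om)))^2) \<partial>M)"
   by (rule nn_square_add) measurable
   also have "... <= 2 * ennreal (8 * (lam k)^2 * grid_error T (al k) j) + 2 * ennreal (8 * (lam k)^2 * grid_error T (al k) j)"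
   using Z_coord[OF st(1), of k j] Z_coord[OF st(2), of k j] unfolding R_def
   by (intro add_mono mult_left_mono) (auto simp: power2_commute)
   also have "... = ennreal (2 * (8 * (lam k)^2 * grid_error T (al k) j) + 2 * (8 * (lam k)^2 * grid_error T (al k) j))"
   using grid_error_nonneg[OF T, of "al k" j] by (intro ennreal_twice_sum) auto
   also have "2 * (8 * (lam k)^2 * grid_error T (al k) j) + 2 * (8 * (lam k)^2 * grid_error T (al k) j) = 32 * ((lam k)^2 * grid_error T (al k) j)"
   by simp
   finally show "(\<integral>\<^sup>+om. ennreal ((inner (Z t om - Z s om) (e k) - (R t j om - R s j om))^2) \<partial>M)
   <= ennreal (32 * ((lam k)^2 * grid_error T (al k) j))" .
   qed
   have "(%j. ennreal (32 * ((lam k)^2 * grid_error T (al k) j))) ----> ennreal (32 * ((lam k)^2 * 0))"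
   by (intro tendsto_ennrealI tendsto_intros grid_error_tendsto[OF T])
   then show "(%j. ennreal (32 * ((lam k)^2 * grid_error T (al k) j))) ----> 0" by simp
  qed auto
  show "\<forall>\<^sub>F j in sequentially. (\<integral>\<^sup>+om. ennreal ((R t j om - R s j om) ^ (2 * m)) \<partial>M)
   <= ennreal (gauss_moment m * ((2 * (lam k)^2 * al k powr (p - 1)) * (t - s) powr p) ^ m)"
  proof (rule eventually_sequentiallyI[of j0])
   fix j assume "j0 <= j"
   then obtain v where v: "gaussian M (%om. grid_sum T (al k) t j (%u. W u (e k) om) - grid_sum T (al k) s j (%u. W u (e k) om)) v"
   "0 <= v" "v <= ((1 - exp (- 2 * al k * (t - s))) + (1 - exp (- al k * (t - s)))^2) / (2 * al k)"
   unfolding s_def t_def using Bk.grid_sum_increment[OF al_pos i] by blast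
   have v2: "v <= 2 * al k powr (p - 1) * (t - s) powr p"
   using v(3) variance_bound[OF al_pos _ p, of "t - s" k] st by simp
   have "gaussian M (%om. R t j om - R s j om) ((lam k)^2 * v)"
   using gaussian_scale[OF v(1), of "lam k"] unfolding R_def by (simp add: right_diff_distrib)
   then have "(\<integral>\<^sup>+om. ennreal ((R t j om - R s j om) ^ (2 * m)) \<partial>M) = ennreal (gauss_moment m * ((lam k)^2 * v) ^ m)"
   by (rule gaussian_moment) (use v in simp)
   also have "... <= ennreal (gauss_moment m * ((2 * (lam k)^2 * al k powr (p - 1)) * (t - s) powr p) ^ m)"
   proof (intro ennreal_leI mult_left_mono power_mono)
   have "(lam k)^2 * v <= (lam k)^2 * (2 * al k powr (p - 1) * (t - s) powr p)" by (rule mult_left_mono[OF v2]) simp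
   then show "(lam k)^2 * v <= 2 * (lam k)^2 * al k powr (p - 1) * (t - s) powr p" by (simp add: mult_ac)
   qed (use v gauss_moment_pos[of m] in auto)
   finally show "(\<integral>\<^sup>+om. ennreal ((R t j om - R s j om) ^ (2 * m)) \<partial>M)
   <= ennreal (gauss_moment m * ((2 * (lam k)^2 * al k powr (p - 1)) * (t - s) powr p) ^ m)" .
  qed
 qed measurable
qed

lemma Z_zero: "AE om in M. Z 0 om = 0"
proof -
 have z: "0 \<in> {0..T}" using T by simp
 have [measurable]: "Z 0 \<in> borel_measurable M" by (rule Z_measurable[OF z])
 have "AE om in M. inner (Z 0 om) (e k) = 0" for k
 proof -
  have "(\<integral>\<^sup>+om. ennreal ((inner (Z 0 om) (e k))^2) \<partial>M) <= ennreal (8 * ((lam k)^2 * grid_error T (al k) j))" for j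
   using Z_coord[OF z, of k j] by (simp add: grid_sum_def lo_def mult.assoc)
  moreover have "(%j. ennreal (8 * ((lam k)^2 * grid_error T (al k) j))) ----> ennreal (8 * ((lam k)^2 * 0))"
   by (intro tendsto_ennrealI tendsto_intros grid_error_tendsto[OF T])
  ultimately have "(\<integral>\<^sup>+om. ennreal ((inner (Z 0 om) (e k))^2) \<partial>M) <= ennreal (8 * ((lam k)^2 * 0))"
   by (intro LIMSEQ_le_const) auto
  then have "(\<integral>\<^sup>+om. ennreal ((inner (Z 0 om) (e k))^2) \<partial>M) = 0" by simp
  then show ?thesis by (subst (asm) nn_integral_0_iff_AE) auto
 qed
 then have "AE om in M. \<forall>k. inner (Z 0 om) (e k) = 0" by (simp add: AE_all_countable)
 then show ?thesis
 proof eventually_elim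
  case (elim om)
  then show ?case by (intro onb_eqI[OF onb]) simp
 qed
qed

end

context diagonal_data
begin

definition noise_weight :: "nat => real" where
 "noise_weight k = 2 * (lam k)^2 * al k powr (p - 1)"

lemma noise_weight: "0 < noise_weight k" "summable noise_weight"
proof -
 show "0 < noise_weight k" unfolding noise_weight_def using al_pos[of k] lam_pos[of k] by simp
 show "summable noise_weight" unfolding noise_weight_def[abs_def] mult.assoc
  by (rule summable_mult[OF noise_summable])
qed

definition noise_tail :: "nat => real" where
 "noise_tail K = (\<Sum>k. noise_weight (k + K))"

lemma noise_tail_tendsto: "noise_tail ----> 0"
 unfolding noise_tail_def[abs_def] by (rule suminf_exist_split2[OF noise_weight(2)])

text \<open>The three terms bound the tail of the initial value, of the drift and of the noise.\<close>

definition tail_bound :: "'h => real => nat => real => real" where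
 "tail_bound x C K b = 4 * (norm (x - proj e K x))^2 + 4 * (b * C) + 2 * (noise_tail K * T powr p)"

end

context approx_solution
begin

lemma Z_moment:
 assumes q: "q \<in> dyadics T" "q' \<in> dyadics T" and m: "0 < m"
 shows "(\<integral>\<^sup>+om. ennreal (norm (Z q' om - Z q om) ^ (2 * m)) \<partial>M)
  <= ennreal (gauss_moment m * (suminf noise_weight * \<bar>q' - q\<bar> powr p) ^ m)"
proof -
 have main: "(\<integral>\<^sup>+om. ennreal (norm (Z (dy T j i1) om - Z (dy T j i0) om) ^ (2 * m)) \<partial>M)
  <= ennreal (gauss_moment m * (suminf noise_weight * (dy T j i1 - dy T j i0) powr p) ^ m)"
  if i: "i0 <= i1" "i1 <= 2 ^ j" for i0 i1 j
 proof (rule series_moment[OF onb _ m noise_weight])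
  have [measurable]: "Z (dy T j i) \<in> borel_measurable M" for i by (rule Z_measurable[OF dy_in])
  show "(%om. Z (dy T j i1) om - Z (dy T j i0) om) \<in> borel_measurable M" by measurable
  show "(\<integral>\<^sup>+om. ennreal (inner (Z (dy T j i1) om - Z (dy T j i0) om) (e k) ^ (2 * m)) \<partial>M)
   <= ennreal (gauss_moment m * (noise_weight k * (dy T j i1 - dy T j i0) powr p) ^ m)" for k
   unfolding noise_weight_def by (rule Z_coord_moment[OF i])
 qed (use gauss_moment_pos[of m] in auto)
 obtain a i where a: "i <= 2 ^ a" "q = dy T a i" by (rule dyadics_cases[OF T q(1)])
 obtain b i' where b: "i' <= 2 ^ b" "q' = dy T b i'" by (rule dyadics_cases[OF T q(2)])
 have qq: "q = dy T (a + b) (2 ^ b * i)" "q' = dy T (a + b) (2 ^ a * i')"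
  using dy_refine[OF T, of a b i] dy_refine[OF T, of b a i'] a(2) b(2) by (auto simp: add.commute)
 have le: "2 ^ b * i <= 2 ^ (a + b)" "2 ^ a * i' <= 2 ^ (a + b)" using a b by (auto simp: power_add)
 show ?thesis
 proof (cases "2 ^ b * i <= 2 ^ a * i'")
  case True
  then have "q <= q'" unfolding qq by (rule dy_mono[OF T])
  then show ?thesis using main[OF True le(2)] unfolding qq[symmetric] by simp
 next
  case False
  then have F: "2 ^ a * i' <= 2 ^ b * i" by simp
  then have "q' <= q" unfolding qq by (rule dy_mono[OF T])
  then show ?thesis using main[OF F le(1)] unfolding qq[symmetric] by (simp add: norm_minus_commute)
 qed
qed

lemma X_split: "X t om = (S t x + convol (drift om) t) + Z t om" by (simp add: Z_def)

lemma X_tail: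
 assumes q: "q \<in> dyadics T" and b: "!!k. k \<ge> K ==> 1 / (2 * al k) <= b"
 shows "(\<integral>\<^sup>+om. ennreal ((norm (X q om - proj e K (X q om)))^2) \<partial>M) <= ennreal (tail_bound x C K b)"
proof -
 have qT: "q \<in> {0..T}" using q dyadics_range[OF T] by blast
 have lin: "linear (%y. y - proj e K y)" by (intro linear_compose_sub linear_ident proj_linear[OF onb, unfolded id_def])
 let ?N = "%y. y - proj e K y"
 have Nm: "?N \<in> borel_measurable borel" unfolding proj_def by measurable
 have [measurable]: "Z q \<in> borel_measurable M" "X q \<in> borel_measurable M" using qT by (auto intro: Z_measurable X_measurable)
 have [measurable]: "(%om. ?N (Z q om)) \<in> borel_measurable M" by (rule measurable_compose[OF _ Nm]) simp
 have [measurable]: "(%om. convol (drift om) q) \<in> borel_measurable M" using qT by (intro convol_measurable) auto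
 have b0: "0 <= b" using b[OF order_refl] al_pos[of K] by (smt (verit) divide_nonneg_pos)
 have zt: "(\<integral>\<^sup>+om. ennreal ((norm (?N (Z q om)))^2) \<partial>M) <= ennreal (noise_tail K * T powr p)"
 proof (rule series_second_moment[OF onb, where v = "%k. if k < K then 0 else noise_weight k * T powr p"])
  show "(%k. if k < K then 0 else noise_weight k * T powr p) sums (noise_tail K * T powr p)"
  proof -
   have "(%k. noise_weight (k + K)) sums noise_tail K"
   unfolding noise_tail_def using noise_weight(2) by (intro summable_sums) (simp add: summable_iff_shift)
   then have "(%k. noise_weight (k + K) * T powr p) sums (noise_tail K * T powr p)" by (rule sums_mult2)
   then have "(%k. if k + K < K then 0 else noise_weight (k + K) * T powr p) sums (noise_tail K * T powr p)" by simp
   then show ?thesis by (subst (asm) sums_iff_shift[of "%k. if k < K then 0 else noise_weight k * T powr p"]) simp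
  qed
  show "(\<integral>\<^sup>+om. ennreal ((inner (?N (Z q om)) (e k))^2) \<partial>M) <= ennreal (if k < K then 0 else noise_weight k * T powr p)" for k
  proof (cases "k < K")
   case True
   then show ?thesis by (simp add: proj_complement_inner[OF onb])
  next
   case False
   obtain a i where a: "i <= 2 ^ a" "q = dy T a i" by (rule dyadics_cases[OF T q])
   have "AE om in M. ennreal ((inner (?N (Z q om)) (e k))^2) = ennreal (inner (Z q om - Z 0 om) (e k) ^ (2 * 1))"
   using Z_zero by eventually_elim (use False in \<open>simp add: proj_complement_inner[OF onb]\<close>)
   then have "(\<integral>\<^sup>+om. ennreal ((inner (?N (Z q om)) (e k))^2) \<partial>M) = (\<integral>\<^sup>+om. ennreal (inner (Z q om - Z 0 om) (e k) ^ (2 * 1)) \<partial>M)"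
   by (rule nn_integral_cong_AE)
   also have "... <= ennreal (noise_weight k * q powr p)"
   using Z_coord_moment[of 0 i a k 1] a by (simp add: dy_0[OF T] noise_weight_def gauss_moment_def)
   also have "... <= ennreal (noise_weight k * T powr p)"
   using qT p noise_weight(1)[of k] by (intro ennreal_leI mult_left_mono powr_mono2) (auto intro: less_imp_le)
   finally show ?thesis using False by simp
  qed
 qed (use noise_weight in \<open>auto simp: less_imp_le\<close>)
 have det: "(norm (?N (S q x + convol (drift om) q)))^2 <= 2 * (norm (x - proj e K x))^2 + 2 * (b * energy (drift om))"
  if w: "om \<in> space M" for om
 proof -
  have "?N (S q x + convol (drift om) q) = ?N (S q x) + ?N (convol (drift om) q)" by (rule linear_add[OF lin])
  then have "(norm (?N (S q x + convol (drift om) q)))^2 <= 2 * (norm (?N (S q x)))^2 + 2 * (norm (?N (convol (drift om) q)))^2"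
   using norm_add_square_le by metis
  moreover have "norm (?N (S q x)) <= norm (x - proj e K x)"
  proof -
   have "?N (S q x) = S q (x - proj e K x)"
   using qT by (intro onb_eqI[OF onb]) (simp add: proj_complement_inner[OF onb] S_coord)
   then show ?thesis using S_contraction[of q "x - proj e K x"] qT by simp
  qed
  then have "(norm (?N (S q x)))^2 <= (norm (x - proj e K x))^2" by (rule power_mono) simp
  moreover have "(norm (?N (convol (drift om) q)))^2 <= b * energy (drift om)"
   using qT by (intro convol_tail[OF convol_facts[OF w] _ _ b]) auto
  ultimately show ?thesis by linarith
 qed
 have dt: "(\<integral>\<^sup>+om. ennreal ((norm (?N (S q x + convol (drift om) q)))^2) \<partial>M) <= ennreal (2 * (norm (x - proj e K x))^2 + 2 * (b * C))"
 proof -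
  have "(\<integral>\<^sup>+om. ennreal ((norm (?N (S q x + convol (drift om) q)))^2) \<partial>M)
   <= (\<integral>\<^sup>+om. ennreal (2 * (norm (x - proj e K x))^2) + ennreal (2 * b) * ennreal (energy (drift om)) \<partial>M)"
  proof (rule nn_integral_mono)
   fix om assume w: "om \<in> space M"
   have e0: "0 <= energy (drift om)" by (rule energy_nonneg[OF convol_facts[OF w]])
   from ennreal_leI[OF det[OF w]]
   show "ennreal ((norm (?N (S q x + convol (drift om) q)))^2) <= ennreal (2 * (norm (x - proj e K x))^2) + ennreal (2 * b) * ennreal (energy (drift om))"
   using e0 b0 by (simp add: ennreal_plus[symmetric] ennreal_mult[symmetric] mult.assoc del: ennreal_plus)
  qed
  also have "... = ennreal (2 * (norm (x - proj e K x))^2) + ennreal (2 * b) * (\<integral>\<^sup>+om. ennreal (energy (drift om)) \<partial>M)"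
   by (subst nn_integral_add) (auto simp: nn_integral_cmult emeasure_space_1)
  also have "... <= ennreal (2 * (norm (x - proj e K x))^2) + ennreal (2 * b) * ennreal C"
   by (intro add_left_mono mult_left_mono energy_expectation) simp
  also have "... = ennreal (2 * (norm (x - proj e K x))^2 + 2 * (b * C))"
   using b0 C by (simp add: ennreal_plus[symmetric] ennreal_mult[symmetric] mult.assoc del: ennreal_plus)
  finally show ?thesis .
 qed
 have [measurable]: "(%om. ?N (S q x + convol (drift om) q)) \<in> borel_measurable M" by (rule measurable_compose[OF _ Nm]) measurable
 have "(\<integral>\<^sup>+om. ennreal ((norm (?N (X q om)))^2) \<partial>M) = (\<integral>\<^sup>+om. ennreal ((norm (?N (S q x + convol (drift om) q) + ?N (Z q om)))^2) \<partial>M)"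
 proof -
  have "?N (X q om) = ?N (S q x + convol (drift om) q) + ?N (Z q om)" for om
   by (subst (1 2) X_split) (rule linear_add[OF lin])
  then show ?thesis by (simp only:)
 qed
 also have "... <= 2 * (\<integral>\<^sup>+om. ennreal ((norm (?N (S q x + convol (drift om) q)))^2) \<partial>M) + 2 * (\<integral>\<^sup>+om. ennreal ((norm (?N (Z q om)))^2) \<partial>M)"
  by (rule nn_square_add) measurable
 also have "... <= 2 * ennreal (2 * (norm (x - proj e K x))^2 + 2 * (b * C)) + 2 * ennreal (noise_tail K * T powr p)"
  by (intro add_mono mult_left_mono dt zt) auto
 also have "... = ennreal (tail_bound x C K b)"
 proof -
  have "0 <= noise_tail K" unfolding noise_tail_def using noise_weight by (intro suminf_nonneg) (auto simp: summable_iff_shift less_imp_le)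
  then have "2 * ennreal (2 * (norm (x - proj e K x))^2 + 2 * (b * C)) + 2 * ennreal (noise_tail K * T powr p)
   = ennreal (2 * (2 * (norm (x - proj e K x))^2 + 2 * (b * C)) + 2 * (noise_tail K * T powr p))"
   using b0 C by (intro ennreal_twice_sum) auto
  then show ?thesis unfolding tail_bound_def by (simp add: algebra_simps)
 qed
 finally show ?thesis .
qed

text \<open>Increments of \<open>W t (e k)\<close> for different \<open>k\<close> are combined by linearity of
\<open>W t\<close> into one increment of \<open>W t h\<close> for a vector \<open>h\<close> of the span of the
basis.\<close>

lemma increment_independence:
 fixes ps :: "real => real" and Y :: "'w => real"
 assumes st: "0 <= s" "s < t" "t <= T"
  and Y: "Y \<in> borel_measurable (\<F> s)" "!!om. \<bar>Y om\<bar> <= 1"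
  and ps: "ps \<in> borel_measurable borel" "!!y. \<bar>ps y\<bar> <= 1"
 shows "(\<integral>om. ps (\<Sum>k<K. a k * (W t (e k) om - W s (e k) om)) * Y om \<partial>M)
  = (\<integral>y. ps (sqrt ((\<Sum>k<K. (a k)^2) * (t - s)) * y) \<partial>stdn) * (\<integral>om. Y om \<partial>M)"
proof -
 note [measurable] = ps(1)
 have [measurable]: "Y \<in> borel_measurable M" using st by (intro B0.filt_measurable[OF _ Y(1)]) auto
 have Wm[measurable]: "W t h \<in> borel_measurable M" "W s h \<in> borel_measurable M" for h using st by (auto intro: W_measurable)
 define h where "h = (\<Sum>k<K. a k *\<^sub>R e k)"
 have nh: "(norm h)^2 = (\<Sum>k<K. (a k)^2)" unfolding h_def by (rule onb_norm_sum[OF onb]) simp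
 show ?thesis
 proof (cases "h = 0")
  case True
  then have s0: "(\<Sum>k<K. (a k)^2) = 0" using nh by simp
  then have a0: "\<forall>k<K. a k = 0" by (subst (asm) sum_nonneg_eq_0_iff) auto
  interpret N: prob_space stdn by (rule prob_space_stdn)
  have "(\<integral>y. ps 0 \<partial>stdn) = ps 0" using N.prob_space by simp
  then show ?thesis using a0 s0 by simp
 next
  case False
  have lin: "AE om in M. W u (\<Sum>k<K. c k *\<^sub>R e k) om = (\<Sum>k<K. c k * W u (e k) om)" if u: "u \<in> {0..T}" for u c K
  proof (induction K)
   case 0
   have "AE om in M. W u (0 *\<^sub>R e 0 + 0 *\<^sub>R e 0) om = 0 * W u (e 0) om + 0 * W u (e 0) om"
   using cylW u unfolding cylindrical_wiener_process_def by blast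
   then show ?case by simp
  next
   case (Suc K)
   have "AE om in M. W u (1 *\<^sub>R (\<Sum>k<K. c k *\<^sub>R e k) + c K *\<^sub>R e K) om = 1 * W u (\<Sum>k<K. c k *\<^sub>R e k) om + c K * W u (e K) om"
   using cylW u unfolding cylindrical_wiener_process_def by blast
   with Suc.IH show ?case by eventually_elim simp
  qed
  define c where "c k = a k / norm h" for k
  define v where "v = (\<Sum>k<K. c k *\<^sub>R e k)"
  have "v = h /\<^sub>R norm h" unfolding v_def h_def c_def scaleR_sum_right by (simp add: divide_inverse mult.commute)
  then have nv: "norm v = 1" using False by simp
  interpret Bv: brownian M T \<F> "%t. W t v" by (rule brown[OF nv])
  have eq: "AE om in M. (\<Sum>k<K. a k * (W t (e k) om - W s (e k) om)) = norm h * (W t v om - W s v om)"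
  proof -
   have "AE om in M. W t v om = (\<Sum>k<K. c k * W t (e k) om)" "AE om in M. W s v om = (\<Sum>k<K. c k * W s (e k) om)"
   unfolding v_def using st by (auto intro!: lin)
   then show ?thesis
   proof eventually_elim
   case (elim om)
   show ?case unfolding elim sum_distrib_left sum_subtractf[symmetric]
   using False by (intro sum.cong) (auto simp: c_def right_diff_distrib)
   qed
  qed
  have ind0: "indep_var borel Y borel (%om. W t v om - W s v om)"
   by (rule Bv.bm_incr_indep[OF st Y(1)])
  have "indep_var borel ((%y. y) \<circ> Y) borel ((%y. ps (norm h * y)) \<circ> (%om. W t v om - W s v om))"
   by (rule indep_var_compose[OF ind0]) auto
  then have ind: "indep_var borel Y borel (%om. ps (norm h * (W t v om - W s v om)))" by (simp add: comp_def)
  have iY: "integrable M Y" using Y(2) by (intro integrable_const_bound[of _ 1]) auto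
  have iP: "integrable M (%om. ps (norm h * (W t v om - W s v om)))" using ps(2) by (intro integrable_const_bound[of _ 1]) auto
  have g: "gaussian M (%om. norm h * (W t v om - W s v om)) ((norm h)^2 * (t - s))"
   using st by (intro gaussian_scale Bv.bm_incr_gaussian) auto
  have "(\<integral>om. ps (\<Sum>k<K. a k * (W t (e k) om - W s (e k) om)) * Y om \<partial>M) = (\<integral>om. Y om * ps (norm h * (W t v om - W s v om)) \<partial>M)"
  proof (rule integral_cong_AE)
   show "AE om in M. ps (\<Sum>k<K. a k * (W t (e k) om - W s (e k) om)) * Y om = Y om * ps (norm h * (W t v om - W s v om))"
   using eq by eventually_elim simp
  qed measurable
  also have "... = (\<integral>om. Y om \<partial>M) * (\<integral>om. ps (norm h * (W t v om - W s v om)) \<partial>M)"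
   by (rule indep_var_lebesgue_integral[OF ind iY iP])
  also have "(\<integral>om. ps (norm h * (W t v om - W s v om)) \<partial>M) = (\<integral>y. ps y \<partial>distr M borel (%om. norm h * (W t v om - W s v om)))"
   by (subst integral_distr) auto
  also have "... = (\<integral>y. ps y \<partial>distr stdn borel (%x. sqrt ((norm h)^2 * (t - s)) * x))"
   using g unfolding gaussian_def by simp
  also have "... = (\<integral>y. ps (sqrt ((norm h)^2 * (t - s)) * y) \<partial>stdn)"
   by (subst integral_distr) auto
  finally show ?thesis unfolding nh by (simp add: mult.commute)
 qed
qed

end

context diagonal_data
begin

text \<open>The drift part is controlled by its energy and Markov's inequality, the noise part by high
moments, so that the exponent \<open>m * p\<close> is large enough for Kolmogorov's criterion.\<close>

lemma approx_modulus:
 fixes x :: 'h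
 assumes C: "0 <= C" and eps: "0 < ep" "0 < et"
 shows "\<exists>dl>0. \<forall>(M :: 'w measure) \<F> W X G. approx_solution T S Q e al lam p M \<F> W X G x C \<longrightarrow>
  emeasure M (modulus_event T M X dl ep) <= ennreal et"
proof -
 define m where "m = nat \<lceil>2 / p\<rceil>"
 have m: "0 < m" "2 <= p * real m"
 proof -
  have "2 / p <= real m" unfolding m_def using p by linarith
  then show "2 <= p * real m" using p by (simp add: divide_le_eq mult.commute)
  show "0 < m" unfolding m_def using p by simp
 qed
 define A where "A = gauss_moment m * suminf noise_weight ^ m * T powr (p * real m - 2)"
 have w0: "0 <= suminf noise_weight" using noise_weight by (intro suminf_nonneg) (auto simp: less_imp_le)
 have A: "0 <= A" unfolding A_def using gauss_moment_pos[of m] w0 by simp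
 obtain dl1 where dl1: "0 < dl1" and kol: "!!(M :: 'w measure) (Z :: real => 'w => 'h).
  [|\<forall>q\<in>dyadics T. Z q \<in> borel_measurable M;
  \<forall>q\<in>dyadics T. \<forall>q'\<in>dyadics T. (\<integral>\<^sup>+om. ennreal (norm (Z q' om - Z q om) ^ (2 * m)) \<partial>M) <= ennreal (A * (q' - q)^2)|] ==>
  emeasure M {om\<in>space M. \<exists>q\<in>dyadics T. \<exists>q'\<in>dyadics T. \<bar>q - q'\<bar> < dl1 & ep / 3 < norm (Z q' om - Z q om)} <= ennreal (et / 2)"
  using kolmogorov_modulus[OF T m(1) A, of "ep / 3" "et / 2", where 'w = 'w and 'h = 'h] eps by auto
 have "uniformly_continuous_on {0..T} (%t. S t x)"
  by (rule compact_uniformly_continuous) (auto intro: continuous_on_subset[OF S_continuous])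
 then obtain dl2 where dl2: "0 < dl2" "!!q q'. q \<in> {0..T} ==> q' \<in> {0..T} ==> dist q' q < dl2 ==> dist (S q' x) (S q x) < ep / 3"
  using eps unfolding uniformly_continuous_on_def by (metis divide_pos_pos zero_less_numeral)
 define b where "b = 2 * (C + 1) / et"
 have b: "0 < b" unfolding b_def using C eps by simp
 define dl3 where "dl3 = (ep / 3)^2 / (3 * b)"
 have dl3: "0 < dl3" unfolding dl3_def using b eps by simp
 define dl where "dl = min dl1 (min dl2 dl3)"
 have dl: "0 < dl" "dl <= dl1" "dl <= dl2" "dl <= dl3" unfolding dl_def using dl1 dl2 dl3 by auto
 show ?thesis
 proof (intro exI[of _ dl] conjI dl(1) allI impI)
  fix M :: "'w measure" and \<F> W X G
  assume "approx_solution T S Q e al lam p M \<F> W X G x C"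
  then interpret a: approx_solution T S Q e al lam p M \<F> W X G x C .
  have dT: "q \<in> {0..T}" if "q \<in> dyadics T" for q using that dyadics_range[OF T] by blast
  let ?E1 = "{om\<in>space M. \<exists>q\<in>dyadics T. \<exists>q'\<in>dyadics T. \<bar>q - q'\<bar> < dl1 & ep / 3 < norm (a.Z q' om - a.Z q om)}"
  let ?E2 = "{om\<in>space M. b < energy (a.drift om)}"
  have E1: "emeasure M ?E1 <= ennreal (et / 2)"
  proof (rule kol)
   show "\<forall>q\<in>dyadics T. a.Z q \<in> borel_measurable M" using dT a.Z_measurable by blast
   show "\<forall>q\<in>dyadics T. \<forall>q'\<in>dyadics T. (\<integral>\<^sup>+om. ennreal (norm (a.Z q' om - a.Z q om) ^ (2 * m)) \<partial>M) <= ennreal (A * (q' - q)^2)"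
   proof (intro ballI)
   fix q q' assume q: "q \<in> dyadics T" "q' \<in> dyadics T"
   define d where "d = \<bar>q' - q\<bar>"
   have d: "0 <= d" "d <= T" using dT[OF q(1)] dT[OF q(2)] by (auto simp: d_def)
   have "(d powr p) ^ m <= T powr (p * real m - 2) * d\<^sup>2"
   proof (cases "d = 0")
   case True
   then show ?thesis using m by (simp add: zero_power)
   next
   case False
   then have d0: "0 < d" using d by simp
   have "(d powr p) ^ m = d powr (p * real m)" using d0 by (simp add: powr_powr[symmetric] powr_realpow)
   also have "... = d powr (p * real m - 2) * d powr 2" by (simp add: powr_add[symmetric])
   also have "d powr 2 = d\<^sup>2" using d0 powr_realpow[of d 2] by simp
   also have "d powr (p * real m - 2) * d\<^sup>2 <= T powr (p * real m - 2) * d\<^sup>2"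
   using d d0 m(2) by (intro mult_right_mono powr_mono2) auto
   finally show ?thesis .
   qed
   then have "gauss_moment m * (suminf noise_weight ^ m * (d powr p) ^ m) <= gauss_moment m * (suminf noise_weight ^ m * (T powr (p * real m - 2) * d\<^sup>2))"
   using w0 gauss_moment_pos[of m] by (intro mult_left_mono) auto
   then have "gauss_moment m * (suminf noise_weight * d powr p) ^ m <= A * (q' - q)^2"
   unfolding A_def d_def by (simp add: power_mult_distrib mult.assoc)
   then show "(\<integral>\<^sup>+om. ennreal (norm (a.Z q' om - a.Z q om) ^ (2 * m)) \<partial>M) <= ennreal (A * (q' - q)^2)"
   using a.Z_moment[OF q m(1)] unfolding d_def by (meson ennreal_leI order_trans)
   qed
  qed
  have E2: "emeasure M ?E2 <= ennreal (et / 2)"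
  proof -
   have "emeasure M ?E2 = emeasure M {om\<in>space M. b < \<bar>energy (a.drift om)\<bar>}"
   by (rule arg_cong[where f = "emeasure M"]) (auto simp: energy_nonneg[OF a.convol_facts])
   also have "... <= ennreal (C / b)"
   proof (rule markov_nn[OF _ b])
   have "(\<integral>\<^sup>+om. ennreal \<bar>energy (a.drift om)\<bar> \<partial>M) = (\<integral>\<^sup>+om. ennreal (energy (a.drift om)) \<partial>M)"
   by (rule nn_integral_cong) (simp add: energy_nonneg[OF a.convol_facts])
   then show "(\<integral>\<^sup>+om. ennreal \<bar>energy (a.drift om)\<bar> \<partial>M) <= ennreal C" using a.energy_expectation by simp
   qed auto
   also have "... <= ennreal (et / 2)"
   unfolding b_def using C eps by (intro ennreal_leI) (simp add: field_simps)
   finally show ?thesis .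
  qed
  have sub: "modulus_event T M X dl ep \<subseteq> ?E1 \<union> ?E2"
  proof (rule subsetI, rule ccontr)
   fix om assume "om \<in> modulus_event T M X dl ep" and no: "om \<notin> ?E1 \<union> ?E2"
   then obtain q q' where w: "om \<in> space M" and q: "q \<in> dyadics T" "q' \<in> dyadics T" "\<bar>q - q'\<bar> < dl" "ep < norm (X q' om - X q om)"
   unfolding modulus_event_def by blast
   have z: "norm (a.Z q' om - a.Z q om) <= ep / 3" using no w q dl by force
   have en: "energy (a.drift om) <= b" using no w by auto
   have s: "norm (S q' x - S q x) <= ep / 3"
   using dl2(2)[OF dT[OF q(1)] dT[OF q(2)]] q(3) dl by (auto simp: dist_norm dist_real_def abs_minus_commute less_imp_le)
   have c: "norm (convol (a.drift om) q' - convol (a.drift om) q) <= ep / 3"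
   proof -
   have "(norm (convol (a.drift om) q' - convol (a.drift om) q))^2 <= 3 * \<bar>q - q'\<bar> * energy (a.drift om)"
   proof (cases "q <= q'")
   case True
   then show ?thesis using convol_holder[OF a.convol_facts[OF w], of q q'] dT[OF q(1)] dT[OF q(2)] by (simp add: abs_if)
   next
   case False
   then show ?thesis using convol_holder[OF a.convol_facts[OF w], of q' q] dT[OF q(1)] dT[OF q(2)] by (simp add: norm_minus_commute abs_if)
   qed
   also have "... <= 3 * dl3 * b"
   using q(3) dl en energy_nonneg[OF a.convol_facts[OF w]] by (intro mult_mono) auto
   also have "... = (ep / 3)^2" unfolding dl3_def using b by simp
   finally show ?thesis by (rule power2_le_imp_le) (use eps in simp)
   qed
   have "X q' om - X q om = (S q' x - S q x) + (convol (a.drift om) q' - convol (a.drift om) q) + (a.Z q' om - a.Z q om)"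
   proof -
   have alg: "(a + b + c) - (a' + b' + c') = (a - a') + (b - b') + (c - c')" for a b c a' b' c' :: 'h
   by simp
   show ?thesis by (subst (1 2) a.X_split) (rule alg)
   qed
   also have "norm ... <= ep / 3 + ep / 3 + ep / 3" by (intro norm_triangle_mono s c z)
   finally show False using q(4) by simp
  qed
  have E1m: "?E1 \<in> sets M" using modulus_event_sets[of T a.Z M dl1 "ep / 3"] dT a.Z_measurable unfolding modulus_event_def by blast
  have E2m: "?E2 \<in> sets M"
   using borel_measurable_less[OF borel_measurable_const a.energy_measurable, of b] by simp
  have "emeasure M (modulus_event T M X dl ep) <= emeasure M (?E1 \<union> ?E2)"
   by (rule emeasure_mono[OF sub sets.Un[OF E1m E2m]])
  also have "... <= emeasure M ?E1 + emeasure M ?E2" by (rule emeasure_subadditive[OF E1m E2m])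
  also have "... <= ennreal (et / 2) + ennreal (et / 2)" by (intro add_mono E1 E2)
  also have "... = ennreal et" using eps by (subst ennreal_plus[symmetric]) auto
  finally show "emeasure M (modulus_event T M X dl ep) <= ennreal et" .
 qed
qed

end

section \<open>Coordinates on the dyadic grid\<close>

section \<open>Continuous extension from the dyadic grid\<close>

text \<open>Uniform continuity, quantified over countable sets so that the event is measurable.\<close>

definition grid_modulus :: "real => (nat => nat => 'h::real_normed_vector) => bool" where
 "grid_modulus T z \<longleftrightarrow> (\<forall>m. \<exists>l. \<forall>j i j' i'. \<bar>dy T j i - dy T j' i'\<bar> < 1 / real (Suc l) \<longrightarrow>
   norm (z j' i' - z j i) <= 1 / real (Suc m))"

lemma dyadic_extension:
 fixes z :: "nat => nat => 'h::banach"
 assumes T: "0 < T" and z: "grid_modulus T z"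
 obtains g where "continuous_on {0..T} g" "!!j i. g (dy T j i) = z j i"
  "!!t. t \<in> {0..T} ==> (%j. z j (lo T j t)) ----> g t"
proof -
 have mod: "\<exists>dl>0. \<forall>j i j' i'. \<bar>dy T j i - dy T j' i'\<bar> < dl --> norm (z j' i' - z j i) < ep" if eps: "0 < ep" for ep
 proof -
  obtain m where m: "1 / real (Suc m) < ep" by (rule nat_approx_posE[OF eps])
  obtain l where l: "!!j i j' i'. \<bar>dy T j i - dy T j' i'\<bar> < 1 / real (Suc l) ==> norm (z j' i' - z j i) <= 1 / real (Suc m)"
   using z unfolding grid_modulus_def by blast
  have "norm (z j' i' - z j i) < ep" if "\<bar>dy T j i - dy T j' i'\<bar> < 1 / real (Suc l)" for j i j' i'
   using l[OF that] m by linarith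
  then show ?thesis by (intro exI[of _ "1 / real (Suc l)"]) auto
 qed
 have cons: "z j i = z j' i'" if "dy T j i = dy T j' i'" for j i j' i'
 proof (rule ccontr)
  assume "z j i ~= z j' i'"
  then have "0 < norm (z j' i' - z j i)" by auto
  from mod[OF this] obtain dl where "0 < dl" "!!j1 i1 j1' i1'. \<bar>dy T j1 i1 - dy T j1' i1'\<bar> < dl ==> norm (z j1' i1' - z j1 i1) < norm (z j' i' - z j i)"
   by blast
  from this(2)[of j i j' i'] this(1) that show False by simp
 qed
 define u where "u q = (let (j, i) = (SOME (j, i). dy T j i = q) in z j i)" for q
 have u: "u (dy T j i) = z j i" for j i
 proof -
  obtain j' i' where ji: "(SOME (j', i'). dy T j' i' = dy T j i) = (j', i')" by force
  have "case (SOME (j', i'). dy T j' i' = dy T j i) of (j', i') => dy T j' i' = dy T j i"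
   by (rule someI[where P = "%(j', i'). dy T j' i' = dy T j i" and x = "(j, i)"]) simp
  then have "dy T j' i' = dy T j i" unfolding ji by simp
  then have "z j' i' = z j i" by (rule cons)
  then show ?thesis unfolding u_def ji by simp
 qed
 have "uniformly_continuous_on (dyadics T) u"
  unfolding uniformly_continuous_on_def
 proof (intro allI impI)
  fix ep :: real assume "0 < ep"
  from mod[OF this] obtain dl where dl: "0 < dl" "!!j i j' i'. \<bar>dy T j i - dy T j' i'\<bar> < dl ==> norm (z j' i' - z j i) < ep"
   by blast
  show "\<exists>d>0. \<forall>x\<in>dyadics T. \<forall>x'\<in>dyadics T. dist x' x < d --> dist (u x') (u x) < ep"
  proof (intro exI conjI ballI impI)
   fix q q' assume "q \<in> dyadics T" "q' \<in> dyadics T" and d: "dist q' q < dl"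
   then obtain j i j' i' where q: "q = dy T j i" "q' = dy T j' i'" unfolding dyadics_def by blast
   have "norm (z j' i' - z j i) < ep" using d unfolding q by (intro dl(2)) (simp add: dist_real_def abs_minus_commute)
   then show "dist (u q') (u q) < ep" unfolding q by (simp add: u dist_norm)
  qed (rule dl(1))
 qed
 then obtain g where g: "uniformly_continuous_on (closure (dyadics T)) g" "!!q. q \<in> dyadics T ==> u q = g q"
  by (rule uniformly_continuous_on_extension_on_closure) blast
 have sub: "{0..T} \<subseteq> closure (dyadics T)"
 proof
  fix t assume t: "t \<in> {0..T}"
  show "t \<in> closure (dyadics T)"
   unfolding closure_sequential using dy_lo_tendsto[OF T, of t] t dy_in_dyadics by (intro exI[of _ "%j. dy T j (lo T j t)"]) auto
 qed
 have c: "continuous_on {0..T} g"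
  using uniformly_continuous_imp_continuous[OF g(1)] sub by (rule continuous_on_subset)
 have gz: "g (dy T j i) = z j i" for j i using g(2)[of "dy T j i"] u[of j i] by simp
 show thesis
 proof (rule that[OF c gz])
  fix t assume t: "t \<in> {0..T}"
  have "(%j. g (dy T j (lo T j t))) ----> g t"
   using c dy_lo_tendsto[OF T, of t] t dy_range[OF T]
   by (intro continuous_on_tendsto_compose[of "{0..T}" g]) (auto intro!: always_eventually)
  then show "(%j. z j (lo T j t)) ----> g t" unfolding gz .
 qed
qed

lemma modulus_AE:
 fixes z :: "nat => nat => 'w => 'h::{real_normed_vector, second_countable_topology}"
 assumes zm[measurable]: "!!j i. z j i \<in> borel_measurable M"
  and mod: "!!ep et. 0 < ep ==> 0 < et ==> \<exists>dl>0.
   emeasure M {om\<in>space M. \<exists>j i j' i'. \<bar>dy T j i - dy T j' i'\<bar> < dl & ep < norm (z j' i' om - z j i om)} <= ennreal et"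
 shows "AE om in M. grid_modulus T (%j i. z j i om)"
proof -
 have "AE om in M. \<exists>l. \<forall>j i j' i'. \<bar>dy T j i - dy T j' i'\<bar> < 1 / real (Suc l) --> norm (z j' i' om - z j i om) <= 1 / real (Suc m)" for m
 proof -
  let ?B = "{om\<in>space M. \<forall>l. \<exists>j i j' i'. \<bar>dy T j i - dy T j' i'\<bar> < 1 / real (Suc l) & 1 / real (Suc m) < norm (z j' i' om - z j i om)}"
  have Bm: "?B \<in> sets M" by measurable
  have "emeasure M ?B <= ennreal et" if eta: "0 < et" for et
  proof -
   obtain dl where dl: "0 < dl" "emeasure M {om\<in>space M. \<exists>j i j' i'. \<bar>dy T j i - dy T j' i'\<bar> < dl & 1 / real (Suc m) < norm (z j' i' om - z j i om)} <= ennreal et"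
   using mod[of "1 / real (Suc m)" et, OF _ eta] by auto
   obtain l where l: "1 / real (Suc l) < dl" by (rule nat_approx_posE[OF dl(1)])
   have "?B \<subseteq> {om\<in>space M. \<exists>j i j' i'. \<bar>dy T j i - dy T j' i'\<bar> < dl & 1 / real (Suc m) < norm (z j' i' om - z j i om)}"
   proof
   fix om assume "om \<in> ?B"
   then obtain j i j' i' where "om \<in> space M" "\<bar>dy T j i - dy T j' i'\<bar> < 1 / real (Suc l)" "1 / real (Suc m) < norm (z j' i' om - z j i om)"
   by blast
   moreover from this(2) l have "\<bar>dy T j i - dy T j' i'\<bar> < dl" by linarith
   ultimately show "om \<in> {om\<in>space M. \<exists>j i j' i'. \<bar>dy T j i - dy T j' i'\<bar> < dl & 1 / real (Suc m) < norm (z j' i' om - z j i om)}"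
   by blast
   qed
   then have "emeasure M ?B <= emeasure M {om\<in>space M. \<exists>j i j' i'. \<bar>dy T j i - dy T j' i'\<bar> < dl & 1 / real (Suc m) < norm (z j' i' om - z j i om)}"
   by (rule emeasure_mono) measurable
   then show ?thesis using dl(2) by (rule order_trans)
  qed
  then have "emeasure M ?B <= 0" by - (rule ennreal_le_epsilon, simp)
  then have "emeasure M ?B = 0" by simp
  then show ?thesis by (rule AE_I[OF _ _ Bm, rotated]) (auto simp: not_le)
 qed
 then have "AE om in M. \<forall>m. \<exists>l. \<forall>j i j' i'. \<bar>dy T j i - dy T j' i'\<bar> < 1 / real (Suc l) --> norm (z j' i' om - z j i om) <= 1 / real (Suc m)"
  by (simp add: AE_all_countable)
 then show ?thesis unfolding grid_modulus_def .
qed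

section \<open>Convergence in probability\<close>

definition conv_prob :: "'w measure => (nat => 'w => 'h::real_normed_vector) => ('w => 'h) => bool" where
 "conv_prob M A B \<longleftrightarrow> (\<forall>ep>0. \<forall>et>0. \<forall>\<^sub>F n in sequentially. emeasure M {om\<in>space M. ep < norm (A n om - B om)} <= ennreal et)"

lemma (in prob_space) AE_conv_prob:
 fixes A :: "nat => 'a => 'h::{real_normed_vector, second_countable_topology}"
 assumes [measurable]: "!!n. A n \<in> borel_measurable M" "B \<in> borel_measurable M"
  and conv: "AE om in M. (%n. A n om) ----> B om"
 shows "conv_prob M A B"
 unfolding conv_prob_def
proof (intro allI impI)
 fix ep et :: real assume e: "0 < ep" "0 < et"
 have "(%n. \<integral>\<^sup>+om. indicator {om\<in>space M. ep < norm (A n om - B om)} om \<partial>M) ----> (\<integral>\<^sup>+om. 0 \<partial>M)"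
 proof (rule nn_integral_dominated_convergence[where w = "%_. 1"])
  show "AE om in M. (%n. indicator {om\<in>space M. ep < norm (A n om - B om)} om :: ennreal) ----> 0"
   using conv
  proof eventually_elim
   case (elim om)
   have "\<forall>\<^sub>F n in sequentially. dist (A n om) (B om) < ep" using elim e(1) by (rule tendstoD)
   then have "\<forall>\<^sub>F n in sequentially. (indicator {om\<in>space M. ep < norm (A n om - B om)} om :: ennreal) = 0"
   by eventually_elim (simp add: dist_norm)
   then show ?case by (rule tendsto_eventually)
  qed
 qed (auto simp: emeasure_space_1 indicator_def)
 then have "(%n. emeasure M {om\<in>space M. ep < norm (A n om - B om)}) ----> 0" by simp
 then have "\<forall>\<^sub>F n in sequentially. emeasure M {om\<in>space M. ep < norm (A n om - B om)} < ennreal et"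
  using e by (intro order_tendstoD) auto
 then show "\<forall>\<^sub>F n in sequentially. emeasure M {om\<in>space M. ep < norm (A n om - B om)} <= ennreal et"
  by eventually_elim simp
qed

lemma emeasure_norm_triangle:
 fixes A B D :: "'w => 'h::{real_normed_vector, second_countable_topology}"
 assumes [measurable]: "A \<in> borel_measurable M" "B \<in> borel_measurable M" "D \<in> borel_measurable M"
 shows "emeasure M {om\<in>space M. a + b < norm (A om - D om)}
  <= emeasure M {om\<in>space M. a < norm (A om - B om)} + emeasure M {om\<in>space M. b < norm (B om - D om)}"
proof -
 have "emeasure M {om\<in>space M. a + b < norm (A om - D om)}
  <= emeasure M ({om\<in>space M. a < norm (A om - B om)} \<union> {om\<in>space M. b < norm (B om - D om)})"
 proof (rule emeasure_mono)
  show "{om\<in>space M. a + b < norm (A om - D om)} \<subseteq> {om\<in>space M. a < norm (A om - B om)} \<union> {om\<in>space M. b < norm (B om - D om)}"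
  proof
   fix om assume "om \<in> {om\<in>space M. a + b < norm (A om - D om)}"
   moreover have "norm (A om - D om) <= norm (A om - B om) + norm (B om - D om)"
   using norm_triangle_ineq[of "A om - B om" "B om - D om"] by simp
   ultimately show "om \<in> {om\<in>space M. a < norm (A om - B om)} \<union> {om\<in>space M. b < norm (B om - D om)}"
   by (auto simp: not_less)
  qed
 qed measurable
 also have "... <= emeasure M {om\<in>space M. a < norm (A om - B om)} + emeasure M {om\<in>space M. b < norm (B om - D om)}"
  by (rule emeasure_subadditive) measurable
 finally show ?thesis .
qed

lemma (in prob_space) conv_prob_min1:
 fixes A :: "nat => 'a => 'h::{real_normed_vector, second_countable_topology}"
 assumes [measurable]: "!!n. A n \<in> borel_measurable M" "B \<in> borel_measurable M" and conv: "conv_prob M A B"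
 shows "(%n. \<integral>\<^sup>+om. ennreal (min 1 (norm (A n om - B om))) \<partial>M) ----> 0"
proof (rule order_tendstoI)
 fix a :: ennreal assume "0 < a"
 then obtain c where c: "0 < c" "ennreal c < a"
 proof -
  assume that: "!!c. 0 < c ==> ennreal c < a ==> thesis"
  obtain b where b: "0 < b" "b < a" using dense[OF \<open>0 < a\<close>] by blast
  then have "b ~= \<top>" by auto
  then obtain c where "b = ennreal c" "0 <= c" by (cases b) auto
  then show thesis using that[of c] b by auto
 qed
 have "\<forall>\<^sub>F n in sequentially. emeasure M {om\<in>space M. c / 2 < norm (A n om - B om)} <= ennreal (c / 2)"
  using conv c unfolding conv_prob_def by (meson half_gt_zero)
 then show "\<forall>\<^sub>F n in sequentially. (\<integral>\<^sup>+om. ennreal (min 1 (norm (A n om - B om))) \<partial>M) < a"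
 proof eventually_elim
  case (elim n)
  have "(\<integral>\<^sup>+om. ennreal (min 1 (norm (A n om - B om))) \<partial>M)
   <= (\<integral>\<^sup>+om. ennreal (c / 2) + indicator {om\<in>space M. c / 2 < norm (A n om - B om)} om \<partial>M)"
  proof (rule nn_integral_mono)
   fix om assume w: "om \<in> space M"
   show "ennreal (min 1 (norm (A n om - B om))) <= ennreal (c / 2) + indicator {om\<in>space M. c / 2 < norm (A n om - B om)} om"
   proof (cases "c / 2 < norm (A n om - B om)")
   case True
   have "ennreal (min 1 (norm (A n om - B om))) <= ennreal 1" by (rule ennreal_leI) simp
   also have "... <= ennreal (c / 2) + 1" by simp
   finally show ?thesis using True w by simp
   next
   case False
   then have "ennreal (min 1 (norm (A n om - B om))) <= ennreal (c / 2)" by (intro ennreal_leI) simp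
   then show ?thesis using False by simp
   qed
  qed
  also have "... = ennreal (c / 2) + emeasure M {om\<in>space M. c / 2 < norm (A n om - B om)}"
   by (subst nn_integral_add) (auto simp: emeasure_space_1)
  also have "... <= ennreal (c / 2) + ennreal (c / 2)" by (rule add_left_mono[OF elim])
  also have "... = ennreal c" using c by (subst ennreal_plus[symmetric]) auto
  also have "... < a" by (rule c)
  finally show ?case .
 qed
qed simp

lemma nn_L1_AE_subseq_ennreal:
 fixes f :: "nat => 'a => ennreal"
 assumes [measurable]: "!!j. f j \<in> borel_measurable M"
  and lim: "(%j. \<integral>\<^sup>+x. f j x \<partial>M) ----> 0"
 shows "\<exists>r. strict_mono r & (AE x in M. (%j. f (r j) x) ----> 0)"
proof -
 define g where "g j x = enn2real (min 1 (f j x))" for j x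
 have ge: "ennreal (g j x) = min 1 (f j x)" for j x
  unfolding g_def by (rule ennreal_enn2real) (auto simp: min_less_iff_disj)
 have [measurable]: "g j \<in> borel_measurable M" for j unfolding g_def[abs_def] by measurable
 have "(%j. \<integral>\<^sup>+x. ennreal (g j x) \<partial>M) ----> 0"
 proof (rule tendsto_sandwich[OF _ _ tendsto_const lim])
  show "\<forall>\<^sub>F j in sequentially. (\<integral>\<^sup>+x. ennreal (g j x) \<partial>M) <= (\<integral>\<^sup>+x. f j x \<partial>M)"
   by (intro always_eventually allI nn_integral_mono) (simp add: ge)
 qed simp
 then obtain r where r: "strict_mono r" "AE x in M. (%j. g (r j) x) ----> 0"
  using nn_L1_AE_subseq[of g M] by (auto simp: g_def)
 have "AE x in M. (%j. f (r j) x) ----> 0"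
  using r(2)
 proof eventually_elim
  case (elim x)
  have "(%j. ennreal (g (r j) x)) ----> ennreal 0" by (rule tendsto_ennrealI[OF elim])
  then have l: "(%j. min 1 (f (r j) x)) ----> 0" unfolding ge by simp
  then have "\<forall>\<^sub>F j in sequentially. min 1 (f (r j) x) < 1" by (rule order_tendstoD) simp
  then have "\<forall>\<^sub>F j in sequentially. min 1 (f (r j) x) = f (r j) x"
   by eventually_elim (auto simp: min_def split: if_splits)
  then show ?case using l tendsto_cong by force
 qed
 with r(1) show ?thesis by blast
qed

section \<open>Transfer to the limit space\<close>

type_synonym index = "bool \<times> nat \<times> nat \<times> nat"

abbreviation "coord_space \<equiv> PiM UNIV (%_ :: index. borel :: real measure)"

lemma coord_measurable[measurable]: "(%u. u i) \<in> borel_measurable coord_space"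
 by (rule measurable_component_singleton) simp

context diagonal_data
begin

text \<open>The boolean selects the solution or the noise; \<open>dy T j i\<close> is the time and
\<open>k\<close> the coordinate.\<close>

definition coords :: "(real => 'w => 'h) => (real => 'h => 'w => real) => 'w => index => real" where
 "coords X W om = (%(b, j, i, k). if b then inner (X (dy T j i) om) (e k) else W (dy T j i) (e k) om)"

definition grid_point :: "(index => real) => nat => nat => 'h" where
 "grid_point u j i = (\<Sum>k. u (True, j, i, k) *\<^sub>R e k)"

definition path_of :: "(index => real) => real => 'h" where
 "path_of u t = lim (%j. grid_point u j (lo T j t))"

definition coord_sum :: "(index => real) => nat => real => nat => real" where
 "coord_sum u k t j = (\<Sum>i<lo T j t. exp (- al k * (t - dy T j i)) * (u (False, j, Suc i, k) - u (False, j, i, k)))"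

lemma grid_point_coords: "grid_point (coords X W om) j i = X (dy T j i) om"
 using sums_unique[OF onb_sums[OF onb, of "X (dy T j i) om"]] by (simp add: grid_point_def coords_def)

lemma coord_sum_coords: "coord_sum (coords X W om) k t j = grid_sum T (al k) t j (%u. W u (e k) om)"
 by (simp add: coord_sum_def grid_sum_def coords_def)

lemma grid_point_measurable[measurable]: "(%u. grid_point u j i) \<in> borel_measurable coord_space"
 unfolding grid_point_def by measurable

lemma coord_sum_measurable[measurable]: "(%u. coord_sum u k t j) \<in> borel_measurable coord_space"
 unfolding coord_sum_def by measurable

lemma lo_measurable'[measurable]: "lo T j \<in> measurable borel (count_space UNIV)"
 unfolding lo_def[abs_def] by measurable

lemma grid_path_measurable:
 fixes z :: "nat => nat => 'w => 'b::{banach, second_countable_topology}"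
 assumes "!!j i. z j i \<in> borel_measurable N"
 shows "(%w. lim (%j. z j (lo T j (snd w)) (fst w))) \<in> borel_measurable (N \<Otimes>\<^sub>M borel)"
proof -
 have "(%w. z j (lo T j (snd w)) (fst w)) \<in> borel_measurable (N \<Otimes>\<^sub>M borel)" for j
 proof (rule measurable_compose_countable)
  show "(%w. z j i (fst w)) \<in> borel_measurable (N \<Otimes>\<^sub>M borel)" for i
   by (rule measurable_compose[OF measurable_fst assms])
  show "(%w. lo T j (snd w)) \<in> measurable (N \<Otimes>\<^sub>M borel) (count_space UNIV)" by measurable
 qed
 then show ?thesis by (rule borel_measurable_lim_metric)
qed

lemma path_of_measurable2[measurable]: "(%w. path_of (fst w) (snd w)) \<in> borel_measurable (coord_space \<Otimes>\<^sub>M borel)"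
 unfolding path_of_def by (rule grid_path_measurable) measurable

lemma path_of_measurable[measurable]: "(%u. path_of u t) \<in> borel_measurable coord_space"
 unfolding path_of_def by measurable

end

context approx_solution
begin

lemma coords_measurable: "coords X W \<in> measurable M coord_space"
proof (rule measurable_PiM_single')
 fix i :: index
 obtain b j l k where i: "i = (b, j, l, k)" by (cases i) auto
 have [measurable]: "X (dy T j l) \<in> borel_measurable M" "W (dy T j l) (e k) \<in> borel_measurable M"
  using X_measurable[OF dy_in] W_measurable[OF dy_in] by auto
 show "(%om. coords X W om i) \<in> borel_measurable M"
  unfolding i coords_def by (cases b) simp_all
qed auto

lemma path_coords: "path_of (coords X W om) t = Xj t om"
 unfolding path_of_def Xj_def grid_point_coords ..

lemma path_coords_eq: "om \<in> space M ==> t \<in> {0..T} ==> path_of (coords X W om) t = X t om"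
 by (simp add: path_coords Xj_eq)

lemma second_moment:
 assumes b: "!!k. 1 / (2 * al k) <= b"
 shows "(\<integral>\<^sup>+om. ennreal ((norm (X (dy T j i) om))^2) \<partial>M) <= ennreal (tail_bound x C 0 b)"
 using X_tail[of "dy T j i" 0 b] b by (simp add: proj_def)

lemma W_second_moment: "(\<integral>\<^sup>+om. ennreal ((W (dy T j i) (e k) om)^2) \<partial>M) <= ennreal T"
proof -
 interpret Bk: brownian M T \<F> "%t. W t (e k)" by (rule brown) (rule onb_norm[OF onb])
 have "gaussian M (%om. W (dy T j i) (e k) om - W 0 (e k) om) (dy T j i - 0)"
  using dy_in[of j i] by (intro Bk.bm_incr_gaussian) auto
 from gaussian_moment[OF this, of 1] dy_in[of j i]
 have "(\<integral>\<^sup>+om. ennreal ((W (dy T j i) (e k) om - W 0 (e k) om)^2) \<partial>M) = ennreal (dy T j i)"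
  by (simp add: gauss_moment_def)
 moreover have "AE om in M. ennreal ((W (dy T j i) (e k) om - W 0 (e k) om)^2) = ennreal ((W (dy T j i) (e k) om)^2)"
  using Bk.bm_zero by eventually_elim simp
 then have "(\<integral>\<^sup>+om. ennreal ((W (dy T j i) (e k) om - W 0 (e k) om)^2) \<partial>M) = (\<integral>\<^sup>+om. ennreal ((W (dy T j i) (e k) om)^2) \<partial>M)"
  by (rule nn_integral_cong_AE)
 ultimately show ?thesis using dy_in[of j i] by (simp add: ennreal_leI)
qed

lemma coords_second_moment:
 assumes b: "!!k. 1 / (2 * al k) <= b"
 shows "(\<integral>\<^sup>+om. ennreal ((coords X W om idx)^2) \<partial>M) <= ennreal (max T (tail_bound x C 0 b))"
proof -
 obtain c j i k where idx: "idx = (c, j, i, k)" by (cases idx) auto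
 show ?thesis
 proof (cases c)
  case True
  have "(\<integral>\<^sup>+om. ennreal ((coords X W om idx)^2) \<partial>M) <= (\<integral>\<^sup>+om. ennreal ((norm (X (dy T j i) om))^2) \<partial>M)"
  proof (rule nn_integral_mono, rule ennreal_leI)
   fix om
   have "\<bar>inner (X (dy T j i) om) (e k)\<bar> <= norm (X (dy T j i) om)"
   using Cauchy_Schwarz_ineq2[of "X (dy T j i) om" "e k"] by (simp add: onb_norm[OF onb])
   then show "(coords X W om idx)^2 <= (norm (X (dy T j i) om))^2"
   unfolding idx coords_def using True by (simp add: abs_le_square_iff[symmetric])
  qed
  also have "... <= ennreal (tail_bound x C 0 b)" by (rule second_moment[OF b])
  also have "... <= ennreal (max T (tail_bound x C 0 b))" by (rule ennreal_leI) simp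
  finally show ?thesis .
 next
  case False
  have "(\<integral>\<^sup>+om. ennreal ((coords X W om idx)^2) \<partial>M) <= ennreal T"
   using W_second_moment[of j i k] False unfolding idx coords_def by simp
  also have "... <= ennreal (max T (tail_bound x C 0 b))" by (rule ennreal_leI) simp
  finally show ?thesis .
 qed
qed

end

section \<open>The limit process\<close>

text \<open>Copies \<open>U n\<close> of the coordinates of the approximating solutions on one space,
converging almost surely.\<close>

locale coupled = diagonal_data T S Q e al lam p + L: prob_space Om
 for T and S :: "real => 'h::{real_inner, banach, second_countable_topology} \<Rightarrow>\<^sub>L 'h" and Q e al lam p
  and Om :: "'v measure" +
 fixes M :: "nat => 'w measure" and \<F> W X G x C
  and U :: "nat => 'v => index => real" and L :: "'v => index => real"
  and V :: "'h => ennreal" and F :: "real => 'h => 'h" and \<theta> :: "nat => real"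
 assumes sols: "!!n. approx_solution T S Q e al lam p (M n) (\<F> n) (W n) (X n) (G n) x C"
  and U_meas: "!!n. U n \<in> measurable Om coord_space" and L_meas: "L \<in> measurable Om coord_space"
  and law: "!!n. distr Om coord_space (U n) = distr (M n) coord_space (coords (X n) (W n))"
  and U_conv: "AE om in Om. \<forall>i. (%n. U n om i) ----> L om i"
  and V_meas: "V \<in> borel_measurable borel"
  and V_lsc: "!!u y. u ----> y ==> V y <= liminf (%n. V (u n))"
  and V_mean: "!!n. (\<integral>\<^sup>+t\<in>{0..T}. (\<integral>\<^sup>+om. V (X n t om) \<partial>M n) \<partial>lborel) <= ennreal C"
  and G_weak: "!!n t h. t \<in> {0..T} ==> continuous_on UNIV (%y. inner (G n t y) h)"
  and G_square: "!!n t y. t \<in> {0..T} ==> ennreal ((norm (G n t y))^2) <= V y"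
  and F_near: "!!n t y. t \<in> {0..T} ==> V y < \<top> ==> ennreal (norm (F t y - G n t y)) <= ennreal (\<theta> n) * V y"
  and \<theta>_pos: "!!n. 0 < \<theta> n" and \<theta>_lim: "\<theta> ----> 0"
begin

lemma C_nonneg: "0 <= C" using sols[of 0] unfolding approx_solution_def approx_solution_axioms_def by blast

lemma coords_meas: "coords (X n) (W n) \<in> measurable (M n) coord_space"
proof -
 interpret a: approx_solution T S Q e al lam p "M n" "\<F> n" "W n" "X n" "G n" x C by (rule sols)
 show ?thesis by (rule a.coords_measurable)
qed

lemma transfer_nn:
 assumes "\<Phi> \<in> borel_measurable coord_space"
 shows "(\<integral>\<^sup>+om. \<Phi> (U n om) \<partial>Om) = (\<integral>\<^sup>+om. \<Phi> (coords (X n) (W n) om) \<partial>M n)"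
proof -
 have "(\<integral>\<^sup>+om. \<Phi> (U n om) \<partial>Om) = (\<integral>\<^sup>+u. \<Phi> u \<partial>distr Om coord_space (U n))"
  by (rule nn_integral_distr[OF U_meas, symmetric]) (use assms in simp)
 also have "... = (\<integral>\<^sup>+om. \<Phi> (coords (X n) (W n) om) \<partial>M n)"
  unfolding law by (rule nn_integral_distr[OF coords_meas]) (use assms in simp)
 finally show ?thesis .
qed

lemma transfer_int:
 fixes \<Phi> :: "_ => real"
 assumes "\<Phi> \<in> borel_measurable coord_space"
 shows "(\<integral>om. \<Phi> (U n om) \<partial>Om) = (\<integral>om. \<Phi> (coords (X n) (W n) om) \<partial>M n)"
proof -
 have "(\<integral>om. \<Phi> (U n om) \<partial>Om) = (\<integral>u. \<Phi> u \<partial>distr Om coord_space (U n))"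
  by (rule integral_distr[OF U_meas, symmetric]) (use assms in simp)
 also have "... = (\<integral>om. \<Phi> (coords (X n) (W n) om) \<partial>M n)"
  unfolding law by (rule integral_distr[OF coords_meas]) (use assms in simp)
 finally show ?thesis .
qed

lemma transfer_event:
 assumes E: "{u \<in> space coord_space. P u} \<in> sets coord_space"
 shows "emeasure Om {om\<in>space Om. P (U n om)} = emeasure (M n) {om\<in>space (M n). P (coords (X n) (W n) om)}"
proof -
 have "emeasure Om {om\<in>space Om. P (U n om)} = emeasure (distr Om coord_space (U n)) {u \<in> space coord_space. P u}"
  by (subst emeasure_distr[OF U_meas E]) (rule arg_cong[where f = "emeasure Om"], use measurable_space[OF U_meas] in blast)
 also have "... = emeasure (M n) {om\<in>space (M n). P (coords (X n) (W n) om)}"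
  unfolding law
  by (subst emeasure_distr[OF coords_meas E]) (rule arg_cong[where f = "emeasure (M n)"], use measurable_space[OF coords_meas] in blast)
 finally show ?thesis .
qed

lemma transfer_AE:
 assumes E: "{u \<in> space coord_space. P u} \<in> sets coord_space" and "!!om. om \<in> space (M n) ==> P (coords (X n) (W n) om)"
 shows "AE om in Om. P (U n om)"
proof -
 have "AE u in distr (M n) coord_space (coords (X n) (W n)). P u"
  by (subst AE_distr_iff[OF coords_meas E]) (use assms(2) in auto)
 then show ?thesis unfolding law[symmetric] by (subst (asm) AE_distr_iff[OF U_meas E])
qed

lemma Ui_meas[measurable]: "(%om. U n om i) \<in> borel_measurable Om"
 by (rule measurable_compose[OF U_meas coord_measurable])

lemma Li_meas[measurable]: "(%om. L om i) \<in> borel_measurable Om"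
 by (rule measurable_compose[OF L_meas coord_measurable])

definition Y :: "nat => nat => nat => 'v => 'h" where "Y n j i om = grid_point (U n om) j i"
definition \<xi> :: "nat => nat => 'v => 'h" where "\<xi> j i om = grid_point (L om) j i"
definition Xp :: "nat => real => 'v => 'h" where "Xp n t om = path_of (U n om) t"

lemma Y_meas[measurable]: "Y n j i \<in> borel_measurable Om"
 unfolding Y_def[abs_def] by (rule measurable_compose[OF U_meas grid_point_measurable])

lemma \<xi>_meas[measurable]: "\<xi> j i \<in> borel_measurable Om"
 unfolding \<xi>_def[abs_def] by (rule measurable_compose[OF L_meas grid_point_measurable])

lemma Xp_meas[measurable]: "Xp n t \<in> borel_measurable Om"
 unfolding Xp_def[abs_def] by (rule measurable_compose[OF U_meas path_of_measurable])

lemma Xp_meas2[measurable]: "(%w. Xp n (snd w) (fst w)) \<in> borel_measurable (Om \<Otimes>\<^sub>M borel)"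
proof -
 have "(%w. (U n (fst w), snd w)) \<in> measurable (Om \<Otimes>\<^sub>M borel) (coord_space \<Otimes>\<^sub>M borel)"
  by (intro measurable_Pair measurable_compose[OF measurable_fst U_meas] measurable_snd)
 from measurable_compose[OF this path_of_measurable2] show ?thesis unfolding Xp_def by simp
qed

lemma Y_coord: "AE om in Om. \<forall>n j i k. inner (Y n j i om) (e k) = U n om (True, j, i, k)"
proof -
 have "AE om in Om. inner (Y n j i om) (e k) = U n om (True, j, i, k)" for n j i k
  unfolding Y_def
  by (rule transfer_AE[of "%u. inner (grid_point u j i) (e k) = u (True, j, i, k)"])
   (measurable, unfold grid_point_coords, simp add: coords_def)
 then show ?thesis by (simp add: AE_all_countable)
qed

text \<open>Estimates for the solutions hold for their copies because only laws of coordinates are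
involved.\<close>

lemma tail_transfer:
 assumes b: "!!k. k \<ge> K ==> 1 / (2 * al k) <= b"
 shows "(\<integral>\<^sup>+om. ennreal ((norm (Y n j i om - proj e K (Y n j i om)))^2) \<partial>Om) <= ennreal (tail_bound x C K b)"
proof -
 interpret a: approx_solution T S Q e al lam p "M n" "\<F> n" "W n" "X n" "G n" x C by (rule sols)
 have m1: "(%u. ennreal ((norm (grid_point u j i - proj e K (grid_point u j i)))^2)) \<in> borel_measurable coord_space"
  unfolding proj_def by measurable
 have "(\<integral>\<^sup>+om. ennreal ((norm (Y n j i om - proj e K (Y n j i om)))^2) \<partial>Om)
  = (\<integral>\<^sup>+om. ennreal ((norm (X n (dy T j i) om - proj e K (X n (dy T j i) om)))^2) \<partial>M n)"
  unfolding Y_def by (simp only: transfer_nn[OF m1] grid_point_coords)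
 also have "... <= ennreal (tail_bound x C K b)" by (rule a.X_tail[OF dy_in_dyadics b])
 finally show ?thesis .
qed

lemma modulus_transfer:
 assumes "0 < ep" "0 < et"
 shows "\<exists>dl>0. (\<forall>n. emeasure Om {om\<in>space Om. \<exists>j i j' i'. \<bar>dy T j i - dy T j' i'\<bar> < dl & ep < norm (Y n j' i' om - Y n j i om)} <= ennreal et)
  & (\<forall>n j i. \<forall>t\<in>{0..T}. \<bar>t - dy T j i\<bar> < dl --> emeasure Om {om\<in>space Om. ep < norm (Xp n t om - Y n j i om)} <= ennreal et)"
proof -
 obtain dl where dl: "0 < dl" and mod: "!!M \<F> W X G. approx_solution T S Q e al lam p (M :: 'w measure) \<F> W X G x C ==> emeasure M (modulus_event T M X dl ep) <= ennreal et"
  using approx_modulus[OF C_nonneg assms, of x] by blast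
 have m: "emeasure (M n) (modulus_event T (M n) (X n) dl ep) <= ennreal et" for n by (rule mod[OF sols])
 show ?thesis
 proof (intro exI[of _ dl] conjI dl allI ballI impI)
  fix n
  have "emeasure Om {om\<in>space Om. \<exists>j i j' i'. \<bar>dy T j i - dy T j' i'\<bar> < dl & ep < norm (Y n j' i' om - Y n j i om)}
   = emeasure (M n) {om\<in>space (M n). \<exists>j i j' i'. \<bar>dy T j i - dy T j' i'\<bar> < dl & ep < norm (X n (dy T j' i') om - X n (dy T j i) om)}"
   unfolding Y_def
   by (subst transfer_event[of "%u. \<exists>j i j' i'. \<bar>dy T j i - dy T j' i'\<bar> < dl & ep < norm (grid_point u j' i' - grid_point u j i)"])
   (measurable, simp only: grid_point_coords)
  also have "{om\<in>space (M n). \<exists>j i j' i'. \<bar>dy T j i - dy T j' i'\<bar> < dl & ep < norm (X n (dy T j' i') om - X n (dy T j i) om)} = modulus_event T (M n) (X n) dl ep"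
   unfolding modulus_event_def dyadics_def by blast
  finally show "emeasure Om {om\<in>space Om. \<exists>j i j' i'. \<bar>dy T j i - dy T j' i'\<bar> < dl & ep < norm (Y n j' i' om - Y n j i om)} <= ennreal et"
   using m[of n] by simp
 next
  fix n j i t assume t: "t \<in> {0..T}" and d: "\<bar>t - dy T j i\<bar> < dl"
  interpret a: approx_solution T S Q e al lam p "M n" "\<F> n" "W n" "X n" "G n" x C by (rule sols)
  have "emeasure Om {om\<in>space Om. ep < norm (Xp n t om - Y n j i om)}
   = emeasure (M n) {om\<in>space (M n). ep < norm (path_of (coords (X n) (W n) om) t - X n (dy T j i) om)}"
   unfolding Xp_def Y_def
   by (subst transfer_event[of "%u. ep < norm (path_of u t - grid_point u j i)"]) (measurable, simp only: grid_point_coords)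
  also have "... <= emeasure (M n) (modulus_event T (M n) (X n) dl ep)"
  proof (rule emeasure_mono)
   show "modulus_event T (M n) (X n) dl ep \<in> sets (M n)"
   using dyadics_range[OF T] a.X_measurable by (intro modulus_event_sets) blast
   show "{om\<in>space (M n). ep < norm (path_of (coords (X n) (W n) om) t - X n (dy T j i) om)} \<subseteq> modulus_event T (M n) (X n) dl ep"
   proof
   fix om assume "om \<in> {om\<in>space (M n). ep < norm (path_of (coords (X n) (W n) om) t - X n (dy T j i) om)}"
   then have w: "om \<in> space (M n)" and "ep < norm (path_of (coords (X n) (W n) om) t - X n (dy T j i) om)" by auto
   then have big: "ep < norm (X n t om - X n (dy T j i) om)" by (simp only: a.path_coords_eq[OF w t])
   have "(%l. norm (X n (dy T l (lo T l t)) om - X n (dy T j i) om)) ----> norm (X n t om - X n (dy T j i) om)"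
   by (intro tendsto_intros a.X_dyadic_limit w t)
   from order_tendstoD(1)[OF this big]
   have e1: "\<forall>\<^sub>F l in sequentially. ep < norm (X n (dy T l (lo T l t)) om - X n (dy T j i) om)" .
   have "(%l. \<bar>dy T l (lo T l t) - dy T j i\<bar>) ----> \<bar>t - dy T j i\<bar>"
   using t by (intro tendsto_intros dy_lo_tendsto[OF T]) auto
   from order_tendstoD(2)[OF this d]
   have e2: "\<forall>\<^sub>F l in sequentially. \<bar>dy T l (lo T l t) - dy T j i\<bar> < dl" .
   obtain l where "ep < norm (X n (dy T l (lo T l t)) om - X n (dy T j i) om)" "\<bar>dy T l (lo T l t) - dy T j i\<bar> < dl"
   using eventually_happens[OF eventually_conj[OF e1 e2]] by auto
   then show "om \<in> modulus_event T (M n) (X n) dl ep"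
   unfolding modulus_event_def
   by (intro CollectI conjI w bexI[of _ "dy T j i"] bexI[of _ "dy T l (lo T l t)"] dy_in_dyadics)
   (simp_all only: abs_minus_commute)
   qed
  qed
  finally show "emeasure Om {om\<in>space Om. ep < norm (Xp n t om - Y n j i om)} <= ennreal et"
   using m[of n] by (rule order_trans)
 qed
qed

lemma fatou_conv:
 fixes f :: "nat => 'v => real"
 assumes [measurable]: "!!n. f n \<in> borel_measurable Om" and "AE om in Om. (%n. f n om) ----> g om"
  and bd: "!!n. (\<integral>\<^sup>+om. ennreal (f n om) \<partial>Om) <= B"
 shows "(\<integral>\<^sup>+om. ennreal (g om) \<partial>Om) <= B"
proof -
 have "AE om in Om. ennreal (g om) = liminf (%n. ennreal (f n om))"
  using assms(2)
 proof eventually_elim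
  case (elim om)
  show ?case by (rule lim_imp_Liminf[OF trivial_limit_sequentially tendsto_ennrealI[OF elim], symmetric])
 qed
 then have "(\<integral>\<^sup>+om. ennreal (g om) \<partial>Om) = (\<integral>\<^sup>+om. liminf (%n. ennreal (f n om)) \<partial>Om)" by (rule nn_integral_cong_AE)
 also have "... <= liminf (%n. \<integral>\<^sup>+om. ennreal (f n om) \<partial>Om)" by (rule nn_integral_liminf) measurable
 also have "... <= B" by (rule Liminf_le) (auto intro: always_eventually bd)
 finally show ?thesis .
qed

lemma L_tail_sum:
 assumes b: "!!k. k \<ge> K ==> 1 / (2 * al k) <= b"
 shows "(\<integral>\<^sup>+om. (\<Sum>k. if k < K then 0 else ennreal ((L om (True, j, i, k))^2)) \<partial>Om) <= ennreal (tail_bound x C K b)"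
proof -
 have fin: "(\<integral>\<^sup>+om. ennreal (\<Sum>k<m. if k < K then 0 else (L om (True, j, i, k))^2) \<partial>Om) <= ennreal (tail_bound x C K b)" for m
 proof (rule fatou_conv[where f = "%n om. \<Sum>k<m. if k < K then 0 else (U n om (True, j, i, k))^2"])
  show "AE om in Om. (%n. \<Sum>k<m. if k < K then 0 else (U n om (True, j, i, k))^2) ----> (\<Sum>k<m. if k < K then 0 else (L om (True, j, i, k))^2)"
   using U_conv
  proof eventually_elim
   case (elim om)
   have "(%n. if k < K then 0 else (U n om (True, j, i, k))^2) ----> (if k < K then 0 else (L om (True, j, i, k))^2)" for k
   by (cases "k < K") (auto intro!: tendsto_power elim[rule_format])
   then show ?case by (rule tendsto_sum)
  qed
  fix n
  show "(\<integral>\<^sup>+om. ennreal (\<Sum>k<m. if k < K then 0 else (U n om (True, j, i, k))^2) \<partial>Om) <= ennreal (tail_bound x C K b)"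
  proof (rule order_trans[OF nn_integral_mono_AE tail_transfer[OF b, of K n j i]])
   show "AE om in Om. ennreal (\<Sum>k<m. if k < K then 0 else (U n om (True, j, i, k))^2) <= ennreal ((norm (Y n j i om - proj e K (Y n j i om)))^2)"
   using Y_coord
   proof eventually_elim
   case (elim om)
   have "(\<Sum>k<m. if k < K then 0 else (U n om (True, j, i, k))^2) = (\<Sum>k<m. (inner (Y n j i om - proj e K (Y n j i om)) (e k))^2)"
   using elim by (intro sum.cong) (auto simp: proj_complement_inner[OF onb])
   also have "... <= (norm (Y n j i om - proj e K (Y n j i om)))^2"
   using sum_le_suminf[OF sums_summable[OF parseval[OF onb]], of "{..<m}" "Y n j i om - proj e K (Y n j i om)"]
   sums_unique[OF parseval[OF onb, of "Y n j i om - proj e K (Y n j i om)"]] by simp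
   finally show ?case by (rule ennreal_leI)
   qed
  qed
 qed measurable
 have "(\<integral>\<^sup>+om. (\<Sum>k. if k < K then 0 else ennreal ((L om (True, j, i, k))^2)) \<partial>Om)
  = (\<Sum>k. \<integral>\<^sup>+om. (if k < K then 0 else ennreal ((L om (True, j, i, k))^2)) \<partial>Om)"
  by (rule nn_integral_suminf) measurable
 also have "... <= ennreal (tail_bound x C K b)"
 proof (rule suminf_le_const[OF summableI])
  fix m
  have "(\<Sum>k<m. \<integral>\<^sup>+om. (if k < K then 0 else ennreal ((L om (True, j, i, k))^2)) \<partial>Om)
   = (\<integral>\<^sup>+om. (\<Sum>k<m. if k < K then 0 else ennreal ((L om (True, j, i, k))^2)) \<partial>Om)"
   by (subst nn_integral_sum) auto
  also have "... = (\<integral>\<^sup>+om. ennreal (\<Sum>k<m. if k < K then 0 else (L om (True, j, i, k))^2) \<partial>Om)"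
  proof (rule nn_integral_cong)
   fix om
   have "(\<Sum>k<m. if k < K then 0 else ennreal ((L om (True, j, i, k))^2)) = (\<Sum>k<m. ennreal (if k < K then 0 else (L om (True, j, i, k))^2))"
   by (rule sum.cong) auto
   also have "... = ennreal (\<Sum>k<m. if k < K then 0 else (L om (True, j, i, k))^2)" by (rule sum_ennreal) auto
   finally show "(\<Sum>k<m. if k < K then 0 else ennreal ((L om (True, j, i, k))^2)) = ennreal (\<Sum>k<m. if k < K then 0 else (L om (True, j, i, k))^2)" .
  qed
  also have "... <= ennreal (tail_bound x C K b)" by (rule fin)
  finally show "(\<Sum>k<m. \<integral>\<^sup>+om. (if k < K then 0 else ennreal ((L om (True, j, i, k))^2)) \<partial>Om) <= ennreal (tail_bound x C K b)" .
 qed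
 finally show ?thesis .
qed

lemma al_inverse_bounded: "\<exists>b. \<forall>k. 1 / (2 * al k) <= b"
proof -
 obtain K where K: "\<forall>k\<ge>K. 1 / (2 * al k) <= 1" using al_tail_bound[of 1] by auto
 define b where "b = max 1 (Max (insert 0 ((%k. 1 / (2 * al k)) ` {..<K})))"
 have "1 / (2 * al k) <= b" for k
 proof (cases "k < K")
  case True
  then have "1 / (2 * al k) <= Max (insert 0 ((%k. 1 / (2 * al k)) ` {..<K}))" by (intro Max_ge) auto
  then show ?thesis unfolding b_def by simp
 next
  case False
  then show ?thesis using K unfolding b_def by (auto simp: max.coboundedI1)
 qed
 then show ?thesis by blast
qed

lemma \<xi>_coord: "AE om in Om. \<forall>j i k. inner (\<xi> j i om) (e k) = L om (True, j, i, k)"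
proof -
 obtain b where b: "!!k. 1 / (2 * al k) <= b" using al_inverse_bounded by blast
 have "AE om in Om. \<forall>k. inner (\<xi> j i om) (e k) = L om (True, j, i, k)" for j i
 proof -
  let ?A = "\<integral>\<^sup>+om. (\<Sum>k. ennreal ((L om (True, j, i, k))^2)) \<partial>Om"
  have "?A = (\<integral>\<^sup>+om. (\<Sum>k. if k < 0 then 0 else ennreal ((L om (True, j, i, k))^2)) \<partial>Om)" by simp
  also have "... <= ennreal (tail_bound x C 0 b)" by (rule L_tail_sum) (rule b)
  finally have "?A < \<infinity>" unfolding infinity_ennreal_def by (rule le_less_trans[OF _ ennreal_less_top])
  then have "?A ~= \<infinity>" by (rule less_imp_neq)
  then have "AE om in Om. (\<Sum>k. ennreal ((L om (True, j, i, k))^2)) ~= \<infinity>"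
   by (intro nn_integral_PInf_AE) measurable
  then show ?thesis
  proof eventually_elim
   case (elim om)
   then have "summable (%k. (L om (True, j, i, k))^2)" by (intro summable_suminf_not_top) auto
   then have "summable (%k. L om (True, j, i, k) *\<^sub>R e k)" by (rule riesz_fischer[OF onb])
   then show ?case unfolding \<xi>_def grid_point_def by (simp add: inner_suminf[OF onb])
  qed
 qed
 then show ?thesis by (simp add: AE_all_countable)
qed

lemma \<xi>_tail:
 assumes b: "!!k. k \<ge> K ==> 1 / (2 * al k) <= b"
 shows "(\<integral>\<^sup>+om. ennreal ((norm (\<xi> j i om - proj e K (\<xi> j i om)))^2) \<partial>Om) <= ennreal (tail_bound x C K b)"
proof -
 have "AE om in Om. ennreal ((norm (\<xi> j i om - proj e K (\<xi> j i om)))^2) = (\<Sum>k. if k < K then 0 else ennreal ((L om (True, j, i, k))^2))"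
  using \<xi>_coord
 proof eventually_elim
  case (elim om)
  have s1: "(%k. ennreal ((inner (\<xi> j i om - proj e K (\<xi> j i om)) (e k))^2)) sums ennreal ((norm (\<xi> j i om - proj e K (\<xi> j i om)))^2)"
   using parseval[OF onb, of "\<xi> j i om - proj e K (\<xi> j i om)"] by (subst sums_ennreal) auto
  have s2: "(%k. ennreal ((inner (\<xi> j i om - proj e K (\<xi> j i om)) (e k))^2)) = (%k. if k < K then 0 else ennreal ((L om (True, j, i, k))^2))"
   using elim by (auto simp: proj_complement_inner[OF onb])
  show ?case using sums_unique[OF s1] unfolding s2 .
 qed
 then have "(\<integral>\<^sup>+om. ennreal ((norm (\<xi> j i om - proj e K (\<xi> j i om)))^2) \<partial>Om) = (\<integral>\<^sup>+om. (\<Sum>k. if k < K then 0 else ennreal ((L om (True, j, i, k))^2)) \<partial>Om)"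
  by (rule nn_integral_cong_AE)
 then show ?thesis using L_tail_sum[OF b, of K j i] by simp
qed

lemma proj_conv: "AE om in Om. \<forall>K j i. (%n. proj e K (Y n j i om)) ----> proj e K (\<xi> j i om)"
 using U_conv Y_coord \<xi>_coord
proof eventually_elim
 case (elim om)
 show ?case unfolding proj_def using elim by (auto intro!: tendsto_sum tendsto_scaleR)
qed

lemma tail_bound_small: "0 < \<gamma> ==> \<exists>K b. (\<forall>k\<ge>K. 1 / (2 * al k) <= b) & tail_bound x C K b <= \<gamma>"
proof -
 assume g: "0 < \<gamma>"
 define b where "b = \<gamma> / 12 / (C + 1)"
 have b: "0 < b" using g C_nonneg by (simp add: b_def)
 have bC: "4 * (b * C) <= \<gamma> / 3"
 proof -
  have "b * C <= b * (C + 1)" using b by (intro mult_left_mono) auto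
  also have "... = \<gamma> / 12"
  proof -
   have "C + 1 ~= 0" using C_nonneg by simp
   then show ?thesis using nonzero_eq_divide_eq[of "C + 1" b "\<gamma> / 12"] b_def by blast
  qed
  finally show ?thesis by simp
 qed
 have "(%K. 4 * (norm (x - proj e K x))^2) ----> 4 * (norm (x - x))^2" by (intro tendsto_intros proj_tendsto[OF onb])
 then have "\<forall>\<^sub>F K in sequentially. 4 * (norm (x - proj e K x))^2 < \<gamma> / 3" by (rule order_tendstoD(2)) (use g in simp)
 moreover have "(%K. 2 * (noise_tail K * T powr p)) ----> 2 * (0 * T powr p)" by (intro tendsto_intros noise_tail_tendsto)
 then have "\<forall>\<^sub>F K in sequentially. 2 * (noise_tail K * T powr p) < \<gamma> / 3" by (rule order_tendstoD(2)) (use g in simp)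
 moreover obtain K1 where "\<forall>k\<ge>K1. 1 / (2 * al k) <= b" using al_tail_bound[OF b] by blast
 then have "\<forall>\<^sub>F K in sequentially. \<forall>k\<ge>K. 1 / (2 * al k) <= b" by (intro eventually_sequentiallyI[of K1]) auto
 ultimately have "\<forall>\<^sub>F K in sequentially. (\<forall>k\<ge>K. 1 / (2 * al k) <= b) & tail_bound x C K b <= \<gamma>"
  by eventually_elim (use bC in \<open>auto simp: tail_bound_def\<close>)
 then show ?thesis using eventually_happens[of _ sequentially] by fastforce
qed

text \<open>Finitely many coordinates converge almost surely, and the tails are uniformly small in mean
square.\<close>

lemma Y_conv_prob: "conv_prob Om (%n. Y n j i) (\<xi> j i)"
 unfolding conv_prob_def
proof (intro allI impI)
 fix ep et :: real assume e: "0 < ep" "0 < et"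
 define \<gamma> where "\<gamma> = (ep / 3)^2 * (et / 3)"
 have "0 < \<gamma>" unfolding \<gamma>_def using e by simp
 then obtain K b where K: "!!k. k \<ge> K ==> 1 / (2 * al k) <= b" "tail_bound x C K b <= \<gamma>" using tail_bound_small by blast
 have [measurable]: "(%om. proj e K (Z om)) \<in> borel_measurable Om" if [measurable]: "Z \<in> borel_measurable Om" for Z
  unfolding proj_def by measurable
 have tail: "emeasure Om {om\<in>space Om. ep / 3 < norm (Z om - proj e K (Z om))} <= ennreal (et / 3)"
  if [measurable]: "Z \<in> borel_measurable Om" and Z: "(\<integral>\<^sup>+om. ennreal ((norm (Z om - proj e K (Z om)))^2) \<partial>Om) <= ennreal (tail_bound x C K b)" for Z
 proof -
  have "emeasure Om {om\<in>space Om. ep / 3 < norm (Z om - proj e K (Z om))} <= emeasure Om {om\<in>space Om. (ep / 3)^2 < (norm (Z om - proj e K (Z om)))^2}"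
  proof (rule emeasure_mono)
   have "(ep / 3)^2 < r\<^sup>2" if "ep / 3 < r" for r using that e by (intro power_strict_mono) auto
   then show "{om\<in>space Om. ep / 3 < norm (Z om - proj e K (Z om))} \<subseteq> {om\<in>space Om. (ep / 3)^2 < (norm (Z om - proj e K (Z om)))^2}" by blast
  qed measurable
  also have "... <= ennreal (\<gamma> / (ep / 3)^2)"
  proof (rule markov_nn)
   show "(\<integral>\<^sup>+om. ennreal ((norm (Z om - proj e K (Z om)))^2) \<partial>Om) <= ennreal \<gamma>"
   using Z ennreal_leI[OF K(2)] by (rule order_trans)
  qed (use e in simp_all)
  also have "\<gamma> / (ep / 3)^2 = et / 3" unfolding \<gamma>_def using e by simp
  finally show ?thesis .
 qed
 have "conv_prob Om (%n om. proj e K (Y n j i om)) (%om. proj e K (\<xi> j i om))"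
  by (rule L.AE_conv_prob) (measurable, use proj_conv in eventually_elim, blast)
 then have "\<forall>\<^sub>F n in sequentially. emeasure Om {om\<in>space Om. ep / 3 < norm (proj e K (Y n j i om) - proj e K (\<xi> j i om))} <= ennreal (et / 3)"
  using e unfolding conv_prob_def by (meson divide_pos_pos zero_less_numeral)
 then show "\<forall>\<^sub>F n in sequentially. emeasure Om {om\<in>space Om. ep < norm (Y n j i om - \<xi> j i om)} <= ennreal et"
 proof eventually_elim
  case (elim n)
  have "emeasure Om {om\<in>space Om. ep / 3 + (ep / 3 + ep / 3) < norm (Y n j i om - \<xi> j i om)}
   <= emeasure Om {om\<in>space Om. ep / 3 < norm (Y n j i om - proj e K (Y n j i om))}
   + emeasure Om {om\<in>space Om. ep / 3 + ep / 3 < norm (proj e K (Y n j i om) - \<xi> j i om)}"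
   by (rule emeasure_norm_triangle) measurable
  also have "... <= emeasure Om {om\<in>space Om. ep / 3 < norm (Y n j i om - proj e K (Y n j i om))}
   + (emeasure Om {om\<in>space Om. ep / 3 < norm (proj e K (Y n j i om) - proj e K (\<xi> j i om))}
   + emeasure Om {om\<in>space Om. ep / 3 < norm (proj e K (\<xi> j i om) - \<xi> j i om)})"
   by (rule add_left_mono, rule emeasure_norm_triangle) measurable
  also have "... <= ennreal (et / 3) + (ennreal (et / 3) + ennreal (et / 3))"
  proof (intro add_mono)
   show "emeasure Om {om\<in>space Om. ep / 3 < norm (Y n j i om - proj e K (Y n j i om))} <= ennreal (et / 3)"
   by (rule tail[OF Y_meas tail_transfer[OF K(1)]])
   show "emeasure Om {om\<in>space Om. ep / 3 < norm (proj e K (\<xi> j i om) - \<xi> j i om)} <= ennreal (et / 3)"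
   using tail[OF \<xi>_meas \<xi>_tail[OF K(1)], of j i] by (simp add: norm_minus_commute)
  qed (rule elim)
  also have "... = ennreal et" using e by (simp add: ennreal_plus[symmetric] del: ennreal_plus)
  finally show ?case by simp
 qed
qed

lemma \<xi>_modulus: "AE om in Om. grid_modulus T (%j i. \<xi> j i om)"
proof (rule modulus_AE)
 fix ep et :: real assume e: "0 < ep" "0 < et"
 from modulus_transfer[OF e] obtain dl where dl: "0 < dl" and
  mod: "!!n. emeasure Om {om\<in>space Om. \<exists>j i j' i'. \<bar>dy T j i - dy T j' i'\<bar> < dl & ep < norm (Y n j' i' om - Y n j i om)} <= ennreal et"
  by blast
 let ?E = "{om\<in>space Om. \<exists>j i j' i'. \<bar>dy T j i - dy T j' i'\<bar> < dl & ep < norm (\<xi> j' i' om - \<xi> j i om)}"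
 define En where "En n = {om\<in>space Om. \<exists>j i j' i'. \<bar>dy T j i - dy T j' i'\<bar> < dl & ep < norm (Y n j' i' om - Y n j i om)}" for n
 have [measurable]: "En n \<in> sets Om" for n unfolding En_def by measurable
 have "emeasure Om ?E = (\<integral>\<^sup>+om. indicator ?E om \<partial>Om)" by (subst nn_integral_indicator) measurable
 also have "... <= (\<integral>\<^sup>+om. liminf (%n. indicator (En n) om) \<partial>Om)"
 proof (rule nn_integral_mono_AE)
  show "AE om in Om. indicator ?E om <= liminf (%n. indicator (En n) om :: ennreal)"
   using proj_conv AE_space
  proof eventually_elim
   case (elim om)
   show ?case
   proof (cases "om \<in> ?E")
   case True
   then obtain j i j' i' where q: "\<bar>dy T j i - dy T j' i'\<bar> < dl" "ep < norm (\<xi> j' i' om - \<xi> j i om)" by blast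
   have "(%K. norm (proj e K (\<xi> j' i' om - \<xi> j i om))) ----> norm (\<xi> j' i' om - \<xi> j i om)"
   by (intro tendsto_intros proj_tendsto[OF onb])
   from order_tendstoD(1)[OF this q(2)] obtain K where K: "ep < norm (proj e K (\<xi> j' i' om - \<xi> j i om))"
   using eventually_happens[of _ sequentially] by fastforce
   have "(%n. norm (proj e K (Y n j' i' om) - proj e K (Y n j i om))) ----> norm (proj e K (\<xi> j' i' om) - proj e K (\<xi> j i om))"
   using elim(1) by (intro tendsto_intros) blast+
   then have "(%n. norm (proj e K (Y n j' i' om - Y n j i om))) ----> norm (proj e K (\<xi> j' i' om - \<xi> j i om))"
   by (simp only: linear_diff[OF proj_linear[OF onb]])
   from order_tendstoD(1)[OF this K]
   have "\<forall>\<^sub>F n in sequentially. (1 :: ennreal) <= indicator (En n) om"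
   proof eventually_elim
   case (elim n)
   then have "ep < norm (Y n j' i' om - Y n j i om)" using proj_le[OF onb, of K "Y n j' i' om - Y n j i om"] by linarith
   then have "om \<in> En n" unfolding En_def using q(1) \<open>om \<in> space Om\<close> by blast
   then show ?case by simp
   qed
   then have "1 <= liminf (%n. indicator (En n) om :: ennreal)" by (rule Liminf_bounded)
   then show ?thesis using True by simp
   qed simp
  qed
 qed
 also have "... <= liminf (%n. \<integral>\<^sup>+om. indicator (En n) om \<partial>Om)" by (rule nn_integral_liminf) measurable
 also have "... <= ennreal et"
 proof (rule Liminf_le)
  show "\<forall>\<^sub>F n in sequentially. (\<integral>\<^sup>+om. indicator (En n) om \<partial>Om) <= ennreal et"
   using mod unfolding En_def[symmetric] by (intro always_eventually allI) simp
 qed simp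
 finally show "\<exists>dl>0. emeasure Om {om\<in>space Om. \<exists>j i j' i'. \<bar>dy T j i - dy T j' i'\<bar> < dl & ep < norm (\<xi> j' i' om - \<xi> j i om)} <= ennreal et"
  using dl by blast
qed measurable

definition Good :: "'v set" where "Good = {om\<in>space Om. grid_modulus T (%j i. \<xi> j i om)}"

lemma Good_sets[measurable]: "Good \<in> sets Om"
 unfolding Good_def grid_modulus_def by measurable

lemma AE_Good: "AE om in Om. om \<in> Good"
 using \<xi>_modulus AE_space unfolding Good_def by eventually_elim simp

definition Xlim :: "real => 'v => 'h" where
 "Xlim t om = (if om \<in> Good then lim (%j. \<xi> j (lo T j t) om) else 0)"

lemma Xlim_facts:
 assumes "om \<in> Good"
 shows "continuous_on {0..T} (%t. Xlim t om)" "Xlim (dy T j i) om = \<xi> j i om"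
  "t \<in> {0..T} ==> (%j. \<xi> j (lo T j t) om) ----> Xlim t om"
proof -
 have "grid_modulus T (%j i. \<xi> j i om)" using assms unfolding Good_def by simp
 then obtain g where g: "continuous_on {0..T} g" "!!j i. g (dy T j i) = \<xi> j i om"
  "!!t. t \<in> {0..T} ==> (%j. \<xi> j (lo T j t) om) ----> g t" by (rule dyadic_extension[OF T]) blast
 have eq: "Xlim t om = g t" if "t \<in> {0..T}" for t
  unfolding Xlim_def using assms limI[OF g(3)[OF that]] by simp
 show "continuous_on {0..T} (%t. Xlim t om)" using g(1) by (rule continuous_on_eq) (simp add: eq)
 show "Xlim (dy T j i) om = \<xi> j i om" using eq[OF dy_range[OF T]] g(2) by simp
 show "t \<in> {0..T} ==> (%j. \<xi> j (lo T j t) om) ----> Xlim t om" using g(3) eq by simp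
qed

lemma Xlim_continuous: "continuous_on {0..T} (%t. Xlim t om)"
 by (cases "om \<in> Good") (use Xlim_facts(1) in \<open>auto simp: Xlim_def\<close>)

lemma Xlim_meas2[measurable]: "(%w. Xlim (snd w) (fst w)) \<in> borel_measurable (Om \<Otimes>\<^sub>M borel)"
proof -
 have [measurable]: "(%w. lim (%j. \<xi> j (lo T j (snd w)) (fst w))) \<in> borel_measurable (Om \<Otimes>\<^sub>M borel)"
  by (rule grid_path_measurable) measurable
 have "Measurable.pred (Om \<Otimes>\<^sub>M borel) (%w. fst w \<in> Good)" by measurable
 then show ?thesis unfolding Xlim_def by measurable
qed

lemma Xlim_meas[measurable]: "Xlim t \<in> borel_measurable Om"
 unfolding Xlim_def[abs_def] by measurable

text \<open>Convergence holds at dyadic times, and the moduli of continuity are uniform in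
probability.\<close>

lemma Xp_conv_prob:
 assumes t: "t \<in> {0..T}"
 shows "conv_prob Om (%n. Xp n t) (Xlim t)"
 unfolding conv_prob_def
proof (intro allI impI)
 fix ep et :: real assume e: "0 < ep" "0 < et"
 then have e3: "0 < ep / 3" "0 < et / 3" by auto
 obtain dl where dl: "0 < dl" and mod: "!!n j i t. t \<in> {0..T} ==> \<bar>t - dy T j i\<bar> < dl ==>
   emeasure Om {om\<in>space Om. ep / 3 < norm (Xp n t om - Y n j i om)} <= ennreal (et / 3)"
  using modulus_transfer[OF e3] by blast
 have "conv_prob Om (%j. \<xi> j (lo T j t)) (Xlim t)"
  by (rule L.AE_conv_prob) (measurable, use AE_Good in eventually_elim, rule Xlim_facts(3)[OF _ t])
 then have 1: "\<forall>\<^sub>F j in sequentially. emeasure Om {om\<in>space Om. ep / 3 < norm (\<xi> j (lo T j t) om - Xlim t om)} <= ennreal (et / 3)"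
  using e3 unfolding conv_prob_def by blast
 have "(%j. \<bar>t - dy T j (lo T j t)\<bar>) ----> \<bar>t - t\<bar>" using t by (intro tendsto_intros dy_lo_tendsto[OF T]) auto
 then have 2: "\<forall>\<^sub>F j in sequentially. \<bar>t - dy T j (lo T j t)\<bar> < dl" using dl by (intro order_tendstoD) auto
 obtain j where j: "emeasure Om {om\<in>space Om. ep / 3 < norm (\<xi> j (lo T j t) om - Xlim t om)} <= ennreal (et / 3)" "\<bar>t - dy T j (lo T j t)\<bar> < dl"
  using eventually_happens[OF eventually_conj[OF 1 2]] by auto
 define i where "i = lo T j t"
 have "\<forall>\<^sub>F n in sequentially. emeasure Om {om\<in>space Om. ep / 3 < norm (Y n j i om - \<xi> j i om)} <= ennreal (et / 3)"
  using Y_conv_prob[of j i] e3 unfolding conv_prob_def by blast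
 then show "\<forall>\<^sub>F n in sequentially. emeasure Om {om\<in>space Om. ep < norm (Xp n t om - Xlim t om)} <= ennreal et"
 proof eventually_elim
  case (elim n)
  have "emeasure Om {om\<in>space Om. ep / 3 + (ep / 3 + ep / 3) < norm (Xp n t om - Xlim t om)}
   <= emeasure Om {om\<in>space Om. ep / 3 < norm (Xp n t om - Y n j i om)}
   + emeasure Om {om\<in>space Om. ep / 3 + ep / 3 < norm (Y n j i om - Xlim t om)}"
   by (rule emeasure_norm_triangle) measurable
  also have "... <= emeasure Om {om\<in>space Om. ep / 3 < norm (Xp n t om - Y n j i om)}
   + (emeasure Om {om\<in>space Om. ep / 3 < norm (Y n j i om - \<xi> j i om)}
   + emeasure Om {om\<in>space Om. ep / 3 < norm (\<xi> j i om - Xlim t om)})"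
   by (rule add_left_mono, rule emeasure_norm_triangle) measurable
  also have "... <= ennreal (et / 3) + (ennreal (et / 3) + ennreal (et / 3))"
   using j unfolding i_def[symmetric] by (intro add_mono mod[OF t] elim)
  also have "... = ennreal et" using e by (simp add: ennreal_plus[symmetric] del: ennreal_plus)
  finally show ?case by simp
 qed
qed

end

section \<open>The limit of the drift\<close>

lemma tendsto_min1:
 assumes "(%n. ennreal (min 1 (a n))) ----> 0" and "!!n. 0 <= (a n :: real)"
 shows "a ----> 0"
proof -
 have "(%n. ennreal (min 1 (a n))) ----> ennreal 0" using assms(1) by simp
 then have l: "(%n. min 1 (a n)) ----> 0" by (subst (asm) tendsto_ennreal_iff) (use assms(2) in auto)
 then have "\<forall>\<^sub>F n in sequentially. min 1 (a n) < 1" by (rule order_tendstoD(2)) simp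
 then have "\<forall>\<^sub>F n in sequentially. min 1 (a n) = a n" by eventually_elim (simp add: min_def split: if_splits)
 then show ?thesis by (rule Lim_transform_eventually[OF l])
qed

context coupled
begin

sublocale P: pair_sigma_finite Om lborel ..

lemma pair_lborel: "f \<in> borel_measurable (Om \<Otimes>\<^sub>M borel) ==> f \<in> borel_measurable (Om \<Otimes>\<^sub>M lborel)"
 by (subst measurable_cong_sets[OF sets_pair_measure_cong[OF refl sets_lborel] refl])

lemmas Xp_meas3[measurable] = pair_lborel[OF Xp_meas2] and Xlim_meas3[measurable] = pair_lborel[OF Xlim_meas2]

lemma Xp_AE_subseq:
 "\<exists>r. strict_mono r & (AE w in Om \<Otimes>\<^sub>M lborel. snd w \<in> {0..T} --> (%n. Xp (r n) (snd w) (fst w)) ----> Xlim (snd w) (fst w))"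
proof -
 define D :: "nat => 'v \<times> real => ennreal" where
  "D n w = indicator {0..T} (snd w) * ennreal (min 1 (norm (Xp n (snd w) (fst w) - Xlim (snd w) (fst w))))" for n w
 have D[measurable]: "D n \<in> borel_measurable (Om \<Otimes>\<^sub>M lborel)" for n unfolding D_def[abs_def] by measurable
 define h where "h n t = (\<integral>\<^sup>+om. D n (om, t) \<partial>Om)" for n t
 have hm[measurable]: "h n \<in> borel_measurable lborel" for n
  unfolding h_def[abs_def] by measurable
 have heq: "h n t = indicator {0..T} t * (\<integral>\<^sup>+om. ennreal (min 1 (norm (Xp n t om - Xlim t om))) \<partial>Om)" for n t
  unfolding h_def D_def by (simp add: nn_integral_cmult)
 have "(%n. \<integral>\<^sup>+t. h n t \<partial>lborel) ----> (\<integral>\<^sup>+t. 0 \<partial>(lborel :: real measure))"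
 proof (rule nn_integral_dominated_convergence[where w = "indicator {0..T}"])
  show "AE t in lborel. h n t <= indicator {0..T} t" for n
  proof (rule AE_I2)
   fix t
   have "(\<integral>\<^sup>+om. ennreal (min 1 (norm (Xp n t om - Xlim t om))) \<partial>Om) <= (\<integral>\<^sup>+om. ennreal 1 \<partial>Om)"
   by (intro nn_integral_mono ennreal_leI) simp
   also have "... = 1" by (simp add: L.emeasure_space_1)
   finally show "h n t <= indicator {0..T} t" unfolding heq by (auto split: split_indicator)
  qed
  show "AE t in lborel. (%n. h n t) ----> 0"
  proof (rule AE_I2)
   fix t
   show "(%n. h n t) ----> 0"
   proof (cases "t \<in> {0..T}")
   case True
   have "(%n. \<integral>\<^sup>+om. ennreal (min 1 (norm (Xp n t om - Xlim t om))) \<partial>Om) ----> 0"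
   by (rule L.conv_prob_min1[OF Xp_meas Xlim_meas Xp_conv_prob[OF True]])
   then show ?thesis unfolding heq using True by simp
   qed (simp add: heq)
  qed
 qed (use T in \<open>auto simp: emeasure_lborel_Icc_eq\<close>)
 then have "(%n. \<integral>\<^sup>+w. D n w \<partial>(Om \<Otimes>\<^sub>M lborel)) ----> 0"
  unfolding h_def by (simp add: P.nn_integral_snd)
 from nn_L1_AE_subseq_ennreal[OF D this]
 obtain r where r: "strict_mono r" "AE w in Om \<Otimes>\<^sub>M lborel. (%n. D (r n) w) ----> 0" by blast
 have "AE w in Om \<Otimes>\<^sub>M lborel. snd w \<in> {0..T} --> (%n. Xp (r n) (snd w) (fst w)) ----> Xlim (snd w) (fst w)"
  using r(2)
 proof eventually_elim
  case (elim w)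
  show ?case
  proof
   assume "snd w \<in> {0..T}"
   then have "(%n. ennreal (min 1 (norm (Xp (r n) (snd w) (fst w) - Xlim (snd w) (fst w))))) ----> 0"
   using elim unfolding D_def by simp
   then have "(%n. norm (Xp (r n) (snd w) (fst w) - Xlim (snd w) (fst w))) ----> 0" by (rule tendsto_min1) simp
   then have "(%n. Xp (r n) (snd w) (fst w) - Xlim (snd w) (fst w)) ----> 0" by (rule tendsto_norm_zero_cancel)
   then show "(%n. Xp (r n) (snd w) (fst w)) ----> Xlim (snd w) (fst w)" by (rule LIM_zero_cancel)
  qed
 qed
 with r(1) show ?thesis by blast
qed

lemma V_product: "(\<integral>\<^sup>+w. V (Xp n (snd w) (fst w)) * indicator {0..T} (snd w) \<partial>(Om \<Otimes>\<^sub>M lborel)) <= ennreal C"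
proof -
 interpret a: approx_solution T S Q e al lam p "M n" "\<F> n" "W n" "X n" "G n" x C by (rule sols)
 note [measurable] = V_meas
 have m: "(%w. V (Xp n (snd w) (fst w)) * indicator {0..T} (snd w)) \<in> borel_measurable (Om \<Otimes>\<^sub>M lborel)" by measurable
 have "(\<integral>\<^sup>+w. V (Xp n (snd w) (fst w)) * indicator {0..T} (snd w) \<partial>(Om \<Otimes>\<^sub>M lborel))
  = (\<integral>\<^sup>+t. (\<integral>\<^sup>+om. V (Xp n t om) * indicator {0..T} t \<partial>Om) \<partial>lborel)"
  using P.nn_integral_snd[OF m] by simp
 also have "... = (\<integral>\<^sup>+t. (\<integral>\<^sup>+om. V (X n t om) \<partial>M n) * indicator {0..T} t \<partial>lborel)"
 proof (rule nn_integral_cong)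
  fix t
  have "(\<integral>\<^sup>+om. V (Xp n t om) * indicator {0..T} t \<partial>Om) = (\<integral>\<^sup>+om. V (Xp n t om) \<partial>Om) * indicator {0..T} t"
   by (rule nn_integral_multc) measurable
  also have "... = (\<integral>\<^sup>+om. V (X n t om) \<partial>M n) * indicator {0..T} t"
  proof (cases "t \<in> {0..T}")
   case True
   have mV: "(%u. V (path_of u t)) \<in> borel_measurable coord_space" by measurable
   have "(\<integral>\<^sup>+om. V (Xp n t om) \<partial>Om) = (\<integral>\<^sup>+om. V (path_of (coords (X n) (W n) om) t) \<partial>M n)"
   unfolding Xp_def by (rule transfer_nn[OF mV])
   also have "... = (\<integral>\<^sup>+om. V (X n t om) \<partial>M n)"
   by (rule nn_integral_cong) (simp only: a.path_coords_eq[OF _ True])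
   finally show ?thesis by simp
  qed simp
  finally show "(\<integral>\<^sup>+om. V (Xp n t om) * indicator {0..T} t \<partial>Om) = (\<integral>\<^sup>+om. V (X n t om) \<partial>M n) * indicator {0..T} t" .
 qed
 also have "... <= ennreal C" by (rule V_mean)
 finally show ?thesis .
qed

lemma V_limit: "(\<integral>\<^sup>+w. V (Xlim (snd w) (fst w)) * indicator {0..T} (snd w) \<partial>(Om \<Otimes>\<^sub>M lborel)) <= ennreal C"
proof -
 note [measurable] = V_meas
 obtain r where r: "AE w in Om \<Otimes>\<^sub>M lborel. snd w \<in> {0..T} --> (%n. Xp (r n) (snd w) (fst w)) ----> Xlim (snd w) (fst w)"
  using Xp_AE_subseq by blast
 have "(\<integral>\<^sup>+w. V (Xlim (snd w) (fst w)) * indicator {0..T} (snd w) \<partial>(Om \<Otimes>\<^sub>M lborel))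
  <= (\<integral>\<^sup>+w. liminf (%n. V (Xp (r n) (snd w) (fst w)) * indicator {0..T} (snd w)) \<partial>(Om \<Otimes>\<^sub>M lborel))"
 proof (rule nn_integral_mono_AE)
  show "AE w in Om \<Otimes>\<^sub>M lborel. V (Xlim (snd w) (fst w)) * indicator {0..T} (snd w) <= liminf (%n. V (Xp (r n) (snd w) (fst w)) * indicator {0..T} (snd w))"
   using r
  proof eventually_elim
   case (elim w)
   show ?case
   proof (cases "snd w \<in> {0..T}")
   case True
   then show ?thesis using V_lsc elim by simp
   qed simp
  qed
 qed
 also have "... <= liminf (%n. \<integral>\<^sup>+w. V (Xp (r n) (snd w) (fst w)) * indicator {0..T} (snd w) \<partial>(Om \<Otimes>\<^sub>M lborel))"
  by (rule nn_integral_liminf) measurable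
 also have "... <= ennreal C" by (rule Liminf_le) (auto intro: always_eventually V_product)
 finally show ?thesis .
qed

text \<open>Defined as a limit of the \<open>G n\<close> and not by \<open>F\<close>, which need not be
measurable; the two agree where \<open>V\<close> is finite.\<close>

definition drift_lim :: "'v => real => 'h" where
 "drift_lim om t = (if t \<in> {0..T} & V (Xlim t om) < \<top> then lim (%n. G n t (Xlim t om)) else 0)"

lemma G_meas: "(%z. G n (fst z) (snd z)) \<in> borel_measurable (borel \<Otimes>\<^sub>M borel)"
 using sols[of n] unfolding approx_solution_def approx_solution_axioms_def by blast

lemma G_bounded: "\<exists>B. \<forall>t y. norm (G n t y) <= B"
 using sols[of n] unfolding approx_solution_def approx_solution_axioms_def by blast

lemma G_comp_meas:
 assumes "Z \<in> borel_measurable N" "ta \<in> borel_measurable N"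
 shows "(%w. G n (ta w) (Z w)) \<in> borel_measurable N"
 using measurable_compose[OF measurable_Pair[OF assms(2,1)] G_meas] by simp

lemma drift_lim_meas2[measurable]: "(%w. drift_lim (fst w) (snd w)) \<in> borel_measurable (Om \<Otimes>\<^sub>M borel)"
proof -
 note [measurable] = V_meas
 have [measurable]: "(%w. G n (snd w) (Xlim (snd w) (fst w))) \<in> borel_measurable (Om \<Otimes>\<^sub>M borel)" for n
  by (rule G_comp_meas) measurable
 have [measurable]: "(%w. lim (%n. G n (snd w) (Xlim (snd w) (fst w)))) \<in> borel_measurable (Om \<Otimes>\<^sub>M borel)"
  by (rule borel_measurable_lim_metric) measurable
 have "Measurable.pred (Om \<Otimes>\<^sub>M borel) (%w. snd w \<in> {0..T} & V (Xlim (snd w) (fst w)) < \<top>)" by measurable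
 then show ?thesis unfolding drift_lim_def by measurable
qed

lemmas drift_lim_meas3[measurable] = pair_lborel[OF drift_lim_meas2]

lemma drift_lim_meas: "om \<in> space Om ==> drift_lim om \<in> borel_measurable borel"
 using measurable_compose[OF measurable_Pair1' drift_lim_meas2] by simp

lemma drift_lim_eq:
 assumes t: "t \<in> {0..T}" and V: "V (Xlim t om) < \<top>"
 shows "drift_lim om t = F t (Xlim t om)" and "(%n. G n t (Xlim t om)) ----> F t (Xlim t om)"
proof -
 obtain v where v: "V (Xlim t om) = ennreal v" "0 <= v" using V by (cases "V (Xlim t om)") auto
 have le: "norm (G n t (Xlim t om) - F t (Xlim t om)) <= \<theta> n * v" for n
 proof -
  have "ennreal (norm (F t (Xlim t om) - G n t (Xlim t om))) <= ennreal (\<theta> n * v)"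
   using F_near[OF t V, of n] \<theta>_pos[of n] unfolding v(1) by (simp add: ennreal_mult')
  then show ?thesis using \<theta>_pos[of n] v(2) by (subst norm_minus_commute) simp
 qed
 have "(%n. \<theta> n * v) ----> 0 * v" by (intro tendsto_intros \<theta>_lim)
 then have "(%n. \<theta> n * v) ----> 0" by simp
 then have "(%n. G n t (Xlim t om) - F t (Xlim t om)) ----> 0"
  by (rule Lim_null_comparison[OF always_eventually[OF allI[OF le]]])
 then show l: "(%n. G n t (Xlim t om)) ----> F t (Xlim t om)" by (rule LIM_zero_cancel)
 show "drift_lim om t = F t (Xlim t om)" unfolding drift_lim_def using t V limI[OF l] by simp
qed

lemma drift_lim_square: "ennreal ((norm (drift_lim om t))^2) <= V (Xlim t om)"
proof (cases "t \<in> {0..T} & V (Xlim t om) < \<top>")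
 case True
 then have l: "(%n. G n t (Xlim t om)) ----> F t (Xlim t om)" using drift_lim_eq by blast
 have "(%n. ennreal ((norm (G n t (Xlim t om)))^2)) ----> ennreal ((norm (F t (Xlim t om)))^2)"
  by (intro tendsto_ennrealI tendsto_intros l)
 then have "ennreal ((norm (F t (Xlim t om)))^2) <= V (Xlim t om)"
  by (rule LIMSEQ_le_const2) (use G_square True in blast)
 then show ?thesis using drift_lim_eq(1) True by simp
qed (auto simp: drift_lim_def)

definition drift_gap :: "nat => nat => 'v \<times> real => ennreal" where
 "drift_gap n k w = indicator {0..T} (snd w) *
   ennreal \<bar>inner (G n (snd w) (Xp n (snd w) (fst w)) - drift_lim (fst w) (snd w)) (e k)\<bar>"

lemma G_Xp_meas[measurable]: "(%w. G m (snd w) (Xp n (snd w) (fst w))) \<in> borel_measurable (Om \<Otimes>\<^sub>M lborel)"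
 by (rule G_comp_meas) measurable

lemma G_Xlim_meas[measurable]: "(%w. G m (snd w) (Xlim (snd w) (fst w))) \<in> borel_measurable (Om \<Otimes>\<^sub>M lborel)"
 by (rule G_comp_meas) measurable

lemma drift_gap_meas[measurable]: "drift_gap n k \<in> borel_measurable (Om \<Otimes>\<^sub>M lborel)"
 unfolding drift_gap_def[abs_def] by measurable

lemma inner_e_le: "\<bar>inner y (e k)\<bar> <= norm y"
 using Cauchy_Schwarz_ineq2[of y "e k"] by (simp add: onb_norm[OF onb])

text \<open>The comparison with a fixed approximation \<open>G m\<close>: first \<open>n\<close> tends to
infinity, where the weak continuity and boundedness of \<open>G m\<close> are used, and then
\<open>m\<close>.\<close>

lemma drift_gap_lim:
 assumes r: "strict_mono r"
  and conv: "AE w in Om \<Otimes>\<^sub>M lborel. snd w \<in> {0..T} --> (%n. Xp (r n) (snd w) (fst w)) ----> Xlim (snd w) (fst w)"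
 shows "(%n. \<integral>\<^sup>+w. drift_gap (r n) k w \<partial>(Om \<Otimes>\<^sub>M lborel)) ----> 0"
proof -
 note [measurable] = V_meas
 let ?PM = "Om \<Otimes>\<^sub>M (lborel :: real measure)"
 define mid where "mid m n w = indicator {0..T} (snd w) *
   ennreal \<bar>inner (G m (snd w) (Xp n (snd w) (fst w)) - G m (snd w) (Xlim (snd w) (fst w))) (e k)\<bar>" for m n and w :: "'v \<times> real"
 have [measurable]: "mid m n \<in> borel_measurable ?PM" for m n unfolding mid_def[abs_def] by measurable
 have midlim: "(%n. \<integral>\<^sup>+w. mid m (r n) w \<partial>?PM) ----> 0" for m
 proof -
  obtain B where B: "!!t y. norm (G m t y) <= B" using G_bounded by blast
  have "(%n. \<integral>\<^sup>+w. mid m (r n) w \<partial>?PM) ----> (\<integral>\<^sup>+w. 0 \<partial>?PM)"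
  proof (rule nn_integral_dominated_convergence[where u = "%n. mid m (r n)" and u' = "%_. 0"
   and w = "%w. ennreal (2 * B) * indicator (space Om \<times> {0..T}) w"])
   show "AE w in ?PM. mid m (r n) w <= ennreal (2 * B) * indicator (space Om \<times> {0..T}) w" for n
   proof (rule AE_I2)
   fix w assume "w \<in> space ?PM"
   then have w: "fst w \<in> space Om" by (auto simp: space_pair_measure)
   have "\<bar>inner (G m (snd w) (Xp (r n) (snd w) (fst w)) - G m (snd w) (Xlim (snd w) (fst w))) (e k)\<bar>
   <= norm (G m (snd w) (Xp (r n) (snd w) (fst w)) - G m (snd w) (Xlim (snd w) (fst w)))" by (rule inner_e_le)
   also have "... <= B + B" by (rule order_trans[OF norm_triangle_ineq4 add_mono[OF B B]])
   finally show "mid m (r n) w <= ennreal (2 * B) * indicator (space Om \<times> {0..T}) w"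
   unfolding mid_def using w by (cases w) (auto split: split_indicator intro!: ennreal_leI)
   qed
   have "(\<integral>\<^sup>+w. ennreal (2 * B) * indicator (space Om \<times> {0..T}) w \<partial>?PM) = ennreal (2 * B) * emeasure ?PM (space Om \<times> {0..T})"
   by (rule nn_integral_cmult_indicator) measurable
   also have "emeasure ?PM (space Om \<times> {0..T}) = ennreal T"
   using T by (subst lborel.emeasure_pair_measure_Times) (auto simp: L.emeasure_space_1)
   finally show "(\<integral>\<^sup>+w. ennreal (2 * B) * indicator (space Om \<times> {0..T}) w \<partial>?PM) < \<infinity>"
   by (simp add: ennreal_mult_less_top)
   show "AE w in ?PM. (%n. mid m (r n) w) ----> 0"
   using conv
   proof eventually_elim
   case (elim w)
   show ?case
   proof (cases "snd w \<in> {0..T}")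
   case True
   define t where "t = snd w"
   have cont: "continuous_on UNIV (%y. inner (G m t y) (e k))" using G_weak True unfolding t_def by blast
   have "(%n. inner (G m t (Xp (r n) t (fst w))) (e k)) ----> inner (G m t (Xlim t (fst w))) (e k)"
   proof -
   have "(%n. Xp (r n) t (fst w)) ----> Xlim t (fst w)" using elim True unfolding t_def by blast
   from continuous_on_tendsto_compose[OF cont this] show ?thesis by simp
   qed
   then have "(%n. \<bar>inner (G m t (Xp (r n) t (fst w))) (e k) - inner (G m t (Xlim t (fst w))) (e k)\<bar>) ----> \<bar>inner (G m t (Xlim t (fst w))) (e k) - inner (G m t (Xlim t (fst w))) (e k)\<bar>"
   by (intro tendsto_rabs tendsto_diff tendsto_const)
   then have "(%n. ennreal \<bar>inner (G m t (Xp (r n) t (fst w))) (e k) - inner (G m t (Xlim t (fst w))) (e k)\<bar>) ----> ennreal 0"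
   by (intro tendsto_ennrealI) simp
   then show ?thesis unfolding mid_def using True unfolding t_def[symmetric] by (simp add: inner_diff_left)
   qed (simp add: mid_def)
   qed
  qed measurable
  then show ?thesis by simp
 qed
 have split: "(\<integral>\<^sup>+w. drift_gap n k w \<partial>?PM) <= ennreal (\<theta> n * C + 2 * (\<theta> m * C)) + (\<integral>\<^sup>+w. mid m n w \<partial>?PM)" for n m
 proof -
  define V1 V2 :: "'v \<times> real => ennreal" where "V1 w = V (Xp n (snd w) (fst w)) * indicator {0..T} (snd w)"
   and "V2 w = V (Xlim (snd w) (fst w)) * indicator {0..T} (snd w)" for w
  have [measurable]: "V1 \<in> borel_measurable ?PM" "V2 \<in> borel_measurable ?PM" unfolding V1_def[abs_def] V2_def[abs_def] by measurable
  have pw: "drift_gap n k w <= (ennreal (\<theta> n + \<theta> m) * V1 w + mid m n w) + ennreal (\<theta> m) * V2 w" for w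
  proof (cases "snd w \<in> {0..T} & V1 w < \<top> & V2 w < \<top>")
   case False
   have th: "0 < ennreal (\<theta> n + \<theta> m)" "0 < ennreal (\<theta> m)"
   using \<theta>_pos[of n] \<theta>_pos[of m] by (simp_all add: add_pos_pos del: ennreal_plus)
   show ?thesis
   proof (cases "snd w \<in> {0..T}")
   case True
   then have "V1 w = \<top> \<or> V2 w = \<top>" using False unfolding less_top[symmetric] by blast
   then have "(ennreal (\<theta> n + \<theta> m) * V1 w + mid m n w) + ennreal (\<theta> m) * V2 w = \<top>"
   using th by (auto simp: ennreal_mult_top)
   then show ?thesis by (simp only: top_greatest)
   qed (simp add: drift_gap_def)
  next
   case True
   define t om where "t = snd w" "om = fst w"
   have t: "t \<in> {0..T}" using True by (simp add: t_om_def)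
   have v1: "V (Xp n t om) < \<top>" and v2: "V (Xlim t om) < \<top>" using True unfolding V1_def V2_def t_om_def by auto
   have Gap: "ennreal (norm (F t y - G n' t y)) <= ennreal (\<theta> n') * V y" if "V y < \<top>" for y n' by (rule F_near[OF t that])
   let ?y = "Xp n t om" and ?z = "Xlim t om"
   have "\<bar>inner (G n t ?y - drift_lim om t) (e k)\<bar>
   <= (norm (F t ?y - G n t ?y) + norm (F t ?y - G m t ?y)) + \<bar>inner (G m t ?y - G m t ?z) (e k)\<bar> + norm (F t ?z - G m t ?z)"
   proof -
   have "inner (G n t ?y - drift_lim om t) (e k) = - inner (F t ?y - G n t ?y) (e k) + inner (F t ?y - G m t ?y) (e k)
   + inner (G m t ?y - G m t ?z) (e k) - inner (F t ?z - G m t ?z) (e k)"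
   unfolding drift_lim_eq(1)[OF t v2] by (simp add: inner_diff_left)
   then show ?thesis
   using inner_e_le[of "F t ?y - G n t ?y" k] inner_e_le[of "F t ?y - G m t ?y" k] inner_e_le[of "F t ?z - G m t ?z" k] by linarith
   qed
   then have "ennreal \<bar>inner (G n t ?y - drift_lim om t) (e k)\<bar>
   <= (ennreal (norm (F t ?y - G n t ?y)) + ennreal (norm (F t ?y - G m t ?y))) + ennreal \<bar>inner (G m t ?y - G m t ?z) (e k)\<bar> + ennreal (norm (F t ?z - G m t ?z))"
   by (simp add: ennreal_plus[symmetric] ennreal_leI del: ennreal_plus)
   also have "... <= (ennreal (\<theta> n) * V ?y + ennreal (\<theta> m) * V ?y) + ennreal \<bar>inner (G m t ?y - G m t ?z) (e k)\<bar> + ennreal (\<theta> m) * V ?z"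
   by (intro add_mono Gap v1 v2 order_refl)
   also have "ennreal (\<theta> n) * V ?y + ennreal (\<theta> m) * V ?y = ennreal (\<theta> n + \<theta> m) * V ?y"
   using \<theta>_pos[of n] \<theta>_pos[of m] by (simp add: distrib_right[symmetric] ennreal_plus)
   finally show ?thesis
   using t unfolding drift_gap_def mid_def V1_def V2_def t_om_def[symmetric] by simp
  qed
  have "(\<integral>\<^sup>+w. drift_gap n k w \<partial>?PM) <= (\<integral>\<^sup>+w. (ennreal (\<theta> n + \<theta> m) * V1 w + mid m n w) + ennreal (\<theta> m) * V2 w \<partial>?PM)"
   by (rule nn_integral_mono) (rule pw)
  also have "... = (ennreal (\<theta> n + \<theta> m) * (\<integral>\<^sup>+w. V1 w \<partial>?PM) + (\<integral>\<^sup>+w. mid m n w \<partial>?PM)) + ennreal (\<theta> m) * (\<integral>\<^sup>+w. V2 w \<partial>?PM)"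
   by (simp add: nn_integral_add nn_integral_cmult)
  also have "... <= (ennreal (\<theta> n + \<theta> m) * ennreal C + (\<integral>\<^sup>+w. mid m n w \<partial>?PM)) + ennreal (\<theta> m) * ennreal C"
   using V_product[of n] V_limit unfolding V1_def V2_def[symmetric] by (intro add_mono mult_left_mono order_refl) auto
  also have "... = ennreal (\<theta> n * C + 2 * (\<theta> m * C)) + (\<integral>\<^sup>+w. mid m n w \<partial>?PM)"
  proof -
   have "ennreal (\<theta> n + \<theta> m) * ennreal C + ennreal (\<theta> m) * ennreal C = ennreal ((\<theta> n + \<theta> m) * C + \<theta> m * C)"
   using \<theta>_pos[of n] \<theta>_pos[of m] C_nonneg by (subst ennreal_plus) (auto simp: ennreal_mult')
   also have "(\<theta> n + \<theta> m) * C + \<theta> m * C = \<theta> n * C + 2 * (\<theta> m * C)" by (simp add: algebra_simps)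
   finally show ?thesis by (simp add: ac_simps)
  qed
  finally show ?thesis .
 qed
 show ?thesis
 proof (rule order_tendstoI)
  fix a :: ennreal assume "0 < a"
  obtain b where b: "0 < b" "b < a" using dense[OF \<open>0 < a\<close>] by blast
  then have "b ~= \<top>" by auto
  then obtain c where c: "b = ennreal c" "0 <= c" by (cases b) auto
  then have c0: "0 < c" using b by auto
  have "(%m. 2 * (\<theta> m * C)) ----> 2 * (0 * C)" by (intro tendsto_intros \<theta>_lim)
  then have "\<forall>\<^sub>F m in sequentially. 2 * (\<theta> m * C) < c / 3" by (rule order_tendstoD(2)) (use c0 in simp)
  then obtain m where m: "2 * (\<theta> m * C) < c / 3" using eventually_happens[of _ sequentially] by fastforce
  have "(%n. \<theta> (r n) * C) ----> 0 * C"
   using LIMSEQ_subseq_LIMSEQ[OF \<theta>_lim r] by (intro tendsto_mult tendsto_const) (simp add: comp_def)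
  then have e1: "\<forall>\<^sub>F n in sequentially. \<theta> (r n) * C < c / 3" by (rule order_tendstoD(2)) (use c0 in simp)
  have e2: "\<forall>\<^sub>F n in sequentially. (\<integral>\<^sup>+w. mid m (r n) w \<partial>?PM) < ennreal (c / 3)"
   using midlim[of m] by (rule order_tendstoD(2)) (use c0 in simp)
  show "\<forall>\<^sub>F n in sequentially. (\<integral>\<^sup>+w. drift_gap (r n) k w \<partial>?PM) < a"
   using e1 e2
  proof eventually_elim
   case (elim n)
   have "(\<integral>\<^sup>+w. drift_gap (r n) k w \<partial>?PM) <= ennreal (\<theta> (r n) * C + 2 * (\<theta> m * C)) + (\<integral>\<^sup>+w. mid m (r n) w \<partial>?PM)"
   by (rule split)
   also have "... <= ennreal (c / 3 + c / 3) + ennreal (c / 3)"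
   using elim m by (intro add_mono ennreal_leI) (auto simp: less_imp_le)
   also have "... = b" using c c0 by (simp add: ennreal_plus[symmetric] del: ennreal_plus)
   also have "... < a" by (rule b)
   finally show ?case .
  qed
 qed simp
qed

end

section \<open>Limits of the stochastic convolution and of the noise\<close>

declare coord_measurable[measurable del]

context coupled
begin

lemma drift_lim_integrable:
 "AE om in Om. set_integrable lborel {0..T} (%s. (norm (drift_lim om s))^2) & (AE s in lborel. s \<in> {0..T} --> V (Xlim s om) < \<top>)"
proof -
 note [measurable] = V_meas
 have m: "(%w. V (Xlim (snd w) (fst w)) * indicator {0..T} (snd w)) \<in> borel_measurable (Om \<Otimes>\<^sub>M lborel)" by measurable
 have mi: "(%om. \<integral>\<^sup>+s. V (Xlim s om) * indicator {0..T} s \<partial>lborel) \<in> borel_measurable Om"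
  using lborel.borel_measurable_nn_integral_fst[OF m] by simp
 have "(\<integral>\<^sup>+om. (\<integral>\<^sup>+s. V (Xlim s om) * indicator {0..T} s \<partial>lborel) \<partial>Om) <= ennreal C"
  using V_limit lborel.nn_integral_fst[OF m] by simp
 then have "(\<integral>\<^sup>+om. (\<integral>\<^sup>+s. V (Xlim s om) * indicator {0..T} s \<partial>lborel) \<partial>Om) < \<infinity>"
  unfolding infinity_ennreal_def by (rule le_less_trans[OF _ ennreal_less_top])
 then have "(\<integral>\<^sup>+om. (\<integral>\<^sup>+s. V (Xlim s om) * indicator {0..T} s \<partial>lborel) \<partial>Om) ~= \<infinity>" by (rule less_imp_neq)
 from nn_integral_PInf_AE[OF mi this]
 show ?thesis using AE_space
 proof eventually_elim
  case (elim om)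
  have w: "om \<in> space Om" by (rule elim(2))
  have [measurable]: "(%s. Xlim s om) \<in> borel_measurable borel"
   using measurable_compose[OF measurable_Pair1'[OF w] Xlim_meas2] by simp
  define d where "d = drift_lim om"
  have dm: "d \<in> borel_measurable borel" unfolding d_def by (rule drift_lim_meas[OF w])
  have "(\<integral>\<^sup>+s. ennreal (norm (indicator {0..T} s *\<^sub>R (norm (d s))^2)) \<partial>lborel) <= (\<integral>\<^sup>+s. V (Xlim s om) * indicator {0..T} s \<partial>lborel)"
   using drift_lim_square unfolding d_def by (intro nn_integral_mono) (auto split: split_indicator)
  also have "... < \<infinity>" using elim(1) by (simp add: less_top)
  finally have fin: "(\<integral>\<^sup>+s. ennreal (norm (indicator {0..T} s *\<^sub>R (norm (d s))^2)) \<partial>lborel) < \<infinity>" .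
  have "integrable lborel (%s. indicator {0..T} s *\<^sub>R (norm (d s))^2)"
  proof (rule integrableI_bounded[OF _ fin])
   have "d \<in> borel_measurable lborel" using dm by simp
   then have "(%s. (norm (d s))^2) \<in> borel_measurable lborel" by (intro borel_measurable_power measurable_compose[OF _ borel_measurable_norm])
   then show "(%s. indicator {0..T} s *\<^sub>R (norm (d s))^2) \<in> borel_measurable lborel"
   by (intro borel_measurable_scaleR borel_measurable_indicator) auto
  qed
  moreover have "AE s in lborel. V (Xlim s om) * indicator {0..T} s ~= \<infinity>"
   by (rule nn_integral_PInf_AE) (use elim(1) in simp_all)
  then have "AE s in lborel. s \<in> {0..T} --> V (Xlim s om) < \<top>"
   by eventually_elim (auto simp: less_top)
  ultimately show ?case unfolding set_integrable_def d_def by blast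
 qed
qed

definition mild_coord :: "'v => nat => real => real" where
 "mild_coord om k t = inner (Xlim t om) (e k) - exp (- al k * t) * inner x (e k)
   - conv_exp (al k) (%s. inner (drift_lim om s) (e k)) t"

lemma mild_coord_meas[measurable]: "(%om. mild_coord om k t) \<in> borel_measurable Om"
proof -
 have "(%om. conv_exp (al k) (%s. inner (drift_lim om s) (e k)) t) \<in> borel_measurable Om"
  unfolding conv_exp_def set_lebesgue_integral_def
  by (rule lborel.borel_measurable_lebesgue_integral) (unfold split_beta, measurable)
 then show ?thesis unfolding mild_coord_def by measurable
qed

definition approx_coord :: "nat => nat => real => (index => real) => real" where
 "approx_coord n k t u = inner (path_of u t) (e k) - exp (- al k * t) * inner x (e k)
   - conv_exp (al k) (%s. inner (G n s (path_of u s)) (e k)) t"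

lemma approx_coord_meas[measurable]: "approx_coord n k t \<in> borel_measurable coord_space"
proof -
 have p3: "(%w. path_of (fst w) (snd w)) \<in> borel_measurable (coord_space \<Otimes>\<^sub>M lborel)"
  by (subst measurable_cong_sets[OF sets_pair_measure_cong[OF refl sets_lborel] refl]) (rule path_of_measurable2)
 have [measurable]: "(%w. G n (snd w) (path_of (fst w) (snd w))) \<in> borel_measurable (coord_space \<Otimes>\<^sub>M lborel)"
  by (rule G_comp_meas[OF p3]) measurable
 have "(%u. conv_exp (al k) (%s. inner (G n s (path_of u s)) (e k)) t) \<in> borel_measurable coord_space"
  unfolding conv_exp_def set_lebesgue_integral_def
  by (rule lborel.borel_measurable_lebesgue_integral) (unfold split_beta, measurable)
 then show ?thesis unfolding approx_coord_def[abs_def] by measurable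
qed

lemma approx_coord_error:
 assumes t: "t \<in> {0..T}"
 shows "(\<integral>\<^sup>+om. ennreal ((approx_coord n k t (U n om) - lam k * coord_sum (U n om) k t j)^2) \<partial>Om) <= ennreal (8 * (lam k)^2 * grid_error T (al k) j)"
proof -
 interpret a: approx_solution T S Q e al lam p "M n" "\<F> n" "W n" "X n" "G n" x C by (rule sols)
 have m: "(%u. ennreal ((approx_coord n k t u - lam k * coord_sum u k t j)^2)) \<in> borel_measurable coord_space" by measurable
 have "(\<integral>\<^sup>+om. ennreal ((approx_coord n k t (U n om) - lam k * coord_sum (U n om) k t j)^2) \<partial>Om)
  = (\<integral>\<^sup>+om. ennreal ((approx_coord n k t (coords (X n) (W n) om) - lam k * coord_sum (coords (X n) (W n) om) k t j)^2) \<partial>M n)"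
  by (rule transfer_nn[OF m])
 also have "... = (\<integral>\<^sup>+om. ennreal ((inner (a.Z t om) (e k) - lam k * grid_sum T (al k) t j (%u. W n u (e k) om))^2) \<partial>M n)"
 proof (rule nn_integral_cong)
  fix om assume w: "om \<in> space (M n)"
  have "approx_coord n k t (coords (X n) (W n) om) = inner (a.Z t om) (e k)"
   using convol_coord[OF a.convol_facts[OF w], of t k] t a.Xj_eq[OF w t] S_coord[of t x k]
   unfolding approx_coord_def a.path_coords a.Z_def a.drift_def by (simp add: inner_diff_left)
  then show "ennreal ((approx_coord n k t (coords (X n) (W n) om) - lam k * coord_sum (coords (X n) (W n) om) k t j)^2)
   = ennreal ((inner (a.Z t om) (e k) - lam k * grid_sum T (al k) t j (%u. W n u (e k) om))^2)"
   by (simp only: coord_sum_coords)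
 qed
 also have "... <= ennreal (8 * (lam k)^2 * grid_error T (al k) j)" by (rule a.Z_coord[OF t])
 finally show ?thesis .
qed

lemma coord_sum_conv:
 assumes "!!i. (%n. u n i) ----> l i"
 shows "(%n. coord_sum (u n) k t j) ----> coord_sum l k t j"
 unfolding coord_sum_def by (intro tendsto_intros assms)

text \<open>The error bound for the approximating problems does not depend on \<open>n\<close>, so it survives
in the limit by Fatou's lemma.\<close>

lemma limit_coord_error:
 assumes t: "t \<in> {0..T}"
 shows "(\<integral>\<^sup>+om. ennreal ((mild_coord om k t - lam k * coord_sum (L om) k t j)^2) \<partial>Om) <= ennreal (8 * (lam k)^2 * grid_error T (al k) j)"
proof -
 obtain r where r: "strict_mono r" and rconv: "AE w in Om \<Otimes>\<^sub>M lborel. snd w \<in> {0..T} --> (%n. Xp (r n) (snd w) (fst w)) ----> Xlim (snd w) (fst w)"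
  using Xp_AE_subseq by blast
 define H where "H n om = (\<integral>\<^sup>+s. drift_gap n k (om, s) \<partial>lborel)" for n om
 have Hm[measurable]: "H n \<in> borel_measurable Om" for n unfolding H_def[abs_def] by measurable
 have "(%n. \<integral>\<^sup>+om. H (r n) om \<partial>Om) ----> 0"
  using drift_gap_lim[OF r rconv, of k] unfolding H_def by (simp add: lborel.nn_integral_fst)
 moreover have "(%n. \<integral>\<^sup>+om. ennreal (min 1 (norm (Xp (r n) t om - Xlim t om))) \<partial>Om) ----> 0"
  using LIMSEQ_subseq_LIMSEQ[OF L.conv_prob_min1[OF Xp_meas Xlim_meas Xp_conv_prob[OF t]] r] by (simp add: comp_def)
 ultimately have "(%n. (\<integral>\<^sup>+om. H (r n) om \<partial>Om) + (\<integral>\<^sup>+om. ennreal (min 1 (norm (Xp (r n) t om - Xlim t om))) \<partial>Om)) ----> 0 + 0"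
  by (rule tendsto_add)
 then have hl: "(%n. \<integral>\<^sup>+om. H (r n) om + ennreal (min 1 (norm (Xp (r n) t om - Xlim t om))) \<partial>Om) ----> 0"
  by (simp add: nn_integral_add)
 have hm: "(%om. H (r n) om + ennreal (min 1 (norm (Xp (r n) t om - Xlim t om)))) \<in> borel_measurable Om" for n
  by measurable
 obtain r2 where r2: "strict_mono r2" and ae: "AE om in Om. (%n. H (r (r2 n)) om + ennreal (min 1 (norm (Xp (r (r2 n)) t om - Xlim t om)))) ----> 0"
  using nn_L1_AE_subseq_ennreal[OF hm hl] by blast
 define rh where "rh n = r (r2 n)" for n
 have rh: "strict_mono rh" unfolding rh_def using r r2 by (simp add: strict_mono_def)
 have conv: "AE om in Om. (%n. approx_coord (rh n) k t (U (rh n) om)) ----> mild_coord om k t"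
  using ae drift_lim_integrable AE_space
 proof eventually_elim
  case (elim om)
  have w: "om \<in> space Om" by (rule elim(3))
  have z: "(%n. H (rh n) om + ennreal (min 1 (norm (Xp (rh n) t om - Xlim t om)))) ----> 0"
   using elim(1) unfolding rh_def .
  have h0: "(%n. H (rh n) om) ----> 0"
   by (rule tendsto_sandwich[OF _ _ tendsto_const z]) (auto intro!: always_eventually)
  have "(%n. ennreal (min 1 (norm (Xp (rh n) t om - Xlim t om)))) ----> 0"
   by (rule tendsto_sandwich[OF _ _ tendsto_const z]) (auto intro!: always_eventually)
  then have "(%n. norm (Xp (rh n) t om - Xlim t om)) ----> 0" by (rule tendsto_min1) simp
  then have "(%n. Xp (rh n) t om - Xlim t om) ----> 0" by (rule tendsto_norm_zero_cancel)
  then have xc: "(%n. Xp (rh n) t om) ----> Xlim t om" by (rule LIM_zero_cancel)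
  define g where "g s = inner (drift_lim om s) (e k)" for s
  define gn where "gn n s = inner (G n s (Xp n s om)) (e k)" for n s
  have gm[measurable]: "g \<in> borel_measurable borel"
   unfolding g_def[abs_def] by (rule borel_measurable_inner[OF drift_lim_meas[OF w] borel_measurable_const])
  have [measurable]: "(%s. Xp n s om) \<in> borel_measurable borel" for n
   using measurable_compose[OF measurable_Pair1'[OF w] Xp_meas2] by simp
  have [measurable]: "(%s. G n s (Xp n s om)) \<in> borel_measurable borel" for n by (rule G_comp_meas) measurable
  have gnm[measurable]: "gn n \<in> borel_measurable borel" for n unfolding gn_def[abs_def] by measurable
  have g2: "set_integrable lborel {0..T} (%s. (g s)^2)"
   unfolding g_def by (rule coord_square_integrable[OF drift_lim_meas[OF w]]) (use elim(2) in blast)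
  have gn2: "set_integrable lborel {0..T} (%s. (gn n s)^2)" for n
  proof -
   obtain B where B: "!!t y. norm (G n t y) <= B" using G_bounded by blast
   have "integrable lborel (%s. indicator {0..T} s * B\<^sup>2)"
   using T by (intro integrable_mult_left integrable_real_indicator) (auto simp: emeasure_lborel_Icc_eq)
   then show ?thesis unfolding set_integrable_def
   proof (rule Bochner_Integration.integrable_bound)
   have "\<bar>gn n s\<bar> <= \<bar>B\<bar>" for s
   unfolding gn_def using inner_e_le[of "G n s (Xp n s om)" k] B[of s "Xp n s om"] by linarith
   then have "(gn n s)^2 <= B\<^sup>2" for s by (simp only: abs_le_square_iff)
   then show "AE s in lborel. norm (indicator {0..T} s *\<^sub>R (gn n s)^2) <= norm (indicator {0..T} s * B\<^sup>2)"
   by (intro AE_I2) (auto split: split_indicator)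
   qed measurable
  qed
  have tT: "0 <= t" "t <= T" using t by auto
  have le: "ennreal \<bar>conv_exp (al k) (gn n) t - conv_exp (al k) g t\<bar> <= H n om" for n
  proof -
   note i1 = conv_exp_bounds(1)[OF al_pos gnm gn2 tT, of k n, unfolded set_integrable_def]
   note i2 = conv_exp_bounds(1)[OF al_pos gm g2 tT, of k, unfolded set_integrable_def]
   have "conv_exp (al k) (gn n) t - conv_exp (al k) g t
   = (\<integral>s. indicator {0..t} s *\<^sub>R (exp (- al k * (t - s)) * gn n s) - indicator {0..t} s *\<^sub>R (exp (- al k * (t - s)) * g s) \<partial>lborel)"
   unfolding conv_exp_def set_lebesgue_integral_def by (rule Bochner_Integration.integral_diff[OF i1 i2, symmetric])
   then have "ennreal \<bar>conv_exp (al k) (gn n) t - conv_exp (al k) g t\<bar>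
   <= (\<integral>\<^sup>+s. ennreal (norm (indicator {0..t} s *\<^sub>R (exp (- al k * (t - s)) * gn n s) - indicator {0..t} s *\<^sub>R (exp (- al k * (t - s)) * g s))) \<partial>lborel)"
   using integral_norm_bound_ennreal[OF Bochner_Integration.integrable_diff[OF i1 i2]] by simp
   also have "... <= H n om"
   unfolding H_def
   proof (rule nn_integral_mono)
   fix s
   show "ennreal (norm (indicator {0..t} s *\<^sub>R (exp (- al k * (t - s)) * gn n s) - indicator {0..t} s *\<^sub>R (exp (- al k * (t - s)) * g s))) <= drift_gap n k (om, s)"
   proof (cases "s \<in> {0..t}")
   case True
   have "\<bar>exp (- al k * (t - s)) * (gn n s - g s)\<bar> <= 1 * \<bar>gn n s - g s\<bar>"
   unfolding abs_mult using True al_pos[of k] by (intro mult_right_mono) auto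
   then have "\<bar>exp (- al k * (t - s)) * gn n s - exp (- al k * (t - s)) * g s\<bar> <= \<bar>gn n s - g s\<bar>"
   by (simp add: right_diff_distrib)
   then show ?thesis using True tT unfolding drift_gap_def gn_def g_def
   by (simp add: inner_diff_left ennreal_leI)
   qed simp
   qed
   finally show ?thesis .
  qed
  have "(%n. ennreal \<bar>conv_exp (al k) (gn (rh n)) t - conv_exp (al k) g t\<bar>) ----> 0"
   by (rule tendsto_sandwich[OF _ _ tendsto_const h0]) (auto intro!: always_eventually le)
  then have "(%n. ennreal \<bar>conv_exp (al k) (gn (rh n)) t - conv_exp (al k) g t\<bar>) ----> ennreal 0" by simp
  then have "(%n. \<bar>conv_exp (al k) (gn (rh n)) t - conv_exp (al k) g t\<bar>) ----> 0"
   by (subst (asm) tendsto_ennreal_iff) auto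
  then have "(%n. conv_exp (al k) (gn (rh n)) t - conv_exp (al k) g t) ----> 0" by (rule tendsto_rabs_zero_cancel)
  then have cc: "(%n. conv_exp (al k) (gn (rh n)) t) ----> conv_exp (al k) g t" by (rule LIM_zero_cancel)
  show ?case
   unfolding approx_coord_def mild_coord_def
   unfolding Xp_def[symmetric] gn_def[symmetric] g_def[symmetric]
   by (intro tendsto_diff tendsto_inner tendsto_const xc cc)
 qed
 show ?thesis
 proof (rule fatou_conv[where f = "%n om. (approx_coord (rh n) k t (U (rh n) om) - lam k * coord_sum (U (rh n) om) k t j)^2"])
  show "(%om. (approx_coord (rh n) k t (U (rh n) om) - lam k * coord_sum (U (rh n) om) k t j)^2) \<in> borel_measurable Om" for n
   using measurable_compose[OF U_meas approx_coord_meas] measurable_compose[OF U_meas coord_sum_measurable] by measurable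
  show "AE om in Om. (%n. (approx_coord (rh n) k t (U (rh n) om) - lam k * coord_sum (U (rh n) om) k t j)^2) ----> (mild_coord om k t - lam k * coord_sum (L om) k t j)^2"
   using conv U_conv
  proof eventually_elim
   case (elim om)
   have "(%n. U (rh n) om i) ----> L om i" for i
   using LIMSEQ_subseq_LIMSEQ[OF elim(2)[rule_format] rh, of i] by (simp add: comp_def)
   then show ?case by (intro tendsto_power tendsto_diff tendsto_mult tendsto_const elim(1) coord_sum_conv)
  qed
  show "(\<integral>\<^sup>+om. ennreal ((approx_coord (rh n) k t (U (rh n) om) - lam k * coord_sum (U (rh n) om) k t j)^2) \<partial>Om) <= ennreal (8 * (lam k)^2 * grid_error T (al k) j)" for n
   by (rule approx_coord_error[OF t])
 qed
qed

definition idx_time :: "index => real" where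
 "idx_time c = (case c of (b, j, i, k) => dy T j i)"

text \<open>Both sides are means of bounded continuous functions of finitely many coordinates, so the identity
for the approximating solutions is preserved.\<close>

lemma independence_limit:
 fixes g :: "index => real => real"
 assumes i: "i0 < i1" "i1 <= 2 ^ j" and I: "finite I" "!!c. c \<in> I ==> idx_time c <= dy T j i0"
  and g: "!!c. continuous_on UNIV (g c)" "!!c y. \<bar>g c y\<bar> <= 1"
  and ps: "continuous_on UNIV ps" "!!y. \<bar>ps y\<bar> <= 1"
 shows "(\<integral>om. ps (\<Sum>k<K. a k * (L om (False, j, i1, k) - L om (False, j, i0, k))) * (\<Prod>c\<in>I. g c (L om c)) \<partial>Om)
  = (\<integral>y. ps (sqrt ((\<Sum>k<K. (a k)^2) * (dy T j i1 - dy T j i0)) * y) \<partial>stdn) * (\<integral>om. (\<Prod>c\<in>I. g c (L om c)) \<partial>Om)"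
proof -
 note [measurable] = coord_measurable
 have [measurable]: "g c \<in> borel_measurable borel" for c by (rule borel_measurable_continuous_onI[OF g(1)])
 have psm[measurable]: "ps \<in> borel_measurable borel" by (rule borel_measurable_continuous_onI[OF ps(1)])
 have g1: "\<bar>\<Prod>c\<in>I. g c (u c)\<bar> <= 1" for u :: "index => real"
  unfolding abs_prod by (rule prod_le_1) (use g(2) in auto)
 define \<Phi> where "\<Phi> u = ps (\<Sum>k<K. a k * (u (False, j, i1, k) - u (False, j, i0, k))) * (\<Prod>c\<in>I. g c (u c))" for u :: "index => real"
 define Ga where "Ga u = (\<Prod>c\<in>I. g c (u c))" for u :: "index => real"
 have \<Phi>m[measurable]: "\<Phi> \<in> borel_measurable coord_space" unfolding \<Phi>_def[abs_def] by measurable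
 have Gam[measurable]: "Ga \<in> borel_measurable coord_space" unfolding Ga_def[abs_def] by measurable
 have b: "\<bar>\<Phi> u\<bar> <= 1" "\<bar>Ga u\<bar> <= 1" for u
 proof -
  show "\<bar>Ga u\<bar> <= 1" unfolding Ga_def by (rule g1)
  show "\<bar>\<Phi> u\<bar> <= 1" unfolding \<Phi>_def abs_mult using g1[of u] ps(2) by (intro mult_le_one) auto
 qed
 define N where "N = (\<integral>y. ps (sqrt ((\<Sum>k<K. (a k)^2) * (dy T j i1 - dy T j i0)) * y) \<partial>stdn)"
 have eq: "(\<integral>om. \<Phi> (U n om) \<partial>Om) = N * (\<integral>om. Ga (U n om) \<partial>Om)" for n
 proof -
  interpret a: approx_solution T S Q e al lam p "M n" "\<F> n" "W n" "X n" "G n" x C by (rule sols)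
  have st: "0 <= dy T j i0" "dy T j i0 < dy T j i1" "dy T j i1 <= T"
   using dy_range[OF T, of j i0] dy_range[OF T, of j i1] i T by (auto simp: dy_eq[OF T] divide_strict_right_mono)
  have cm: "(%om. coords (X n) (W n) om c) \<in> borel_measurable (\<F> n (dy T j i0))" if "c \<in> I" for c
  proof -
   obtain b j' i' k where c: "c = (b, j', i', k)" by (cases c) auto
   have le: "dy T j' i' <= dy T j i0" using I(2)[OF that] unfolding c idx_time_def by simp
   have "(%om. coords (X n) (W n) om c) \<in> borel_measurable (\<F> n (dy T j' i'))"
   using a.X_adapted[OF a.dy_in] a.W_adapted[OF a.dy_in] unfolding c coords_def by (cases b) simp_all
   then show ?thesis by (rule a.B0.filt_mono[OF a.dy_in a.dy_in le])
  qed
  have "(\<integral>om. \<Phi> (U n om) \<partial>Om) = (\<integral>om. \<Phi> (coords (X n) (W n) om) \<partial>M n)" by (rule transfer_int[OF \<Phi>m])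
  also have "... = (\<integral>om. ps (\<Sum>k<K. a k * (W n (dy T j i1) (e k) om - W n (dy T j i0) (e k) om)) * Ga (coords (X n) (W n) om) \<partial>M n)"
   unfolding \<Phi>_def Ga_def by (simp add: coords_def)
  also have "... = N * (\<integral>om. Ga (coords (X n) (W n) om) \<partial>M n)"
   unfolding N_def
  proof (rule a.increment_independence[OF st _ b(2) psm ps(2)])
   show "(%om. Ga (coords (X n) (W n) om)) \<in> borel_measurable (\<F> n (dy T j i0))"
   unfolding Ga_def by (intro borel_measurable_prod measurable_compose[OF cm]) auto
  qed
  also have "(\<integral>om. Ga (coords (X n) (W n) om) \<partial>M n) = (\<integral>om. Ga (U n om) \<partial>Om)" by (rule transfer_int[OF Gam, symmetric])
  finally show ?thesis .
 qed
 have gc: "(%n. g c (U n om c)) ----> g c (L om c)" if "(%n. U n om c) ----> L om c" for c om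
  using continuous_on_tendsto_compose[OF g(1) that] by simp
 have l1: "(%n. \<integral>om. Ga (U n om) \<partial>Om) ----> (\<integral>om. Ga (L om) \<partial>Om)"
 proof (rule integral_dominated_convergence[where w = "%_. 1"])
  show "AE om in Om. (%n. Ga (U n om)) ----> Ga (L om)"
   using U_conv
  proof eventually_elim
   case (elim om)
   show ?case unfolding Ga_def by (intro tendsto_prod gc elim[rule_format])
  qed
  show "(%om. Ga (L om)) \<in> borel_measurable Om" by (rule measurable_compose[OF L_meas Gam])
  show "(%om. Ga (U n om)) \<in> borel_measurable Om" for n by (rule measurable_compose[OF U_meas Gam])
 qed (use b in auto)
 have l2: "(%n. \<integral>om. \<Phi> (U n om) \<partial>Om) ----> (\<integral>om. \<Phi> (L om) \<partial>Om)"
 proof (rule integral_dominated_convergence[where w = "%_. 1"])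
  show "AE om in Om. (%n. \<Phi> (U n om)) ----> \<Phi> (L om)"
   using U_conv
  proof eventually_elim
   case (elim om)
   have "(%n. \<Sum>k<K. a k * (U n om (False, j, i1, k) - U n om (False, j, i0, k))) ----> (\<Sum>k<K. a k * (L om (False, j, i1, k) - L om (False, j, i0, k)))"
   by (intro tendsto_sum tendsto_mult tendsto_diff tendsto_const elim[rule_format])
   then have "(%n. ps (\<Sum>k<K. a k * (U n om (False, j, i1, k) - U n om (False, j, i0, k)))) ----> ps (\<Sum>k<K. a k * (L om (False, j, i1, k) - L om (False, j, i0, k)))"
   using continuous_on_tendsto_compose[OF ps(1)] by simp
   then show ?case unfolding \<Phi>_def by (intro tendsto_mult tendsto_prod gc elim[rule_format])
  qed
  show "(%om. \<Phi> (L om)) \<in> borel_measurable Om" by (rule measurable_compose[OF L_meas \<Phi>m])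
  show "(%om. \<Phi> (U n om)) \<in> borel_measurable Om" for n by (rule measurable_compose[OF U_meas \<Phi>m])
 qed (use b in auto)
 have "(%n. \<integral>om. \<Phi> (U n om) \<partial>Om) ----> N * (\<integral>om. Ga (L om) \<partial>Om)"
  unfolding eq by (intro tendsto_mult tendsto_const l1)
 then have "(\<integral>om. \<Phi> (L om) \<partial>Om) = N * (\<integral>om. Ga (L om) \<partial>Om)" by (rule LIMSEQ_unique[OF l2])
 then show ?thesis unfolding \<Phi>_def Ga_def N_def .
qed

lemma L_consistent: "AE om in Om. \<forall>b j i j' i' k. dy T j i = dy T j' i' --> L om (b, j, i, k) = L om (b, j', i', k)"
proof -
 have eq: "AE om in Om. U n om (b, j, i, k) = U n om (b, j', i', k)" if d: "dy T j i = dy T j' i'" for n b j i j' i' k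
 proof (rule transfer_AE[of "%u. u (b, j, i, k) = u (b, j', i', k)"])
  show "{u \<in> space coord_space. u (b, j, i, k) = u (b, j', i', k)} \<in> sets coord_space"
   by (rule borel_measurable_eq[OF coord_measurable coord_measurable])
  show "coords (X n) (W n) om (b, j, i, k) = coords (X n) (W n) om (b, j', i', k)" for om
   unfolding coords_def by (simp add: d)
 qed
 have "AE om in Om. dy T j i = dy T j' i' --> U n om (b, j, i, k) = U n om (b, j', i', k)" for n b j i j' i' k
 proof (cases "dy T j i = dy T j' i'")
  case True
  from eq[OF True, of n b k] show ?thesis by eventually_elim simp
 next
  case False
  then show ?thesis by (intro AE_I2) blast
 qed
 then have "AE om in Om. \<forall>n b j i j' i' k. dy T j i = dy T j' i' --> U n om (b, j, i, k) = U n om (b, j', i', k)"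
  by (simp only: AE_all_countable) blast
 then show ?thesis using U_conv
 proof eventually_elim
  case (elim om)
  show ?case
  proof (intro allI impI)
   fix b j i j' i' k assume d: "dy T j i = dy T j' i'"
   have "(%n. U n om (b, j, i, k)) = (%n. U n om (b, j', i', k))" using elim(1) d by blast
   then have "(%n. U n om (b, j, i, k)) ----> L om (b, j', i', k)" using elim(2) by simp
   then show "L om (b, j, i, k) = L om (b, j', i', k)" using LIMSEQ_unique elim(2)[rule_format] by blast
  qed
 qed
qed

lemma L_start: "AE om in Om. \<forall>j k. L om (False, j, 0, k) = 0"
proof -
 have "AE om in Om. U n om (False, j, 0, k) = 0" for n j k
 proof -
  interpret a: approx_solution T S Q e al lam p "M n" "\<F> n" "W n" "X n" "G n" x C by (rule sols)
  interpret Bk: brownian "M n" T "\<F> n" "%t. W n t (e k)" by (rule a.brown) (rule onb_norm[OF onb])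
  have m: "{u \<in> space coord_space. u (False, j, 0, k) ~= 0} \<in> sets coord_space"
   by (rule borel_measurable_neq[OF coord_measurable borel_measurable_const])
  have "emeasure Om {om\<in>space Om. U n om (False, j, 0, k) ~= 0} = emeasure (M n) {om\<in>space (M n). W n 0 (e k) om ~= 0}"
   using transfer_event[OF m, of n] by (simp add: coords_def dy_0[OF T])
  also have "... = 0"
  proof -
   have z: "0 \<in> {0..T}" using T by simp
   have [measurable]: "W n 0 (e k) \<in> borel_measurable (M n)" by (rule a.W_measurable[OF z])
   show ?thesis using Bk.bm_zero by (subst (asm) AE_iff_measurable) auto
  qed
  finally show ?thesis by (intro AE_I[of _ _ "{om\<in>space Om. U n om (False, j, 0, k) ~= 0}"]) auto
 qed
 then have "AE om in Om. \<forall>n j k. U n om (False, j, 0, k) = 0" by (simp only: AE_all_countable) blast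
 then show ?thesis using U_conv
 proof eventually_elim
  case (elim om)
  show ?case
  proof (intro allI)
   fix j k
   have "(%n. U n om (False, j, 0, k)) ----> L om (False, j, 0, k)" using elim(2) by blast
   then show "L om (False, j, 0, k) = 0" using elim(1) by (simp add: LIMSEQ_const_iff)
  qed
 qed
qed

end

declare coord_measurable[measurable]

section \<open>The limit Wiener process\<close>

declare coord_measurable[measurable del]

context coupled
begin

abbreviation \<Lambda> :: "index => 'v => real" where "\<Lambda> \<equiv> %c om. L om c"

definition known :: "real => index set" where "known t = {c. idx_time c <= t}"

lemma known_mono: "s <= t ==> known s \<subseteq> known t" unfolding known_def by auto

definition lin :: "nat => 'h => nat => nat => 'v => real" where
 "lin K g j i om = (\<Sum>k<K. inner g (e k) * L om (False, j, i, k))"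

lemma lin_meas[measurable]: "lin K g j i \<in> borel_measurable Om"
 unfolding lin_def[abs_def] by measurable

lemma lin_linear: "lin K (a *\<^sub>R g + b *\<^sub>R h) j i om = a * lin K g j i om + b * lin K h j i om"
 unfolding lin_def by (simp add: inner_add_left sum_distrib_left sum.distrib[symmetric] algebra_simps)

lemma lin_diff: "lin K (g - h) j i om = lin K g j i om - lin K h j i om"
 using lin_linear[of K 1 g "-1" h j i om] by simp

lemma lin_proj: "K <= N ==> lin N (proj e K h) j i om = lin K h j i om"
 unfolding lin_def proj_inner[OF onb] by (rule sum.mono_neutral_cong_right) auto

lemma coords_le_norm: "(\<Sum>k<K. (inner g (e k))^2) <= (norm g)^2"
 unfolding proj_norm[OF onb, symmetric] by (rule power_mono[OF proj_le[OF onb]]) simp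

lemma lin_incr:
 assumes "i0 < i1" "i1 <= 2 ^ j"
 shows "L.indep_gauss \<Lambda> (known (dy T j i0)) (%om. lin K h j i1 om - lin K h j i0 om)
  ((\<Sum>k<K. (inner h (e k))^2) * (dy T j i1 - dy T j i0))"
 unfolding L.indep_gauss_def
proof (intro conjI allI impI)
 show "(%om. lin K h j i1 om - lin K h j i0 om) \<in> borel_measurable Om" by measurable
next
 fix I and ps :: "real => real" and g :: "index => real => real"
 assume I: "finite I" "I \<subseteq> known (dy T j i0)" and ps: "continuous_on UNIV ps" "\<forall>y. \<bar>ps y\<bar> <= (1::real)"
  and g: "\<forall>c. continuous_on UNIV (g c)" "\<forall>c y. \<bar>g c y\<bar> <= 1"
 have eq: "lin K h j i1 om - lin K h j i0 om = (\<Sum>k<K. inner h (e k) * (L om (False, j, i1, k) - L om (False, j, i0, k)))" for om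
  unfolding lin_def sum_subtractf[symmetric] right_diff_distrib ..
 have c: "idx_time c <= dy T j i0" if "c \<in> I" for c using I(2) that unfolding known_def by blast
 show "(\<integral>om. ps (lin K h j i1 om - lin K h j i0 om) * (\<Prod>c\<in>I. g c (L om c)) \<partial>Om)
  = (\<integral>y. ps (sqrt ((\<Sum>k<K. (inner h (e k))^2) * (dy T j i1 - dy T j i0)) * y) \<partial>stdn) * (\<integral>om. (\<Prod>c\<in>I. g c (L om c)) \<partial>Om)"
  unfolding eq by (rule independence_limit[OF assms I(1) c g(1)[rule_format] g(2)[rule_format] ps(1) ps(2)[rule_format]])
qed

lemma lin_consistent: "AE om in Om. \<forall>K h j i j' i'. dy T j i = dy T j' i' --> lin K h j i om = lin K h j' i' om"
 using L_consistent
proof eventually_elim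
 case (elim om)
 show ?case unfolding lin_def using elim by (intro allI impI sum.cong refl) metis
qed

lemma lin_start: "AE om in Om. \<forall>K h j. lin K h j 0 om = 0"
 using L_start by eventually_elim (simp add: lin_def)

lemma lin_gaussian:
 assumes i: "i <= 2 ^ j"
 shows "gaussian Om (lin K h j i) ((\<Sum>k<K. (inner h (e k))^2) * dy T j i)"
proof (cases "i = 0")
 case True
 have "gaussian Om (lin K h j 0) 0"
  by (rule gaussian_AE_cong[OF gaussian_zero[OF L.prob_space_axioms] lin_meas]) (use lin_start in eventually_elim, simp)
 then show ?thesis using True by (simp add: dy_0[OF T])
next
 case False
 then have "0 < i" by simp
 from L.indep_gauss_gaussian[OF lin_incr[OF this i] Li_meas, of K h]
 have "gaussian Om (%om. lin K h j i om - lin K h j 0 om) ((\<Sum>k<K. (inner h (e k))^2) * dy T j i)" by (simp add: dy_0[OF T])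
 then show ?thesis
  by (rule gaussian_AE_cong[OF _ lin_meas]) (use lin_start in eventually_elim, simp)
qed

lemma lin_second_moment: "(\<integral>\<^sup>+om. ennreal ((lin K h j i om)^2) \<partial>Om) <= ennreal (T * (norm h)^2)"
proof -
 define i' where "i' = min i (2 ^ j)"
 have i': "i' <= 2 ^ j" "dy T j i' = dy T j i" unfolding i'_def dy_def by auto
 have "AE om in Om. ennreal ((lin K h j i om)^2) = ennreal (lin K h j i' om ^ (2 * 1))"
  using lin_consistent
 proof eventually_elim
  case (elim om)
  have "lin K h j i om = lin K h j i' om" using elim i'(2) by metis
  then show ?case by simp
 qed
 then have "(\<integral>\<^sup>+om. ennreal ((lin K h j i om)^2) \<partial>Om) = (\<integral>\<^sup>+om. ennreal (lin K h j i' om ^ (2 * 1)) \<partial>Om)"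
  by (rule nn_integral_cong_AE)
 also have "... = ennreal (gauss_moment 1 * ((\<Sum>k<K. (inner h (e k))^2) * dy T j i') ^ 1)"
  using dy_range[OF T, of j i'] by (intro gaussian_moment lin_gaussian i' mult_nonneg_nonneg sum_nonneg) auto
 also have "... <= ennreal (T * (norm h)^2)"
 proof (rule ennreal_leI)
  have "(\<Sum>k<K. (inner h (e k))^2) * dy T j i' <= (norm h)^2 * T"
   using dy_range[OF T, of j i'] by (intro mult_mono coords_le_norm) auto
  then show "gauss_moment 1 * ((\<Sum>k<K. (inner h (e k))^2) * dy T j i') ^ 1 <= T * (norm h)^2"
   by (simp add: gauss_moment_def mult.commute)
 qed
 finally show ?thesis .
qed

text \<open>The pairing with a general \<open>h\<close> is a limit of pairings with partial sums of its
expansion. The geometric rate makes the limit exist almost surely and not only in mean square.\<close>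

definition trunc :: "'h => nat => nat" where
 "trunc h l = (SOME K. norm (h - proj e K h) <= 1 / 2 ^ l)"

lemma trunc: "norm (h - proj e (trunc h l) h) <= 1 / 2 ^ l"
proof -
 have "(%K. norm (h - proj e K h)) ----> norm (h - h)" by (intro tendsto_intros proj_tendsto[OF onb])
 then have "\<forall>\<^sub>F K in sequentially. norm (h - proj e K h) < 1 / 2 ^ l" by (rule order_tendstoD(2)) simp
 then obtain K where "norm (h - proj e K h) < 1 / 2 ^ l" using eventually_happens[of _ sequentially] by fastforce
 then have "\<exists>K. norm (h - proj e K h) <= 1 / 2 ^ l" by (intro exI[of _ K]) simp
 then show ?thesis unfolding trunc_def by (rule someI_ex)
qed

lemma half_power_tendsto: "(%l. 1 / 2 ^ l :: real) ----> 0"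
 using LIMSEQ_power_zero[of "1/2 :: real"] by (simp add: power_one_over)

lemma trunc_tendsto: "(%l. proj e (trunc h l) h) ----> h"
proof -
 have "(%l. norm (h - proj e (trunc h l) h)) ----> 0"
  by (rule tendsto_sandwich[OF _ _ tendsto_const half_power_tendsto]) (auto intro!: always_eventually trunc)
 then have "(%l. h - proj e (trunc h l) h) ----> 0" by (rule tendsto_norm_zero_cancel)
 then have "(%l. h - (h - proj e (trunc h l) h)) ----> h - 0" by (intro tendsto_diff tendsto_const)
 then show ?thesis by simp
qed

definition wn :: "'h => nat => nat => nat => 'v => real" where
 "wn h l j i = lin (trunc h l) h j i"

definition Wg :: "'h => nat => nat => 'v => real" where
 "Wg h j i om = lim (%l. wn h l j i om)"

lemma wn_meas[measurable]: "wn h l j i \<in> borel_measurable Om" unfolding wn_def by (rule lin_meas)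

lemma Wg_meas[measurable]: "Wg h j i \<in> borel_measurable Om"
 unfolding Wg_def[abs_def] by (rule borel_measurable_lim_metric[OF wn_meas])

lemma wn_lin: "trunc h l <= N ==> wn h l j i om = lin N (proj e (trunc h l) h) j i om"
 unfolding wn_def by (simp only: lin_proj)

lemma wn_step:
 "(\<integral>\<^sup>+om. ennreal \<bar>wn h (Suc l) j i om - wn h l j i om\<bar> \<partial>Om) <= ennreal ((4 * T + 1) * (1 / 2) ^ l)"
proof -
 define N where "N = max (trunc h (Suc l)) (trunc h l)"
 define g where "g = proj e (trunc h (Suc l)) h - proj e (trunc h l) h"
 have d: "wn h (Suc l) j i om - wn h l j i om = lin N g j i om" for om
  unfolding g_def lin_diff by (simp add: wn_lin[of h "Suc l" N] wn_lin[of h l N] N_def)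
 have "norm g <= norm (h - proj e (trunc h l) h) + norm (h - proj e (trunc h (Suc l)) h)"
  unfolding g_def using norm_triangle_ineq4[of "h - proj e (trunc h l) h" "h - proj e (trunc h (Suc l)) h"] by simp
 also have "... <= 1 / 2 ^ l + 1 / 2 ^ Suc l" by (intro add_mono trunc)
 also have "... <= 2 / 2 ^ l" by (simp add: field_simps)
 finally have g: "(norm g)^2 <= (2 / 2 ^ l)^2" by (rule power_mono) simp
 have pw: "\<bar>y\<bar> <= 2 ^ l * y\<^sup>2 + 1 / 2 ^ l" for y :: real
 proof -
  have "0 <= (2 ^ l * \<bar>y\<bar> - 1)^2" by simp
  then have "2 * (2 ^ l * \<bar>y\<bar>) <= (2 ^ l * \<bar>y\<bar>)^2 + 1" by (simp add: power2_diff)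
  then have "2 ^ l * \<bar>y\<bar> <= (2 ^ l * \<bar>y\<bar>)^2 + 1" using zero_le_power[of "2::real" l] mult_nonneg_nonneg[of "2 ^ l" "\<bar>y\<bar>"] by linarith
  then have "\<bar>y\<bar> <= ((2 ^ l * \<bar>y\<bar>)^2 + 1) / 2 ^ l" by (simp add: pos_le_divide_eq mult.commute)
  also have "... = 2 ^ l * y\<^sup>2 + 1 / 2 ^ l" by (simp add: add_divide_distrib power_mult_distrib power2_eq_square)
  finally show ?thesis .
 qed
 have "(\<integral>\<^sup>+om. ennreal \<bar>wn h (Suc l) j i om - wn h l j i om\<bar> \<partial>Om) <= (\<integral>\<^sup>+om. ennreal (2 ^ l) * ennreal ((lin N g j i om)^2) + ennreal (1 / 2 ^ l) \<partial>Om)"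
 proof (rule nn_integral_mono)
  fix om
  have "ennreal \<bar>lin N g j i om\<bar> <= ennreal (2 ^ l * (lin N g j i om)^2 + 1 / 2 ^ l)" by (rule ennreal_leI[OF pw])
  also have "... = ennreal (2 ^ l) * ennreal ((lin N g j i om)^2) + ennreal (1 / 2 ^ l)"
   by (subst ennreal_plus) (auto simp: ennreal_mult)
  finally show "ennreal \<bar>wn h (Suc l) j i om - wn h l j i om\<bar> <= ennreal (2 ^ l) * ennreal ((lin N g j i om)^2) + ennreal (1 / 2 ^ l)"
   unfolding d .
 qed
 also have "... = ennreal (2 ^ l) * (\<integral>\<^sup>+om. ennreal ((lin N g j i om)^2) \<partial>Om) + ennreal (1 / 2 ^ l)"
  by (simp add: nn_integral_add nn_integral_cmult L.emeasure_space_1)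
 also have "... <= ennreal (2 ^ l) * ennreal (T * (norm g)^2) + ennreal (1 / 2 ^ l)"
  by (intro add_mono mult_left_mono lin_second_moment order_refl zero_le)
 also have "... = ennreal (2 ^ l * (T * (norm g)^2) + 1 / 2 ^ l)"
  using T by (subst ennreal_plus) (auto simp: ennreal_mult)
 also have "... <= ennreal ((4 * T + 1) * (1 / 2) ^ l)"
 proof (rule ennreal_leI)
  have "2 ^ l * (T * (norm g)^2) <= 2 ^ l * (T * (2 / 2 ^ l)^2)" using g T by (intro mult_left_mono) auto
  also have "... = 4 * T * (1 / 2) ^ l" by (simp add: power_one_over power2_eq_square field_simps)
  finally show "2 ^ l * (T * (norm g)^2) + 1 / 2 ^ l <= (4 * T + 1) * (1 / 2) ^ l"
   by (simp add: power_one_over distrib_right add_divide_distrib)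
 qed
 finally show ?thesis .
qed

lemma wn_conv: "AE om in Om. \<forall>j i. (%l. wn h l j i om) ----> Wg h j i om"
proof -
 have "AE om in Om. (%l. wn h l j i om) ----> Wg h j i om" for j i
 proof -
  let ?d = "%l om. wn h (Suc l) j i om - wn h l j i om"
  have s: "(%l. (4 * T + 1) * (1 / 2) ^ l) sums ((4 * T + 1) * (1 / (1 - 1 / 2)))"
   by (intro sums_mult geometric_sums) simp
  have "(\<integral>\<^sup>+om. (\<Sum>l. ennreal \<bar>?d l om\<bar>) \<partial>Om) = (\<Sum>l. \<integral>\<^sup>+om. ennreal \<bar>?d l om\<bar> \<partial>Om)"
   by (rule nn_integral_suminf) measurable
  also have "... <= (\<Sum>l. ennreal ((4 * T + 1) * (1 / 2) ^ l))" by (rule suminf_le[OF wn_step summableI summableI])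
  also have "... = ennreal ((4 * T + 1) * (1 / (1 - 1 / 2)))"
   by (rule suminf_ennreal_eq[OF _ s]) (use T in auto)
  finally have "(\<integral>\<^sup>+om. (\<Sum>l. ennreal \<bar>?d l om\<bar>) \<partial>Om) < \<infinity>" unfolding infinity_ennreal_def by (rule le_less_trans[OF _ ennreal_less_top])
  then have "(\<integral>\<^sup>+om. (\<Sum>l. ennreal \<bar>?d l om\<bar>) \<partial>Om) ~= \<infinity>" by (rule less_imp_neq)
  then have "AE om in Om. (\<Sum>l. ennreal \<bar>?d l om\<bar>) ~= \<infinity>" by (intro nn_integral_PInf_AE) measurable
  then show ?thesis
  proof eventually_elim
   case (elim om)
   then have "summable (%l. \<bar>?d l om\<bar>)"
   unfolding infinity_ennreal_def by (rule summable_suminf_not_top[OF abs_ge_zero])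
   then have "summable (%l. ?d l om)" by (rule summable_rabs_cancel)
   then have "(%n. \<Sum>l<n. ?d l om) ----> (\<Sum>l. ?d l om)" by (rule summable_LIMSEQ)
   then have "(%n. wn h n j i om - wn h 0 j i om) ----> (\<Sum>l. ?d l om)" unfolding sum_lessThan_telescope[of "%l. wn h l j i om"] .
   then have "(%n. (wn h n j i om - wn h 0 j i om) + wn h 0 j i om) ----> (\<Sum>l. ?d l om) + wn h 0 j i om"
   by (intro tendsto_add tendsto_const)
   then have "convergent (%n. wn h n j i om)" unfolding convergent_def by auto
   then show ?case unfolding Wg_def by (simp only: convergent_LIMSEQ_iff)
  qed
 qed
 then show ?thesis by (simp add: AE_all_countable)
qed

lemma Wg_incr:
 assumes "i0 < i1" "i1 <= 2 ^ j"
 shows "L.indep_gauss \<Lambda> (known (dy T j i0)) (%om. Wg h j i1 om - Wg h j i0 om) ((norm h)^2 * (dy T j i1 - dy T j i0))"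
proof (rule L.indep_gauss_limit[where Z = "%l om. wn h l j i1 om - wn h l j i0 om"])
 show "L.indep_gauss \<Lambda> (known (dy T j i0)) (%om. wn h l j i1 om - wn h l j i0 om)
   ((norm (proj e (trunc h l) h))^2 * (dy T j i1 - dy T j i0))" for l
  unfolding wn_def proj_norm[OF onb] by (rule lin_incr[OF assms])
 show "(%om. Wg h j i1 om - Wg h j i0 om) \<in> borel_measurable Om" by measurable
 show "AE om in Om. (%l. wn h l j i1 om - wn h l j i0 om) ----> Wg h j i1 om - Wg h j i0 om"
  using wn_conv[of h] by eventually_elim (intro tendsto_diff, auto)
 show "(%l. (norm (proj e (trunc h l) h))^2 * (dy T j i1 - dy T j i0)) ----> (norm h)^2 * (dy T j i1 - dy T j i0)"
  by (intro tendsto_intros trunc_tendsto)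
qed (rule Li_meas)

lemma Wg_linear: "AE om in Om. \<forall>j i. Wg (a *\<^sub>R g + b *\<^sub>R h) j i om = a * Wg g j i om + b * Wg h j i om"
proof -
 have "AE om in Om. Wg (a *\<^sub>R g + b *\<^sub>R h) j i om = a * Wg g j i om + b * Wg h j i om" for j i
 proof -
  define f where "f = a *\<^sub>R g + b *\<^sub>R h"
  define R where "R l om = wn f l j i om - (a * wn g l j i om + b * wn h l j i om)" for l om
  define P where "P l = proj e (trunc f l) f - (a *\<^sub>R proj e (trunc g l) g + b *\<^sub>R proj e (trunc h l) h)" for l
  have [measurable]: "R l \<in> borel_measurable Om" for l unfolding R_def[abs_def] by measurable
  have RP: "R l om = lin (max (trunc f l) (max (trunc g l) (trunc h l))) (P l) j i om" for l om
   unfolding R_def P_def lin_diff lin_linear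
   by (simp add: wn_lin[of f l "max (trunc f l) (max (trunc g l) (trunc h l))"]
   wn_lin[of g l "max (trunc f l) (max (trunc g l) (trunc h l))"] wn_lin[of h l "max (trunc f l) (max (trunc g l) (trunc h l))"])
  have "P ----> f - (a *\<^sub>R g + b *\<^sub>R h)" unfolding P_def by (intro tendsto_intros trunc_tendsto)
  then have "(%l. T * (norm (P l))^2) ----> T * (norm (f - (a *\<^sub>R g + b *\<^sub>R h)))^2" by (intro tendsto_intros)
  then have "(%l. T * (norm (P l))^2) ----> 0" unfolding f_def by simp
  then have "(%l. ennreal (T * (norm (P l))^2)) ----> ennreal 0" by (rule tendsto_ennrealI)
  then have z: "(%l. ennreal (T * (norm (P l))^2)) ----> 0" by simp
  have "(\<integral>\<^sup>+om. ennreal ((R l om)^2) \<partial>Om) <= ennreal (T * (norm (P l))^2)" for l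
   unfolding RP by (rule lin_second_moment)
  then have "(%l. \<integral>\<^sup>+om. ennreal ((R l om)^2) \<partial>Om) ----> 0"
   by (intro tendsto_sandwich[OF _ _ tendsto_const z]) (auto intro!: always_eventually)
  from nn_L1_AE_subseq[OF _ _ this]
  obtain r where r: "strict_mono r" "AE om in Om. (%l. (R (r l) om)^2) ----> 0" by auto
  show ?thesis
   using r(2) wn_conv[of f] wn_conv[of g] wn_conv[of h]
  proof eventually_elim
   case (elim om)
   have "(%l. (R l om)^2) ----> (Wg f j i om - (a * Wg g j i om + b * Wg h j i om))^2"
   unfolding R_def using elim(2-4) by (intro tendsto_intros) blast+
   from LIMSEQ_subseq_LIMSEQ[OF this r(1)]
   have "(%l. (R (r l) om)^2) ----> (Wg f j i om - (a * Wg g j i om + b * Wg h j i om))^2" by (simp add: comp_def)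
   from LIMSEQ_unique[OF this elim(1)] show ?case unfolding f_def by simp
  qed
 qed
 then show ?thesis by (simp add: AE_all_countable)
qed

lemma Wg_basis: "Wg (e k) j i om = L om (False, j, i, k)"
proof -
 have "wn (e k) l j i om = L om (False, j, i, k)" if l: "1 <= l" for l
 proof -
  let ?K = "trunc (e k) l"
  have "k < ?K"
  proof (rule ccontr)
   assume "\<not> k < ?K"
   then have "proj e ?K (e k) = 0" unfolding proj_def by (intro sum.neutral) (auto simp: onb_inner[OF onb])
   then have "1 <= 1 / (2::real) ^ l" using trunc[of "e k" l] by (simp add: onb_norm[OF onb])
   moreover have "(2::real) ^ 1 <= 2 ^ l" using l by (rule power_increasing) simp
   ultimately show False by (simp add: field_simps)
  qed
  moreover have "wn (e k) l j i om = (\<Sum>k'<?K. if k' = k then L om (False, j, i, k) else 0)"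
   unfolding wn_def lin_def by (rule sum.cong) (auto simp: onb_inner[OF onb])
  ultimately show ?thesis by simp
 qed
 then have "\<forall>\<^sub>F l in sequentially. wn (e k) l j i om = L om (False, j, i, k)" by (intro eventually_sequentiallyI[of 1])
 then have "(%l. wn (e k) l j i om) ----> L om (False, j, i, k)" by (rule tendsto_eventually)
 then show ?thesis unfolding Wg_def by (rule limI)
qed

lemma Wg_consistent: "AE om in Om. \<forall>j i j' i'. dy T j i = dy T j' i' --> Wg h j i om = Wg h j' i' om"
 using lin_consistent
proof eventually_elim
 case (elim om)
 show ?case
 proof (intro allI impI)
  fix j i j' i' assume "dy T j i = dy T j' i'"
  then have "wn h l j i om = wn h l j' i' om" for l unfolding wn_def using elim by blast
  then show "Wg h j i om = Wg h j' i' om" unfolding Wg_def by simp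
 qed
qed

lemma Wg_start: "AE om in Om. \<forall>j. Wg h j 0 om = 0"
 using lin_start
proof eventually_elim
 case (elim om)
 have "wn h l j 0 om = 0" for l j unfolding wn_def using elim by blast
 then show ?case unfolding Wg_def by (simp add: limI)
qed

definition rep :: "real => nat \<times> nat" where
 "rep q = (SOME z. snd z <= 2 ^ fst z & q = dy T (fst z) (snd z))"

lemma rep: "q \<in> dyadics T ==> snd (rep q) <= 2 ^ fst (rep q) & q = dy T (fst (rep q)) (snd (rep q))"
 unfolding rep_def
proof (rule someI_ex)
 assume "q \<in> dyadics T"
 then obtain j i where "i <= 2 ^ j" "q = dy T j i" by (rule dyadics_cases[OF T])
 then show "\<exists>z. snd z <= 2 ^ fst z & q = dy T (fst z) (snd z)" by (intro exI[of _ "(j, i)"]) simp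
qed

definition Wq :: "'h => real => 'v => real" where
 "Wq h q = Wg h (fst (rep q)) (snd (rep q))"

lemma Wq_eq: "AE om in Om. \<forall>j i. Wq h (dy T j i) om = Wg h j i om"
 using Wg_consistent[of h]
proof eventually_elim
 case (elim om)
 have "dy T (fst (rep (dy T j i))) (snd (rep (dy T j i))) = dy T j i" for j i
  using rep[OF dy_in_dyadics, of j i] by simp
 then show ?case using elim unfolding Wq_def by blast
qed

lemma Wq_moment:
 assumes q: "q \<in> dyadics T" "q' \<in> dyadics T" "q < q'"
 shows "(\<integral>\<^sup>+om. ennreal (norm (Wq h q' om - Wq h q om) ^ (2 * 2)) \<partial>Om) <= ennreal (gauss_moment 2 * (norm h)^4 * (q' - q)^2)"
proof -
 obtain j1 i1 where 1: "i1 <= 2 ^ j1" "q = dy T j1 i1" by (rule dyadics_cases[OF T q(1)])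
 obtain j2 i2 where 2: "i2 <= 2 ^ j2" "q' = dy T j2 i2" by (rule dyadics_cases[OF T q(2)])
 define J a b where "J = j1 + j2" and "a = 2 ^ j2 * i1" and "b = 2 ^ j1 * i2"
 have qa: "q = dy T J a" unfolding J_def a_def 1 by (rule dy_refine[OF T, symmetric])
 have qb: "q' = dy T J b" unfolding J_def b_def 2 add.commute[of j1 j2] by (rule dy_refine[OF T, symmetric])
 have b: "b <= 2 ^ J" unfolding b_def J_def power_add using 2(1) by simp
 have ab: "a < b" using q(3) dy_mono[OF T, of b a J] unfolding qa qb by (meson not_less)
 have G: "gaussian Om (%om. Wg h J b om - Wg h J a om) ((norm h)^2 * (dy T J b - dy T J a))"
  by (rule L.indep_gauss_gaussian[OF Wg_incr[OF ab b] Li_meas])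
 have "AE om in Om. ennreal (norm (Wq h q' om - Wq h q om) ^ (2 * 2)) = ennreal ((Wg h J b om - Wg h J a om) ^ (2 * 2))"
  using Wq_eq[of h] by eventually_elim (simp add: qa qb power_even_abs)
 then have "(\<integral>\<^sup>+om. ennreal (norm (Wq h q' om - Wq h q om) ^ (2 * 2)) \<partial>Om) = (\<integral>\<^sup>+om. ennreal ((Wg h J b om - Wg h J a om) ^ (2 * 2)) \<partial>Om)"
  by (rule nn_integral_cong_AE)
 also have "... = ennreal (gauss_moment 2 * ((norm h)^2 * (q' - q)) ^ 2)"
  using gaussian_moment[OF G, of 2] q(3) unfolding qa[symmetric] qb[symmetric] by simp
 also have "((norm h)^2 * (q' - q)) ^ 2 = (norm h)^4 * (q' - q)^2" by (simp add: power_mult_distrib flip: power_mult)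
 finally show ?thesis by (simp add: mult.assoc)
qed

text \<open>Kolmogorov's argument with the fourth moment of Gaussian increments.\<close>

lemma Wg_modulus: "AE om in Om. grid_modulus T (%j i. Wg h j i om)"
proof (rule modulus_AE[OF Wg_meas])
 fix ep et :: real assume eps: "0 < ep" "0 < et"
 define C where "C = gauss_moment 2 * (norm h)^4"
 have C: "0 <= C" unfolding C_def using gauss_moment_pos[of 2] by simp
 have Wm: "\<forall>q\<in>dyadics T. Wq h q \<in> borel_measurable Om" unfolding Wq_def by (intro ballI Wg_meas)
 have mom: "\<forall>q\<in>dyadics T. \<forall>q'\<in>dyadics T. (\<integral>\<^sup>+om. ennreal (norm (Wq h q' om - Wq h q om) ^ (2 * 2)) \<partial>Om) <= ennreal (C * (q' - q)^2)"
 proof (intro ballI)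
  fix q q' assume q: "q \<in> dyadics T" "q' \<in> dyadics T"
  consider "q < q'" | "q = q'" | "q' < q" by linarith
  then show "(\<integral>\<^sup>+om. ennreal (norm (Wq h q' om - Wq h q om) ^ (2 * 2)) \<partial>Om) <= ennreal (C * (q' - q)^2)"
  proof cases
   case 1 show ?thesis unfolding C_def by (rule Wq_moment[OF q 1])
  next
   case 2 then show ?thesis by simp
  next
   case 3
   have "(\<integral>\<^sup>+om. ennreal (norm (Wq h q om - Wq h q' om) ^ (2 * 2)) \<partial>Om) <= ennreal (C * (q - q')^2)"
   unfolding C_def by (rule Wq_moment[OF q(2,1) 3])
   then show ?thesis by (simp only: norm_minus_commute[of "Wq h q' _"] power2_commute[of q' q])
  qed
 qed
 have K: "\<exists>dl>0. \<forall>(M :: 'v measure) (Z :: real => 'v => real).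
  (\<forall>q\<in>dyadics T. Z q \<in> borel_measurable M) \<longrightarrow>
  (\<forall>q\<in>dyadics T. \<forall>q'\<in>dyadics T. (\<integral>\<^sup>+om. ennreal (norm (Z q' om - Z q om) ^ (2 * 2)) \<partial>M) <= ennreal (C * (q' - q)^2)) \<longrightarrow>
  emeasure M {om\<in>space M. \<exists>q\<in>dyadics T. \<exists>q'\<in>dyadics T. \<bar>q - q'\<bar> < dl & ep < norm (Z q' om - Z q om)} <= ennreal et"
  by (rule kolmogorov_modulus[OF T _ C eps]) simp
 then obtain dl where dl: "0 < dl" and m: "emeasure Om {om\<in>space Om. \<exists>q\<in>dyadics T. \<exists>q'\<in>dyadics T. \<bar>q - q'\<bar> < dl & ep < norm (Wq h q' om - Wq h q om)} <= ennreal et"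
  using Wm mom by blast
 have "emeasure Om {om\<in>space Om. \<exists>j i j' i'. \<bar>dy T j i - dy T j' i'\<bar> < dl & ep < norm (Wg h j' i' om - Wg h j i om)}
  <= emeasure Om {om\<in>space Om. \<exists>q\<in>dyadics T. \<exists>q'\<in>dyadics T. \<bar>q - q'\<bar> < dl & ep < norm (Wq h q' om - Wq h q om)}"
 proof (rule emeasure_mono_AE)
  show "AE om in Om. om \<in> {om\<in>space Om. \<exists>j i j' i'. \<bar>dy T j i - dy T j' i'\<bar> < dl & ep < norm (Wg h j' i' om - Wg h j i om)} \<longrightarrow>
   om \<in> {om\<in>space Om. \<exists>q\<in>dyadics T. \<exists>q'\<in>dyadics T. \<bar>q - q'\<bar> < dl & ep < norm (Wq h q' om - Wq h q om)}"
   using Wq_eq[of h]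
  proof eventually_elim
   case (elim om)
   show ?case
   proof
   assume "om \<in> {om\<in>space Om. \<exists>j i j' i'. \<bar>dy T j i - dy T j' i'\<bar> < dl & ep < norm (Wg h j' i' om - Wg h j i om)}"
   then obtain j i j' i' where w: "om \<in> space Om" and d: "\<bar>dy T j i - dy T j' i'\<bar> < dl" "ep < norm (Wg h j' i' om - Wg h j i om)" by blast
   have "ep < norm (Wq h (dy T j' i') om - Wq h (dy T j i) om)" using d(2) elim by simp
   then show "om \<in> {om\<in>space Om. \<exists>q\<in>dyadics T. \<exists>q'\<in>dyadics T. \<bar>q - q'\<bar> < dl & ep < norm (Wq h q' om - Wq h q om)}"
   using w d(1) by (intro CollectI conjI bexI[of _ "dy T j i"] bexI[of _ "dy T j' i'"] dy_in_dyadics)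
   qed
  qed
  show "{om\<in>space Om. \<exists>q\<in>dyadics T. \<exists>q'\<in>dyadics T. \<bar>q - q'\<bar> < dl & ep < norm (Wq h q' om - Wq h q om)} \<in> sets Om"
   by (rule modulus_event_sets[unfolded modulus_event_def]) (use Wm in blast)
 qed
 then have "emeasure Om {om\<in>space Om. \<exists>j i j' i'. \<bar>dy T j i - dy T j' i'\<bar> < dl & ep < norm (Wg h j' i' om - Wg h j i om)} <= ennreal et"
  using m by (rule order_trans)
 then show "\<exists>dl>0. emeasure Om {om\<in>space Om. \<exists>j i j' i'. \<bar>dy T j i - dy T j' i'\<bar> < dl & ep < norm (Wg h j' i' om - Wg h j i om)} <= ennreal et"
  using dl by blast
qed

definition Wb :: "real => 'h => 'v => real" where
 "Wb t h om = lim (%j. Wg h j (lo T j t) om)"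

lemma Wb_facts: "AE om in Om. \<exists>g. continuous_on {0..T} g & (\<forall>j i. g (dy T j i) = Wg h j i om) & (\<forall>t\<in>{0..T}. Wb t h om = g t)
  & (\<forall>t\<in>{0..T}. (%j. Wg h j (lo T j t) om) ----> Wb t h om)"
 using Wg_modulus[of h]
proof eventually_elim
 case (elim om)
 obtain g where g: "continuous_on {0..T} g" "!!j i. g (dy T j i) = Wg h j i om"
  "!!t. t \<in> {0..T} ==> (%j. Wg h j (lo T j t) om) ----> g t" by (rule dyadic_extension[OF T elim]) blast
 have eq: "Wb t h om = g t" if "t \<in> {0..T}" for t unfolding Wb_def by (rule limI[OF g(3)[OF that]])
 show ?case
 proof (intro exI[of _ g] conjI allI ballI)
  show "(%j. Wg h j (lo T j t) om) ----> Wb t h om" if "t \<in> {0..T}" for t using g(3)[OF that] eq[OF that] by simp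
 qed (use g(1,2) eq in auto)
qed

definition Fb :: "real => 'v measure" where "Fb t = L.aug \<Lambda> (known t)"

lemma hist_coord: "dy T j i <= t ==> (%om. L om (b, j, i, k)) \<in> borel_measurable (sigma (space Om) (L.hist \<Lambda> (known t)))"
 by (rule L.hist_measurable[of "(b, j, i, k)" _ \<Lambda>]) (simp add: known_def idx_time_def)

lemma Wb_hist:
 assumes t: "t \<in> {0..T}"
 shows "Wb t h \<in> borel_measurable (sigma (space Om) (L.hist \<Lambda> (known t)))"
proof -
 have "dy T j (lo T j t) <= t" for j using t by (intro dy_lo(1)[OF T]) auto
 then show ?thesis
  unfolding Wb_def[abs_def] Wg_def wn_def lin_def
  by (intro borel_measurable_lim_metric borel_measurable_sum borel_measurable_times borel_measurable_const hist_coord)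
qed

lemma Wb_meas: "t \<in> {0..T} ==> Wb t h \<in> borel_measurable Om"
 by (rule L.hist_measurable_M[OF Li_meas Wb_hist])

lemma Wb_adapted: "t \<in> {0..T} ==> Wb t h \<in> borel_measurable (Fb t)"
 unfolding Fb_def by (rule L.aug_measurable[OF Wb_meas Wb_hist]) auto

lemma Xlim_adapted:
 assumes t: "t \<in> {0..T}"
 shows "Xlim t \<in> borel_measurable (Fb t)"
 unfolding Fb_def
proof (rule L.aug_measurable[OF Xlim_meas])
 have le: "dy T j (lo T j t) <= t" for j using t by (intro dy_lo(1)[OF T]) auto
 have "(%om. \<Sum>k. L om (True, j, lo T j t, k) *\<^sub>R e k) \<in> borel_measurable (sigma (space Om) (L.hist \<Lambda> (known t)))" for j
  using hist_coord[OF le] by measurable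
 then show "(%om. lim (%j. \<xi> j (lo T j t) om)) \<in> borel_measurable (sigma (space Om) (L.hist \<Lambda> (known t)))"
  unfolding \<xi>_def grid_point_def by (rule borel_measurable_lim_metric)
 show "AE om in Om. Xlim t om = lim (%j. \<xi> j (lo T j t) om)"
  using AE_Good by eventually_elim (simp add: Xlim_def)
qed

text \<open>Approximation from the right at \<open>s\<close> and from the left at \<open>t\<close>, so that
the past up to \<open>s\<close> is contained in the past of the dyadic increments.\<close>

lemma Wb_incr:
 assumes st: "0 <= s" "s < t" "t <= T"
 shows "L.indep_gauss \<Lambda> (known s) (%om. Wb t h om - Wb s h om) ((norm h)^2 * (t - s))"
proof -
 have sT: "s \<in> {0..T}" "t \<in> {0..T}" using st by auto
 define a where "a j = Suc (lo T j s)" for j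
 define b where "b j = lo T j t" for j
 have bl: "(%j. dy T j (b j)) ----> t" unfolding b_def using st by (intro dy_lo_tendsto[OF T]) auto
 have sl: "(%j. dy T j (lo T j s)) ----> s" using st by (intro dy_lo_tendsto[OF T]) auto
 have sl2: "(%j. dy T j (lo T j s) + T / 2 ^ j) ----> s + 0" by (intro tendsto_add sl T_over_pow_tendsto[OF T])
 have al: "(%j. dy T j (a j)) ----> s"
 proof (rule tendsto_sandwich[OF _ _ sl])
  show "(%j. dy T j (lo T j s) + T / 2 ^ j) ----> s" using sl2 by simp
  show "\<forall>\<^sub>F j in sequentially. dy T j (lo T j s) <= dy T j (a j)" unfolding a_def by (intro always_eventually allI dy_mono[OF T]) simp
  show "\<forall>\<^sub>F j in sequentially. dy T j (a j) <= dy T j (lo T j s) + T / 2 ^ j" unfolding a_def by (intro always_eventually allI dy_step[OF T])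
 qed
 have mid: "s < (s + t) / 2" "(s + t) / 2 < t" using st by auto
 have "\<forall>\<^sub>F j in sequentially. dy T j (a j) < (s + t) / 2 & (s + t) / 2 < dy T j (b j)"
  by (intro eventually_conj order_tendstoD(2)[OF al mid(1)] order_tendstoD(1)[OF bl mid(2)])
 then obtain N where N: "!!j. N <= j ==> dy T j (a j) < dy T j (b j)" unfolding eventually_sequentially by force
 have ab: "a j < b j" if "N <= j" for j using N[OF that] dy_mono[OF T, of "b j" "a j" j] by (meson not_less)
 have b2: "b j <= 2 ^ j" for j unfolding b_def using st by (intro lo_le[OF T]) auto
 have sa: "s <= dy T j (a j)" if "N <= j" for j
 proof -
  have aj: "a j <= 2 ^ j" "lo T j s <= 2 ^ j" using ab[OF that] b2[of j] unfolding a_def by auto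
  have "s < dy T j (lo T j s) + T / 2 ^ j" using st by (intro dy_lo(2)[OF T]) auto
  also have "... = dy T j (a j)" unfolding dy_eq[OF T aj(1)] dy_eq[OF T aj(2)] by (simp add: a_def add_divide_distrib distrib_left)
  finally show ?thesis by simp
 qed
 show ?thesis
 proof (rule L.indep_gauss_limit[where Z = "%n om. Wg h (n + N) (b (n + N)) om - Wg h (n + N) (a (n + N)) om"])
  fix n
  have nN: "N <= n + N" by simp
  show "L.indep_gauss \<Lambda> (known s) (%om. Wg h (n + N) (b (n + N)) om - Wg h (n + N) (a (n + N)) om)
   ((norm h)^2 * (dy T (n + N) (b (n + N)) - dy T (n + N) (a (n + N))))"
   by (rule L.indep_gauss_mono[OF Wg_incr[OF ab[OF nN] b2] known_mono[OF sa[OF nN]]])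
 next
  show "(%om. Wb t h om - Wb s h om) \<in> borel_measurable Om" by (rule borel_measurable_diff[OF Wb_meas[OF sT(2)] Wb_meas[OF sT(1)]])
  show "(%n. (norm h)^2 * (dy T (n + N) (b (n + N)) - dy T (n + N) (a (n + N)))) ----> (norm h)^2 * (t - s)"
   by (intro tendsto_mult tendsto_const tendsto_diff LIMSEQ_ignore_initial_segment[OF bl] LIMSEQ_ignore_initial_segment[OF al])
  show "AE om in Om. (%n. Wg h (n + N) (b (n + N)) om - Wg h (n + N) (a (n + N)) om) ----> Wb t h om - Wb s h om"
   using Wb_facts[of h]
  proof eventually_elim
   case (elim om)
   then obtain g where g: "continuous_on {0..T} g" "!!j i. g (dy T j i) = Wg h j i om" "!!t. t \<in> {0..T} ==> Wb t h om = g t" by blast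
   have "(%j. g (dy T j (b j))) ----> g t"
   by (rule continuous_on_tendsto_compose[OF g(1) bl sT(2)]) (intro always_eventually allI dy_range[OF T])
   moreover have "(%j. g (dy T j (a j))) ----> g s"
   by (rule continuous_on_tendsto_compose[OF g(1) al sT(1)]) (intro always_eventually allI dy_range[OF T])
   ultimately have "(%j. Wg h j (b j) om - Wg h j (a j) om) ----> Wb t h om - Wb s h om"
   unfolding g(2) g(3)[OF sT(1)] g(3)[OF sT(2)] by (rule tendsto_diff)
   then show ?case by (rule LIMSEQ_ignore_initial_segment)
  qed
 qed (rule Li_meas)
qed

lemma filtered: "filtered_prob_space T Om Fb"
 unfolding filtered_prob_space_def Fb_def
 using L.prob_space_axioms L.subalgebra_aug[of \<Lambda>] L.aug_mono[OF known_mono, of _ _ \<Lambda>] by blast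

lemma Wb_brownian:
 assumes h: "norm h = 1"
 shows "brownian_motion T Om Fb (%t. Wb t h)"
 unfolding brownian_motion_def
proof (intro conjI ballI allI impI)
 show "Wb t h \<in> borel_measurable (Fb t)" if "t \<in> {0..T}" for t by (rule Wb_adapted[OF that])
 show "AE om in Om. Wb 0 h om = 0"
  using Wg_start[of h]
 proof eventually_elim
  case (elim om)
  have "lo T j 0 = 0" for j by (simp add: lo_def)
  then show ?case unfolding Wb_def using elim by (simp add: limI)
 qed
 show "AE om in Om. continuous_on {0..T} (%t. Wb t h om)"
  using Wb_facts[of h]
 proof eventually_elim
  case (elim om)
  then obtain g where g: "continuous_on {0..T} g" "!!t. t \<in> {0..T} ==> Wb t h om = g t" by blast
  show ?case by (rule continuous_on_eq[OF g(1)]) (simp add: g(2))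
 qed
 fix s t assume st: "0 <= s & s < t & t <= T"
 then have sT: "s \<in> {0..T}" "t \<in> {0..T}" by auto
 have G: "L.indep_gauss \<Lambda> (known s) (%om. Wb t h om - Wb s h om) (t - s)"
  using Wb_incr[of s t h] st h by simp
 have m: "(%om. Wb t h om - Wb s h om) \<in> borel_measurable Om" by (rule L.indep_gauss_measurable[OF G])
 have "0 < t - s" using st by simp
 from gaussian_iff_distributed[OF this m] L.indep_gauss_gaussian[OF G Li_meas]
 show "distributed Om lborel (%om. Wb t h om - Wb s h om) (normal_density 0 (sqrt (t - s)))" by blast
 show "L.indep_set (sets (Fb s)) {(%om. Wb t h om - Wb s h om) -` B \<inter> space Om |B. B \<in> sets borel}"
  unfolding Fb_def by (rule L.indep_gauss_aug[OF G Li_meas])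
qed

lemma Wb_linear:
 assumes t: "t \<in> {0..T}"
 shows "AE om in Om. Wb t (a *\<^sub>R g + b *\<^sub>R h) om = a * Wb t g om + b * Wb t h om"
 using Wg_linear[of a g b h] Wb_facts[of "a *\<^sub>R g + b *\<^sub>R h"] Wb_facts[of g] Wb_facts[of h]
proof eventually_elim
 case (elim om)
 have l: "(%j. Wg (a *\<^sub>R g + b *\<^sub>R h) j (lo T j t) om) ----> Wb t (a *\<^sub>R g + b *\<^sub>R h) om"
  "(%j. Wg g j (lo T j t) om) ----> Wb t g om" "(%j. Wg h j (lo T j t) om) ----> Wb t h om"
  using elim(2-4) t by blast+
 have "(%j. a * Wg g j (lo T j t) om + b * Wg h j (lo T j t) om) ----> a * Wb t g om + b * Wb t h om"
  by (intro tendsto_add tendsto_mult tendsto_const l)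
 moreover have "(%j. a * Wg g j (lo T j t) om + b * Wg h j (lo T j t) om) = (%j. Wg (a *\<^sub>R g + b *\<^sub>R h) j (lo T j t) om)"
  using elim(1) by simp
 ultimately show ?case using LIMSEQ_unique[OF l(1)] by simp
qed

lemma Wb_cylindrical: "cylindrical_wiener_process T Om Fb Wb"
 unfolding cylindrical_wiener_process_def using Wb_adapted Wb_linear Wb_brownian by blast

lemma Wb_basis: "AE om in Om. \<forall>j i k. Wb (dy T j i) (e k) om = L om (False, j, i, k)"
proof -
 have "AE om in Om. \<forall>j i. Wb (dy T j i) (e k) om = L om (False, j, i, k)" for k
  using Wb_facts[of "e k"]
 proof eventually_elim
  case (elim om)
  then obtain g where "!!j i. g (dy T j i) = Wg (e k) j i om" "!!t. t \<in> {0..T} ==> Wb t (e k) om = g t" by blast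
  then show ?case using dy_range[OF T] by (simp add: Wg_basis)
 qed
 then have "AE om in Om. \<forall>k j i. Wb (dy T j i) (e k) om = L om (False, j, i, k)" by (simp only: AE_all_countable) blast
 then show ?thesis by eventually_elim blast
qed

end

declare coord_measurable[measurable]

section \<open>The equation for the limit\<close>

text \<open>The completed measure is needed since \<open>F\<close> is arbitrary on the null set of times at
which \<open>V\<close> is infinite.\<close>

lemma measurable_AE_lebesgue:
 fixes f g :: "real => 'b::topological_space"
 assumes f: "f \<in> borel_measurable lebesgue" and eq: "AE s in lebesgue. f s = g s"
 shows "g \<in> borel_measurable lebesgue"
proof (rule measurableI)
 fix B :: "'b set" assume B: "B \<in> sets borel"
 obtain N where N: "N \<in> null_sets lebesgue" "{s\<in>space lebesgue. \<not> f s = g s} \<subseteq> N"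
  using eq unfolding eventually_ae_filter by blast
 have same: "f s = g s" if "s \<notin> N" for s using N(2) that by auto
 have "g -` B \<inter> N \<in> null_sets lebesgue"
  by (rule null_sets_completion_subset[OF _ N(1)]) blast
 then have 1: "g -` B \<inter> N \<in> sets lebesgue" by blast
 have "f -` B \<inter> space lebesgue \<in> sets lebesgue" by (rule measurable_sets[OF f B])
 then have 2: "f -` B - N \<in> sets lebesgue" using N(1) by auto
 have "g -` B \<inter> space lebesgue = (f -` B - N) \<union> (g -` B \<inter> N)"
 proof (rule set_eqI)
  fix s
  show "s \<in> g -` B \<inter> space lebesgue \<longleftrightarrow> s \<in> (f -` B - N) \<union> (g -` B \<inter> N)"
   using same[of s] by (cases "s \<in> N") auto
 qed
 then show "g -` B \<inter> space lebesgue \<in> sets lebesgue" using sets.Un[OF 2 1] by (simp only:)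
qed simp

context coupled
begin

text \<open>A Riemann sum of an increasing exponential, compared with its integral.\<close>

lemma coord_sum_second_moment:
 assumes t: "t \<in> {0..T}"
 shows "(\<integral>\<^sup>+om. ennreal ((lam k * coord_sum (L om) k t j) ^ (2 * 1)) \<partial>Om) <= ennreal ((lam k)^2 / (2 * al k))"
proof -
 define n where "n = lo T j t"
 define dl where "dl = T / 2 ^ j"
 define d where "d i = exp (- al k * (t - dy T j i))" for i
 have tT: "0 <= t" "t <= T" using t by auto
 have n2: "n <= 2 ^ j" unfolding n_def by (rule lo_le[OF T tT(2)])
 have dl0: "0 < dl" unfolding dl_def using T by simp
 have a0: "0 < al k" by (rule al_pos)
 interpret Bk: brownian Om T Fb "%t. Wb t (e k)"
  unfolding brownian_def brownian_axioms_def
  using L.prob_space_axioms T filtered Wb_brownian[OF onb_norm[OF onb]] by blast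
 have G: "gaussian Om (%om. \<Sum>i<n. d i * (Wb (dy T j (Suc i)) (e k) om - Wb (dy T j i) (e k) om)) (\<Sum>i<n. (d i)^2 * dl)"
  using Bk.gaussian_steps[OF n2] unfolding dl_def by blast
 have "AE om in Om. ennreal ((lam k * coord_sum (L om) k t j) ^ (2 * 1))
   = ennreal ((lam k * (\<Sum>i<n. d i * (Wb (dy T j (Suc i)) (e k) om - Wb (dy T j i) (e k) om))) ^ (2 * 1))"
  using Wb_basis by eventually_elim (simp add: coord_sum_def n_def d_def)
 then have "(\<integral>\<^sup>+om. ennreal ((lam k * coord_sum (L om) k t j) ^ (2 * 1)) \<partial>Om)
  = (\<integral>\<^sup>+om. ennreal ((lam k * (\<Sum>i<n. d i * (Wb (dy T j (Suc i)) (e k) om - Wb (dy T j i) (e k) om))) ^ (2 * 1)) \<partial>Om)"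
  by (rule nn_integral_cong_AE)
 also have "... = ennreal (gauss_moment 1 * ((lam k)^2 * (\<Sum>i<n. (d i)^2 * dl)) ^ 1)"
  using dl0 by (intro gaussian_moment gaussian_scale[OF G] mult_nonneg_nonneg sum_nonneg) auto
 also have "... <= ennreal ((lam k)^2 / (2 * al k))"
 proof (rule ennreal_leI)
  define E where "E i = exp (- 2 * al k * (t - dy T j i))" for i
  have step: "(d i)^2 * dl <= (E (Suc i) - E i) / (2 * al k)" if i: "i < n" for i
  proof -
   have d2: "(d i)^2 = E i" unfolding d_def E_def by (simp add: exp_double[symmetric])
   have "dy T j (Suc i) = dy T j i + dl"
   using i n2 unfolding dl_def by (simp add: dy_eq[OF T] add_divide_distrib distrib_left)
   then have "E (Suc i) = E i * exp (2 * al k * dl)" unfolding E_def by (simp add: exp_add[symmetric] algebra_simps)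
   moreover have "1 + 2 * al k * dl <= exp (2 * al k * dl)" by (rule exp_ge_add_one_self)
   then have "E i * (1 + 2 * al k * dl) <= E i * exp (2 * al k * dl)" by (intro mult_left_mono) (simp_all add: E_def)
   ultimately have "2 * al k * (E i * dl) <= E (Suc i) - E i" by (simp add: algebra_simps)
   then show ?thesis unfolding d2 using a0 by (simp add: field_simps)
  qed
  have "(\<Sum>i<n. (d i)^2 * dl) <= (\<Sum>i<n. (E (Suc i) - E i) / (2 * al k))" by (rule sum_mono) (use step in auto)
  also have "... = (\<Sum>i<n. E (Suc i) - E i) / (2 * al k)" by (rule sum_divide_distrib[symmetric])
  also have "(\<Sum>i<n. E (Suc i) - E i) = E n - E 0" by (rule sum_lessThan_telescope)
  also have "(E n - E 0) / (2 * al k) <= 1 / (2 * al k)"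
  proof (rule divide_right_mono)
   have "dy T j n <= t" unfolding n_def by (rule dy_lo(1)[OF T tT])
   then have "E n <= 1" unfolding E_def using a0 by simp
   moreover have "0 <= E 0" unfolding E_def by simp
   ultimately show "E n - E 0 <= 1" by linarith
  qed (use a0 in simp)
  finally have "(lam k)^2 * (\<Sum>i<n. (d i)^2 * dl) <= (lam k)^2 * (1 / (2 * al k))" by (intro mult_left_mono) auto
  then show "gauss_moment 1 * ((lam k)^2 * (\<Sum>i<n. (d i)^2 * dl)) ^ 1 <= (lam k)^2 / (2 * al k)"
   by (simp add: gauss_moment_def)
 qed
 finally show ?thesis .
qed

lemma coord_sum_L_meas: "(%om. lam k * coord_sum (L om) k t j) \<in> borel_measurable Om"
 unfolding coord_sum_def by measurable

lemma limit_coord_tendsto: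
 assumes t: "t \<in> {0..T}"
 shows "(%j. \<integral>\<^sup>+om. ennreal ((mild_coord om k t - lam k * coord_sum (L om) k t j)^2) \<partial>Om) ----> 0"
proof -
 have "(%j. 8 * (lam k)^2 * grid_error T (al k) j) ----> 8 * (lam k)^2 * 0" by (intro tendsto_intros grid_error_tendsto[OF T])
 then have "(%j. ennreal (8 * (lam k)^2 * grid_error T (al k) j)) ----> ennreal (8 * (lam k)^2 * 0)" by (rule tendsto_ennrealI)
 then have z: "(%j. ennreal (8 * (lam k)^2 * grid_error T (al k) j)) ----> 0" by simp
 show ?thesis
  by (rule tendsto_sandwich[OF _ _ tendsto_const z]) (auto intro!: always_eventually limit_coord_error[OF t])
qed

lemma mild_coord_second_moment:
 assumes t: "t \<in> {0..T}"
 shows "(\<integral>\<^sup>+om. ennreal ((mild_coord om k t)^2) \<partial>Om) <= ennreal ((lam k)^2 / (2 * al k))"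
 using L2_limit_moment[OF mild_coord_meas coord_sum_L_meas limit_coord_tendsto[OF t],
   where m = 1 and C = "ennreal ((lam k)^2 / (2 * al k))"]
  coord_sum_second_moment[OF t] by (simp add: always_eventually)

lemma weights_summable: "summable (%k. (lam k)^2 / (2 * al k))"
proof (rule summable_comparison_test_ev[OF _ noise_summable])
 have "\<forall>\<^sub>F k in sequentially. 1 <= al k" using al_top by (simp add: filterlim_at_top)
 then show "\<forall>\<^sub>F k in sequentially. norm ((lam k)^2 / (2 * al k)) <= (lam k)^2 * al k powr (p - 1)"
 proof eventually_elim
  case (elim k)
  have "1 / (2 * al k) <= 1 / al k" using al_pos[of k] by (simp add: field_simps)
  also have "... = al k powr (- 1)" using al_pos[of k] by (simp add: powr_minus_divide)
  also have "... <= al k powr (p - 1)" using elim p by (intro powr_mono) auto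
  finally have "(lam k)^2 * (1 / (2 * al k)) <= (lam k)^2 * al k powr (p - 1)" by (intro mult_left_mono) auto
  then show ?case using al_pos[of k] by (simp add: abs_of_nonneg)
 qed
qed

text \<open>The stochastic convolution, defined by its coordinates to make it measurable.\<close>

definition Ilim :: "real => 'v => 'h" where
 "Ilim t om = (\<Sum>k. mild_coord om k t *\<^sub>R e k)"

lemma Ilim_meas[measurable]: "Ilim t \<in> borel_measurable Om"
 unfolding Ilim_def[abs_def] by measurable

lemma Ilim_eq:
 assumes t: "t \<in> {0..T}"
 shows "AE om in Om. Ilim t om = Xlim t om - S t x - convol (drift_lim om) t & (\<forall>k. inner (Ilim t om) (e k) = mild_coord om k t)"
 using drift_lim_integrable AE_space
proof eventually_elim
 case (elim om)
 have tT: "0 <= t" "t <= T" using t by auto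
 have c: "inner (Xlim t om - S t x - convol (drift_lim om) t) (e k) = mild_coord om k t" for k
  using convol_coord[OF drift_lim_meas[OF elim(2)] _ tT, of k] elim(1) S_coord[OF tT(1), of x k]
  unfolding mild_coord_def by (simp add: inner_diff_left)
 have "(%k. mild_coord om k t *\<^sub>R e k) sums (Xlim t om - S t x - convol (drift_lim om) t)"
  using onb_sums[OF onb, of "Xlim t om - S t x - convol (drift_lim om) t"] unfolding c .
 then have "Ilim t om = Xlim t om - S t x - convol (drift_lim om) t" unfolding Ilim_def by (rule sums_unique[symmetric])
 then show ?case using c by simp
qed

lemma wiener_integral_coord:
 assumes t: "t \<in> {0..T}"
 shows "has_wiener_integral Om (%s. Wb s (e k)) t (%s. S (t - s) (Q (e k))) (%om. mild_coord om k t *\<^sub>R e k)"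
 unfolding has_wiener_integral_def
proof (intro conjI)
 have tT: "0 <= t" "t <= T" using t by auto
 have "(%s. indicator {0..t} s *\<^sub>R S (t - s) (Q (e k))) = (%s. indicator {0..t} s *\<^sub>R (exp (- al k * (t - s)) *\<^sub>R (lam k *\<^sub>R e k)))"
  by (rule ext) (auto simp: integrand_eigen split: split_indicator)
 then show "set_borel_measurable lborel {0..t} (%s. S (t - s) (Q (e k)))"
  unfolding set_borel_measurable_def by simp
 show "(%om. mild_coord om k t *\<^sub>R e k) \<in> borel_measurable Om" by measurable
 define c where "c j i = exp (- al k * (t - dy T j i)) *\<^sub>R (lam k *\<^sub>R e k)" for j i
 show "\<exists>n ta c. (\<forall>j. \<forall>i\<le>n j. ta j i \<in> {0..t}) & (\<forall>j. \<forall>i<n j. ta j i <= ta j (Suc i)) \<and>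
   (%j. \<integral>\<^sup>+s\<in>{0..t}. ennreal ((norm (S (t - s) (Q (e k)) - step_function (n j) (ta j) (c j) s))^2) \<partial>lborel) ----> 0 \<and>
   (%j. \<integral>\<^sup>+om. ennreal ((norm (mild_coord om k t *\<^sub>R e k - step_integral (n j) (ta j) (c j) (%s. Wb s (e k)) om))^2) \<partial>Om) ----> 0"
 proof (intro exI[of _ "%j. lo T j t"] exI[of _ "%j. dy T j"] exI[of _ c] conjI)
  show "\<forall>j. \<forall>i\<le>lo T j t. dy T j i \<in> {0..t}" using grid_times(1)[OF tT] by blast
  show "\<forall>j. \<forall>i<lo T j t. dy T j i <= dy T j (Suc i)" using grid_times(2)[OF tT] by blast
  have "(%j. (lam k)^2 * grid_error T (al k) j) ----> (lam k)^2 * 0" by (intro tendsto_intros grid_error_tendsto[OF T])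
  then have "(%j. ennreal ((lam k)^2 * grid_error T (al k) j)) ----> ennreal ((lam k)^2 * 0)" by (rule tendsto_ennrealI)
  then have z: "(%j. ennreal ((lam k)^2 * grid_error T (al k) j)) ----> 0" by simp
  have ste: "(\<integral>\<^sup>+s\<in>{0..t}. ennreal ((norm (S (t - s) (Q (e k)) - step_function (lo T j t) (dy T j) (c j) s))^2) \<partial>lborel)
   <= ennreal ((lam k)^2 * grid_error T (al k) j)" for j
   unfolding c_def by (rule integrand_step_error[OF tT])
  show "(%j. \<integral>\<^sup>+s\<in>{0..t}. ennreal ((norm (S (t - s) (Q (e k)) - step_function (lo T j t) (dy T j) (c j) s))^2) \<partial>lborel) ----> 0"
   by (rule tendsto_sandwich[OF _ _ tendsto_const z]) (auto intro!: always_eventually ste)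
  have "(\<integral>\<^sup>+om. ennreal ((norm (mild_coord om k t *\<^sub>R e k - step_integral (lo T j t) (dy T j) (c j) (%s. Wb s (e k)) om))^2) \<partial>Om)
   = (\<integral>\<^sup>+om. ennreal ((mild_coord om k t - lam k * coord_sum (L om) k t j)^2) \<partial>Om)" for j
  proof (rule nn_integral_cong_AE)
   show "AE om in Om. ennreal ((norm (mild_coord om k t *\<^sub>R e k - step_integral (lo T j t) (dy T j) (c j) (%s. Wb s (e k)) om))^2)
   = ennreal ((mild_coord om k t - lam k * coord_sum (L om) k t j)^2)"
   using Wb_basis
   proof eventually_elim
   case (elim om)
   have "grid_sum T (al k) t j (%u. Wb u (e k) om) = coord_sum (L om) k t j"
   unfolding grid_sum_def coord_sum_def using elim by simp
   then have "step_integral (lo T j t) (dy T j) (c j) (%s. Wb s (e k)) om = (lam k * coord_sum (L om) k t j) *\<^sub>R e k"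
   unfolding c_def step_integral_grid by simp
   then show ?case by (simp add: scaleR_diff_left[symmetric] onb_norm[OF onb] power_mult_distrib)
   qed
  qed
  then show "(%j. \<integral>\<^sup>+om. ennreal ((norm (mild_coord om k t *\<^sub>R e k - step_integral (lo T j t) (dy T j) (c j) (%s. Wb s (e k)) om))^2) \<partial>Om) ----> 0"
   using limit_coord_tendsto[OF t, of k] by simp
 qed
qed

lemma stochastic_integral_limit:
 assumes t: "t \<in> {0..T}"
 shows "has_stochastic_integral Om e Wb t (%s h. S (t - s) (Q h)) (Ilim t)"
 unfolding has_stochastic_integral_def
proof (intro conjI exI[of _ "%k om. mild_coord om k t *\<^sub>R e k"] allI)
 show "Ilim t \<in> borel_measurable Om" by (rule Ilim_meas)
 show "has_wiener_integral Om (%s. Wb s (e k)) t (%s. S (t - s) (Q (e k))) (%om. mild_coord om k t *\<^sub>R e k)" for k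
  by (rule wiener_integral_coord[OF t])
 define w where "w k = (lam k)^2 / (2 * al k)" for k
 have w0: "0 <= w k" for k unfolding w_def using al_pos[of k] by simp
 have ws: "w sums suminf w" unfolding w_def using weights_summable by (rule summable_sums)
 have bd: "(\<integral>\<^sup>+om. ennreal ((norm (Ilim t om - (\<Sum>k<n. mild_coord om k t *\<^sub>R e k)))^2) \<partial>Om) <= ennreal (suminf w - (\<Sum>k<n. w k))" for n
 proof (rule series_second_moment[OF onb])
  show "(%om. Ilim t om - (\<Sum>k<n. mild_coord om k t *\<^sub>R e k)) \<in> borel_measurable Om" by measurable
  show "0 <= (if k < n then 0 else w k)" for k using w0 by simp
  have "(%k. if k \<in> {..<n} then w k else 0) sums (\<Sum>k<n. w k)" by (rule sums_If_finite_set) simp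
  from sums_diff[OF ws this]
  have "(%k. w k - (if k \<in> {..<n} then w k else 0)) sums (suminf w - (\<Sum>k<n. w k))" .
  moreover have "(%k. w k - (if k \<in> {..<n} then w k else 0)) = (%k. if k < n then 0 else w k)" by auto
  ultimately show "(%k. if k < n then 0 else w k) sums (suminf w - (\<Sum>k<n. w k))" by simp
  fix k
  have "AE om in Om. ennreal ((inner (Ilim t om - (\<Sum>k<n. mild_coord om k t *\<^sub>R e k)) (e k))^2) = (if k < n then 0 else ennreal ((mild_coord om k t)^2))"
   using Ilim_eq[OF t]
  proof eventually_elim
   case (elim om)
   have i: "inner (Ilim t om) (e k) = mild_coord om k t" using elim by blast
   show ?case unfolding inner_diff_left i onb_inner_sum[OF onb finite_lessThan] by simp
  qed
  then have "(\<integral>\<^sup>+om. ennreal ((inner (Ilim t om - (\<Sum>k<n. mild_coord om k t *\<^sub>R e k)) (e k))^2) \<partial>Om)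
   = (\<integral>\<^sup>+om. (if k < n then 0 else ennreal ((mild_coord om k t)^2)) \<partial>Om)" by (rule nn_integral_cong_AE)
  also have "... <= ennreal (if k < n then 0 else w k)"
   using mild_coord_second_moment[OF t, of k] unfolding w_def by simp
  finally show "(\<integral>\<^sup>+om. ennreal ((inner (Ilim t om - (\<Sum>k<n. mild_coord om k t *\<^sub>R e k)) (e k))^2) \<partial>Om) <= ennreal (if k < n then 0 else w k)" .
 qed
 have "(%n. suminf w - (\<Sum>k<n. w k)) ----> suminf w - suminf w"
  using ws unfolding sums_def by (intro tendsto_diff tendsto_const)
 then have "(%n. ennreal (suminf w - (\<Sum>k<n. w k))) ----> ennreal (suminf w - suminf w)" by (rule tendsto_ennrealI)
 then have z: "(%n. ennreal (suminf w - (\<Sum>k<n. w k))) ----> 0" by simp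
 show "(%n. \<integral>\<^sup>+om. ennreal ((norm (Ilim t om - (\<Sum>k<n. mild_coord om k t *\<^sub>R e k)))^2) \<partial>Om) ----> 0"
  by (rule tendsto_sandwich[OF _ _ tendsto_const z]) (auto intro!: always_eventually bd)
qed

lemma drift_lebesgue:
 "AE om in Om. (AE s in lebesgue. s \<in> {0..T} --> V (Xlim s om) < \<top>)
  & set_integrable lebesgue {0..T} (%s. F s (Xlim s om))
  & (\<forall>t\<in>{0..T}. (LINT s:{0..t}|lebesgue. S (t - s) (F s (Xlim s om))) = convol (drift_lim om) t)"
 using drift_lim_integrable AE_space
proof eventually_elim
 case (elim om)
 define d where "d = drift_lim om"
 have dm: "d \<in> borel_measurable borel" unfolding d_def by (rule drift_lim_meas[OF elim(2)])
 have d2: "set_integrable lborel {0..T} (%s. (norm (d s))^2)" unfolding d_def using elim(1) by blast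
 have ae: "AE s in lebesgue. s \<in> {0..T} --> V (Xlim s om) < \<top>" using elim(1) by (intro AE_completion) blast
 then have eq: "AE s in lebesgue. s \<in> {0..T} --> d s = F s (Xlim s om)"
  unfolding d_def by eventually_elim (use drift_lim_eq(1) in blast)
 have Fint: "set_integrable lebesgue {0..T} (%s. F s (Xlim s om))"
 proof -
  have dmi: "(%s. indicator {0..T} s *\<^sub>R d s) \<in> borel_measurable lborel"
   using dm by (intro borel_measurable_scaleR borel_measurable_indicator) auto
  have "integrable lborel (%s. indicator {0..T} s *\<^sub>R d s)"
  proof (rule Bochner_Integration.integrable_bound[OF _ dmi])
   have "integrable lborel (%s. indicator {0..T} s *\<^sub>R (norm (d s))^2)" using d2 unfolding set_integrable_def .
   moreover have "integrable lborel (indicator {0..T} :: real => real)"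
   using T by (intro integrable_real_indicator) (auto simp: emeasure_lborel_Icc_eq)
   ultimately show "integrable lborel (%s. indicator {0..T} s *\<^sub>R (norm (d s))^2 + indicator {0..T} s)"
   by (rule Bochner_Integration.integrable_add)
   have "y <= y\<^sup>2 + 1" if "0 <= y" for y :: real
   proof -
   have "0 <= (y - 1)^2" by simp
   then show ?thesis using that by (simp add: power2_diff)
   qed
   then show "AE s in lborel. norm (indicator {0..T} s *\<^sub>R d s) <= norm (indicator {0..T} s *\<^sub>R (norm (d s))^2 + indicator {0..T} s :: real)"
   by (intro AE_I2) (auto split: split_indicator)
  qed
  then have i1: "integrable lebesgue (%s. indicator {0..T} s *\<^sub>R d s)"
   by (simp add: integrable_completion[OF dmi])
  have e1: "AE s in lebesgue. indicator {0..T} s *\<^sub>R d s = indicator {0..T} s *\<^sub>R F s (Xlim s om)"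
   using eq by eventually_elim (auto split: split_indicator)
  have m1: "(%s. indicator {0..T} s *\<^sub>R F s (Xlim s om)) \<in> borel_measurable lebesgue"
   by (rule measurable_AE_lebesgue[OF borel_measurable_integrable[OF i1] e1])
  show ?thesis
   unfolding set_integrable_def by (rule integrable_cong_AE_imp[OF i1 m1 e1])
 qed
 have conv: "(LINT s:{0..t}|lebesgue. S (t - s) (F s (Xlim s om))) = convol d t" if t: "t \<in> {0..T}" for t
 proof -
  let ?h = "%s. indicator {0..t} s *\<^sub>R (if 0 <= t - s then S (t - s) (d s) else 0)"
  have "(%s. if 0 <= t - s then S (t - s) (d s) else 0) \<in> borel_measurable lborel"
   by (rule S_measurable) (use dm in simp_all)
  then have hm: "?h \<in> borel_measurable lborel" by (rule borel_measurable_scaleR[rotated]) simp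
  have e1: "AE s in lebesgue. ?h s = indicator {0..t} s *\<^sub>R S (t - s) (F s (Xlim s om))"
   using eq by eventually_elim (use t in \<open>auto split: split_indicator\<close>)
  have hl: "?h \<in> borel_measurable lebesgue" using hm by (rule measurable_completion)
  have m1: "(%s. indicator {0..t} s *\<^sub>R S (t - s) (F s (Xlim s om))) \<in> borel_measurable lebesgue"
   by (rule measurable_AE_lebesgue[OF hl e1])
  have "(LINT s:{0..t}|lebesgue. S (t - s) (F s (Xlim s om))) = (\<integral>s. ?h s \<partial>lebesgue)"
   unfolding set_lebesgue_integral_def by (rule integral_cong_AE[OF m1 hl e1[THEN AE_symmetric]])
  also have "... = (\<integral>s. ?h s \<partial>lborel)" by (rule integral_completion[OF hm])
  also have "... = convol d t"
   unfolding convol_def set_lebesgue_integral_def by (rule Bochner_Integration.integral_cong) (auto split: split_indicator)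
  finally show ?thesis .
 qed
 show ?case using ae Fint conv unfolding d_def by blast
qed

text \<open>The limit of the approximating solutions, for any set that contains the points of finite
\<open>V\<close>.\<close>

theorem limit_solution:
 assumes DF: "!!y. V y < \<top> ==> y \<in> DF"
 shows "martingale_solution T S Q e DF F x Om Fb Wb Xlim"
 unfolding martingale_solution_def
proof (intro conjI ballI)
 show "filtered_prob_space T Om Fb" by (rule filtered)
 show "cylindrical_wiener_process T Om Fb Wb" by (rule Wb_cylindrical)
 show "Xlim t \<in> borel_measurable (Fb t)" if "t \<in> {0..T}" for t by (rule Xlim_adapted[OF that])
 show "continuous_on {0..T} (%t. Xlim t om)" for om by (rule Xlim_continuous)
 show "AE om in Om. (AE s in lebesgue. s \<in> {0..T} --> Xlim s om \<in> DF) & set_integrable lebesgue {0..T} (%s. F s (Xlim s om))"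
  using drift_lebesgue
 proof eventually_elim
  case (elim om)
  then have "AE s in lebesgue. s \<in> {0..T} --> V (Xlim s om) < \<top>" by blast
  then have "AE s in lebesgue. s \<in> {0..T} --> Xlim s om \<in> DF" by eventually_elim (use DF in blast)
  then show ?case using elim by blast
 qed
 fix t assume t: "t \<in> {0..T}"
 show "\<exists>I. has_stochastic_integral Om e Wb t (%s h. S (t - s) (Q h)) I \<and>
   (AE om in Om. Xlim t om = S t x + (LINT s:{0..t}|lebesgue. S (t - s) (F s (Xlim s om))) + I om)"
 proof (intro exI[of _ "Ilim t"] conjI)
  show "has_stochastic_integral Om e Wb t (%s h. S (t - s) (Q h)) (Ilim t)" by (rule stochastic_integral_limit[OF t])
  show "AE om in Om. Xlim t om = S t x + (LINT s:{0..t}|lebesgue. S (t - s) (F s (Xlim s om))) + Ilim t om"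
   using drift_lebesgue Ilim_eq[OF t]
  proof eventually_elim
   case (elim om)
   have "(LINT s:{0..t}|lebesgue. S (t - s) (F s (Xlim s om))) = convol (drift_lim om) t" using elim(1) t by blast
   then show ?case using elim(2) by simp
  qed
 qed
qed

end

section \<open>Existence of a martingale solution\<close>

lemma lsc_nhds:
 assumes V: "lower_semicontinuous V" and c: "c < V y"
 shows "\<forall>\<^sub>F z in nhds y. c < V z"
proof -
 have "V y <= Liminf (at y) V" using V unfolding lower_semicontinuous_def by blast
 with c have "c < Liminf (at y) V" by (rule less_le_trans)
 then have "\<forall>\<^sub>F z in at y. c < V z" by (rule less_LiminfD)
 then have "\<forall>\<^sub>F z in nhds y. z ~= y --> c < V z" unfolding eventually_at_filter by simp
 then show ?thesis by eventually_elim (use c in blast)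
qed

lemma lsc_sequential:
 assumes V: "lower_semicontinuous V" and u: "u ----> y"
 shows "V y <= liminf (%n. V (u n))"
 unfolding le_Liminf_iff
proof (intro allI impI)
 fix c assume "c < V y"
 from lsc_nhds[OF V this] u show "\<forall>\<^sub>F n in sequentially. c < V (u n)"
  by (rule eventually_compose_filterlim)
qed

lemma lsc_borel:
 assumes V: "lower_semicontinuous V"
 shows "V \<in> borel_measurable borel"
proof (rule borel_measurableI_greater)
 fix c
 have "open {y. c < V y}"
  unfolding open_subopen[of "{y. c < V y}"]
 proof
  fix y assume "y \<in> {y. c < V y}"
  then have "\<forall>\<^sub>F z in nhds y. c < V z" using lsc_nhds[OF V] by blast
  then obtain O' where "open O'" "y \<in> O'" "\<forall>z\<in>O'. c < V z" unfolding eventually_nhds by blast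
  then show "\<exists>T. open T & y \<in> T & T \<subseteq> {y. c < V y}" by blast
 qed
 then show "{y \<in> space borel. c < V y} \<in> sets borel" by simp
qed

text \<open>Cutting the drift off outside \<open>{0..T}\<close> makes it measurable on the whole line and does
not change the equation.\<close>

lemma martingale_solution_cong:
 assumes G: "!!t y. t \<in> {0..T} ==> G t y = G' t y" and sol: "martingale_solution T S Q e D G x M \<F> W X"
 shows "martingale_solution T S Q e D G' x M \<F> W X"
proof -
 have si: "set_integrable lebesgue {0..T} (%s. G s (X s om)) = set_integrable lebesgue {0..T} (%s. G' s (X s om))" for om
  by (rule set_integrable_cong) (auto simp: G)
 have li: "(LINT s:{0..t}|lebesgue. S (t - s) (G s (X s om))) = (LINT s:{0..t}|lebesgue. S (t - s) (G' s (X s om)))" if "t \<in> {0..T}" for t om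
  by (rule set_lebesgue_integral_cong) (use that G in auto)
 have ex: "\<exists>I. has_stochastic_integral M e W t (%s h. S (t - s) (Q h)) I \<and>
   (AE om in M. X t om = S t x + (LINT s:{0..t}|lebesgue. S (t - s) (G' s (X s om))) + I om)" if t: "t \<in> {0..T}" for t
  using sol t unfolding martingale_solution_def li[OF t, symmetric] by blast
 show ?thesis using sol ex unfolding martingale_solution_def si by blast
qed

text \<open>Tonelli's theorem; joint measurability of the process comes from its continuity.\<close>

lemma (in diagonal_data) mean_energy:
 fixes X :: "real => 'w => 'h" and G :: "real => 'h => 'h" and V :: "'h => ennreal"
 assumes M: "prob_space M" and X: "!!t. t \<in> {0..T} ==> X t \<in> borel_measurable M"
  and cont: "!!om. om \<in> space M ==> continuous_on {0..T} (%t. X t om)"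
  and V[measurable]: "V \<in> borel_measurable borel"
  and G: "!!t y. t \<in> {0..T} ==> ennreal ((norm (G t y))^2) <= V y"
 shows "(\<integral>\<^sup>+om. (\<integral>\<^sup>+t\<in>{0..T}. ennreal ((norm (G t (X t om)))^2) \<partial>lborel) \<partial>M) <= (\<integral>\<^sup>+t\<in>{0..T}. (\<integral>\<^sup>+om. V (X t om) \<partial>M) \<partial>lborel)"
proof -
 interpret prob_space M by (rule M)
 interpret P: pair_sigma_finite M lborel by unfold_locales
 define Y where "Y t om = lim (%j. X (dy T j (lo T j t)) om)" for t om
 have Y: "Y t om = X t om" if "om \<in> space M" "t \<in> {0..T}" for t om
  unfolding Y_def
 proof (rule limI)
  have "(%j. dy T j (lo T j t)) ----> t" using that by (intro dy_lo_tendsto[OF T]) auto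
  then show "(%j. X (dy T j (lo T j t)) om) ----> X t om"
   by (rule continuous_on_tendsto_compose[OF cont[OF that(1)] _ that(2)]) (intro always_eventually allI dy_range[OF T])
 qed
 have "(%w. lim (%j. X (dy T j (lo T j (snd w))) (fst w))) \<in> borel_measurable (M \<Otimes>\<^sub>M borel)"
  by (rule grid_path_measurable) (rule X[OF dy_range[OF T]])
 then have "(%w. Y (snd w) (fst w)) \<in> borel_measurable (M \<Otimes>\<^sub>M borel)" unfolding Y_def .
 then have Ym[measurable]: "(%w. Y (snd w) (fst w)) \<in> borel_measurable (M \<Otimes>\<^sub>M lborel)"
  by (subst measurable_cong_sets[OF sets_pair_measure_cong[OF refl sets_lborel] refl])
 have fm: "(%(om, t). V (Y t om) * indicator {0..T} t) \<in> borel_measurable (M \<Otimes>\<^sub>M lborel)"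
  unfolding split_beta by measurable
 have "(\<integral>\<^sup>+om. (\<integral>\<^sup>+t\<in>{0..T}. ennreal ((norm (G t (X t om)))^2) \<partial>lborel) \<partial>M) <= (\<integral>\<^sup>+om. (\<integral>\<^sup>+t. V (Y t om) * indicator {0..T} t \<partial>lborel) \<partial>M)"
  by (intro nn_integral_mono) (use G Y in \<open>auto split: split_indicator\<close>)
 also have "... = (\<integral>\<^sup>+t. (\<integral>\<^sup>+om. V (Y t om) * indicator {0..T} t \<partial>M) \<partial>lborel)"
  by (rule P.Fubini'[OF fm, symmetric])
 also have "... = (\<integral>\<^sup>+t\<in>{0..T}. (\<integral>\<^sup>+om. V (X t om) \<partial>M) \<partial>lborel)"
 proof (rule nn_integral_cong)
  fix t
  show "(\<integral>\<^sup>+om. V (Y t om) * indicator {0..T} t \<partial>M) = (\<integral>\<^sup>+om. V (X t om) \<partial>M) * indicator {0..T} t"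
  proof (cases "t \<in> {0..T}")
   case True
   have "(\<integral>\<^sup>+om. V (Y t om) * indicator {0..T} t \<partial>M) = (\<integral>\<^sup>+om. V (X t om) \<partial>M)"
   by (rule nn_integral_cong) (use Y True in simp)
   then show ?thesis using True by simp
  qed simp
 qed
 finally show ?thesis .
qed

lemma diagonal_data_A1:
 assumes T: "0 < T" and A1: "assumption_A1 DA A S DQ Q e al lam"
 obtains p where "diagonal_data T S Q e al lam p"
proof -
 have onb: "orthonormal_basis e" and an: "analytic_semigroup S" and gen: "generates DA A S"
  and al: "!!k. 0 < al k" and lm: "!!k. 0 < lam k" and Ae: "!!k. e k \<in> DA" "!!k. A (e k) = - (al k *\<^sub>R e k)"
  and Qe: "!!k. Q (e k) = lam k *\<^sub>R e k" and inf: "0 < (INF k. al k)"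
  and comp: "!!\<gamma>. 0 < \<gamma> ==> compact_operator (diagonal_power e al (- \<gamma>))"
  using A1 unfolding assumption_A1_def by blast+
 obtain \<gamma> where \<gamma>: "0 < \<gamma>" "summable (%k. (lam k)^2 * al k powr (2 * \<gamma> - 1))"
  using A1 unfolding assumption_A1_def by blast
 define p where "p = min 1 (2 * \<gamma>)"
 define a0 where "a0 = (INF k. al k)"
 have bb: "bdd_below (range al)" using al by (intro bdd_belowI2[of _ 0]) (auto simp: less_imp_le)
 have a0: "0 < a0" "!!k. a0 <= al k" unfolding a0_def using inf cINF_lower[OF bb] by auto
 have "summable (%k. (lam k)^2 * al k powr (p - 1))"
 proof (rule summable_comparison_test'[where N = 0])
  show "summable (%k. a0 powr (p - 2 * \<gamma>) * ((lam k)^2 * al k powr (2 * \<gamma> - 1)))" by (rule summable_mult[OF \<gamma>(2)])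
  fix k :: nat
  have "al k powr (p - 1) = al k powr (p - 2 * \<gamma>) * al k powr (2 * \<gamma> - 1)" by (simp add: powr_add[symmetric])
  also have "... <= a0 powr (p - 2 * \<gamma>) * al k powr (2 * \<gamma> - 1)"
   using a0 by (intro mult_right_mono powr_mono2') (auto simp: p_def)
  finally have "(lam k)^2 * al k powr (p - 1) <= (lam k)^2 * (a0 powr (p - 2 * \<gamma>) * al k powr (2 * \<gamma> - 1))"
   by (intro mult_left_mono) auto
  then show "norm ((lam k)^2 * al k powr (p - 1)) <= a0 powr (p - 2 * \<gamma>) * ((lam k)^2 * al k powr (2 * \<gamma> - 1))"
   by (simp add: mult_ac)
 qed
 moreover have "filterlim al at_top sequentially"
  by (rule eigenvalues_at_top[OF onb al]) (use comp[of 1] in simp)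
 moreover have "S t (e k) = exp (- al k * t) *\<^sub>R e k" if "0 <= t" for t k
  by (rule semigroup_eigen[OF onb an gen Ae that])
 moreover have "0 < p" "p <= 1" unfolding p_def using \<gamma>(1) by auto
 ultimately have "diagonal_data T S Q e al lam p"
  unfolding diagonal_data_def using T onb Qe al lm by blast
 then show ?thesis by (rule that)
qed

lemma second_moment_tight:
 assumes fm: "!!n. f n \<in> borel_measurable (M n)" and pr: "!!n. prob_space (M n)"
  and B: "!!n. (\<integral>\<^sup>+om. ennreal ((f n om)^2) \<partial>M n) <= ennreal B" and ep: "0 < ep"
 shows "\<exists>K. \<forall>n. measure (M n) {om\<in>space (M n). K < \<bar>f n om :: real\<bar>} <= ep"
proof (intro exI allI)
 fix n
 define B' where "B' = max B 0"
 define K where "K = max B 0 / ep + 1"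
 have K1: "1 <= K" unfolding K_def using ep by simp
 have Bn: "(\<integral>\<^sup>+om. ennreal ((f n om)^2) \<partial>M n) <= ennreal B'" by (rule order_trans[OF B ennreal_leI]) (simp add: B'_def)
 interpret prob_space "M n" by (rule pr)
 note [measurable] = fm[of n]
 have "K\<^sup>2 < y\<^sup>2" if "K < \<bar>y\<bar>" for y :: real
  using power_strict_mono[OF that, of 2] K1 by simp
 then have "emeasure (M n) {om\<in>space (M n). K < \<bar>f n om\<bar>} <= emeasure (M n) {om\<in>space (M n). K\<^sup>2 < (f n om)^2}"
  by (intro emeasure_mono) auto
 also have "... <= ennreal (B' / K\<^sup>2)" by (rule markov_nn) (use K1 Bn in auto)
 also have "... <= ennreal ep"
 proof (rule ennreal_leI)
  have "B' <= ep * K" unfolding K_def B'_def using ep by (simp add: distrib_left)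
  also have "... <= ep * K\<^sup>2" using K1 ep by (intro mult_left_mono) (auto simp: power2_eq_square)
  finally show "B' / K\<^sup>2 <= ep" using K1 by (simp add: divide_le_eq)
 qed
 finally show "measure (M n) {om\<in>space (M n). max B 0 / ep + 1 < \<bar>f n om\<bar>} <= ep"
  using ep unfolding emeasure_eq_measure K_def by simp
qed

theorem theoremA1:
  fixes T :: real
    and A :: "'h::{real_inner, banach, second_countable_topology} \<Rightarrow> 'h" and DA :: "'h set"
    and S :: "real \<Rightarrow> 'h \<Rightarrow>\<^sub>L 'h"
    and Q :: "'h \<Rightarrow> 'h" and DQ :: "'h set"
    and e :: "nat \<Rightarrow> 'h" and \<alpha> lam :: "nat \<Rightarrow> real"
    and F :: "real \<Rightarrow> 'h \<Rightarrow> 'h" and DF :: "'h set"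
    and F\<theta> :: "real \<Rightarrow> real \<Rightarrow> 'h \<Rightarrow> 'h" and V :: "'h \<Rightarrow> ennreal"
    and \<theta> :: "nat \<Rightarrow> real"
    and M :: "nat \<Rightarrow> 'h \<Rightarrow> 'w measure" and \<F> :: "nat \<Rightarrow> 'h \<Rightarrow> real \<Rightarrow> 'w measure"
    and W :: "nat \<Rightarrow> 'h \<Rightarrow> real \<Rightarrow> 'h \<Rightarrow> 'w \<Rightarrow> real" and X :: "nat \<Rightarrow> 'h \<Rightarrow> real \<Rightarrow> 'w \<Rightarrow> 'h"
    and x :: 'h
  assumes "T > 0"
    and A1: "assumption_A1 DA A S DQ Q e \<alpha> lam"
    and A2: "assumption_A2 T DF F F\<theta> V"
    and "range \<theta> \<subseteq> {0<..<1}" and "\<theta> \<longlonglongrightarrow> 0"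
    and approx: "\<And>n y. y \<in> DF \<Longrightarrow>
      martingale_solution T S Q e UNIV (F\<theta> (\<theta> n)) y (M n y) (\<F> n y) (W n y) (X n y)"
    and A3: "assumption_A3 T DF V M X"
    and "x \<in> finite_domain V"
  shows "\<exists>(Mbar :: real measure) \<F>bar Wbar Xbar.
    martingale_solution T S Q e DF F x Mbar \<F>bar Wbar Xbar"
proof -
 obtain p where dd: "diagonal_data T S Q e \<alpha> lam p"
  by (rule diagonal_data_A1[OF \<open>T > 0\<close> A1])
 interpret diagonal_data T S Q e \<alpha> lam p by (rule dd)
 have \<theta>: "\<theta> n \<in> {0<..<1}" for n using assms(4) by blast
 have Vx: "V x < \<top>" and lsc: "lower_semicontinuous V" and sub: "finite_domain V \<subseteq> DF"
  using \<open>x \<in> finite_domain V\<close> A2 unfolding finite_domain_def assumption_A2_def by auto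
 have xD: "x \<in> DF" using sub \<open>x \<in> finite_domain V\<close> by blast
 have DF: "y \<in> DF" if "V y < \<top>" for y using sub that unfolding finite_domain_def by auto
 have Vm: "V \<in> borel_measurable borel" by (rule lsc_borel[OF lsc])
 have meas: "(%(t, x). F\<theta> (\<theta> n) t x) \<in> borel_measurable (restrict_space borel ({0..T} \<times> UNIV))"
  and bdd: "\<exists>C. \<forall>t\<in>{0..T}. \<forall>x. norm (F\<theta> (\<theta> n) t x) <= C"
  and weak: "!!t h. t \<in> {0..T} ==> continuous_on UNIV (%x. inner (F\<theta> (\<theta> n) t x) h)"
  and sq: "!!t y. t \<in> {0..T} ==> ennreal ((norm (F\<theta> (\<theta> n) t y))^2) <= V y"
  and near: "!!t y. t \<in> {0..T} ==> y \<in> DF ==> ennreal (norm (F t y - F\<theta> (\<theta> n) t y)) <= ennreal (\<theta> n) * V y" for n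
  using A2 \<theta>[of n] unfolding assumption_A2_def by blast+
 define G where "G n t y = indicator {0..T} t *\<^sub>R F\<theta> (\<theta> n) t y" for n t and y :: 'h
 have G: "G n t y = F\<theta> (\<theta> n) t y" if "t \<in> {0..T}" for n t y using that unfolding G_def by simp
 have Gm: "(%z. G n (fst z) (snd z)) \<in> borel_measurable (borel \<Otimes>\<^sub>M borel)" for n
 proof -
  have "{0..T} \<times> (UNIV :: 'h set) \<in> sets (borel :: (real \<times> 'h) measure)"
   by (intro borel_closed closed_Times) auto
  then have "(%z. indicator ({0..T} \<times> UNIV) z *\<^sub>R (case z of (t, x) => F\<theta> (\<theta> n) t x)) \<in> borel_measurable (borel :: (real \<times> 'h) measure)"
   using meas[of n] by (subst (asm) borel_measurable_restrict_space_iff) auto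
  moreover have "(%z. indicator ({0..T} \<times> UNIV) z *\<^sub>R (case z of (t, x) => F\<theta> (\<theta> n) t x)) = (%z. G n (fst z) (snd z))"
   unfolding G_def by (auto simp: fun_eq_iff split: split_indicator)
  ultimately show ?thesis by (simp add: borel_prod)
 qed
 have Gb: "\<exists>B. \<forall>t y. norm (G n t y) <= B" for n
 proof -
  obtain B where "\<forall>t\<in>{0..T}. \<forall>y. norm (F\<theta> (\<theta> n) t y) <= B" using bdd[of n] by blast
  then have "norm (G n t y) <= max B 0" for t y
   unfolding G_def by (cases "t \<in> {0..T}") (auto simp: le_max_iff_disj)
  then show ?thesis by blast
 qed
 have sol: "martingale_solution T S Q e UNIV (G n) x (M n x) (\<F> n x) (W n x) (X n x)" for n
  by (rule martingale_solution_cong[OF _ approx[OF xD]]) (simp add: G)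
 obtain c where c: "0 < c" "(SUP n. \<integral>\<^sup>+t\<in>{0..T}. (\<integral>\<^sup>+om. V (X n x t om) \<partial>M n x) \<partial>lborel) <= ennreal c * V x"
  using A3 xD unfolding assumption_A3_def by blast
 obtain v where v: "V x = ennreal v" "0 <= v" using Vx by (cases "V x") auto
 define C where "C = c * v"
 have C0: "0 <= C" unfolding C_def using c v by simp
 have mean: "(\<integral>\<^sup>+t\<in>{0..T}. (\<integral>\<^sup>+om. V (X n x t om) \<partial>M n x) \<partial>lborel) <= ennreal C" for n
 proof -
  have "(\<integral>\<^sup>+t\<in>{0..T}. (\<integral>\<^sup>+om. V (X n x t om) \<partial>M n x) \<partial>lborel) <= (SUP n. \<integral>\<^sup>+t\<in>{0..T}. (\<integral>\<^sup>+om. V (X n x t om) \<partial>M n x) \<partial>lborel)"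
   by (rule SUP_upper) simp
  also have "... <= ennreal c * V x" by (rule c(2))
  also have "... = ennreal C" unfolding C_def v(1) using c(1) v(2) by (simp add: ennreal_mult)
  finally show ?thesis .
 qed
 have prob: "prob_space (M n x)" for n
  using sol[of n] unfolding martingale_solution_def filtered_prob_space_def by blast
 have appr: "approx_solution T S Q e \<alpha> lam p (M n x) (\<F> n x) (W n x) (X n x) (G n) x C" for n
 proof (intro approx_solution.intro approx_solution_axioms.intro dd prob sol Gm Gb C0)
  have Xm: "X n x t \<in> borel_measurable (M n x)" if "t \<in> {0..T}" for t
  proof -
   have "X n x t \<in> borel_measurable (\<F> n x t)" "subalgebra (M n x) (\<F> n x t)"
   using sol[of n] that unfolding martingale_solution_def filtered_prob_space_def by blast+
   then show ?thesis by (rule measurable_from_subalg[rotated])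
  qed
  have Xc: "continuous_on {0..T} (%t. X n x t om)" if "om \<in> space (M n x)" for om
   using sol[of n] that unfolding martingale_solution_def by blast
  have "(\<integral>\<^sup>+om. (\<integral>\<^sup>+t\<in>{0..T}. ennreal ((norm (G n t (X n x t om)))^2) \<partial>lborel) \<partial>M n x)
   <= (\<integral>\<^sup>+t\<in>{0..T}. (\<integral>\<^sup>+om. V (X n x t om) \<partial>M n x) \<partial>lborel)"
   by (rule mean_energy[OF prob Xm Xc Vm]) (use sq G in auto)
  then show "(\<integral>\<^sup>+om. (\<integral>\<^sup>+t\<in>{0..T}. ennreal ((norm (G n t (X n x t om)))^2) \<partial>lborel) \<partial>M n x) <= ennreal C"
   using mean by (rule order_trans)
 qed
 obtain b where b: "!!k. 1 / (2 * \<alpha> k) <= b"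
 proof -
  have "(INF k. \<alpha> k) > 0" using A1 unfolding assumption_A1_def by blast
  moreover have "(INF k. \<alpha> k) <= \<alpha> k" for k
   by (rule cINF_lower) (auto intro!: bdd_belowI2[of _ 0] less_imp_le[OF al_pos])
  ultimately have "1 / (2 * \<alpha> k) <= 1 / (2 * (INF k. \<alpha> k))" for k
   by (intro divide_left_mono) (auto simp: al_pos mult_pos_pos)
  then show ?thesis by (rule that)
 qed
 have tight: "\<exists>K. \<forall>n. measure (M n x) {om\<in>space (M n x). K < \<bar>coords (X n x) (W n x) om i\<bar>} <= ep" if "0 < ep" for i :: index and ep
 proof (rule second_moment_tight[OF _ prob _ that])
  show "(%om. coords (X n x) (W n x) om i) \<in> borel_measurable (M n x)" for n
   by (rule measurable_compose[OF approx_solution.coords_measurable[OF appr] coord_measurable])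
  show "(\<integral>\<^sup>+om. ennreal ((coords (X n x) (W n x) om i)^2) \<partial>M n x) <= ennreal (max T (tail_bound x C 0 b))" for n
   by (rule approx_solution.coords_second_moment[OF appr b])
 qed
 obtain r :: "nat => nat" and Om :: "real measure" and U' and L :: "real => index => real"
  where r: "strict_mono r" and Om0: "prob_space Om" and U: "!!n. U' n \<in> measurable Om coord_space" and L: "L \<in> measurable Om coord_space"
   and law: "!!n. distr Om coord_space (U' n) = distr (M (r n) x) coord_space (coords (X (r n) x) (W (r n) x))"
   and conv: "AE om in Om. \<forall>i. (%n. U' n om i) ----> L om i"
 proof (rule skorohod_countable[of "%n. M n x" "%n. coords (X n x) (W n x)"])
  show "prob_space (M n x)" for n by (rule prob)
  show "coords (X n x) (W n x) \<in> measurable (M n x) coord_space" for n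
   by (rule approx_solution.coords_measurable[OF appr])
  show "\<exists>K. \<forall>n. measure (M n x) {om\<in>space (M n x). K < \<bar>coords (X n x) (W n x) om i\<bar>} <= ep" if "0 < ep" for i ep
   by (rule tight[OF that])
 qed (rule that; assumption)
 have "coupled T S Q e \<alpha> lam p Om (%n. M (r n) x) (%n. \<F> (r n) x) (%n. W (r n) x) (%n. X (r n) x) (%n. G (r n)) x C
  U' L V F (%n. \<theta> (r n))"
 proof (intro coupled.intro coupled_axioms.intro dd Om0 appr U L law conv Vm mean)
  show "V y <= liminf (%n. V (u n))" if "u ----> y" for u y by (rule lsc_sequential[OF lsc that])
  show "continuous_on UNIV (%y. inner (G (r n) t y) h)" if "t \<in> {0..T}" for n t h using weak[OF that] G[OF that] by simp
  show "ennreal ((norm (G (r n) t y))^2) <= V y" if "t \<in> {0..T}" for n t y using sq[OF that] G[OF that] by simp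
  show "ennreal (norm (F t y - G (r n) t y)) <= ennreal (\<theta> (r n)) * V y" if "t \<in> {0..T}" "V y < \<top>" for n t y
   using near[OF that(1) DF[OF that(2)]] G[OF that(1)] by simp
  show "0 < \<theta> (r n)" for n using \<theta>[of "r n"] by simp
  show "(%n. \<theta> (r n)) ----> 0" using LIMSEQ_subseq_LIMSEQ[OF \<open>\<theta> ----> 0\<close> r] by (simp add: comp_def)
 qed
 from coupled.limit_solution[OF this DF] show ?thesis by blast
qed

end
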